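(* Let $M>0$. There is a constant $C>0$, depending only on $\Omega$, $(a^{ij})$, $n$, $g$ and the a priori bounds on the unknown coefficient ($q_0,k,q^\ast,M$), such that for all $q,\widetilde q\in\mathscr{Q}\cap W^{1,\infty}(\Omega)$ satisfying $q-\widetilde q\in H^1_0(\Omega)$ and $$\|q\|_{W^{1,\infty}(\Omega)}\le M,\qquad \|\widetilde q\|_{W^{1,\infty}(\Omega)}\le M,$$ one has $$\left\|\sqrt{I_q}\,(q-\widetilde q)\right\|_{H^1(\Omega)}\le C\left\|\sqrt{I_q}-\sqrt{I_{\widetilde q}}\right\|_{H^1(\Omega)}^{\frac12}.$$
   Context: Setting and standing assumptions: $n\in\{2,3\}$, $\Omega\subset\mathbb{R}^n$ is a bounded domain of class $C^{1,1}$ with boundary $\Gamma$; all functions are real valued and repeated indices are summed. The matrix $(a^{ij}(x))_{1\le i,j\le n}$ is symmetric for every $x\in\Omega$, $a^{ij}\in W^{1,\infty}(\Omega)$, and there is $\lambda>0$ with $a^{ij}(x)\xi_i\xi_j\ge\lambda|\xi|^2$ for all $x\in\Omega$, $\xi\in\mathbb{R}^n$. The boundary datum $g\in W^{2-\frac1p,p}(\Gamma)$, with $p>n$, is not identically zero. For $q\in L^\infty(\Omega)$ put $L_q=\partial_i(a^{ij}\partial_j\,\cdot\,)+q$. $\mathscr{Q}_0$ is the set of $q\in L^\infty(\Omega)$ such that $0$ is not an eigenvalue of the realization of $L_q$ on $L^2(\Omega)$ under the Dirichlet boundary condition. For $q\in\mathscr{Q}_0$, $u_q\in H^1(\Omega)$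 is the unique weak solution of $L_qu=0$ in $\Omega$, $u=g$ on $\Gamma$, and $I_q(x)=q(x)u_q^2(x)$, $x\in\Omega$. $A_q$ is the unbounded operator $A_qw=-L_qw$ on $L^2(\Omega)$ with domain $D(A_q)=\{w\in H^1_0(\Omega):L_qw\in L^2(\Omega)\}$; for $q\in\mathscr{Q}_0$, $A_q^{-1}$ is bounded on $L^2(\Omega)$. Fix $q_0>0$, $0<k<1$ and $q^\ast\in\mathscr{Q}_0$ with $0<2q_0\le q^\ast$. $\mathscr{Q}$ is the set of $q\in L^\infty(\Omega)$ with $$\|q-q^\ast\|_{L^\infty(\Omega)}\le\min\left(\frac{k}{\|A_{q^\ast}^{-1}\|_{\mathscr{B}(L^2(\Omega))}},\,q_0\right),$$ where $\mathscr{B}(L^2(\Omega))$ denotes bounded operators on $L^2(\Omega)$. One has $\mathscr{Q}\subset\mathscr{Q}_0$. *)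

theory Defs
  imports "HOL-Analysis.Analysis" "HOL-Probability.Essential_Supremum"
begin

text \<open>
  Elements of Lebesgue and Sobolev spaces over \<open>\<Omega>\<close> are represented by functions on the whole space;
  values outside \<open>\<Omega>\<close> are irrelevant, and functions that agree almost everywhere in \<open>\<Omega>\<close> represent
  the same element.
\<close>

subsection \<open>Domains of class \<open>C\<^sup>1\<^sup>,\<^sup>1\<close>\<close>

definition C11_function :: "(real ^ 'n \<Rightarrow> real) \<Rightarrow> bool" where
  "C11_function \<phi> \<longleftrightarrow>
    (\<exists>D L. (\<forall>x. (\<phi> has_derivative (\<lambda>h. D x \<bullet> h)) (at x)) \<and> L-lipschitz_on UNIV D)"

text \<open>
  Near each boundary point, in coordinates whose last axis is the unit vector \<open>e\<close>, the domain is the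
  part above the graph of a \<open>C\<^sup>1\<^sup>,\<^sup>1\<close> function of the remaining coordinates.  The argument
  \<open>x - (x \<bullet> e) *\<^sub>R e\<close> is the projection of \<open>x\<close> to the hyperplane orthogonal to \<open>e\<close>, so only the
  restriction of \<open>\<phi>\<close> to that hyperplane matters.
\<close>

definition C11_domain :: "(real ^ 'n) set \<Rightarrow> bool" where
  "C11_domain \<Omega> \<longleftrightarrow> open \<Omega> \<and> connected \<Omega> \<and> \<Omega> \<noteq> {} \<and>
    (\<forall>x0\<in>frontier \<Omega>. \<exists>U e \<phi>. open U \<and> x0 \<in> U \<and> norm e = 1 \<and> C11_function \<phi> \<and>
       \<Omega> \<inter> U = {x\<in>U. x \<bullet> e > \<phi> (x - (x \<bullet> e) *\<^sub>R e)})"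

subsection \<open>Test functions\<close>

definition pderivative :: "'n \<Rightarrow> (real ^ 'n \<Rightarrow> real) \<Rightarrow> real ^ 'n \<Rightarrow> real" where
  "pderivative i f x = frechet_derivative f (at x) (axis i 1)"

primrec Ck_function :: "nat \<Rightarrow> (real ^ 'n \<Rightarrow> real) \<Rightarrow> bool" where
  "Ck_function 0 f \<longleftrightarrow> continuous_on UNIV f"
| "Ck_function (Suc k) f \<longleftrightarrow> f differentiable_on UNIV \<and> (\<forall>i. Ck_function k (pderivative i f))"

definition test_functions :: "(real ^ 'n) set \<Rightarrow> (real ^ 'n \<Rightarrow> real) set" where
  "test_functions \<Omega> = {\<phi>. (\<forall>k. Ck_function k \<phi>) \<and>
     compact (closure {x. \<phi> x \<noteq> 0}) \<and> closure {x. \<phi> x \<noteq> 0} \<subseteq> \<Omega>}"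

subsection \<open>Lebesgue spaces\<close>

definition Lp :: "real \<Rightarrow> (real ^ 'n) set \<Rightarrow> (real ^ 'n \<Rightarrow> real) set" where
  "Lp p \<Omega> = {f \<in> borel_measurable (lebesgue_on \<Omega>).
     integrable (lebesgue_on \<Omega>) (\<lambda>x. \<bar>f x\<bar> powr p)}"

definition L2_norm :: "(real ^ 'n) set \<Rightarrow> (real ^ 'n \<Rightarrow> real) \<Rightarrow> real" where
  "L2_norm \<Omega> f = sqrt (LINT x|lebesgue_on \<Omega>. (f x)\<^sup>2)"

definition Linf_norm :: "(real ^ 'n) set \<Rightarrow> (real ^ 'n \<Rightarrow> real) \<Rightarrow> ereal" where
  "Linf_norm \<Omega> f = esssup (lebesgue_on \<Omega>) (\<lambda>x. ereal \<bar>f x\<bar>)"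

definition Linf :: "(real ^ 'n) set \<Rightarrow> (real ^ 'n \<Rightarrow> real) set" where
  "Linf \<Omega> = {f \<in> borel_measurable (lebesgue_on \<Omega>). Linf_norm \<Omega> f < \<infinity>}"

subsection \<open>Sobolev spaces\<close>

definition has_weak_deriv ::
  "(real ^ 'n) set \<Rightarrow> 'n \<Rightarrow> (real ^ 'n \<Rightarrow> real) \<Rightarrow> (real ^ 'n \<Rightarrow> real) \<Rightarrow> bool" where
  "has_weak_deriv \<Omega> i f g \<longleftrightarrow>
    (\<forall>K. compact K \<and> K \<subseteq> \<Omega> \<longrightarrow> f absolutely_integrable_on K \<and> g absolutely_integrable_on K) \<and>
    (\<forall>\<phi>\<in>test_functions \<Omega>.
       (LINT x|lebesgue_on \<Omega>. f x * pderivative i \<phi> x) = - (LINT x|lebesgue_on \<Omega>. g x * \<phi> x))"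

text \<open>A representative of the weak derivative; it is unique almost everywhere if it exists.\<close>

definition weak_deriv :: "(real ^ 'n) set \<Rightarrow> 'n \<Rightarrow> (real ^ 'n \<Rightarrow> real) \<Rightarrow> real ^ 'n \<Rightarrow> real" where
  "weak_deriv \<Omega> i f = (SOME g. has_weak_deriv \<Omega> i f g)"

text \<open>\<open>sobolev k X \<Omega>\<close>: all weak derivatives up to order \<open>k\<close> exist and belong to \<open>X\<close>.\<close>

primrec sobolev ::
  "nat \<Rightarrow> (real ^ 'n \<Rightarrow> real) set \<Rightarrow> (real ^ 'n) set \<Rightarrow> (real ^ 'n \<Rightarrow> real) set" where
  "sobolev 0 X \<Omega> = X"
| "sobolev (Suc k) X \<Omega> = {f \<in> X. \<forall>i. \<exists>g\<in>sobolev k X \<Omega>. has_weak_deriv \<Omega> i f g}"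

abbreviation H1 :: "(real ^ 'n) set \<Rightarrow> (real ^ 'n \<Rightarrow> real) set" where
  "H1 \<Omega> \<equiv> sobolev 1 (Lp 2 \<Omega>) \<Omega>"

abbreviation W1inf :: "(real ^ 'n) set \<Rightarrow> (real ^ 'n \<Rightarrow> real) set" where
  "W1inf \<Omega> \<equiv> sobolev 1 (Linf \<Omega>) \<Omega>"

definition H1_norm :: "(real ^ 'n) set \<Rightarrow> (real ^ 'n \<Rightarrow> real) \<Rightarrow> real" where
  "H1_norm \<Omega> f = sqrt ((L2_norm \<Omega> f)\<^sup>2 + (\<Sum>i\<in>UNIV. (L2_norm \<Omega> (weak_deriv \<Omega> i f))\<^sup>2))"

definition W1inf_norm :: "(real ^ 'n) set \<Rightarrow> (real ^ 'n \<Rightarrow> real) \<Rightarrow> ereal" where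
  "W1inf_norm \<Omega> f = Linf_norm \<Omega> f + (\<Sum>i\<in>UNIV. Linf_norm \<Omega> (weak_deriv \<Omega> i f))"

definition H10 :: "(real ^ 'n) set \<Rightarrow> (real ^ 'n \<Rightarrow> real) set" where
  "H10 \<Omega> = {f \<in> H1 \<Omega>. \<forall>\<epsilon>>0. \<exists>\<phi>\<in>test_functions \<Omega>. H1_norm \<Omega> (\<lambda>x. f x - \<phi> x) < \<epsilon>}"

subsection \<open>Boundary values\<close>

text \<open>
  The boundary data are continuous, since \<open>p\<close> exceeds the dimension.  An \<open>H\<^sup>1\<close> function has such a
  boundary value \<open>g\<close> if it differs by an element of \<open>H\<^sub>0\<^sup>1\<close> from an \<open>H\<^sup>1\<close> function that is
  continuous up to the boundary and restricts to \<open>g\<close> there.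
\<close>

definition has_trace :: "(real ^ 'n) set \<Rightarrow> (real ^ 'n \<Rightarrow> real) \<Rightarrow> (real ^ 'n \<Rightarrow> real) \<Rightarrow> bool" where
  "has_trace \<Omega> u g \<longleftrightarrow> u \<in> H1 \<Omega> \<and>
    (\<exists>G\<in>H1 \<Omega>. continuous_on (closure \<Omega>) G \<and> (\<forall>x\<in>frontier \<Omega>. G x = g x) \<and>
       (\<lambda>x. u x - G x) \<in> H10 \<Omega>)"

text \<open>
  \<open>W\<^sup>2\<^sup>-\<^sup>1\<^sup>/\<^sup>p\<^sup>,\<^sup>p(\<Gamma>)\<close>, as the space of traces of \<open>W\<^sup>2\<^sup>,\<^sup>p(\<Omega>)\<close>.  Because of the encoding of traces this
  is meant for \<open>p\<close> larger than the dimension only; an element is represented by its continuous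
  representative on \<open>\<Gamma> = frontier \<Omega>\<close>.
\<close>

definition W2_trace_space :: "real \<Rightarrow> (real ^ 'n) set \<Rightarrow> (real ^ 'n \<Rightarrow> real) set" where
  "W2_trace_space p \<Omega> = {g. \<exists>G\<in>sobolev 2 (Lp p \<Omega>) \<Omega>. has_trace \<Omega> G g}"

subsection \<open>The operator \<open>L\<^sub>q\<close> and its Dirichlet realization\<close>

text \<open>\<open>L\<^sub>q w = f\<close> in the sense of distributions, for \<open>w\<close> in \<open>H\<^sup>1\<close>.\<close>

definition Lq_eq ::
  "(real ^ 'n) set \<Rightarrow> (real ^ 'n \<Rightarrow> real ^ 'n ^ 'n) \<Rightarrow> (real ^ 'n \<Rightarrow> real) \<Rightarrow>
   (real ^ 'n \<Rightarrow> real) \<Rightarrow> (real ^ 'n \<Rightarrow> real) \<Rightarrow> bool" where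
  "Lq_eq \<Omega> a q w f \<longleftrightarrow> (\<forall>\<phi>\<in>test_functions \<Omega>.
     (LINT x|lebesgue_on \<Omega>.
        - (\<Sum>i\<in>UNIV. \<Sum>j\<in>UNIV. a x $ i $ j * weak_deriv \<Omega> j w x * pderivative i \<phi> x)
        + q x * w x * \<phi> x)
     = (LINT x|lebesgue_on \<Omega>. f x * \<phi> x))"

text \<open>\<open>A_rel \<Omega> a q w f\<close>: \<open>w\<close> is in the domain of \<open>A\<^sub>q\<close> and \<open>A\<^sub>q w = f\<close>.\<close>

definition A_rel ::
  "(real ^ 'n) set \<Rightarrow> (real ^ 'n \<Rightarrow> real ^ 'n ^ 'n) \<Rightarrow> (real ^ 'n \<Rightarrow> real) \<Rightarrow>
   (real ^ 'n \<Rightarrow> real) \<Rightarrow> (real ^ 'n \<Rightarrow> real) \<Rightarrow> bool" where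
  "A_rel \<Omega> a q w f \<longleftrightarrow> w \<in> H10 \<Omega> \<and> f \<in> Lp 2 \<Omega> \<and> Lq_eq \<Omega> a q w (\<lambda>x. - f x)"

definition A_inv ::
  "(real ^ 'n) set \<Rightarrow> (real ^ 'n \<Rightarrow> real ^ 'n ^ 'n) \<Rightarrow> (real ^ 'n \<Rightarrow> real) \<Rightarrow>
   (real ^ 'n \<Rightarrow> real) \<Rightarrow> (real ^ 'n \<Rightarrow> real)" where
  "A_inv \<Omega> a q f = (SOME w. A_rel \<Omega> a q w f)"

definition L2_opnorm ::
  "(real ^ 'n) set \<Rightarrow> ((real ^ 'n \<Rightarrow> real) \<Rightarrow> (real ^ 'n \<Rightarrow> real)) \<Rightarrow> ereal" where
  "L2_opnorm \<Omega> T = (SUP f\<in>{f \<in> Lp 2 \<Omega>. L2_norm \<Omega> f \<le> 1}. ereal (L2_norm \<Omega> (T f)))"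

text \<open>\<open>\<Q>\<^sub>0\<close>: zero is not an eigenvalue of the Dirichlet realization of \<open>L\<^sub>q\<close>.\<close>

definition Q0_set ::
  "(real ^ 'n) set \<Rightarrow> (real ^ 'n \<Rightarrow> real ^ 'n ^ 'n) \<Rightarrow> (real ^ 'n \<Rightarrow> real) set" where
  "Q0_set \<Omega> a = {q \<in> Linf \<Omega>.
     \<not> (\<exists>w. A_rel \<Omega> a q w (\<lambda>x. 0) \<and> \<not> (AE x in lebesgue_on \<Omega>. w x = 0))}"

definition Q_set ::
  "(real ^ 'n) set \<Rightarrow> (real ^ 'n \<Rightarrow> real ^ 'n ^ 'n) \<Rightarrow> real \<Rightarrow> real \<Rightarrow> (real ^ 'n \<Rightarrow> real) \<Rightarrow>
   (real ^ 'n \<Rightarrow> real) set" where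
  "Q_set \<Omega> a q0 k qs = {q \<in> Linf \<Omega>.
     Linf_norm \<Omega> (\<lambda>x. q x - qs x) \<le> min (ereal k / L2_opnorm \<Omega> (A_inv \<Omega> a qs)) (ereal q0)}"

text \<open>
  \<open>u\<close> is (a representative of) \<open>u\<^sub>q\<close>; for \<open>q \<in> \<Q>\<^sub>0\<close> it exists and is unique almost everywhere.
\<close>

definition weak_solution ::
  "(real ^ 'n) set \<Rightarrow> (real ^ 'n \<Rightarrow> real ^ 'n ^ 'n) \<Rightarrow> (real ^ 'n \<Rightarrow> real) \<Rightarrow>
   (real ^ 'n \<Rightarrow> real) \<Rightarrow> (real ^ 'n \<Rightarrow> real) \<Rightarrow> bool" where
  "weak_solution \<Omega> a g q u \<longleftrightarrow> u \<in> H1 \<Omega> \<and> Lq_eq \<Omega> a q u (\<lambda>x. 0) \<and> has_trace \<Omega> u g"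

definition internal_data :: "(real ^ 'n \<Rightarrow> real) \<Rightarrow> (real ^ 'n \<Rightarrow> real) \<Rightarrow> real ^ 'n \<Rightarrow> real" where
  "internal_data q u x = q x * (u x)\<^sup>2"

end

theory Submission
  imports Defs
begin

text \<open>
  Put \<open>J = sqrt q * |u|\<close>, the square root of the internal data, and \<open>\<rho> = 1 / sqrt q\<close>, so that
  \<open>|u| = \<rho> J\<close>. Where \<open>u\<close> is positive, the equation for \<open>u\<close> is a semilinear equation for \<open>\<rho>\<close> with given \<open>J\<close>,
  \<open>div (a \<nabla> (\<rho> J)) + J / \<rho> = 0\<close>, and the term \<open>J / \<rho>\<close> decreases in \<open>\<rho>\<close>. For such equations there is a
  uniqueness argument going back to Picone's identity: the equations for \<open>\<rho>\<close> and \<open>\<rho>t\<close> are tested with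
  \<open>J \<psi> / \<rho>\<close> and \<open>Jt \<psi> / \<rho>t\<close>, where \<open>\<psi> = \<rho>\<^sup>2 - \<rho>t\<^sup>2 = 1 / q - 1 / qt\<close>, which vanishes on the boundary
  together with \<open>q - qt\<close>. If \<open>J = Jt\<close>, then the difference of the two is the integral of \<open>J\<^sup>2\<close> times an
  expression that is coercive in \<open>R - Rt\<close> and \<open>q - qt\<close>, where \<open>R = \<nabla> (ln \<rho>)\<close>
  (\<open>picone_difference\<close>). In general the error is a sum of products, each with a difference of the data
  as a factor (\<open>perturbation_bound\<close>). Hence the integral of \<open>J\<^sup>2 (|R - Rt|\<^sup>2 + (q - qt)\<^sup>2)\<close> is bounded
  by the first power of the \<open>H\<^sup>1\<close> distance of the data (\<open>defect_integral_bound\<close>).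

  This integral controls \<open>J (q - qt)\<close> and \<open>J \<nabla> (q - qt)\<close> in \<open>L\<^sup>2\<close>. What is missing for the \<open>H\<^sup>1\<close> norm of
  \<open>J (q - qt)\<close> is \<open>(q - qt) \<nabla> u\<close>, and Caccioppoli's inequality, that is, the equation for \<open>u\<close> tested with
  \<open>(q - qt)\<^sup>2 u\<close>, bounds it by the same integral (\<open>caccioppoli_integral_bound\<close>). The square of the norm
  is thus bounded by the first power of the distance, which is the exponent one half
  (\<open>stability_of_admissible\<close>). The weight \<open>J\<close> may vanish, and the argument never divides by it.

  The constant is uniform if the solutions are bounded in \<open>H\<^sup>1\<close> uniformly in \<open>q\<close>. The difference of two
  solutions has zero boundary values, and it solves an equation for the operator of \<open>q\<^sup>*\<close> with a
  right-hand side in which the smallness of \<open>q - q\<^sup>*\<close> and \<open>k < 1\<close> allow an absorption. So the norm of every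
  solution is bounded by that of a single one, chosen once and for all (\<open>solution_L2_bound\<close>,
  \<open>solution_gradient_bound\<close>). If there is no solution at all, nothing is to be proved, and if the
  operator norm in the definition of the class is infinite, the class consists of \<open>q\<^sup>*\<close> only.

  All of this takes place in \<open>H\<^sup>1\<close>. The calculus of weak derivatives is developed by mollification: chain
  and product rule, the gradient of \<open>|u|\<close>, the vanishing of the gradient on the zero set of \<open>u\<close>
  (\<open>weak_deriv_zero_set\<close>), and stability of \<open>H\<^sub>0\<^sup>1\<close> under multiplication by bounded functions with
  bounded derivatives. The equations may be tested with products \<open>u \<phi>\<close> by \<open>energy_identity\<close>.
\<close>

section \<open>Smooth functions\<close>

lemma pderivative_eq: "(f has_derivative f') (at x) \<Longrightarrow> pderivative i f x = f' (axis i 1)"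
  by (metis pderivative_def frechet_derivative_at)

lemma Ck_Suc_has_derivative:
  "Ck_function (Suc k) f \<Longrightarrow> (f has_derivative frechet_derivative f (at x)) (at x)"
  by (simp add: differentiable_on_def frechet_derivative_works[symmetric])

lemma Ck_SucI:
  assumes "\<And>x. (f has_derivative f' x) (at x)" and "\<And>i. Ck_function k (\<lambda>x. f' x (axis i 1))"
  shows "Ck_function (Suc k) f"
proof -
  have "pderivative i f = (\<lambda>x. f' x (axis i 1))" for i
    using assms(1) pderivative_eq by blast
  moreover have "f differentiable_on UNIV"
    using assms(1) by (auto simp: differentiable_on_def differentiable_def)
  ultimately show ?thesis using assms(2) by simp
qed

lemma Ck_SucD: "Ck_function (Suc k) f \<Longrightarrow> Ck_function k f"
proof (induction k arbitrary: f)
  case 0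
  then show ?case by (simp add: differentiable_imp_continuous_on)
next
  case (Suc k)
  then show ?case by (metis Ck_function.simps(2))
qed

lemma Ck_continuous: "Ck_function k f \<Longrightarrow> continuous_on UNIV f"
  by (induction k) (use Ck_SucD in auto)

lemma Ck_const: "Ck_function k (\<lambda>x. c)"
proof (induction k arbitrary: c)
  case (Suc k)
  show ?case by (rule Ck_SucI[where f' = "\<lambda>x h. 0"]) (auto intro: Suc)
qed auto

lemma Ck_component: "Ck_function k (\<lambda>x. x $ i)"
proof (cases k)
  case (Suc l)
  have "bounded_linear (\<lambda>x. x $ i :: real)" by (rule bounded_linear_vec_nth)
  then show ?thesis unfolding Suc
    by (intro Ck_SucI[where f' = "\<lambda>x h. h $ i"] Ck_const) (rule bounded_linear_imp_has_derivative)
qed (simp add: continuous_on_component)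

lemma Ck_add:
  assumes "Ck_function k f" "Ck_function k g"
  shows "Ck_function k (\<lambda>x. f x + g x)"
  using assms
proof (induction k arbitrary: f g)
  case (Suc k)
  show ?case
    by (rule Ck_SucI[OF has_derivative_add[OF Ck_Suc_has_derivative[OF Suc.prems(1)] Ck_Suc_has_derivative[OF Suc.prems(2)]]])
      (use Suc in \<open>auto intro!: Suc.IH simp flip: pderivative_def simp: fun_eq_iff\<close>)
qed (auto intro: continuous_on_add)

lemma Ck_mult:
  assumes "Ck_function k f" "Ck_function k g"
  shows "Ck_function k (\<lambda>x. f x * g x)"
  using assms
proof (induction k arbitrary: f g)
  case (Suc k)
  have "Ck_function k (\<lambda>x. f x * pderivative i g x + pderivative i f x * g x)" for i
    using Suc.prems Suc.prems[THEN Ck_SucD] by (intro Ck_add Suc.IH) auto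
  then show ?case
    by (intro Ck_SucI[OF has_derivative_mult[OF Ck_Suc_has_derivative[OF Suc.prems(1)] Ck_Suc_has_derivative[OF Suc.prems(2)]]])
      (auto simp flip: pderivative_def)
qed (auto intro: continuous_on_mult)

lemma Ck_sum: "finite I \<Longrightarrow> (\<And>i. i \<in> I \<Longrightarrow> Ck_function k (f i)) \<Longrightarrow> Ck_function k (\<lambda>x. \<Sum>i\<in>I. f i x)"
  by (induction I rule: finite_induct) (auto intro: Ck_const Ck_add)

lemma Ck_reflect:
  assumes "Ck_function k f"
  shows "Ck_function k (\<lambda>y. f (x - y))"
  using assms
proof (induction k arbitrary: f)
  case 0
  then show ?case by (auto intro!: continuous_on_compose2[of UNIV f] continuous_on_diff continuous_on_const continuous_on_id)
next
  case (Suc k)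
  have D: "((\<lambda>y. f (x - y)) has_derivative (\<lambda>h. frechet_derivative f (at (x - y)) (- h))) (at y)" for y
    by (rule has_derivative_compose[where f = "\<lambda>y. x - y" and g = f, OF _ Ck_Suc_has_derivative[OF Suc.prems]])
      (auto intro!: derivative_eq_intros)
  have l: "linear (frechet_derivative f (at z))" for z
    using Ck_Suc_has_derivative[OF Suc.prems] has_derivative_linear by blast
  have "Ck_function k (\<lambda>y. (- 1) * pderivative i f (x - y))" for i
    using Suc by (intro Ck_mult Ck_const) auto
  then show ?case
    by (intro Ck_SucI[OF D]) (simp add: pderivative_def linear_neg[OF l])
qed

lemma pderivative_reflect:
  assumes "Ck_function (Suc k) f"
  shows "pderivative i (\<lambda>y. f (x - y)) y = - pderivative i f (x - y)"
proof -
  have D: "((\<lambda>y. f (x - y)) has_derivative (\<lambda>h. frechet_derivative f (at (x - y)) (- h))) (at y)"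
    by (rule has_derivative_compose[where f = "\<lambda>y. x - y" and g = f, OF _ Ck_Suc_has_derivative[OF assms]])
      (auto intro!: derivative_eq_intros)
  have l: "linear (frechet_derivative f (at z))" for z
    using Ck_Suc_has_derivative[OF assms] has_derivative_linear by blast
  show ?thesis unfolding pderivative_eq[OF D] by (simp add: pderivative_def linear_neg[OF l])
qed

lemma pderivative_mult:
  assumes "Ck_function (Suc k) f" "Ck_function (Suc l) g"
  shows "pderivative i (\<lambda>x. f x * g x) x = f x * pderivative i g x + pderivative i f x * g x"
  using pderivative_eq[OF has_derivative_mult[OF Ck_Suc_has_derivative[OF assms(1)] Ck_Suc_has_derivative[OF assms(2)]]]
  by (simp add: pderivative_def)

lemma power_le_fact_exp:
  fixes x :: real
  assumes "x \<ge> 0"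
  shows "x ^ n \<le> fact n * exp x"
proof -
  have "(\<Sum>k\<in>{n}. x ^ k /\<^sub>R fact k) \<le> (\<Sum>k. x ^ k /\<^sub>R fact k)"
    using assms by (intro sum_le_suminf summable_exp_generic) auto
  then show ?thesis by (simp add: exp_def divide_simps mult.commute)
qed

text \<open>
  The factors \<open>1 / t\<^sup>m\<close> make the family of these flat functions closed under differentiation, which is
  what the induction in \<open>Ck_expinv\<close> needs.
\<close>

definition expinv :: "nat \<Rightarrow> real \<Rightarrow> real" where
  "expinv m t = (if t > 0 then exp (- 1 / t) / t ^ m else 0)"

text \<open>
  The exponential series dominates every power of \<open>1 / t\<close>; two spare powers of \<open>t\<close> give the vanishing
  difference quotient at the origin.
\<close>

lemma expinv_bound: "\<bar>expinv m t\<bar> \<le> fact (m + 2) * t\<^sup>2"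
proof (cases "t > 0")
  case True
  define s where "s = 1 / t"
  have s: "s > 0" "t = 1 / s" using True by (auto simp: s_def)
  have "s ^ (m + 2) \<le> fact (m + 2) * exp s"
    using s(1) by (intro power_le_fact_exp) auto
  then have "s ^ m * exp (- s) \<le> fact (m + 2) * (1 / s)\<^sup>2"
    using s(1) by (simp add: field_simps exp_minus power_add power2_eq_square del: fact_Suc)
  moreover have "expinv m t = s ^ m * exp (- s)" "1 / s = t"
    using True by (simp_all add: expinv_def s_def power_one_over)
  ultimately show ?thesis using s(1) by simp
qed (simp add: expinv_def)

lemma expinv_has_derivative:
  "(expinv m has_real_derivative (expinv (m + 2) t - real m * expinv (m + 1) t)) (at t)"
proof -
  consider "t > 0" | "t < 0" | "t = 0" by linarith
  then show ?thesis
  proof cases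
    case 1
    have "((\<lambda>t. exp (- 1 / t) * (1 / t) ^ m) has_real_derivative
       (expinv (m + 2) t - real m * expinv (m + 1) t)) (at t)"
    proof (cases m)
      case (Suc l)
      have "((\<lambda>t. exp (- 1 / t) * (1 / t) ^ m) has_real_derivative
          exp (- 1 / t) * (1 / t\<^sup>2) * (1 / t) ^ m + exp (- 1 / t) * (m * (1 / t) ^ (m - 1) * (- 1 / t\<^sup>2))) (at t)"
        using 1 by (auto intro!: derivative_eq_intros simp: power2_eq_square)
      then show ?thesis using 1 Suc
        by (simp add: expinv_def power_one_over power2_eq_square field_simps)
    qed (use 1 in \<open>auto intro!: derivative_eq_intros simp: expinv_def power2_eq_square\<close>)
    moreover have ev: "\<forall>\<^sub>F s in nhds t. expinv m s = exp (- 1 / s) * (1 / s) ^ m"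
      using eventually_nhds_in_open[of "{0<..}" t] 1
      by (auto simp: expinv_def power_one_over divide_simps elim!: eventually_mono)
    ultimately show ?thesis using DERIV_cong_ev[OF refl ev refl] by blast
  next
    case 2
    have ev: "\<forall>\<^sub>F s in nhds t. expinv m s = 0"
      using eventually_nhds_in_open[of "{..<0}" t] 2
      by (auto simp: expinv_def elim!: eventually_mono)
    then have "(expinv m has_real_derivative 0) (at t)"
      using DERIV_cong_ev[OF refl ev refl] by simp
    then show ?thesis using 2 by (simp add: expinv_def)
  next
    case 3
    have "((\<lambda>h. expinv m h / h) \<longlongrightarrow> 0) (at 0)"
    proof (rule Lim_null_comparison[where g = "\<lambda>h. fact (m + 2) * \<bar>h\<bar>"])
      show "\<forall>\<^sub>F h in at 0. norm (expinv m h / h) \<le> fact (m + 2) * \<bar>h\<bar>"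
      proof (intro always_eventually allI)
        fix h :: real
        have "\<bar>expinv m h\<bar> / \<bar>h\<bar> \<le> fact (m + 2) * h\<^sup>2 / \<bar>h\<bar>"
          by (intro divide_right_mono expinv_bound) auto
        also have "\<dots> = fact (m + 2) * \<bar>h\<bar>"
          by (cases "h = 0") (simp_all add: power2_eq_square divide_simps del: fact_Suc)
        finally show "norm (expinv m h / h) \<le> fact (m + 2) * \<bar>h\<bar>" by simp
      qed
      show "((\<lambda>h. fact (m + 2) * \<bar>h\<bar> :: real) \<longlongrightarrow> 0) (at 0)"
        by (intro tendsto_mult_right_zero tendsto_rabs_zero) simp
    qed
    then show ?thesis using 3 by (simp add: DERIV_def expinv_def)
  qed
qed

lemma Ck_expinv: "Ck_function k f \<Longrightarrow> Ck_function k (\<lambda>x. expinv m (f x))"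
proof (induction k arbitrary: m)
  case 0
  have "continuous_on UNIV (expinv m)"
    using expinv_has_derivative DERIV_isCont by (metis continuous_at_imp_continuous_on)
  then show ?case using 0 by (auto intro: continuous_on_compose2)
next
  case (Suc k)
  have D: "((\<lambda>x. expinv m (f x)) has_derivative (\<lambda>h. (expinv (m + 2) (f x) - real m * expinv (m + 1) (f x)) *
      frechet_derivative f (at x) h)) (at x)" for x
    using has_derivative_compose[OF Ck_Suc_has_derivative[OF Suc.prems]
        expinv_has_derivative[unfolded has_field_derivative_def]] by simp
  have "Ck_function k (\<lambda>x. (expinv (m + 2) (f x) + (- real m) * expinv (m + 1) (f x)) * pderivative i f x)" for i
    using Suc.prems Suc.prems[THEN Ck_SucD] by (intro Ck_mult Ck_add Ck_const Suc.IH) auto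
  then show ?case
    by (intro Ck_SucI[OF D]) (simp flip: pderivative_def)
qed

text \<open>The square \<open>x \<bullet> x\<close> in place of the norm avoids the singularity of the norm at the origin.\<close>

definition bump :: "real \<Rightarrow> real ^ 'n \<Rightarrow> real" where
  "bump \<epsilon> x = expinv 0 (\<epsilon>\<^sup>2 - x \<bullet> x)"

lemma Ck_bump: "Ck_function k (bump \<epsilon>)"
proof -
  have "Ck_function k (\<lambda>x. expinv 0 (\<epsilon>\<^sup>2 + (- 1) * (\<Sum>i\<in>UNIV. x $ i * x $ i)))"
    by (intro Ck_expinv Ck_add Ck_mult Ck_const Ck_sum Ck_component) auto
  then show ?thesis by (simp add: bump_def[abs_def] inner_vec_def)
qed

lemma bump_nonneg: "0 \<le> bump \<epsilon> x"
  by (simp add: bump_def expinv_def)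

lemma bump_pos_iff: "\<epsilon> > 0 \<Longrightarrow> 0 < bump \<epsilon> x \<longleftrightarrow> norm x < \<epsilon>"
  using power_mono_iff[of \<epsilon> "norm x" 2] by (simp add: bump_def expinv_def dot_square_norm linorder_not_le[symmetric])

section \<open>Square-integrable functions\<close>

definition square_integrable :: "'a measure \<Rightarrow> ('a \<Rightarrow> real) \<Rightarrow> bool" where
  "square_integrable M f \<longleftrightarrow> f \<in> borel_measurable M \<and> integrable M (\<lambda>x. (f x)\<^sup>2)"

lemma square_integrable_measurable [measurable_dest]:
  "square_integrable M f \<Longrightarrow> f \<in> borel_measurable M"
  by (simp add: square_integrable_def)

lemma square_integrableD: "square_integrable M f \<Longrightarrow> integrable M (\<lambda>x. (f x)\<^sup>2)"
  by (simp add: square_integrable_def)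

lemma abs_mult_le_squares: "\<bar>a * b\<bar> \<le> a\<^sup>2 + (b::real)\<^sup>2"
proof -
  have "0 \<le> \<bar>a\<bar> * \<bar>b\<bar>" by simp
  then show ?thesis
    unfolding abs_mult using sum_squares_bound[of "\<bar>a\<bar>" "\<bar>b\<bar>"] by (simp only: power2_abs)
qed

lemma square_integrable_bound:
  assumes "f \<in> borel_measurable M" "square_integrable M g" "AE x in M. \<bar>f x\<bar> \<le> \<bar>g x\<bar>"
  shows "square_integrable M f"
  unfolding square_integrable_def
  by (intro conjI assms(1) Bochner_Integration.integrable_bound[OF square_integrableD[OF assms(2)]])
    (use assms in \<open>auto simp: abs_le_square_iff elim!: eventually_mono\<close>)

lemma integrable_mult_square_integrable:
  assumes "square_integrable M f" "square_integrable M g"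
  shows "integrable M (\<lambda>x. f x * g x)"
proof (rule Bochner_Integration.integrable_bound)
  show "integrable M (\<lambda>x. (f x)\<^sup>2 + (g x)\<^sup>2)"
    using assms by (intro Bochner_Integration.integrable_add square_integrableD)
  show "(\<lambda>x. f x * g x) \<in> borel_measurable M" using assms by measurable
  show "AE x in M. norm (f x * g x) \<le> norm ((f x)\<^sup>2 + (g x)\<^sup>2)"
    using abs_mult_le_squares by (auto simp: add_nonneg_nonneg)
qed

lemma square_integrable_cmult: "square_integrable M f \<Longrightarrow> square_integrable M (\<lambda>x. c * f x)"
  by (auto simp: square_integrable_def power_mult_distrib)

lemma square_integrable_add:
  assumes "square_integrable M f" "square_integrable M g"
  shows "square_integrable M (\<lambda>x. f x + g x)"
proof -
  have "integrable M (\<lambda>x. (f x)\<^sup>2 + (g x)\<^sup>2 + 2 * (f x * g x))"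
    using assms by (intro Bochner_Integration.integrable_add square_integrableD
        integrable_mult_right integrable_mult_square_integrable)
  then show ?thesis using assms by (auto simp: square_integrable_def power2_sum algebra_simps)
qed

lemma square_integrable_diff:
  assumes "square_integrable M f" "square_integrable M g"
  shows "square_integrable M (\<lambda>x. f x - g x)"
  using square_integrable_add[OF assms(1) square_integrable_cmult[OF assms(2), of "-1"]] by simp

lemma square_integrable_zero: "square_integrable M (\<lambda>x. 0)"
  by (simp add: square_integrable_def)

lemma square_integrable_sum:
  "(\<And>i. i \<in> I \<Longrightarrow> square_integrable M (f i)) \<Longrightarrow> square_integrable M (\<lambda>x. \<Sum>i\<in>I. f i x)"
  by (induction I rule: infinite_finite_induct) (auto intro: square_integrable_add square_integrable_zero)

lemma square_integrable_abs: "square_integrable M f \<Longrightarrow> square_integrable M (\<lambda>x. \<bar>f x\<bar>)"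
  by (auto simp: square_integrable_def)

lemma square_integrable_mult_bounded:
  assumes "square_integrable M f" "m \<in> borel_measurable M" "AE x in M. \<bar>m x\<bar> \<le> B"
  shows "square_integrable M (\<lambda>x. m x * f x)"
proof (rule square_integrable_bound[OF _ square_integrable_cmult[OF assms(1), of B]])
  show "(\<lambda>x. m x * f x) \<in> borel_measurable M" using assms(1,2) by measurable
  show "AE x in M. \<bar>m x * f x\<bar> \<le> \<bar>B * f x\<bar>"
    using assms(3) by eventually_elim (auto simp: abs_mult intro!: mult_right_mono)
qed

lemma square_integrable_cong_AE:
  assumes "square_integrable M f" "g \<in> borel_measurable M" "AE x in M. f x = g x"
  shows "square_integrable M g"
  using assms(3) by (intro square_integrable_bound[OF assms(2,1)]) (auto elim: eventually_mono)

text \<open>The inequality \<open>|ab| \<le> (s a\<^sup>2 + b\<^sup>2 / s) / 2\<close> is integrated and then optimized in \<open>s\<close>.\<close>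

lemma Cauchy_Schwarz_integral:
  assumes f: "square_integrable M f" and g: "square_integrable M g"
  shows "(LINT x|M. \<bar>f x * g x\<bar>) \<le> sqrt (LINT x|M. (f x)\<^sup>2) * sqrt (LINT x|M. (g x)\<^sup>2)"
proof -
  define A where "A = sqrt (LINT x|M. (f x)\<^sup>2)"
  define B where "B = sqrt (LINT x|M. (g x)\<^sup>2)"
  have AB: "A \<ge> 0" "B \<ge> 0" "A\<^sup>2 = (LINT x|M. (f x)\<^sup>2)" "B\<^sup>2 = (LINT x|M. (g x)\<^sup>2)"
    by (auto simp: A_def B_def)
  have *: "(LINT x|M. \<bar>f x * g x\<bar>) \<le> (s * A\<^sup>2 + B\<^sup>2 / s) / 2" if "s > 0" for s
  proof -
    have "\<bar>f x * g x\<bar> \<le> (s * (f x)\<^sup>2 + (g x)\<^sup>2 / s) / 2" for x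
      using sum_squares_bound[of "sqrt s * \<bar>f x\<bar>" "\<bar>g x\<bar> / sqrt s"] that
      by (simp add: power_mult_distrib power_divide abs_mult field_simps)
    then have "(LINT x|M. \<bar>f x * g x\<bar>) \<le> (LINT x|M. (s * (f x)\<^sup>2 + (g x)\<^sup>2 / s) / 2)"
      using f g by (intro integral_mono integrable_abs integrable_mult_square_integrable)
        (auto intro!: Bochner_Integration.integrable_add square_integrableD)
    also have "\<dots> = (s * A\<^sup>2 + B\<^sup>2 / s) / 2"
      unfolding AB using f g by (simp add: square_integrable_def)
    finally show ?thesis .
  qed
  have "(LINT x|M. \<bar>f x * g x\<bar>) \<le> (A + e) * (B + e)" if "e > 0" for e
  proof -
    have "(LINT x|M. \<bar>f x * g x\<bar>) \<le> ((B + e) / (A + e) * A\<^sup>2 + B\<^sup>2 / ((B + e) / (A + e))) / 2"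
      using AB that by (intro *) auto
    also have "\<dots> \<le> ((B + e) / (A + e) * (A + e)\<^sup>2 + (B + e)\<^sup>2 / ((B + e) / (A + e))) / 2"
      using AB that by (intro divide_right_mono add_mono mult_left_mono power_mono) auto
    also have "\<dots> = (A + e) * (B + e)"
    proof -
      have pos: "A + e > 0" "B + e > 0" using AB that by auto
      then show ?thesis by (simp add: power2_eq_square)
    qed
    finally show ?thesis .
  qed
  then have "\<forall>\<^sub>F e in at_right 0. (LINT x|M. \<bar>f x * g x\<bar>) \<le> (A + e) * (B + e)"
    by (auto simp: eventually_at_right_less eventually_at intro!: exI[of _ 1])
  moreover have "((\<lambda>e. (A + e) * (B + e)) \<longlongrightarrow> (A + 0) * (B + 0)) (at_right 0)"
    by (intro tendsto_intros)
  ultimately have "(LINT x|M. \<bar>f x * g x\<bar>) \<le> (A + 0) * (B + 0)"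
    by (intro tendsto_lowerbound[where F = "at_right 0"]) auto
  then show ?thesis by (simp add: A_def B_def)
qed

lemma abs_integral_mult_le:
  assumes f: "square_integrable M f" and g: "square_integrable M g"
  shows "\<bar>LINT x|M. f x * g x\<bar> \<le> sqrt (LINT x|M. (f x)\<^sup>2) * sqrt (LINT x|M. (g x)\<^sup>2)"
  using integral_abs_bound[of M "\<lambda>x. f x * g x"] Cauchy_Schwarz_integral[OF assms] by linarith

lemma L2_triangle:
  assumes f: "square_integrable M f" and g: "square_integrable M g"
  shows "sqrt (LINT x|M. (f x + g x)\<^sup>2) \<le> sqrt (LINT x|M. (f x)\<^sup>2) + sqrt (LINT x|M. (g x)\<^sup>2)"
proof (rule real_le_lsqrt)
  have "(LINT x|M. (f x + g x)\<^sup>2) = (LINT x|M. (f x)\<^sup>2) + (LINT x|M. (g x)\<^sup>2) + 2 * (LINT x|M. f x * g x)"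
    using f g by (simp add: power2_sum square_integrableD integrable_mult_square_integrable[OF f g] mult.assoc)
  also have "\<dots> \<le> (sqrt (LINT x|M. (f x)\<^sup>2) + sqrt (LINT x|M. (g x)\<^sup>2))\<^sup>2"
    using abs_integral_mult_le[OF f g] by (simp add: power2_sum)
  finally show "(LINT x|M. (f x + g x)\<^sup>2) \<le> (sqrt (LINT x|M. (f x)\<^sup>2) + sqrt (LINT x|M. (g x)\<^sup>2))\<^sup>2" .
qed auto

subsection \<open>Convergence in the mean square\<close>

text \<open>
  The members and the limit are required to be square integrable, so that the Bochner integral of the
  squared difference, which is zero by default for a nonintegrable function, means what it should.
\<close>

definition L2_tendsto :: "'a measure \<Rightarrow> (nat \<Rightarrow> 'a \<Rightarrow> real) \<Rightarrow> ('a \<Rightarrow> real) \<Rightarrow> bool" where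
  "L2_tendsto M F f \<longleftrightarrow> (\<forall>n. square_integrable M (F n)) \<and> square_integrable M f \<and>
     (\<lambda>n. LINT x|M. (F n x - f x)\<^sup>2) \<longlonglongrightarrow> 0"

lemma L2_tendsto_AE_subseq:
  assumes "L2_tendsto M F f"
  obtains r where "strict_mono r" "AE x in M. (\<lambda>n. F (r n) x) \<longlonglongrightarrow> f x"
proof -
  have "\<exists>r::nat\<Rightarrow>nat. strict_mono r \<and> (AE x in M. (\<lambda>n. (F (r n) x - f x)\<^sup>2) \<longlonglongrightarrow> 0)"
    using assms unfolding L2_tendsto_def
    by (intro tendsto_L1_AE_subseq) (auto intro!: square_integrableD square_integrable_diff)
  then obtain r where r: "strict_mono r" "AE x in M. (\<lambda>n. (F (r n) x - f x)\<^sup>2) \<longlonglongrightarrow> 0" by auto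
  have "(\<lambda>n. F (r n) x) \<longlonglongrightarrow> f x" if "(\<lambda>n. (F (r n) x - f x)\<^sup>2) \<longlonglongrightarrow> 0" for x
  proof -
    have "(\<lambda>n. F (r n) x - f x) \<longlonglongrightarrow> 0"
      using tendsto_real_sqrt[OF that] by (simp add: tendsto_rabs_zero_iff)
    then show ?thesis using Lim_null by blast
  qed
  with r(2) have "AE x in M. (\<lambda>n. F (r n) x) \<longlonglongrightarrow> f x" by (rule eventually_mono)
  then show ?thesis using that r(1) by blast
qed

lemma L2_tendsto_subseq: "L2_tendsto M F f \<Longrightarrow> strict_mono r \<Longrightarrow> L2_tendsto M (\<lambda>n. F (r n)) f"
  using LIMSEQ_subseq_LIMSEQ[of "\<lambda>n. LINT x|M. (F n x - f x)\<^sup>2" 0 r]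
  by (auto simp: L2_tendsto_def o_def)

lemma L2_tendsto_integral_mult:
  assumes F: "L2_tendsto M F f" and g: "square_integrable M g"
  shows "(\<lambda>n. LINT x|M. F n x * g x) \<longlonglongrightarrow> (LINT x|M. f x * g x)"
proof (rule Lim_null[THEN iffD2], rule Lim_null_comparison)
  have sq: "square_integrable M (\<lambda>x. F n x - f x)" for n
    using F by (intro square_integrable_diff) (auto simp: L2_tendsto_def)
  show "\<forall>\<^sub>F n in sequentially. norm ((LINT x|M. F n x * g x) - (LINT x|M. f x * g x))
     \<le> sqrt (LINT x|M. (F n x - f x)\<^sup>2) * sqrt (LINT x|M. (g x)\<^sup>2)"
  proof (intro always_eventually allI)
    fix n
    have "(LINT x|M. F n x * g x) - (LINT x|M. f x * g x) = (LINT x|M. (F n x - f x) * g x)"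
      using F g unfolding left_diff_distrib L2_tendsto_def
      by (intro Bochner_Integration.integral_diff[symmetric] integrable_mult_square_integrable) auto
    then show "norm ((LINT x|M. F n x * g x) - (LINT x|M. f x * g x))
     \<le> sqrt (LINT x|M. (F n x - f x)\<^sup>2) * sqrt (LINT x|M. (g x)\<^sup>2)"
      using abs_integral_mult_le[OF sq[of n] g] by simp
  qed
  have "(\<lambda>n. sqrt (LINT x|M. (F n x - f x)\<^sup>2)) \<longlonglongrightarrow> sqrt 0"
    using F by (intro tendsto_real_sqrt) (simp add: L2_tendsto_def)
  then show "(\<lambda>n. sqrt (LINT x|M. (F n x - f x)\<^sup>2) * sqrt (LINT x|M. (g x)\<^sup>2)) \<longlonglongrightarrow> 0"
    by (intro tendsto_mult_left_zero) simp
qed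

lemma L2_tendsto_dominated:
  assumes F: "\<And>n. F n \<in> borel_measurable M" and f: "f \<in> borel_measurable M"
    and G: "square_integrable M G" and le: "\<And>n. AE x in M. \<bar>F n x\<bar> \<le> G x"
    and lim: "AE x in M. (\<lambda>n. F n x) \<longlonglongrightarrow> f x"
  shows "L2_tendsto M F f"
proof -
  have all: "AE x in M. \<forall>n. \<bar>F n x\<bar> \<le> G x" using le by (simp add: AE_all_countable)
  have fle: "AE x in M. \<bar>f x\<bar> \<le> G x"
    using all lim
  proof eventually_elim
    case (elim x)
    show ?case by (rule LIMSEQ_le_const2[OF tendsto_rabs[OF elim(2)]]) (use elim(1) in auto)
  qed
  have sqF: "square_integrable M (F n)" for n
    using le[of n] by (intro square_integrable_bound[OF F G]) (auto elim!: eventually_mono)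
  have sqf: "square_integrable M f"
    using fle by (intro square_integrable_bound[OF f G]) (auto elim!: eventually_mono)
  have "(\<lambda>n. LINT x|M. (F n x - f x)\<^sup>2) \<longlonglongrightarrow> (LINT x|M. 0)"
  proof (rule integral_dominated_convergence[where w = "\<lambda>x. (2 * G x)\<^sup>2"])
    show "integrable M (\<lambda>x. (2 * G x)\<^sup>2)"
      using G by (intro square_integrableD square_integrable_cmult)
    show "AE x in M. (\<lambda>n. (F n x - f x)\<^sup>2) \<longlonglongrightarrow> 0"
      using lim
    proof eventually_elim
      case (elim x)
      have "(\<lambda>n. (F n x - f x)\<^sup>2) \<longlonglongrightarrow> (f x - f x)\<^sup>2" by (intro tendsto_intros elim)
      then show ?case by simp
    qed
    show "AE x in M. norm ((F n x - f x)\<^sup>2) \<le> (2 * G x)\<^sup>2" for n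
      using fle le[of n]
    proof eventually_elim
      case (elim x)
      then have "\<bar>F n x - f x\<bar> \<le> 2 * G x" by linarith
      then show ?case using power_mono[of "\<bar>F n x - f x\<bar>" "2 * G x" 2] by simp
    qed
  qed (use F f in measurable)
  then show ?thesis using sqF sqf by (auto simp: L2_tendsto_def)
qed

lemma square_sum_le: "(a + b)\<^sup>2 \<le> 2 * a\<^sup>2 + 2 * (b::real)\<^sup>2"
  using sum_squares_bound[of a b] by (simp add: power2_sum)

lemma L2_tendsto_add:
  assumes "L2_tendsto M F f" "L2_tendsto M G g"
  shows "L2_tendsto M (\<lambda>n x. F n x + G n x) (\<lambda>x. f x + g x)"
proof -
  have sq: "square_integrable M (F n)" "square_integrable M (G n)" "square_integrable M f" "square_integrable M g" for n
    using assms by (auto simp: L2_tendsto_def)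
  have "(\<lambda>n. LINT x|M. (F n x + G n x - (f x + g x))\<^sup>2) \<longlonglongrightarrow> 0"
  proof (rule tendsto_sandwich[OF _ _ tendsto_const])
    show "(\<lambda>n. 2 * (LINT x|M. (F n x - f x)\<^sup>2) + 2 * (LINT x|M. (G n x - g x)\<^sup>2)) \<longlonglongrightarrow> 0"
      using assms by (auto simp: L2_tendsto_def intro!: tendsto_add_zero tendsto_mult_right_zero)
    have "(LINT x|M. (F n x + G n x - (f x + g x))\<^sup>2) \<le> (LINT x|M. 2 * (F n x - f x)\<^sup>2 + 2 * (G n x - g x)\<^sup>2)" for n
      using sq by (intro integral_mono square_integrableD square_integrable_diff square_integrable_add
          Bochner_Integration.integrable_add integrable_mult_right)
       (auto simp: add_diff_add intro!: square_sum_le)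
    also have "(LINT x|M. 2 * (F n x - f x)\<^sup>2 + 2 * (G n x - g x)\<^sup>2) =
        2 * (LINT x|M. (F n x - f x)\<^sup>2) + 2 * (LINT x|M. (G n x - g x)\<^sup>2)" for n
      using sq by (simp add: square_integrableD square_integrable_diff)
    finally show "\<forall>\<^sub>F n in sequentially. (LINT x|M. (F n x + G n x - (f x + g x))\<^sup>2)
       \<le> 2 * (LINT x|M. (F n x - f x)\<^sup>2) + 2 * (LINT x|M. (G n x - g x)\<^sup>2)" by simp
  qed auto
  then show ?thesis using sq by (auto simp: L2_tendsto_def intro: square_integrable_add)
qed

lemma L2_tendsto_mult_bounded:
  assumes F: "L2_tendsto M F f" and m: "m \<in> borel_measurable M" "AE x in M. \<bar>m x\<bar> \<le> B"
  shows "L2_tendsto M (\<lambda>n x. m x * F n x) (\<lambda>x. m x * f x)"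
proof -
  have sq: "square_integrable M (F n)" "square_integrable M f" for n
    using F by (auto simp: L2_tendsto_def)
  note sqm = square_integrable_mult_bounded[OF _ m]
  have "(\<lambda>n. LINT x|M. (m x * F n x - m x * f x)\<^sup>2) \<longlonglongrightarrow> 0"
  proof (rule tendsto_sandwich[OF _ _ tendsto_const])
    show "(\<lambda>n. B\<^sup>2 * (LINT x|M. (F n x - f x)\<^sup>2)) \<longlonglongrightarrow> 0"
      using F by (auto simp: L2_tendsto_def intro!: tendsto_mult_right_zero)
    have "(LINT x|M. (m x * F n x - m x * f x)\<^sup>2) \<le> (LINT x|M. B\<^sup>2 * (F n x - f x)\<^sup>2)" for n
    proof (rule integral_mono_AE)
      show "AE x in M. (m x * F n x - m x * f x)\<^sup>2 \<le> B\<^sup>2 * (F n x - f x)\<^sup>2"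
        using m(2)
      proof eventually_elim
        case (elim x)
        have "(m x)\<^sup>2 \<le> B\<^sup>2" using elim power_mono[of "\<bar>m x\<bar>" B 2] by simp
        then have "(m x)\<^sup>2 * (F n x - f x)\<^sup>2 \<le> B\<^sup>2 * (F n x - f x)\<^sup>2" by (rule mult_right_mono) simp
        then show ?case by (simp add: power_mult_distrib flip: right_diff_distrib)
      qed
    qed (use sq in \<open>auto intro!: square_integrableD square_integrable_diff sqm\<close>)
    then show "\<forall>\<^sub>F n in sequentially. (LINT x|M. (m x * F n x - m x * f x)\<^sup>2) \<le> B\<^sup>2 * (LINT x|M. (F n x - f x)\<^sup>2)"
      by simp
  qed auto
  then show ?thesis using sq by (auto simp: L2_tendsto_def intro: sqm)
qed

section \<open>Mollification\<close>

lemma integrable_lebesgue_bounded_support: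
  fixes f :: "'a::euclidean_space \<Rightarrow> real"
  assumes "f \<in> borel_measurable lebesgue" "\<And>x. \<bar>f x\<bar> \<le> B" "\<forall>x. norm x > R \<longrightarrow> f x = 0"
  shows "integrable lebesgue f"
proof (rule integrableI_bounded_set[where A = "cball 0 R" and B = B])
  show "emeasure lebesgue (cball (0::'a) R) < \<infinity>"
    using emeasure_bounded_finite[of "cball (0::'a) R"] by simp
qed (use assms in auto)

lemma continuous_bounded_support:
  fixes f :: "'a::euclidean_space \<Rightarrow> real"
  assumes "continuous_on UNIV f" "\<forall>x. norm x > R \<longrightarrow> f x = 0"
  obtains B where "B > 0" "\<And>x. \<bar>f x\<bar> \<le> B"
proof -
  have "compact (f ` cball 0 R)"
    using assms(1) by (intro compact_continuous_image continuous_on_subset[OF assms(1)]) auto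
  then obtain B where B: "B > 0" "\<And>y. y \<in> f ` cball 0 R \<Longrightarrow> norm y \<le> B"
    using compact_imp_bounded bounded_pos by metis
  have "\<bar>f x\<bar> \<le> B" for x
    using B assms(2) by (cases "norm x \<le> R") auto
  then show ?thesis using that B(1) by blast
qed

lemma continuous_measurable_lebesgue:
  "continuous_on UNIV f \<Longrightarrow> f \<in> borel_measurable lebesgue"
  for f :: "'a::euclidean_space \<Rightarrow> 'b::{second_countable_topology, topological_space}"
  by (intro measurable_completion) (simp add: borel_measurable_continuous_onI)

lemma integrable_continuous_bounded_support:
  fixes f :: "'a::euclidean_space \<Rightarrow> real"
  assumes "continuous_on UNIV f" "\<forall>x. norm x > R \<longrightarrow> f x = 0"
  shows "integrable lebesgue f"
proof -
  obtain B where "B > 0" "\<And>x. \<bar>f x\<bar> \<le> B" using continuous_bounded_support[OF assms] by blast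
  then show ?thesis
    using assms by (intro integrable_lebesgue_bounded_support continuous_measurable_lebesgue)
qed

definition convolve :: "(real ^ 'n \<Rightarrow> real) \<Rightarrow> (real ^ 'n \<Rightarrow> real) \<Rightarrow> real ^ 'n \<Rightarrow> real" where
  "convolve f \<phi> x = (LINT y|lebesgue. f y * \<phi> (x - y))"

lemma integrable_convolve:
  fixes f :: "real ^ 'n \<Rightarrow> real"
  assumes f: "integrable lebesgue f" and c: "continuous_on UNIV \<phi>" and B: "\<And>x. \<bar>\<phi> x\<bar> \<le> B"
  shows "integrable lebesgue (\<lambda>y. f y * \<phi> (x - y))"
proof (rule Bochner_Integration.integrable_bound)
  show "integrable lebesgue (\<lambda>y. B * f y)" using f by simp
  have "(\<lambda>y. \<phi> (x - y)) \<in> borel_measurable lebesgue"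
    by (intro continuous_measurable_lebesgue continuous_on_compose2[OF c] continuous_intros) auto
  then show "(\<lambda>y. f y * \<phi> (x - y)) \<in> borel_measurable lebesgue" using f by simp
  have "B \<ge> 0" using B[of 0] by linarith
  then show "AE y in lebesgue. norm (f y * \<phi> (x - y)) \<le> norm (B * f y)"
    using mult_left_mono[OF B[of "x - _"], of "\<bar>f _\<bar>"] by (intro AE_I2) (simp add: abs_mult mult.commute)
qed

lemma frechet_derivative_pderivative:
  fixes f :: "real ^ 'n \<Rightarrow> real"
  assumes "Ck_function (Suc k) f"
  shows "frechet_derivative f (at x) h = (\<Sum>i\<in>UNIV. h $ i * pderivative i f x)"
proof -
  have l: "linear (frechet_derivative f (at x))"
    using Ck_Suc_has_derivative[OF assms] has_derivative_linear by blast
  have "frechet_derivative f (at x) h = frechet_derivative f (at x) (\<Sum>i\<in>UNIV. (h $ i) *\<^sub>R axis i 1)"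
    by (simp add: basis_expansion flip: scalar_mult_eq_scaleR)
  also have "\<dots> = (\<Sum>i\<in>UNIV. h $ i * pderivative i f x)"
    by (simp add: linear_sum[OF l] linear_cmul[OF l] pderivative_def)
  finally show ?thesis .
qed

lemma pderivative_zero_outside:
  fixes \<phi> :: "real ^ 'n \<Rightarrow> real"
  assumes "closed S" "\<And>x. x \<notin> S \<Longrightarrow> \<phi> x = 0" "x \<notin> S"
  shows "pderivative i \<phi> x = 0"
proof -
  have "(\<phi> has_derivative (\<lambda>h. 0)) (at x)"
    by (rule has_derivative_transform_within_open[OF has_derivative_const[of 0], of "- S"])
      (use assms in \<open>simp_all add: open_Compl\<close>)
  then show ?thesis by (simp add: pderivative_eq)
qed

text \<open>
  Differentiation under the integral sign: the difference quotients of \<open>\<phi>\<close> are bounded by its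
  Lipschitz constant, so \<open>2 L |f|\<close> dominates the remainder.
\<close>

lemma convolve_has_derivative:
  fixes f :: "real ^ 'n \<Rightarrow> real"
  assumes f: "integrable lebesgue f" and \<phi>: "Ck_function (Suc 0) \<phi>" and supp: "\<forall>x. norm x > R \<longrightarrow> \<phi> x = 0"
  shows "(convolve f \<phi> has_derivative (\<lambda>h. \<Sum>i\<in>UNIV. h $ i * convolve f (pderivative i \<phi>) x)) (at x)"
proof -
  have c: "continuous_on UNIV \<phi>" "continuous_on UNIV (pderivative i \<phi>)" for i
    using Ck_continuous[OF \<phi>] \<phi> by auto
  have supp': "\<forall>x. norm x > R \<longrightarrow> pderivative i \<phi> x = 0" for i
    using pderivative_zero_outside[of "cball 0 R" \<phi> _ i] supp by auto
  obtain B0 where B0: "\<And>x. \<bar>\<phi> x\<bar> \<le> B0"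
    using continuous_bounded_support[OF c(1) supp] by metis
  have "\<exists>B. \<forall>x. \<bar>pderivative i \<phi> x\<bar> \<le> B" for i
    using continuous_bounded_support[OF c(2) supp'] by metis
  then obtain B where B: "\<And>i x. \<bar>pderivative i \<phi> x\<bar> \<le> B i" by metis
  define L where "L = (\<Sum>i\<in>UNIV. B i)"
  have D: "\<bar>\<Sum>i\<in>UNIV. h $ i * pderivative i \<phi> z\<bar> \<le> L * norm h" for h z
  proof -
    have "\<bar>\<Sum>i\<in>UNIV. h $ i * pderivative i \<phi> z\<bar> \<le> (\<Sum>i\<in>UNIV. \<bar>h $ i * pderivative i \<phi> z\<bar>)" by (rule sum_abs)
    also have "\<dots> \<le> (\<Sum>i\<in>UNIV. norm h * B i)"
      unfolding abs_mult using B component_le_norm_cart[of h] by (intro sum_mono mult_mono) auto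
    finally show ?thesis by (simp add: L_def sum_distrib_left mult.commute)
  qed
  have Lip: "\<bar>\<phi> (z + h) - \<phi> z\<bar> \<le> L * norm h" for z h
  proof -
    have "norm (\<phi> (z + h) - \<phi> z) \<le> L * norm (z + h - z)"
    proof (rule differentiable_bound[of UNIV \<phi> "\<lambda>x. frechet_derivative \<phi> (at x)"])
      fix x
      show "(\<phi> has_derivative frechet_derivative \<phi> (at x)) (at x within UNIV)"
        using Ck_Suc_has_derivative[OF \<phi>] by simp
      show "onorm (frechet_derivative \<phi> (at x)) \<le> L"
        using D by (intro onorm_le) (simp add: frechet_derivative_pderivative[OF \<phi>])
    qed auto
    then show ?thesis by simp
  qed
  have int: "integrable lebesgue (\<lambda>y. f y * \<phi> (x - y))" for x
    using integrable_convolve[OF f c(1) B0] .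
  have int': "integrable lebesgue (\<lambda>y. f y * pderivative i \<phi> (x - y))" for x i
    using integrable_convolve[OF f c(2) B] .
  \<comment> \<open>The remainder of first order, divided by the length of the increment.\<close>
  define E where "E h y = (\<phi> (x - y + h) - \<phi> (x - y) - (\<Sum>i\<in>UNIV. h $ i * pderivative i \<phi> (x - y))) / norm h" for h y
  have E_eq: "(convolve f \<phi> (x + h) - convolve f \<phi> x - (\<Sum>i\<in>UNIV. h $ i * convolve f (pderivative i \<phi>) x)) / norm h
     = (LINT y|lebesgue. f y * E h y)" for h
  proof -
    have "(LINT y|lebesgue. f y * E h y) = (LINT y|lebesgue. (f y * \<phi> (x + h - y) - f y * \<phi> (x - y) -
        (\<Sum>i\<in>UNIV. h $ i * (f y * pderivative i \<phi> (x - y)))) / norm h)"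
      by (intro Bochner_Integration.integral_cong refl)
        (simp add: E_def algebra_simps sum_distrib_left diff_divide_distrib)
    also have "\<dots> = (convolve f \<phi> (x + h) - convolve f \<phi> x - (\<Sum>i\<in>UNIV. h $ i * convolve f (pderivative i \<phi>) x)) / norm h"
      unfolding convolve_def using int int'
      by (simp add: Bochner_Integration.integral_sum Bochner_Integration.integrable_sum)
    finally show ?thesis by simp
  qed
  have "((\<lambda>h. LINT y|lebesgue. f y * E h y) \<longlongrightarrow> 0) (at 0)"
    unfolding tendsto_at_iff_sequentially
  proof (intro allI impI)
    fix X :: "nat \<Rightarrow> real ^ 'n" assume X: "\<forall>i. X i \<in> UNIV - {0}" "X \<longlonglongrightarrow> 0"
    have "(\<lambda>n. LINT y|lebesgue. f y * E (X n) y) \<longlonglongrightarrow> (LINT (y :: real ^ 'n)|lebesgue. 0)"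
    proof (rule integral_dominated_convergence[where w = "\<lambda>y. 2 * L * \<bar>f y\<bar>"])
      show "integrable lebesgue (\<lambda>y. 2 * L * \<bar>f y\<bar>)" using f by simp
      have "(\<lambda>y. E h y) \<in> borel_measurable lebesgue" for h
      proof -
        have [measurable]: "(\<lambda>y. \<phi> (x - y + h)) \<in> borel_measurable lebesgue" "(\<lambda>y. \<phi> (x - y)) \<in> borel_measurable lebesgue"
          "(\<lambda>y. pderivative i \<phi> (x - y)) \<in> borel_measurable lebesgue" for i
          by (intro continuous_measurable_lebesgue continuous_intros
              continuous_on_compose2[OF c(1)] continuous_on_compose2[OF c(2)]; simp)+
        show ?thesis unfolding E_def by measurable
      qed
      then show "(\<lambda>y. f y * E (X n) y) \<in> borel_measurable lebesgue" for n using f by simp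
      show "AE y in lebesgue. (\<lambda>n. f y * E (X n) y) \<longlonglongrightarrow> 0"
      proof (intro AE_I2 tendsto_mult_right_zero)
        fix y
        have "((\<lambda>h. E h y) \<longlongrightarrow> 0) (at 0)"
        proof (rule tendsto_norm_zero_cancel)
          have "norm (E h y) = norm (\<phi> (x - y + h) - \<phi> (x - y) - frechet_derivative \<phi> (at (x - y)) h) / norm h" for h
            by (simp add: E_def frechet_derivative_pderivative[OF \<phi>])
          then show "((\<lambda>h. norm (E h y)) \<longlongrightarrow> 0) (at 0)"
            using Ck_Suc_has_derivative[OF \<phi>, of "x - y"] unfolding has_derivative_at by simp
        qed
        then show "(\<lambda>n. E (X n) y) \<longlonglongrightarrow> 0"
          using X unfolding tendsto_at_iff_sequentially o_def by auto
      qed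
      show "AE y in lebesgue. norm (f y * E (X n) y) \<le> 2 * L * \<bar>f y\<bar>" for n
      proof (intro AE_I2)
        fix y
        have "X n \<noteq> 0" using X by auto
        have "\<bar>\<phi> (x - y + X n) - \<phi> (x - y) - (\<Sum>i\<in>UNIV. X n $ i * pderivative i \<phi> (x - y))\<bar> \<le> 2 * L * norm (X n)"
          using Lip[of "x - y" "X n"] D[of "X n" "x - y"] by linarith
        then have "\<bar>E (X n) y\<bar> \<le> 2 * L"
          using \<open>X n \<noteq> 0\<close> by (simp add: E_def divide_le_eq)
        then show "norm (f y * E (X n) y) \<le> 2 * L * \<bar>f y\<bar>"
          by (simp add: abs_mult mult.commute mult_left_mono)
      qed
    qed simp
    then show "((\<lambda>h. LINT y|lebesgue. f y * E h y) \<circ> X) \<longlonglongrightarrow> 0" by (simp add: o_def)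
  qed
  from tendsto_norm_zero[OF this] have "((\<lambda>h. norm (convolve f \<phi> (x + h) - convolve f \<phi> x - (\<Sum>i\<in>UNIV. h $ i * convolve f (pderivative i \<phi>) x)) / norm h) \<longlongrightarrow> 0) (at 0)"
    by (simp only: E_eq[symmetric] abs_divide real_norm_def abs_norm_cancel)
  moreover have "bounded_linear (\<lambda>h. \<Sum>i\<in>UNIV. h $ i * convolve f (pderivative i \<phi>) x)"
    by (intro bounded_linear_sum bounded_linear_mult_const bounded_linear_vec_nth)
  ultimately show ?thesis unfolding has_derivative_at by simp
qed

lemma pderivative_convolve:
  assumes "integrable lebesgue f" and "Ck_function (Suc 0) \<phi>" and "\<forall>x. norm x > R \<longrightarrow> \<phi> x = 0"
  shows "pderivative i (convolve f \<phi>) x = convolve f (pderivative i \<phi>) x"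
proof -
  have "pderivative i (convolve f \<phi>) x = (\<Sum>j\<in>UNIV. axis i 1 $ j * convolve f (pderivative j \<phi>) x)"
    by (rule pderivative_eq[OF convolve_has_derivative[OF assms]])
  also have "\<dots> = (\<Sum>j\<in>UNIV. if j = i then convolve f (pderivative j \<phi>) x else 0)"
    by (intro sum.cong) (auto simp: axis_def)
  finally show ?thesis by simp
qed

lemma Ck_convolve:
  assumes f: "integrable lebesgue f" and \<phi>: "\<And>k. Ck_function k \<phi>" and supp: "\<forall>x. norm x > R \<longrightarrow> \<phi> x = 0"
  shows "Ck_function k (convolve f \<phi>)"
  using \<phi> supp
proof (induction k arbitrary: \<phi>)
  case 0
  then show ?case
    using has_derivative_continuous[OF convolve_has_derivative[OF f 0]]
    by (simp add: continuous_on_eq_continuous_at)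
next
  case (Suc k)
  have "pderivative i (convolve f \<phi>) = convolve f (pderivative i \<phi>)" for i
    using pderivative_convolve[OF f Suc.prems] by auto
  moreover have "Ck_function k (convolve f (pderivative i \<phi>))" for i
    using Suc.prems(1)[of "Suc _"] pderivative_zero_outside[of "cball 0 R" \<phi> _ i] Suc.prems(2)
    by (intro Suc.IH) auto
  moreover have "convolve f \<phi> differentiable_on UNIV"
    using convolve_has_derivative[OF f Suc.prems] by (auto simp: differentiable_on_def differentiable_def)
  ultimately show ?case by simp
qed

subsection \<open>The standard mollifier\<close>

definition mollifier :: "real \<Rightarrow> real ^ 'n \<Rightarrow> real" where
  "mollifier \<epsilon> x = bump \<epsilon> x / (LINT y|lebesgue. bump \<epsilon> (y :: real ^ 'n))"

lemma Ck_mollifier: "Ck_function k (mollifier \<epsilon>)"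
  using Ck_mult[OF Ck_const Ck_bump, of k "1 / (LINT y|lebesgue. bump \<epsilon> (y :: real ^ 'n))" \<epsilon>]
  by (simp add: mollifier_def[abs_def])

lemma bump_zero: "\<epsilon> > 0 \<Longrightarrow> \<epsilon> \<le> norm x \<Longrightarrow> bump \<epsilon> x = 0"
  using bump_pos_iff[of \<epsilon> x] bump_nonneg[of \<epsilon> x] by linarith

lemma mollifier_zero: "\<epsilon> > 0 \<Longrightarrow> \<epsilon> \<le> norm x \<Longrightarrow> mollifier \<epsilon> x = 0"
  by (simp add: mollifier_def bump_zero)

lemma mollifier_nonneg: "0 \<le> mollifier \<epsilon> x"
  by (simp add: mollifier_def bump_nonneg Bochner_Integration.integral_nonneg)

lemma mollifier_minus: "mollifier \<epsilon> (- x) = mollifier \<epsilon> x"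
  by (simp add: mollifier_def bump_def)

lemma mollifier_bounded:
  assumes "\<epsilon> > 0"
  obtains B where "\<And>x :: real ^ 'n. \<bar>mollifier \<epsilon> x\<bar> \<le> B"
proof -
  have "\<forall>x :: real ^ 'n. norm x > \<epsilon> \<longrightarrow> mollifier \<epsilon> x = 0" by (simp add: mollifier_zero[OF assms])
  then show ?thesis
    using continuous_bounded_support[OF Ck_continuous[OF Ck_mollifier]] that by blast
qed

lemma integrable_bump: "\<epsilon> > 0 \<Longrightarrow> integrable lebesgue (bump \<epsilon> :: real ^ 'n \<Rightarrow> real)"
  by (rule integrable_continuous_bounded_support[OF Ck_continuous[OF Ck_bump], of \<epsilon>]) (simp add: bump_zero)

lemma integral_mollifier: "\<epsilon> > 0 \<Longrightarrow> (LINT y|lebesgue. mollifier \<epsilon> (y :: real ^ 'n)) = 1"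
proof -
  assume e: "\<epsilon> > 0"
  have "(LINT y|lebesgue. bump \<epsilon> (y :: real ^ 'n)) \<noteq> 0"
  proof
    assume "(LINT y|lebesgue. bump \<epsilon> (y :: real ^ 'n)) = 0"
    then have "AE y :: real ^ 'n in lebesgue. bump \<epsilon> y = 0"
      using integral_nonneg_eq_0_iff_AE[OF integrable_bump[OF e]] bump_nonneg by auto
    then have "AE y :: real ^ 'n in lebesgue. y \<notin> ball 0 \<epsilon>"
      by eventually_elim (use bump_pos_iff[OF e] in \<open>auto simp: less_le\<close>)
    then have "ball (0 :: real ^ 'n) \<epsilon> \<in> null_sets lebesgue"
      by (subst (asm) AE_iff_null_sets[symmetric]) auto
    then have "negligible (ball (0 :: real ^ 'n) \<epsilon>)" by (simp add: negligible_iff_null_sets)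
    then show False using e open_not_negligible[of "ball (0 :: real ^ 'n) \<epsilon>"] by auto
  qed
  then show ?thesis by (simp add: mollifier_def)
qed

lemma nn_integral_reflect:
  fixes f :: "'a::euclidean_space \<Rightarrow> ennreal"
  assumes "f \<in> borel_measurable borel"
  shows "(\<integral>\<^sup>+y. f (x - y) \<partial>lborel) = (\<integral>\<^sup>+y. f y \<partial>lborel)"
proof -
  have "lborel = distr lborel borel (\<lambda>y. x - y)"
    using lborel_affine[of "-1" x] by (simp add: density_1)
  then have "(\<integral>\<^sup>+y. f y \<partial>lborel) = (\<integral>\<^sup>+y. f y \<partial>distr lborel borel (\<lambda>y. x - y))"
    by simp
  also have "\<dots> = (\<integral>\<^sup>+y. f (x - y) \<partial>lborel)"
    using assms by (intro nn_integral_distr) auto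
  finally show ?thesis by simp
qed

lemma nn_integral_mollifier:
  fixes x :: "real ^ 'n"
  assumes "\<epsilon> > 0"
  shows "(\<integral>\<^sup>+y. ennreal (mollifier \<epsilon> (x - y)) \<partial>lborel) = 1" "(\<integral>\<^sup>+y. ennreal (mollifier \<epsilon> (y - x)) \<partial>lborel) = 1"
proof -
  have m: "mollifier \<epsilon> \<in> borel_measurable borel"
    by (intro borel_measurable_continuous_onI Ck_continuous[OF Ck_mollifier])
  have i: "integrable lebesgue (mollifier \<epsilon> :: real ^ 'n \<Rightarrow> real)"
    by (rule integrable_continuous_bounded_support[OF Ck_continuous[OF Ck_mollifier], of \<epsilon>])
      (simp add: mollifier_zero[OF assms])
  have "(\<integral>\<^sup>+y. ennreal (mollifier \<epsilon> (x - y)) \<partial>lborel) = (\<integral>\<^sup>+y. ennreal (mollifier \<epsilon> (y :: real ^ 'n)) \<partial>lborel)"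
    using m by (intro nn_integral_reflect measurable_compose[OF _ measurable_ennreal])
  also have "\<dots> = (\<integral>\<^sup>+y. ennreal (mollifier \<epsilon> (y :: real ^ 'n)) \<partial>lebesgue)"
    by (simp add: nn_integral_completion)
  also have "\<dots> = 1"
    using nn_integral_eq_integral[OF i] integral_mollifier[OF assms] by (simp add: mollifier_nonneg)
  finally show *: "(\<integral>\<^sup>+y. ennreal (mollifier \<epsilon> (x - y)) \<partial>lborel) = 1" .
  have "mollifier \<epsilon> (y - x) = mollifier \<epsilon> (x - y)" for y
    using mollifier_minus[of \<epsilon> "x - y"] by simp
  then show "(\<integral>\<^sup>+y. ennreal (mollifier \<epsilon> (y - x)) \<partial>lborel) = 1" using * by simp
qed

lemma mollifier_shift:
  fixes x :: "real ^ 'n"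
  assumes "\<epsilon> > 0"
  shows "integrable lebesgue (\<lambda>y. mollifier \<epsilon> (x - y))" "(LINT y|lebesgue. mollifier \<epsilon> (x - y)) = 1"
proof -
  have "has_bochner_integral lebesgue (\<lambda>y. mollifier \<epsilon> (x - y)) 1"
  proof (rule has_bochner_integral_nn_integral)
    show "(\<lambda>y. mollifier \<epsilon> (x - y)) \<in> borel_measurable lebesgue"
      by (intro continuous_measurable_lebesgue continuous_on_compose2[OF Ck_continuous[OF Ck_mollifier]] continuous_intros) auto
    show "(\<integral>\<^sup>+y. ennreal (mollifier \<epsilon> (x - y)) \<partial>lebesgue) = ennreal 1"
      using nn_integral_mollifier(1)[OF assms, of x] by (simp add: nn_integral_completion)
  qed (auto simp: mollifier_nonneg)
  then show "integrable lebesgue (\<lambda>y. mollifier \<epsilon> (x - y))" "(LINT y|lebesgue. mollifier \<epsilon> (x - y)) = 1"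
    by (auto simp: has_bochner_integral_iff)
qed

subsection \<open>Mean square convergence of mollifications\<close>

lemma square_diff_le: "(a - b)\<^sup>2 \<le> 2 * a\<^sup>2 + 2 * (b::real)\<^sup>2"
  using square_sum_le[of a "- b"] by simp

lemma convolve_cong_AE:
  fixes f :: "real ^ 'n \<Rightarrow> real"
  assumes "f \<in> borel_measurable lebesgue" "f' \<in> borel_measurable lebesgue" "AE y in lebesgue. f y = f' y"
    and "continuous_on UNIV \<phi>"
  shows "convolve f \<phi> x = convolve f' \<phi> x"
proof -
  have "(\<lambda>y. \<phi> (x - y)) \<in> borel_measurable lebesgue"
    by (intro continuous_measurable_lebesgue continuous_on_compose2[OF assms(4)] continuous_intros) auto
  then show ?thesis unfolding convolve_def
    using assms by (intro integral_cong_AE) (auto elim: eventually_mono)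
qed

text \<open>This is the Cauchy--Schwarz inequality for the probability density \<open>\<lambda>y. mollifier \<epsilon> (x - y)\<close>.\<close>

lemma convolve_mollifier_square_le:
  fixes f :: "real ^ 'n \<Rightarrow> real"
  assumes e: "\<epsilon> > 0" and f: "integrable lebesgue f" and f2: "integrable lebesgue (\<lambda>x. (f x)\<^sup>2)"
  shows "(convolve f (mollifier \<epsilon>) x)\<^sup>2 \<le> (LINT y|lebesgue. (f y)\<^sup>2 * mollifier \<epsilon> (x - y))"
proof -
  obtain B where B: "\<And>x :: real ^ 'n. \<bar>mollifier \<epsilon> x\<bar> \<le> B" using mollifier_bounded[OF e] by blast
  note i = integrable_convolve[OF f Ck_continuous[OF Ck_mollifier] B, of x]
  note i2 = integrable_convolve[OF f2 Ck_continuous[OF Ck_mollifier] B, of x]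
  define c where "c = convolve f (mollifier \<epsilon>) x"
  have "0 \<le> (LINT y|lebesgue. (f y - c)\<^sup>2 * mollifier \<epsilon> (x - y))"
    by (simp add: Bochner_Integration.integral_nonneg mollifier_nonneg)
  also have "\<dots> = (LINT y|lebesgue. (f y)\<^sup>2 * mollifier \<epsilon> (x - y) - 2 * c * (f y * mollifier \<epsilon> (x - y)) + c\<^sup>2 * mollifier \<epsilon> (x - y))"
    by (intro Bochner_Integration.integral_cong refl) (simp add: power2_eq_square algebra_simps)
  also have "\<dots> = (LINT y|lebesgue. (f y)\<^sup>2 * mollifier \<epsilon> (x - y)) - 2 * c * c + c\<^sup>2"
    using i i2 mollifier_shift[OF e, of x] by (simp add: c_def convolve_def)
  finally show ?thesis by (simp add: c_def power2_eq_square)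
qed

text \<open>
  The pointwise bound is integrated over \<open>x\<close> and the order of integration exchanged; the mollifier has
  mass one in either variable. Tonelli's theorem concerns Borel functions, hence the Borel
  representative \<open>f'\<close>.
\<close>

lemma convolve_mollifier_contraction:
  fixes f :: "real ^ 'n \<Rightarrow> real"
  assumes e: "\<epsilon> > 0" and f: "integrable lebesgue f" and f2: "square_integrable lebesgue f"
  shows "square_integrable lebesgue (convolve f (mollifier \<epsilon>))"
    and "(LINT x|lebesgue. (convolve f (mollifier \<epsilon>) x)\<^sup>2) \<le> (LINT x|lebesgue. (f x)\<^sup>2)"
proof -
  obtain B where B: "\<And>x :: real ^ 'n. \<bar>mollifier \<epsilon> x\<bar> \<le> B" using mollifier_bounded[OF e] by blast
  obtain f' where f'[measurable]: "f' \<in> borel_measurable lborel" and ff': "AE x in lborel. f x = f' x"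
    using completion_ex_borel_measurable_real[of f lborel] f by blast
  have ff'': "AE x in lebesgue. f x = f' x" using ff' by (rule AE_completion)
  have f'm: "f' \<in> borel_measurable lebesgue" by (rule measurable_completion[OF f'])
  have if': "integrable lebesgue f'"
    using f ff'' integrable_cong_AE[of f lebesgue f'] f'm by auto
  have f2': "square_integrable lebesgue f'"
    using square_integrable_cong_AE[OF f2 f'm ff''] .
  have meq: "convolve f (mollifier \<epsilon>) = convolve f' (mollifier \<epsilon>)"
    using f f'm ff'' by (intro ext convolve_cong_AE Ck_continuous[OF Ck_mollifier]) auto
  have [measurable]: "mollifier \<epsilon> \<in> borel_measurable (borel :: (real ^ 'n) measure)"
    by (intro borel_measurable_continuous_onI Ck_continuous[OF Ck_mollifier])
  have cm: "convolve f (mollifier \<epsilon>) \<in> borel_measurable lebesgue"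
    by (intro continuous_measurable_lebesgue Ck_continuous[OF Ck_convolve[OF f Ck_mollifier, of \<epsilon>]])
      (simp add: mollifier_zero[OF e])
  have "(\<integral>\<^sup>+x. ennreal ((convolve f (mollifier \<epsilon>) x)\<^sup>2) \<partial>lebesgue)
     \<le> (\<integral>\<^sup>+x. ennreal (LINT y|lebesgue. (f' y)\<^sup>2 * mollifier \<epsilon> (x - y)) \<partial>lebesgue)"
    unfolding meq using convolve_mollifier_square_le[OF e if' square_integrableD[OF f2']]
    by (intro nn_integral_mono ennreal_leI)
  also have "\<dots> = (\<integral>\<^sup>+x. (\<integral>\<^sup>+y. ennreal ((f' y)\<^sup>2 * mollifier \<epsilon> (x - y)) \<partial>lborel) \<partial>lborel)"
    using integrable_convolve[OF square_integrableD[OF f2'] Ck_continuous[OF Ck_mollifier] B]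
    by (simp add: nn_integral_completion mollifier_nonneg flip: nn_integral_eq_integral)
  also have "\<dots> = (\<integral>\<^sup>+y. (\<integral>\<^sup>+x. ennreal ((f' y)\<^sup>2 * mollifier \<epsilon> (x - y)) \<partial>lborel) \<partial>lborel)"
    by (rule lborel_pair.Fubini'[symmetric]) measurable
  also have "\<dots> = (\<integral>\<^sup>+y. ennreal ((f' y)\<^sup>2) \<partial>lborel)"
    by (simp add: ennreal_mult mollifier_nonneg nn_integral_cmult nn_integral_mollifier(2)[OF e])
  also have "\<dots> = ennreal (LINT x|lebesgue. (f x)\<^sup>2)"
  proof -
    have "(LINT x|lebesgue. (f' x)\<^sup>2) = (LINT x|lebesgue. (f x)\<^sup>2)"
      using ff'' f f'm by (intro integral_cong_AE) (auto elim: eventually_mono)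
    then show ?thesis
      using nn_integral_eq_integral[OF square_integrableD[OF f2']] by (simp add: nn_integral_completion)
  qed
  finally have le: "(\<integral>\<^sup>+x. ennreal ((convolve f (mollifier \<epsilon>) x)\<^sup>2) \<partial>lebesgue) \<le> ennreal (LINT x|lebesgue. (f x)\<^sup>2)" .
  then have i: "integrable lebesgue (\<lambda>x. (convolve f (mollifier \<epsilon>) x)\<^sup>2)"
    using cm by (intro integrableI_nonneg) (auto intro: le_less_trans)
  then show "square_integrable lebesgue (convolve f (mollifier \<epsilon>))"
    using cm by (simp add: square_integrable_def)
  show "(LINT x|lebesgue. (convolve f (mollifier \<epsilon>) x)\<^sup>2) \<le> (LINT x|lebesgue. (f x)\<^sup>2)"
    using le nn_integral_eq_integral[OF i] by simp
qed

lemma integrable_indicator_cball: "integrable lebesgue (indicat_real (cball (0::'a::euclidean_space) R))"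
  by (rule integrable_lebesgue_bounded_support[of _ 1 R])
    (auto split: split_indicator intro!: measurable_completion borel_measurable_indicator)

lemma square_integrable_indicator_cball: "square_integrable lebesgue (indicat_real (cball (0::'a::euclidean_space) R))"
proof -
  have "(\<lambda>x. (indicat_real (cball (0::'a) R) x)\<^sup>2) = indicat_real (cball 0 R)" by (auto simp: indicator_def)
  then show ?thesis using integrable_indicator_cball[where 'a = 'a, of R] borel_measurable_integrable
    unfolding square_integrable_def by metis
qed

lemma integrable_of_square_integrable:
  fixes f :: "'a::euclidean_space \<Rightarrow> real"
  assumes f: "square_integrable lebesgue f" and R: "\<forall>x. norm x > R \<longrightarrow> f x = 0"
  shows "integrable lebesgue f"
proof -
  have "square_integrable lebesgue (indicator (cball 0 R) :: 'a \<Rightarrow> real)"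
    by (rule square_integrable_indicator_cball)
  from integrable_mult_square_integrable[OF f this] show ?thesis
    by (rule Bochner_Integration.integrable_cong[THEN iffD1, rotated -1]) (use R in \<open>auto simp: indicator_def not_le\<close>)
qed

text \<open>
  The projection onto \<open>[-N, N]\<close>. It serves twice: for bounding functions, and, through \<open>t - clip N t\<close>,
  for removing the small values of a function.
\<close>

definition clip :: "real \<Rightarrow> real \<Rightarrow> real" where
  "clip N t = max (- N) (min N t)"

lemma clip_props:
  "N \<ge> 0 \<Longrightarrow> \<bar>clip N t\<bar> \<le> N" "N \<ge> 0 \<Longrightarrow> \<bar>clip N t\<bar> \<le> \<bar>t\<bar>" "\<bar>t\<bar> \<le> N \<Longrightarrow> clip N t = t"
  by (auto simp: clip_def)

lemma continuous_clip: "continuous_on UNIV (clip N)"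
  unfolding clip_def by (intro continuous_intros)

lemma clip_measurable [measurable]: "clip N \<in> borel_measurable borel"
  by (intro borel_measurable_continuous_onI continuous_clip)

lemma clip_tendsto: "(\<lambda>n. clip (real n) t) \<longlonglongrightarrow> t"
proof (rule tendsto_eventually)
  obtain n0 where "\<bar>t\<bar> \<le> real n0" using real_arch_simple by blast
  then show "\<forall>\<^sub>F n in sequentially. clip (real n) t = t"
    by (intro eventually_sequentiallyI[of n0] clip_props(3)) auto
qed

text \<open>
  A measurable function is the pointwise limit of continuous functions almost everywhere. Once \<open>f\<close> is
  truncated to bounded values and the approximants are cut off outside a ball, dominated convergence
  turns this into convergence in mean square.
\<close>

lemma L2_dense_continuous:
  fixes f :: "'a::euclidean_space \<Rightarrow> real"
  assumes f: "square_integrable lebesgue f" and R: "\<forall>x. norm x > R \<longrightarrow> f x = 0" and d: "\<delta> > 0"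
  obtains h where "continuous_on UNIV h" "\<forall>x. norm x > R + 1 \<longrightarrow> h x = 0" "(LINT x|lebesgue. (f x - h x)\<^sup>2) < \<delta>"
proof -
  note [measurable] = square_integrable_measurable[OF f]
  have "L2_tendsto lebesgue (\<lambda>n x. clip (real n) (f x)) f"
    by (intro L2_tendsto_dominated[OF _ _ square_integrable_abs[OF f]])
      (auto simp: clip_props clip_tendsto intro: measurable_compose[OF _ clip_measurable])
  then have "(\<lambda>n. LINT x|lebesgue. (clip (real n) (f x) - f x)\<^sup>2) \<longlonglongrightarrow> 0" by (simp add: L2_tendsto_def)
  then have "\<forall>\<^sub>F n in sequentially. (LINT x|lebesgue. (clip (real n) (f x) - f x)\<^sup>2) < \<delta> / 4"
    using d by (intro order_tendstoD) auto
  then obtain k where k: "(LINT x|lebesgue. (clip (real k) (f x) - f x)\<^sup>2) < \<delta> / 4"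
    using eventually_happens by force
  have sqk: "square_integrable lebesgue (\<lambda>x. clip (real k) (f x))"
    by (rule square_integrable_bound[OF _ f]) (auto simp: clip_props intro: measurable_compose[OF _ clip_measurable])
  obtain N g where N: "negligible N" and g: "\<And>n. continuous_on UNIV (g n)"
    and gf: "\<And>x. x \<notin> N \<Longrightarrow> (\<lambda>n. g n x) \<longlonglongrightarrow> f x"
    using lebesgue_measurable_imp_measurable_on[of f UNIV] unfolding measurable_on_def by auto
  define cut where "cut x = max 0 (min 1 (R + 1 - norm x))" for x :: 'a
  define h where "h n x = cut x * clip (real k) (g n x)" for n x
  have hc: "continuous_on UNIV (h n)" for n
    unfolding h_def cut_def by (intro continuous_intros continuous_on_compose2[OF continuous_clip g]) auto
  have h0: "\<forall>x. norm x > R + 1 \<longrightarrow> h n x = 0" for n by (simp add: h_def cut_def)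
  have lim: "(\<lambda>n. h n x) \<longlonglongrightarrow> clip (real k) (f x)" if "x \<notin> N" for x
  proof -
    have "(\<lambda>n. h n x) \<longlonglongrightarrow> cut x * clip (real k) (f x)"
      unfolding h_def
      by (intro tendsto_intros isCont_tendsto_compose[OF _ gf[OF that]])
        (metis continuous_clip continuous_on_eq_continuous_at open_UNIV UNIV_I)
    moreover have "cut x * clip (real k) (f x) = clip (real k) (f x)"
      using R by (cases "norm x > R") (auto simp: cut_def clip_def)
    ultimately show ?thesis by simp
  qed
  have "L2_tendsto lebesgue h (\<lambda>x. clip (real k) (f x))"
  proof (rule L2_tendsto_dominated[where G = "\<lambda>x. real k * indicator (cball 0 (R + 1)) x"])
    show "h n \<in> borel_measurable lebesgue" for n by (rule continuous_measurable_lebesgue[OF hc])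
    show "(\<lambda>x. clip (real k) (f x)) \<in> borel_measurable lebesgue" using sqk by (rule square_integrable_measurable)
    show "square_integrable lebesgue (\<lambda>x. real k * indicator (cball 0 (R + 1)) x)"
      by (intro square_integrable_cmult square_integrable_indicator_cball)
    show "AE x in lebesgue. \<bar>h n x\<bar> \<le> real k * indicator (cball 0 (R + 1)) x" for n
    proof (intro AE_I2)
      fix x
      have "\<bar>h n x\<bar> \<le> 1 * real k" unfolding h_def abs_mult
        by (intro mult_mono clip_props) (auto simp: cut_def)
      then show "\<bar>h n x\<bar> \<le> real k * indicator (cball 0 (R + 1)) x"
        using h0[of n] by (auto simp: indicator_def not_le)
    qed
    have "N \<in> null_sets lebesgue" using N by (simp add: negligible_iff_null_sets)
    then show "AE x in lebesgue. (\<lambda>n. h n x) \<longlonglongrightarrow> clip (real k) (f x)"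
      using lim by (intro AE_I'[of N]) auto
  qed
  then have sqh: "square_integrable lebesgue (h n)"
    and "(\<lambda>n. LINT x|lebesgue. (h n x - clip (real k) (f x))\<^sup>2) \<longlonglongrightarrow> 0" for n by (simp_all add: L2_tendsto_def)
  then have "\<forall>\<^sub>F n in sequentially. (LINT x|lebesgue. (h n x - clip (real k) (f x))\<^sup>2) < \<delta> / 4"
    using d by (intro order_tendstoD) auto
  then obtain n where n: "(LINT x|lebesgue. (h n x - clip (real k) (f x))\<^sup>2) < \<delta> / 4"
    using eventually_happens by force
  have "(LINT x|lebesgue. (f x - h n x)\<^sup>2) \<le>
      (LINT x|lebesgue. 2 * (clip (real k) (f x) - f x)\<^sup>2 + 2 * (h n x - clip (real k) (f x))\<^sup>2)"
  proof (intro integral_mono)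
    fix x
    have "(f x - h n x)\<^sup>2 = ((clip (real k) (f x) - f x) + (h n x - clip (real k) (f x)))\<^sup>2"
      by (simp add: power2_commute)
    then show "(f x - h n x)\<^sup>2 \<le> 2 * (clip (real k) (f x) - f x)\<^sup>2 + 2 * (h n x - clip (real k) (f x))\<^sup>2"
      using square_sum_le by metis
  qed (use f sqk sqh in \<open>auto intro!: square_integrableD square_integrable_diff Bochner_Integration.integrable_add integrable_mult_right\<close>)
  also have "\<dots> = 2 * (LINT x|lebesgue. (clip (real k) (f x) - f x)\<^sup>2) + 2 * (LINT x|lebesgue. (h n x - clip (real k) (f x))\<^sup>2)"
    using f sqk sqh by (simp add: square_integrableD square_integrable_diff)
  also have "\<dots> < \<delta>" using n k by linarith
  finally show ?thesis using that[OF hc h0] by blast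
qed

text \<open>
  A continuous function of bounded support is uniformly continuous, and a mollification averages its
  values over a small ball.
\<close>

lemma convolve_continuous_uniform:
  fixes h :: "real ^ 'n \<Rightarrow> real"
  assumes h: "continuous_on UNIV h" "\<forall>x. norm x > R \<longrightarrow> h x = 0" and d: "\<delta> > 0"
  obtains e where "e > 0" "\<And>\<epsilon> x. 0 < \<epsilon> \<Longrightarrow> \<epsilon> < e \<Longrightarrow> \<bar>convolve h (mollifier \<epsilon>) x - h x\<bar> \<le> \<delta>"
proof -
  have "uniformly_continuous_on (cball 0 (R + 1)) h"
    by (intro compact_uniformly_continuous continuous_on_subset[OF h(1)]) auto
  then obtain e where e: "e > 0" "\<And>x y. norm x \<le> R + 1 \<Longrightarrow> norm y \<le> R + 1 \<Longrightarrow> dist y x < e \<Longrightarrow> \<bar>h y - h x\<bar> < \<delta>"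
    using d unfolding uniformly_continuous_on_def by (auto simp: dist_real_def)
  have near: "\<bar>h y - h x\<bar> \<le> \<delta>" if "dist y x < min e 1" for x y
  proof (cases "norm x \<le> R + 1 \<and> norm y \<le> R + 1")
    case True
    then show ?thesis using e(2)[of x y] that by auto
  next
    case False
    have "\<bar>norm x - norm y\<bar> < 1" using that norm_triangle_ineq3[of x y] by (simp add: dist_norm norm_minus_commute)
    then have "norm x > R \<and> norm y > R" using False by auto
    then show ?thesis using h(2) d by auto
  qed
  have "\<bar>convolve h (mollifier \<epsilon>) x - h x\<bar> \<le> \<delta>" if \<epsilon>: "0 < \<epsilon>" "\<epsilon> < min e 1" for \<epsilon> x
  proof -
    obtain B where B: "\<And>x :: real ^ 'n. \<bar>mollifier \<epsilon> x\<bar> \<le> B" using mollifier_bounded[OF \<epsilon>(1)] by blast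
    have ih: "integrable lebesgue h" by (rule integrable_continuous_bounded_support[OF h])
    note i = integrable_convolve[OF ih Ck_continuous[OF Ck_mollifier] B, of x]
    note sh = mollifier_shift[OF \<epsilon>(1), of x]
    have "convolve h (mollifier \<epsilon>) x - h x = (LINT y|lebesgue. h y * mollifier \<epsilon> (x - y) - h x * mollifier \<epsilon> (x - y))"
      using i sh by (simp add: convolve_def)
    also have "\<bar>\<dots>\<bar> \<le> (LINT y|lebesgue. \<bar>h y * mollifier \<epsilon> (x - y) - h x * mollifier \<epsilon> (x - y)\<bar>)"
      by (rule integral_abs_bound)
    also have "\<dots> \<le> (LINT y|lebesgue. \<delta> * mollifier \<epsilon> (x - y))"
    proof (intro integral_mono integrable_abs)
      fix y
      have "\<bar>h y - h x\<bar> * mollifier \<epsilon> (x - y) \<le> \<delta> * mollifier \<epsilon> (x - y)"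
      proof (cases "norm (x - y) < \<epsilon>")
        case True
        then show ?thesis using near[of y x] \<epsilon>
          by (intro mult_right_mono mollifier_nonneg) (auto simp: dist_norm norm_minus_commute)
      qed (simp add: mollifier_zero[OF \<epsilon>(1)])
      then show "\<bar>h y * mollifier \<epsilon> (x - y) - h x * mollifier \<epsilon> (x - y)\<bar> \<le> \<delta> * mollifier \<epsilon> (x - y)"
        using mollifier_nonneg[of \<epsilon> "x - y"] by (simp add: abs_mult flip: left_diff_distrib)
    qed (use i sh in auto)
    also have "\<dots> = \<delta>" using sh by simp
    finally show ?thesis .
  qed
  moreover have "min e 1 > 0" using e by simp
  ultimately show ?thesis using that by blast
qed

lemma convolve_zero_outside:
  fixes f :: "real ^ 'n \<Rightarrow> real"
  assumes \<epsilon>: "\<epsilon> > 0" and "\<And>y. norm (x - y) < \<epsilon> \<Longrightarrow> f y = 0"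
  shows "convolve f (mollifier \<epsilon>) x = 0"
proof -
  have "f y * mollifier \<epsilon> (x - y) = 0" for y
    using assms(2)[of y] mollifier_zero[OF \<epsilon>, of "x - y"] by (cases "norm (x - y) < \<epsilon>") auto
  then have "(\<lambda>y. f y * mollifier \<epsilon> (x - y)) = (\<lambda>y. 0)" by blast
  then show ?thesis unfolding convolve_def by simp
qed

text \<open>
  Mollification contracts the mean square norm, so it suffices to approximate by continuous functions
  of bounded support, for which the convergence is uniform.
\<close>

theorem L2_tendsto_mollification:
  fixes f :: "real ^ 'n \<Rightarrow> real"
  assumes f: "square_integrable lebesgue f" and R: "\<forall>x. norm x > R \<longrightarrow> f x = 0"
    and \<epsilon>: "\<And>n. \<epsilon> n > 0" "\<epsilon> \<longlonglongrightarrow> 0"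
  shows "L2_tendsto lebesgue (\<lambda>n. convolve f (mollifier (\<epsilon> n))) f"
proof -
  have fi: "integrable lebesgue f" by (rule integrable_of_square_integrable[OF f R])
  have sq: "square_integrable lebesgue (convolve f (mollifier (\<epsilon> n)))" for n
    by (rule convolve_mollifier_contraction(1)[OF \<epsilon>(1) fi f])
  have "(\<lambda>n. LINT x|lebesgue. (convolve f (mollifier (\<epsilon> n)) x - f x)\<^sup>2) \<longlonglongrightarrow> 0"
  proof (rule tendstoI)
    fix \<delta> :: real assume d: "\<delta> > 0"
    obtain h where h: "continuous_on UNIV h" "\<forall>x. norm x > R + 1 \<longrightarrow> h x = 0" "(LINT x|lebesgue. (f x - h x)\<^sup>2) < \<delta> / 12"
      using L2_dense_continuous[OF f R, of "\<delta> / 12"] d by auto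
    have hi: "integrable lebesgue h" by (rule integrable_continuous_bounded_support[OF h(1,2)])
    have hs: "square_integrable lebesgue h"
      unfolding square_integrable_def using h
      by (intro conjI continuous_measurable_lebesgue integrable_continuous_bounded_support[of _ "R + 1"] continuous_intros) auto
    have fh: "square_integrable lebesgue (\<lambda>x. f x - h x)" "integrable lebesgue (\<lambda>x. f x - h x)"
      using f hs fi hi by (auto intro: square_integrable_diff)
    define I where "I x = (indicator (cball 0 (R + 2)) x :: real)" for x :: "real ^ 'n"
    have I: "integrable lebesgue I"
      unfolding I_def by (rule integrable_indicator_cball)
    define m where "m = (LINT x|lebesgue. I x)"
    have m: "m \<ge> 0" unfolding m_def I_def by (rule Bochner_Integration.integral_nonneg) auto
    define s where "s = sqrt (\<delta> / (12 * (m + 1)))"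
    have s: "s > 0" "s\<^sup>2 * m < \<delta> / 12"
      using d m by (simp_all add: s_def field_simps add_pos_pos)
    obtain e where e: "e > 0" "\<And>\<epsilon> x. 0 < \<epsilon> \<Longrightarrow> \<epsilon> < e \<Longrightarrow> \<bar>convolve h (mollifier \<epsilon>) x - h x\<bar> \<le> s"
      using convolve_continuous_uniform[OF h(1,2) s(1)] by blast
    have "\<forall>\<^sub>F n in sequentially. \<epsilon> n < min e 1"
      using \<epsilon>(2) e(1) by (intro order_tendstoD) auto
    then show "\<forall>\<^sub>F n in sequentially. dist (LINT x|lebesgue. (convolve f (mollifier (\<epsilon> n)) x - f x)\<^sup>2) 0 < \<delta>"
    proof eventually_elim
      case (elim n)
      define C where "C u = convolve u (mollifier (\<epsilon> n))" for u :: "real ^ 'n \<Rightarrow> real"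
      obtain B where B: "\<And>x :: real ^ 'n. \<bar>mollifier (\<epsilon> n) x\<bar> \<le> B" using mollifier_bounded[OF \<epsilon>(1)] by blast
      have C_diff: "C (\<lambda>x. f x - h x) x = C f x - C h x" for x
        using integrable_convolve[OF fi Ck_continuous[OF Ck_mollifier] B] integrable_convolve[OF hi Ck_continuous[OF Ck_mollifier] B]
        by (simp add: C_def convolve_def left_diff_distrib)
      have sqC: "square_integrable lebesgue (C f)" "square_integrable lebesgue (C h)" "square_integrable lebesgue (C (\<lambda>x. f x - h x))"
        unfolding C_def
        by (intro convolve_mollifier_contraction(1)[OF \<epsilon>(1)] f fi hs hi fh)+
      have bd: "(C h x - h x)\<^sup>2 \<le> s\<^sup>2 * I x" for x
      proof (cases "norm x \<le> R + 2")
        case True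
        then show ?thesis using power_mono[OF e(2)[of "\<epsilon> n" x], of 2] elim \<epsilon>(1)[of n] by (simp add: C_def I_def)
      next
        case False
        have "C h x = 0" unfolding C_def
        proof (rule convolve_zero_outside[OF \<epsilon>(1)])
          fix y assume "norm (x - y) < \<epsilon> n"
          then show "h y = 0" using elim False norm_triangle_ineq2[of x y] by (intro h(2)[rule_format]) auto
        qed
        then show ?thesis using False h(2) by (simp add: I_def)
      qed
      have "(LINT x|lebesgue. (C f x - f x)\<^sup>2) \<le> (LINT x|lebesgue. 4 * (C (\<lambda>x. f x - h x) x)\<^sup>2 + 4 * (f x - h x)\<^sup>2 + 2 * (s\<^sup>2 * I x))"
      proof (intro integral_mono)
        fix x
        have "(C f x - f x)\<^sup>2 = ((C (\<lambda>x. f x - h x) x - (f x - h x)) + (C h x - h x))\<^sup>2" by (simp add: C_diff)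
        also have "\<dots> \<le> 2 * (C (\<lambda>x. f x - h x) x - (f x - h x))\<^sup>2 + 2 * (C h x - h x)\<^sup>2" by (rule square_sum_le)
        also have "\<dots> \<le> 2 * (2 * (C (\<lambda>x. f x - h x) x)\<^sup>2 + 2 * (f x - h x)\<^sup>2) + 2 * (s\<^sup>2 * I x)"
          by (intro add_mono mult_left_mono square_diff_le bd) auto
        finally show "(C f x - f x)\<^sup>2 \<le> 4 * (C (\<lambda>x. f x - h x) x)\<^sup>2 + 4 * (f x - h x)\<^sup>2 + 2 * (s\<^sup>2 * I x)" by simp
      qed (use sqC f fh I in \<open>auto intro!: square_integrableD square_integrable_diff Bochner_Integration.integrable_add integrable_mult_right\<close>)
      also have "\<dots> = 4 * (LINT x|lebesgue. (C (\<lambda>x. f x - h x) x)\<^sup>2) + 4 * (LINT x|lebesgue. (f x - h x)\<^sup>2) + 2 * (s\<^sup>2 * m)"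
        unfolding m_def using square_integrableD[OF sqC(3)] square_integrableD[OF fh(1)] I by simp
      also have "\<dots> \<le> 4 * (LINT x|lebesgue. (f x - h x)\<^sup>2) + 4 * (LINT x|lebesgue. (f x - h x)\<^sup>2) + 2 * (s\<^sup>2 * m)"
        using convolve_mollifier_contraction(2)[OF \<epsilon>(1) fh(2,1), of n] by (simp add: C_def)
      also have "\<dots> < \<delta>" using h(3) s(2) d by linarith
      finally show ?case by (simp add: C_def)
    qed
  qed
  then show ?thesis using sq f by (simp add: L2_tendsto_def)
qed

section \<open>Weak derivatives\<close>

lemma test_functionsI:
  assumes "\<And>k. Ck_function k \<phi>" "compact K" "K \<subseteq> \<Omega>" "\<And>x. x \<notin> K \<Longrightarrow> \<phi> x = 0"
  shows "\<phi> \<in> test_functions \<Omega>"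
proof -
  have "closure {x. \<phi> x \<noteq> 0} \<subseteq> K"
    using assms(2,4) by (intro closure_minimal) (auto simp: compact_imp_closed)
  then show ?thesis using assms(1-3)
    using bounded_subset[OF compact_imp_bounded[OF assms(2)], of "{x. \<phi> x \<noteq> 0}"] closure_subset[of "{x. \<phi> x \<noteq> 0}"]
    by (simp add: test_functions_def subset_trans)
qed

lemma test_functionsE:
  assumes "\<phi> \<in> test_functions \<Omega>"
  obtains K where "compact K" "K \<subseteq> \<Omega>" "\<forall>x. x \<notin> K \<longrightarrow> \<phi> x = 0" "\<forall>i x. x \<notin> K \<longrightarrow> pderivative i \<phi> x = 0"
proof -
  let ?K = "closure {x. \<phi> x \<noteq> 0}"
  have K: "compact ?K" "?K \<subseteq> \<Omega>" using assms by (auto simp: test_functions_def)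
  have 0: "\<forall>x. x \<notin> ?K \<longrightarrow> \<phi> x = 0" using closure_subset[of "{x. \<phi> x \<noteq> 0}"] by auto
  have "\<forall>i x. x \<notin> ?K \<longrightarrow> pderivative i \<phi> x = 0"
    using pderivative_zero_outside[OF closed_closure] 0 by blast
  then show ?thesis using that K 0 by blast
qed

lemma test_functions_Ck: "\<phi> \<in> test_functions \<Omega> \<Longrightarrow> Ck_function k \<phi>"
  by (simp add: test_functions_def)

lemma compact_support_bounded:
  fixes f :: "real ^ 'n \<Rightarrow> real"
  assumes "continuous_on UNIV f" "compact K" "\<forall>x. x \<notin> K \<longrightarrow> f x = 0"
  obtains B where "\<forall>x. \<bar>f x\<bar> \<le> B"
proof -
  obtain R where "\<forall>x\<in>K. norm x \<le> R" using compact_imp_bounded[OF assms(2)] by (auto simp: bounded_iff)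
  then have "\<forall>x. norm x > R \<longrightarrow> f x = 0" using assms(3) by force
  then show ?thesis using continuous_bounded_support[OF assms(1)] that by metis
qed

lemma pderivative_continuous: "Ck_function (Suc k) \<phi> \<Longrightarrow> continuous_on UNIV (pderivative i \<phi>)"
  using Ck_continuous by auto

lemma test_functions_bounded:
  assumes "\<phi> \<in> test_functions \<Omega>"
  obtains B where "B > 0" "\<forall>x. \<bar>\<phi> x\<bar> \<le> B" "\<forall>i x. \<bar>pderivative i \<phi> x\<bar> \<le> B"
proof -
  obtain K where K: "compact K" "\<forall>x. x \<notin> K \<longrightarrow> \<phi> x = 0" "\<forall>i x. x \<notin> K \<longrightarrow> pderivative i \<phi> x = 0"
    using test_functionsE[OF assms] by metis
  obtain B0 where B0: "\<forall>x. \<bar>\<phi> x\<bar> \<le> B0"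
    using compact_support_bounded[OF Ck_continuous[OF test_functions_Ck[OF assms]] K(1,2)] by blast
  have "\<exists>B. \<forall>x. \<bar>pderivative i \<phi> x\<bar> \<le> B" for i
    using compact_support_bounded[OF pderivative_continuous[OF test_functions_Ck[OF assms]] K(1)] K(3) by metis
  then obtain B where B: "\<And>i x. \<bar>pderivative i \<phi> x\<bar> \<le> B i" by metis
  have B_nonneg: "B i \<ge> 0" for i using B[of i 0] by linarith
  have le: "B i \<le> (\<Sum>j\<in>UNIV. B j)" for i using B_nonneg by (intro member_le_sum) auto
  show ?thesis
  proof (rule that[of "\<bar>B0\<bar> + (\<Sum>j\<in>UNIV. B j) + 1"])
    have s: "(\<Sum>j\<in>UNIV. B j) \<ge> 0" using B_nonneg by (intro sum_nonneg) auto
    show "\<bar>B0\<bar> + (\<Sum>j\<in>UNIV. B j) + 1 > 0" using s by linarith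
    show "\<forall>x. \<bar>\<phi> x\<bar> \<le> \<bar>B0\<bar> + (\<Sum>j\<in>UNIV. B j) + 1"
    proof
      fix x
      have "\<bar>\<phi> x\<bar> \<le> B0" using B0 by blast
      then show "\<bar>\<phi> x\<bar> \<le> \<bar>B0\<bar> + (\<Sum>j\<in>UNIV. B j) + 1" using s by linarith
    qed
    show "\<forall>i x. \<bar>pderivative i \<phi> x\<bar> \<le> \<bar>B0\<bar> + (\<Sum>j\<in>UNIV. B j) + 1"
    proof (intro allI)
      fix i x
      show "\<bar>pderivative i \<phi> x\<bar> \<le> \<bar>B0\<bar> + (\<Sum>j\<in>UNIV. B j) + 1"
        using B[of i x] le[of i] by linarith
    qed
  qed
qed

subsection \<open>Local integrability\<close>

text \<open>Multiplying by the indicator moves everything to the whole space, where the convolution is defined.\<close>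

definition locally_integrable :: "(real ^ 'n) set \<Rightarrow> (real ^ 'n \<Rightarrow> real) \<Rightarrow> bool" where
  "locally_integrable \<Omega> f \<longleftrightarrow> (\<forall>K. compact K \<and> K \<subseteq> \<Omega> \<longrightarrow> integrable lebesgue (\<lambda>x. indicator K x * f x))"

lemma has_weak_deriv_iff:
  "has_weak_deriv \<Omega> i f g \<longleftrightarrow> locally_integrable \<Omega> f \<and> locally_integrable \<Omega> g \<and>
    (\<forall>\<phi>\<in>test_functions \<Omega>. (LINT x|lebesgue_on \<Omega>. f x * pderivative i \<phi> x) = - (LINT x|lebesgue_on \<Omega>. g x * \<phi> x))"
  by (auto simp: has_weak_deriv_def locally_integrable_def set_integrable_def)

lemma lebesgue_on_eqs:
  fixes f :: "real ^ 'n \<Rightarrow> real"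
  assumes "open \<Omega>"
  shows "f \<in> borel_measurable (lebesgue_on \<Omega>) \<longleftrightarrow> (\<lambda>x. indicator \<Omega> x * f x) \<in> borel_measurable lebesgue"
    and "integrable (lebesgue_on \<Omega>) f \<longleftrightarrow> integrable lebesgue (\<lambda>x. indicator \<Omega> x * f x)"
    and "(LINT x|lebesgue_on \<Omega>. f x) = (LINT x|lebesgue. indicator \<Omega> x * f x)"
  using assms borel_measurable_restrict_space_iff[of \<Omega> lebesgue f] integrable_restrict_space[of \<Omega> lebesgue f]
    integral_restrict_space[of \<Omega> lebesgue f]
  by auto

lemma AE_lebesgue_on: "open \<Omega> \<Longrightarrow> (AE x in lebesgue_on \<Omega>. P x) \<longleftrightarrow> (AE x in lebesgue. x \<in> \<Omega> \<longrightarrow> P x)"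
  for \<Omega> :: "(real ^ 'n) set"
  by (intro AE_restrict_space_iff) auto

lemma lebesgue_on_support:
  fixes f :: "real ^ 'n \<Rightarrow> real"
  assumes "open \<Omega>" "\<And>x. x \<notin> \<Omega> \<Longrightarrow> f x = 0"
  shows "integrable (lebesgue_on \<Omega>) f \<longleftrightarrow> integrable lebesgue f"
    and "(LINT x|lebesgue_on \<Omega>. f x) = (LINT x|lebesgue. f x)"
proof -
  have "(\<lambda>x. indicator \<Omega> x * f x) = f" using assms(2) by (auto simp: indicator_def fun_eq_iff)
  then show "integrable (lebesgue_on \<Omega>) f \<longleftrightarrow> integrable lebesgue f"
    and "(LINT x|lebesgue_on \<Omega>. f x) = (LINT x|lebesgue. f x)"
    by (simp_all add: lebesgue_on_eqs[OF assms(1)])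
qed

lemma compact_sets_lebesgue: "compact K \<Longrightarrow> K \<in> sets lebesgue" for K :: "'a::euclidean_space set"
  by (simp add: lmeasurable_compact fmeasurableD)

lemma integrable_mult_bounded:
  fixes f m :: "'a \<Rightarrow> real"
  assumes "integrable M f" "m \<in> borel_measurable M" "AE x in M. \<bar>m x\<bar> \<le> B"
  shows "integrable M (\<lambda>x. m x * f x)"
proof (rule Bochner_Integration.integrable_bound)
  show "integrable M (\<lambda>x. B * f x)" using assms(1) by simp
  show "AE x in M. norm (m x * f x) \<le> norm (B * f x)"
    using assms(3) by eventually_elim (auto simp: abs_mult intro!: mult_right_mono)
qed (use assms in auto)

lemma locally_integrable_bound:
  assumes "open \<Omega>" "locally_integrable \<Omega> g" "f \<in> borel_measurable (lebesgue_on \<Omega>)"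
    and "AE x in lebesgue_on \<Omega>. \<bar>f x\<bar> \<le> \<bar>g x\<bar>"
  shows "locally_integrable \<Omega> f"
  unfolding locally_integrable_def
proof safe
  fix K assume K: "compact K" "K \<subseteq> \<Omega>"
  show "integrable lebesgue (\<lambda>x. indicator K x * f x)"
  proof (rule Bochner_Integration.integrable_bound)
    show "integrable lebesgue (\<lambda>x. indicator K x * g x)" using assms(2) K by (simp add: locally_integrable_def)
    have [measurable]: "K \<in> sets lebesgue" using K compact_sets_lebesgue by blast
    have [measurable]: "(\<lambda>x. indicator \<Omega> x * f x) \<in> borel_measurable lebesgue"
      using assms(3) by (simp add: lebesgue_on_eqs[OF assms(1)])
    have "(\<lambda>x. indicator K x * f x) = (\<lambda>x. indicator K x * (indicator \<Omega> x * f x))"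
      using K(2) by (auto simp: indicator_def fun_eq_iff)
    then show "(\<lambda>x. indicator K x * f x) \<in> borel_measurable lebesgue" by simp
    show "AE x in lebesgue. norm (indicator K x * f x) \<le> norm (indicator K x * g x)"
      using assms(4)[unfolded AE_lebesgue_on[OF assms(1)]]
      by eventually_elim (use K(2) in \<open>auto simp: indicator_def\<close>)
  qed
qed

lemma square_integrable_restrict:
  fixes \<Omega> :: "(real ^ 'n) set"
  assumes "open \<Omega>" "square_integrable (lebesgue_on \<Omega>) f" "compact K" "K \<subseteq> \<Omega>"
  shows "square_integrable lebesgue (\<lambda>x. indicator K x * f x)"
proof -
  have [measurable]: "K \<in> sets lebesgue" using assms(3) compact_sets_lebesgue by blast
  have "(\<lambda>x. (indicator \<Omega> x * f x)\<^sup>2) = (\<lambda>x. indicator \<Omega> x * (f x)\<^sup>2)" by (auto simp: indicator_def fun_eq_iff)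
  then have sq: "square_integrable lebesgue (\<lambda>x. indicator \<Omega> x * f x)"
    using assms(2) by (simp add: square_integrable_def lebesgue_on_eqs[OF assms(1)])
  then have "square_integrable lebesgue (\<lambda>x. indicator K x * (indicator \<Omega> x * f x))"
    by (rule square_integrable_mult_bounded[where B = 1]) (auto simp: indicator_def[abs_def] split: if_splits)
  moreover have "(\<lambda>x. indicator K x * (indicator \<Omega> x * f x)) = (\<lambda>x. indicator K x * f x)"
    using assms(4) by (auto simp: indicator_def fun_eq_iff)
  ultimately show ?thesis by simp
qed

lemma compact_norm_bound:
  assumes "compact K"
  obtains R where "\<forall>x. norm x > R \<longrightarrow> indicat_real K x * f x = 0"
  using compact_imp_bounded[OF assms] that by (auto simp: bounded_iff indicator_def) (metis not_le)

lemma locally_integrable_square: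
  assumes "open \<Omega>" "square_integrable (lebesgue_on \<Omega>) f"
  shows "locally_integrable \<Omega> f"
  unfolding locally_integrable_def
proof safe
  fix K assume K: "compact K" "K \<subseteq> \<Omega>"
  obtain R where "\<forall>x. norm x > R \<longrightarrow> indicat_real K x * f x = 0"
    using compact_norm_bound[OF K(1)] by blast
  then show "integrable lebesgue (\<lambda>x. indicator K x * f x)"
    by (rule integrable_of_square_integrable[OF square_integrable_restrict[OF assms K]])
qed

lemma locally_integrable_const: "locally_integrable \<Omega> (\<lambda>x. c)"
  unfolding locally_integrable_def
proof safe
  fix K :: "(real ^ 'n) set" assume "compact K"
  then have "integrable lebesgue (indicat_real K)"
    using lmeasurable_compact by (simp add: fmeasurable_def integrable_indicator_iff)
  then show "integrable lebesgue (\<lambda>x. indicator K x * c)" by simp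
qed

lemma locally_integrable_add:
  "locally_integrable \<Omega> f \<Longrightarrow> locally_integrable \<Omega> g \<Longrightarrow> locally_integrable \<Omega> (\<lambda>x. f x + g x)"
  by (auto simp: locally_integrable_def distrib_left)

lemma locally_integrable_cmult:
  "locally_integrable \<Omega> f \<Longrightarrow> locally_integrable \<Omega> (\<lambda>x. c * f x)"
  by (auto simp: locally_integrable_def mult.left_commute[of _ c])

lemma locally_integrable_mult_support:
  assumes "open \<Omega>" "locally_integrable \<Omega> f" "compact K" "K \<subseteq> \<Omega>" "\<forall>x. x \<notin> K \<longrightarrow> \<phi> x = 0" "continuous_on UNIV \<phi>"
  shows "integrable lebesgue (\<lambda>x. f x * \<phi> x)" "integrable (lebesgue_on \<Omega>) (\<lambda>x. f x * \<phi> x)"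
    "(LINT x|lebesgue_on \<Omega>. f x * \<phi> x) = (LINT x|lebesgue. (indicator K x * f x) * \<phi> x)"
proof -
  obtain B where B: "\<forall>x. \<bar>\<phi> x\<bar> \<le> B" using compact_support_bounded[OF assms(6,3,5)] by blast
  have i: "integrable lebesgue (\<lambda>x. indicator K x * f x)" using assms by (simp add: locally_integrable_def)
  have "integrable lebesgue (\<lambda>x. \<phi> x * (indicator K x * f x))"
    by (rule integrable_mult_bounded[OF i continuous_measurable_lebesgue[OF assms(6)]]) (use B in auto)
  moreover have eq: "(\<lambda>x. \<phi> x * (indicator K x * f x)) = (\<lambda>x. f x * \<phi> x)"
    using assms(5) by (auto simp: indicator_def fun_eq_iff)
  ultimately show *: "integrable lebesgue (\<lambda>x. f x * \<phi> x)" by simp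
  have z: "x \<notin> \<Omega> \<Longrightarrow> f x * \<phi> x = 0" for x using assms(4,5) by auto
  show "integrable (lebesgue_on \<Omega>) (\<lambda>x. f x * \<phi> x)"
    using * lebesgue_on_support(1)[OF assms(1) z] by simp
  show "(LINT x|lebesgue_on \<Omega>. f x * \<phi> x) = (LINT x|lebesgue. (indicator K x * f x) * \<phi> x)"
    using lebesgue_on_support(2)[OF assms(1) z] eq by (simp add: mult.commute mult.left_commute)
qed

lemma locally_integrable_mult_test:
  assumes "open \<Omega>" "locally_integrable \<Omega> f" "\<phi> \<in> test_functions \<Omega>"
  shows "integrable (lebesgue_on \<Omega>) (\<lambda>x. f x * \<phi> x)" "integrable (lebesgue_on \<Omega>) (\<lambda>x. f x * pderivative i \<phi> x)"
proof -
  obtain K where K: "compact K" "K \<subseteq> \<Omega>" "\<forall>x. x \<notin> K \<longrightarrow> \<phi> x = 0" "\<forall>i x. x \<notin> K \<longrightarrow> pderivative i \<phi> x = 0"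
    using test_functionsE[OF assms(3)] by metis
  show "integrable (lebesgue_on \<Omega>) (\<lambda>x. f x * \<phi> x)"
    using locally_integrable_mult_support(2)[OF assms(1,2) K(1,2,3) Ck_continuous[OF test_functions_Ck[OF assms(3)]]] .
  show "integrable (lebesgue_on \<Omega>) (\<lambda>x. f x * pderivative i \<phi> x)"
    using K by (intro locally_integrable_mult_support(2)[OF assms(1,2) K(1,2)] pderivative_continuous[OF test_functions_Ck[OF assms(3)]]) auto
qed

lemma has_weak_deriv_add:
  assumes "open \<Omega>" "has_weak_deriv \<Omega> i f f'" "has_weak_deriv \<Omega> i g g'"
  shows "has_weak_deriv \<Omega> i (\<lambda>x. f x + g x) (\<lambda>x. f' x + g' x)"
  using assms
  by (auto simp: has_weak_deriv_iff locally_integrable_add distrib_right locally_integrable_mult_test)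

lemma has_weak_deriv_cmult:
  assumes "has_weak_deriv \<Omega> i f f'"
  shows "has_weak_deriv \<Omega> i (\<lambda>x. c * f x) (\<lambda>x. c * f' x)"
  using assms
  by (auto simp: has_weak_deriv_iff locally_integrable_cmult mult.assoc)

lemma has_weak_deriv_diff:
  assumes "open \<Omega>" "has_weak_deriv \<Omega> i f f'" "has_weak_deriv \<Omega> i g g'"
  shows "has_weak_deriv \<Omega> i (\<lambda>x. f x - g x) (\<lambda>x. f' x - g' x)"
  using has_weak_deriv_add[OF assms(1,2) has_weak_deriv_cmult[OF assms(3), of "-1"]] by simp

subsection \<open>Integration by parts\<close>

lemma integral_reflect:
  fixes f :: "'a::euclidean_space \<Rightarrow> real"
  assumes "continuous_on UNIV f"
  shows "(LINT y|lebesgue. f (x - y)) = (LINT y|lebesgue. f y)"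
proof -
  have m: "f \<in> borel_measurable borel" using assms by (rule borel_measurable_continuous_onI)
  have "lborel = distr lborel borel (\<lambda>y. x - y)"
    using lborel_affine[of "-1" x] by (simp add: density_1)
  then have "(LINT y|lborel. f y) = (LINT y|distr lborel borel (\<lambda>y. x - y). f y)" by simp
  also have "\<dots> = (LINT y|lborel. f (x - y))" using m by (intro integral_distr) auto
  finally show ?thesis using m by (simp add: integral_completion)
qed

text \<open>
  The integral of \<open>\<zeta> (x - y)\<close> over a large ball of \<open>y\<close> does not depend on small \<open>x\<close>, so its derivative,
  the integral of the derivative of \<open>\<zeta>\<close>, vanishes.
\<close>

lemma integral_pderivative_zero:
  fixes \<zeta> :: "real ^ 'n \<Rightarrow> real"
  assumes \<zeta>: "Ck_function (Suc 0) \<zeta>" and K: "compact K" "\<forall>x. x \<notin> K \<longrightarrow> \<zeta> x = 0"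
  shows "(LINT x|lebesgue. pderivative i \<zeta> x) = 0"
proof -
  obtain R where R: "\<forall>x\<in>K. norm x \<le> R" using compact_imp_bounded[OF K(1)] by (auto simp: bounded_iff)
  have supp: "\<forall>x. norm x > R \<longrightarrow> \<zeta> x = 0" using R K(2) by force
  have supp': "\<forall>x. norm x > R \<longrightarrow> pderivative i \<zeta> x = 0"
    using pderivative_zero_outside[of "cball 0 R" \<zeta> _ i] supp by auto
  define b where "b = indicat_real (cball (0 :: real ^ 'n) (R + 1))"
  have b: "integrable lebesgue b" unfolding b_def by (rule integrable_indicator_cball)
  have eq: "convolve b u x = (LINT y|lebesgue. u y)"
    if "norm x < 1" "\<forall>x. norm x > R \<longrightarrow> u x = 0" "continuous_on UNIV u" for u x
  proof -
    have "b y * u (x - y) = u (x - y)" for y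
      using that(1,2) norm_triangle_ineq2[of y x] by (auto simp: b_def indicator_def norm_minus_commute)
    then have "(\<lambda>y. b y * u (x - y)) = (\<lambda>y. u (x - y))" by blast
    then show ?thesis using integral_reflect[OF that(3), of x] by (simp add: convolve_def)
  qed
  have "((\<lambda>x. LINT y|lebesgue. \<zeta> y) has_derivative (\<lambda>h. \<Sum>j\<in>UNIV. h $ j * convolve b (pderivative j \<zeta>) 0)) (at 0)"
    by (rule has_derivative_transform_within_open[OF convolve_has_derivative[OF b \<zeta> supp], of "ball 0 1"])
      (simp_all add: eq[OF _ supp Ck_continuous[OF \<zeta>]])
  from has_derivative_unique[OF has_derivative_const this]
  have "0 = (\<Sum>j\<in>UNIV. axis i 1 $ j * convolve b (pderivative j \<zeta>) 0)"
    by (rule fun_cong)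
  also have "\<dots> = (\<Sum>j\<in>UNIV. if j = i then convolve b (pderivative j \<zeta>) 0 else 0)"
    by (intro sum.cong refl) (simp add: axis_def)
  also have "\<dots> = (LINT y|lebesgue. pderivative i \<zeta> y)"
    using eq[OF _ supp' pderivative_continuous[OF \<zeta>], of 0] by simp
  finally show ?thesis by simp
qed

text \<open>
  For a test function \<open>\<phi>\<close> the product \<open>F \<phi>\<close> has compact support, so the integral of its derivative is
  zero by the preceding lemma.
\<close>

lemma has_weak_deriv_continuous:
  fixes F :: "real ^ 'n \<Rightarrow> real"
  assumes "open \<Omega>" "Ck_function (Suc 0) F"
  shows "has_weak_deriv \<Omega> i F (pderivative i F)"
proof -
  have li: "locally_integrable \<Omega> u" if "continuous_on UNIV u" for u :: "real ^ 'n \<Rightarrow> real"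
    unfolding locally_integrable_def
  proof safe
    fix K :: "(real ^ 'n) set" assume K: "compact K"
    have "integrable lborel (\<lambda>x. indicator K x *\<^sub>R u x)"
      using K continuous_on_subset[OF that] by (intro borel_integrable_compact) auto
    then have "integrable lborel (\<lambda>x. indicator K x * u x)" by simp
    then show "integrable lebesgue (\<lambda>x. indicator K x * u x)"
      using integrable_completion borel_measurable_integrable by blast
  qed
  have c: "continuous_on UNIV F" "continuous_on UNIV (pderivative i F)"
    using Ck_continuous[OF assms(2)] pderivative_continuous[OF assms(2)] .
  have "(LINT x|lebesgue_on \<Omega>. F x * pderivative i \<phi> x) = - (LINT x|lebesgue_on \<Omega>. pderivative i F x * \<phi> x)"
    if \<phi>: "\<phi> \<in> test_functions \<Omega>" for \<phi>
  proof -
    obtain K where K: "compact K" "K \<subseteq> \<Omega>" "\<forall>x. x \<notin> K \<longrightarrow> \<phi> x = 0" "\<forall>i x. x \<notin> K \<longrightarrow> pderivative i \<phi> x = 0"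
      using test_functionsE[OF \<phi>] by metis
    note p = pderivative_mult[OF assms(2) test_functions_Ck[OF \<phi>]]
    have "0 = (LINT x|lebesgue. pderivative i (\<lambda>x. F x * \<phi> x) x)"
      using K by (intro integral_pderivative_zero[symmetric, OF Ck_mult[OF assms(2) test_functions_Ck[OF \<phi>]] K(1)]) auto
    also have "\<dots> = (LINT x|lebesgue_on \<Omega>. pderivative i (\<lambda>x. F x * \<phi> x) x)"
    proof (intro lebesgue_on_support(2)[symmetric, OF assms(1)])
      fix x assume "x \<notin> \<Omega>"
      then have "x \<notin> K" using K(2) by blast
      then show "pderivative i (\<lambda>x. F x * \<phi> x) x = 0" using K(3,4) by (simp add: p)
    qed
    also have "\<dots> = (LINT x|lebesgue_on \<Omega>. F x * pderivative i \<phi> x) + (LINT x|lebesgue_on \<Omega>. pderivative i F x * \<phi> x)"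
      unfolding p using locally_integrable_mult_test[OF assms(1) _ \<phi>] li c by simp
    finally show ?thesis by simp
  qed
  then show ?thesis using li c by (simp add: has_weak_deriv_iff)
qed

subsection \<open>Mollification of weakly differentiable functions\<close>

definition fatten :: "(real ^ 'n) set \<Rightarrow> real \<Rightarrow> (real ^ 'n) set" where
  "fatten K e = (\<Union>x\<in>K. cball x e)"

lemma compact_fatten: "compact K \<Longrightarrow> compact (fatten K e)"
  unfolding fatten_def by (rule compact_minkowski_sum_cball)

lemma fatten_in_open:
  assumes "compact K" "open \<Omega>" "K \<subseteq> \<Omega>"
  obtains e where "e > 0" "fatten K e \<subseteq> \<Omega>"
  using compact_subset_open_imp_cball_epsilon_subset[OF assms] unfolding fatten_def by metis

lemma convolve_fatten:
  fixes f :: "real ^ 'n \<Rightarrow> real"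
  assumes "0 < \<epsilon>" "\<epsilon> \<le> e" "\<forall>y. y \<notin> K \<longrightarrow> f y = 0" "x \<notin> fatten K e"
  shows "convolve f (mollifier \<epsilon>) x = 0"
proof (rule convolve_zero_outside[OF assms(1)])
  fix y assume "norm (x - y) < \<epsilon>"
  then have "x \<in> cball y e" using assms(2) by (simp add: dist_norm norm_minus_commute)
  then show "f y = 0" using assms(3,4) by (auto simp: fatten_def)
qed

lemma mollifier_vanishes: "\<epsilon> > 0 \<Longrightarrow> \<forall>x. norm x > \<epsilon> \<longrightarrow> mollifier \<epsilon> x = 0"
  by (simp add: mollifier_zero)

lemma Ck_convolve_mollifier:
  "integrable lebesgue f \<Longrightarrow> \<epsilon> > 0 \<Longrightarrow> Ck_function k (convolve f (mollifier \<epsilon>))"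
  by (rule Ck_convolve[OF _ Ck_mollifier mollifier_vanishes])

lemma convolve_test_function:
  fixes f :: "real ^ 'n \<Rightarrow> real"
  assumes "integrable lebesgue f" "\<forall>y. y \<notin> K \<longrightarrow> f y = 0" "compact K" "fatten K e \<subseteq> \<Omega>" "0 < \<epsilon>" "\<epsilon> \<le> e"
  shows "convolve f (mollifier \<epsilon>) \<in> test_functions \<Omega>"
  by (rule test_functionsI[OF Ck_convolve_mollifier[OF assms(1,5)] compact_fatten[OF assms(3)] assms(4)])
    (use convolve_fatten[OF assms(5,6,2)] in blast)

lemma convolve_bounded:
  fixes f :: "real ^ 'n \<Rightarrow> real"
  assumes "\<epsilon> > 0" "integrable lebesgue f" "AE y in lebesgue. \<bar>f y\<bar> \<le> B"
  shows "\<bar>convolve f (mollifier \<epsilon>) x\<bar> \<le> B"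
proof -
  obtain C where C: "\<And>x :: real ^ 'n. \<bar>mollifier \<epsilon> x\<bar> \<le> C" using mollifier_bounded[OF assms(1)] by blast
  note i = integrable_convolve[OF assms(2) Ck_continuous[OF Ck_mollifier] C, of x]
  have "\<bar>convolve f (mollifier \<epsilon>) x\<bar> \<le> (LINT y|lebesgue. \<bar>f y * mollifier \<epsilon> (x - y)\<bar>)"
    unfolding convolve_def by (rule integral_abs_bound)
  also have "\<dots> \<le> (LINT y|lebesgue. B * mollifier \<epsilon> (x - y))"
  proof (rule integral_mono_AE)
    show "AE y in lebesgue. \<bar>f y * mollifier \<epsilon> (x - y)\<bar> \<le> B * mollifier \<epsilon> (x - y)"
      using assms(3) by eventually_elim (auto simp: abs_mult mollifier_nonneg intro!: mult_right_mono)
  qed (use i mollifier_shift[OF assms(1), of x] in auto)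
  also have "\<dots> = B" using mollifier_shift[OF assms(1), of x] by simp
  finally show ?thesis .
qed

text \<open>
  The reflected mollifier centred at \<open>x\<close> is itself a test function, because its support stays in \<open>K\<close>.
  The definition of the weak derivative, tested with it, is the claim.
\<close>

lemma pderivative_mollification:
  fixes f :: "real ^ 'n \<Rightarrow> real"
  assumes "open \<Omega>" and w: "has_weak_deriv \<Omega> i f g" and K: "compact K" "K \<subseteq> \<Omega>" and e: "\<epsilon> > 0" "cball x \<epsilon> \<subseteq> K"
  shows "pderivative i (convolve (\<lambda>y. indicator K y * f y) (mollifier \<epsilon>)) x
       = convolve (\<lambda>y. indicator K y * g y) (mollifier \<epsilon>) x"
proof -
  define \<phi> where "\<phi> y = mollifier \<epsilon> (x - y)" for y
  have li: "locally_integrable \<Omega> f" "locally_integrable \<Omega> g" using w by (auto simp: has_weak_deriv_iff)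
  have fi: "integrable lebesgue (\<lambda>y. indicator K y * f y)"
    using li(1) K by (simp add: locally_integrable_def)
  have out: "y \<notin> K \<Longrightarrow> \<epsilon> < norm (x - y)" for y
    using e(2) by (auto simp: subset_iff dist_norm not_le)
  have \<phi>0: "\<forall>y. y \<notin> K \<longrightarrow> \<phi> y = 0" by (auto simp: \<phi>_def intro!: mollifier_zero[OF e(1)] less_imp_le out)
  have Ck\<phi>: "Ck_function k \<phi>" for k unfolding \<phi>_def by (intro Ck_reflect Ck_mollifier)
  have test: "\<phi> \<in> test_functions \<Omega>"
    by (rule test_functionsI[OF Ck\<phi> K]) (use \<phi>0 in blast)
  have d\<phi>: "pderivative i \<phi> y = - pderivative i (mollifier \<epsilon>) (x - y)" for y
    unfolding \<phi>_def by (rule pderivative_reflect[OF Ck_mollifier[of "Suc 0"]])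
  have d\<phi>0: "\<forall>y. y \<notin> K \<longrightarrow> pderivative i \<phi> y = 0"
    using pderivative_zero_outside[OF compact_imp_closed[OF K(1)]] \<phi>0 by blast
  have c: "continuous_on UNIV (pderivative i \<phi>)" by (rule pderivative_continuous[OF Ck\<phi>[of "Suc 0"]])
  have "pderivative i (convolve (\<lambda>y. indicator K y * f y) (mollifier \<epsilon>)) x
      = convolve (\<lambda>y. indicator K y * f y) (pderivative i (mollifier \<epsilon>)) x"
    by (rule pderivative_convolve[OF fi Ck_mollifier mollifier_vanishes[OF e(1)]])
  also have "\<dots> = - (LINT y|lebesgue. (indicator K y * f y) * pderivative i \<phi> y)"
    by (simp add: convolve_def d\<phi>)
  also have "\<dots> = - (LINT y|lebesgue_on \<Omega>. f y * pderivative i \<phi> y)"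
    using locally_integrable_mult_support(3)[OF assms(1) li(1) K d\<phi>0 c] by simp
  also have "\<dots> = (LINT y|lebesgue_on \<Omega>. g y * \<phi> y)"
    using w test by (simp add: has_weak_deriv_iff)
  also have "\<dots> = (LINT y|lebesgue. (indicator K y * g y) * \<phi> y)"
    by (rule locally_integrable_mult_support(3)[OF assms(1) li(2) K \<phi>0 Ck_continuous[OF Ck\<phi>[of 0]]])
  also have "\<dots> = convolve (\<lambda>y. indicator K y * g y) (mollifier \<epsilon>) x"
    by (simp add: convolve_def \<phi>_def)
  finally show ?thesis .
qed

definition shrinking :: "real \<Rightarrow> nat \<Rightarrow> real" where
  "shrinking e n = e / real (Suc n)"

lemma shrinking: "e > 0 \<Longrightarrow> shrinking e n > 0" "e > 0 \<Longrightarrow> shrinking e n \<le> e" "shrinking e \<longlonglongrightarrow> 0"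
proof -
  show "e > 0 \<Longrightarrow> shrinking e n > 0" by (simp add: shrinking_def)
  show "e > 0 \<Longrightarrow> shrinking e n \<le> e" by (simp add: shrinking_def divide_le_eq)
  have "(\<lambda>n. e * inverse (real (Suc n))) \<longlonglongrightarrow> e * 0"
    by (intro tendsto_intros LIMSEQ_inverse_real_of_nat)
  then show "shrinking e \<longlonglongrightarrow> 0" by (simp add: shrinking_def[abs_def] divide_inverse)
qed

lemma L2_tendsto_restricted_mollification:
  fixes f :: "real ^ 'n \<Rightarrow> real"
  assumes "compact K" "square_integrable lebesgue (\<lambda>x. indicator K x * f x)" "e > 0"
  shows "L2_tendsto lebesgue (\<lambda>n. convolve (\<lambda>y. indicator K y * f y) (mollifier (shrinking e n))) (\<lambda>x. indicator K x * f x)"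
proof -
  obtain R where "\<forall>x. norm x > R \<longrightarrow> indicat_real K x * f x = 0"
    using compact_norm_bound[OF assms(1)] by blast
  then show ?thesis
    by (intro L2_tendsto_mollification[OF assms(2)] shrinking assms(3))
qed

text \<open>
  The fundamental lemma of the calculus of variations: on a compact set the function is tested with
  mollifications of its own sign.
\<close>

lemma AE_zero_of_test:
  fixes h :: "real ^ 'n \<Rightarrow> real"
  assumes \<Omega>: "open \<Omega>" and h: "locally_integrable \<Omega> h"
    and zero: "\<And>\<phi>. \<phi> \<in> test_functions \<Omega> \<Longrightarrow> (LINT x|lebesgue_on \<Omega>. h x * \<phi> x) = 0"
  shows "AE x in lebesgue_on \<Omega>. h x = 0"
proof -
  have K_zero: "AE x in lebesgue. x \<in> K \<longrightarrow> h x = 0" if K: "compact K" "K \<subseteq> \<Omega>" for K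
  proof -
    obtain e where e: "e > 0" "fatten K e \<subseteq> \<Omega>" using fatten_in_open[OF K(1) \<Omega> K(2)] by blast
    have hK: "integrable lebesgue (\<lambda>x. indicator K x * h x)" using h K by (simp add: locally_integrable_def)
    define s where "s x = sgn (indicat_real K x * h x)" for x
    have [measurable]: "s \<in> borel_measurable lebesgue" unfolding s_def using hK by measurable
    have s01: "\<bar>s x\<bar> \<le> 1" for x by (simp add: s_def sgn_if)
    have s0: "\<forall>x. x \<notin> K \<longrightarrow> s x = 0" by (simp add: s_def)
    have sK: "s = (\<lambda>x. indicator K x * s x)" by (auto simp: s_def indicator_def)
    obtain R where R: "\<forall>x. norm x > R \<longrightarrow> indicat_real K x * s x = 0"
      using compact_norm_bound[OF K(1)] by blast
    have sR: "\<forall>x. norm x > R \<longrightarrow> s x = 0"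
      using R s0 by (auto simp: indicator_def split: if_splits)
    have si: "integrable lebesgue s"
      by (rule integrable_lebesgue_bounded_support[of _ 1 R]) (use s01 sR in auto)
    have sq: "square_integrable lebesgue s"
      unfolding square_integrable_def
      by (intro conjI integrable_lebesgue_bounded_support[of _ 1 R])
        (use s01 sR in \<open>auto simp: abs_square_le_1\<close>)
    define S where "S n = convolve s (mollifier (shrinking e n))" for n
    have "L2_tendsto lebesgue S s"
      unfolding S_def using L2_tendsto_restricted_mollification[OF K(1) _ e(1), of s] sq sK by simp
    then obtain r where r: "strict_mono r" "AE x in lebesgue. (\<lambda>n. S (r n) x) \<longlonglongrightarrow> s x"
      using L2_tendsto_AE_subseq by blast
    let ?K = "fatten K e"
    have hK': "integrable lebesgue (\<lambda>x. indicator ?K x * h x)"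
      using h e compact_fatten[OF K(1)] by (simp add: locally_integrable_def)
    have test: "S n \<in> test_functions \<Omega>" for n
      unfolding S_def by (rule convolve_test_function[OF si s0 K(1) e(2) shrinking(1,2)[OF e(1)]])
    have S0: "\<forall>x. x \<notin> ?K \<longrightarrow> S n x = 0" for n
      unfolding S_def using convolve_fatten[OF shrinking(1,2)[OF e(1)] s0] by blast
    have Sc: "continuous_on UNIV (S n)" for n using Ck_continuous[OF test_functions_Ck[OF test]] .
    have "(\<lambda>n. LINT x|lebesgue. (indicator ?K x * h x) * S (r n) x) \<longlonglongrightarrow> (LINT x|lebesgue. (indicator ?K x * h x) * s x)"
    proof (rule integral_dominated_convergence[where w = "\<lambda>x. \<bar>indicator ?K x * h x\<bar>"])
      show "integrable lebesgue (\<lambda>x. \<bar>indicator ?K x * h x\<bar>)" using hK' by simp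
      show "(\<lambda>x. indicator ?K x * h x * S (r n) x) \<in> borel_measurable lebesgue" for n
        using hK' continuous_measurable_lebesgue[OF Sc] by measurable
      show "AE x in lebesgue. (\<lambda>n. indicator ?K x * h x * S (r n) x) \<longlonglongrightarrow> indicator ?K x * h x * s x"
        using r(2) by eventually_elim (intro tendsto_intros)
      have "\<bar>S n x\<bar> \<le> 1" for n x
        unfolding S_def by (rule convolve_bounded[OF shrinking(1)[OF e(1)] si]) (use s01 in auto)
      then show "AE x in lebesgue. norm (indicator ?K x * h x * S (r n) x) \<le> \<bar>indicator ?K x * h x\<bar>" for n
        by (intro AE_I2) (auto simp: abs_mult intro!: mult_left_le)
    qed (use hK' in measurable)
    moreover have "(LINT x|lebesgue. (indicator ?K x * h x) * S n x) = 0" for n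
      using locally_integrable_mult_support(3)[OF \<Omega> h compact_fatten[OF K(1)] e(2) S0 Sc] zero[OF test] by simp
    ultimately have "(LINT x|lebesgue. (indicator ?K x * h x) * s x) = 0"
      using LIMSEQ_unique[OF _ tendsto_const] by simp
    also have "(\<lambda>x. (indicator ?K x * h x) * s x) = (\<lambda>x. \<bar>indicator K x * h x\<bar>)"
    proof
      fix x
      have "x \<in> K \<Longrightarrow> x \<in> ?K" using e(1) by (auto simp: fatten_def intro!: bexI[of _ x])
      then show "(indicator ?K x * h x) * s x = \<bar>indicator K x * h x\<bar>"
        by (auto simp: s_def indicator_def sgn_if)
    qed
    finally have "AE x in lebesgue. \<bar>indicator K x * h x\<bar> = 0"
      using hK by (subst (asm) integral_nonneg_eq_0_iff_AE) auto
    then show ?thesis by eventually_elim (auto simp: indicator_def split: if_splits)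
  qed
  obtain C :: "nat \<Rightarrow> (real ^ 'n) set" where C: "\<And>n. compact (C n)" "\<And>n. C n \<subseteq> \<Omega>" "\<Union>(range C) = \<Omega>"
    using open_Union_compact_subsets[OF \<Omega>] by metis
  have K0: "AE x in lebesgue. x \<in> C n \<longrightarrow> h x = 0" for n
    by (rule K_zero[OF C(1,2)])
  have "AE x in lebesgue. \<forall>n. x \<in> C n \<longrightarrow> h x = 0"
    unfolding AE_all_countable by (intro allI K0)
  then show ?thesis unfolding AE_lebesgue_on[OF \<Omega>]
  proof eventually_elim
    case (elim x)
    have "x \<in> \<Omega> \<Longrightarrow> \<exists>n. x \<in> C n" unfolding C(3)[symmetric] by simp
    then show ?case using elim by blast
  qed
qed

lemma has_weak_deriv_unique:
  assumes "open \<Omega>" "has_weak_deriv \<Omega> i f g" "has_weak_deriv \<Omega> i f g'"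
  shows "AE x in lebesgue_on \<Omega>. g x = g' x"
proof -
  have w: "has_weak_deriv \<Omega> i (\<lambda>x. 0) (\<lambda>x. g x - g' x)"
    using has_weak_deriv_diff[OF assms] by simp
  have "AE x in lebesgue_on \<Omega>. g x - g' x = 0"
    using w by (intro AE_zero_of_test[OF assms(1)]) (auto simp: has_weak_deriv_iff)
  then show ?thesis by simp
qed

lemma locally_integrable_cong_AE:
  assumes "open \<Omega>" "locally_integrable \<Omega> f" "AE x in lebesgue_on \<Omega>. f x = g x" "g \<in> borel_measurable (lebesgue_on \<Omega>)"
  shows "locally_integrable \<Omega> g"
  using assms(3) by (intro locally_integrable_bound[OF assms(1,2,4)]) auto

lemma has_weak_deriv_cong_AE:
  assumes "open \<Omega>" "has_weak_deriv \<Omega> i f g"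
    and "AE x in lebesgue_on \<Omega>. f x = f' x" "f' \<in> borel_measurable (lebesgue_on \<Omega>)"
    and "AE x in lebesgue_on \<Omega>. g x = g' x" "g' \<in> borel_measurable (lebesgue_on \<Omega>)"
  shows "has_weak_deriv \<Omega> i f' g'"
proof -
  have li: "locally_integrable \<Omega> f" "locally_integrable \<Omega> g" "locally_integrable \<Omega> f'" "locally_integrable \<Omega> g'"
    using assms locally_integrable_cong_AE[OF assms(1)] by (auto simp: has_weak_deriv_iff)
  have "(LINT x|lebesgue_on \<Omega>. f' x * pderivative i \<phi> x) = - (LINT x|lebesgue_on \<Omega>. g' x * \<phi> x)"
    if \<phi>: "\<phi> \<in> test_functions \<Omega>" for \<phi>
  proof -
    note m = locally_integrable_mult_test[OF assms(1) _ \<phi>, THEN borel_measurable_integrable]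
    have "(LINT x|lebesgue_on \<Omega>. f' x * pderivative i \<phi> x) = (LINT x|lebesgue_on \<Omega>. f x * pderivative i \<phi> x)"
      using li assms(3) by (intro integral_cong_AE m) (auto elim: eventually_mono)
    moreover have "(LINT x|lebesgue_on \<Omega>. g' x * \<phi> x) = (LINT x|lebesgue_on \<Omega>. g x * \<phi> x)"
      using li assms(5) by (intro integral_cong_AE m) (auto elim: eventually_mono)
    ultimately show ?thesis using assms(2) \<phi> by (simp add: has_weak_deriv_iff)
  qed
  then show ?thesis using li by (simp add: has_weak_deriv_iff)
qed

lemma has_weak_deriv_const: "open \<Omega> \<Longrightarrow> has_weak_deriv \<Omega> i (\<lambda>x. c) (\<lambda>x. 0)"
  using has_weak_deriv_continuous[OF _ Ck_const, of \<Omega> i c]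
  by (simp add: pderivative_def[abs_def] frechet_derivative_const)

text \<open>
  Both sides of the defining identity pass to the limit by dominated convergence, since test functions
  and their derivatives are bounded and vanish outside a compact set.
\<close>

lemma has_weak_deriv_limit:
  assumes \<Omega>: "open \<Omega>" and w: "\<And>n. has_weak_deriv \<Omega> i (F n) (G n)"
    and lim: "AE x in lebesgue_on \<Omega>. (\<lambda>n. F n x) \<longlonglongrightarrow> f x" "AE x in lebesgue_on \<Omega>. (\<lambda>n. G n x) \<longlonglongrightarrow> g x"
    and m: "f \<in> borel_measurable (lebesgue_on \<Omega>)" "g \<in> borel_measurable (lebesgue_on \<Omega>)"
    and b: "\<And>n. AE x in lebesgue_on \<Omega>. \<bar>F n x\<bar> \<le> \<bar>A x\<bar>" "\<And>n. AE x in lebesgue_on \<Omega>. \<bar>G n x\<bar> \<le> \<bar>B x\<bar>"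
    and li: "locally_integrable \<Omega> A" "locally_integrable \<Omega> B"
  shows "has_weak_deriv \<Omega> i f g"
proof -
  have bound: "AE x in lebesgue_on \<Omega>. \<bar>f x\<bar> \<le> \<bar>A x\<bar>"
    if "AE x in lebesgue_on \<Omega>. (\<lambda>n. F n x) \<longlonglongrightarrow> f x" "\<And>n. AE x in lebesgue_on \<Omega>. \<bar>F n x\<bar> \<le> \<bar>A x\<bar>" for F :: "nat \<Rightarrow> _ \<Rightarrow> real" and f A
  proof -
    have "AE x in lebesgue_on \<Omega>. \<forall>n. \<bar>F n x\<bar> \<le> \<bar>A x\<bar>" using that(2) by (simp add: AE_all_countable)
    then show ?thesis using that(1)
    proof eventually_elim
      case (elim x)
      show ?case by (rule LIMSEQ_le_const2[OF tendsto_rabs[OF elim(2)]]) (use elim(1) in auto)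
    qed
  qed
  have lf: "locally_integrable \<Omega> f" by (rule locally_integrable_bound[OF \<Omega> li(1) m(1) bound[OF lim(1) b(1)]])
  have lg: "locally_integrable \<Omega> g" by (rule locally_integrable_bound[OF \<Omega> li(2) m(2) bound[OF lim(2) b(2)]])
  have conv: "(\<lambda>n. LINT x|lebesgue_on \<Omega>. F n x * \<phi> x) \<longlonglongrightarrow> (LINT x|lebesgue_on \<Omega>. f x * \<phi> x)"
    if "AE x in lebesgue_on \<Omega>. (\<lambda>n. F n x) \<longlonglongrightarrow> f x" "\<And>n. AE x in lebesgue_on \<Omega>. \<bar>F n x\<bar> \<le> \<bar>A x\<bar>"
      "integrable (lebesgue_on \<Omega>) (\<lambda>x. A x * \<phi> x)"
      "\<And>n. integrable (lebesgue_on \<Omega>) (\<lambda>x. F n x * \<phi> x)" "integrable (lebesgue_on \<Omega>) (\<lambda>x. f x * \<phi> x)" for F :: "nat \<Rightarrow> _ \<Rightarrow> real" and f A \<phi>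
  proof (rule integral_dominated_convergence[where w = "\<lambda>x. \<bar>A x * \<phi> x\<bar>"])
    show "AE x in lebesgue_on \<Omega>. (\<lambda>n. F n x * \<phi> x) \<longlonglongrightarrow> f x * \<phi> x"
      using that(1) by eventually_elim (intro tendsto_intros)
    show "AE x in lebesgue_on \<Omega>. norm (F n x * \<phi> x) \<le> \<bar>A x * \<phi> x\<bar>" for n
      using that(2)[of n] by eventually_elim (auto simp: abs_mult intro: mult_right_mono)
  qed (use that(3-5) in auto)
  have "(LINT x|lebesgue_on \<Omega>. f x * pderivative i \<phi> x) = - (LINT x|lebesgue_on \<Omega>. g x * \<phi> x)"
    if \<phi>: "\<phi> \<in> test_functions \<Omega>" for \<phi>
  proof -
    note I = locally_integrable_mult_test[OF \<Omega> _ \<phi>]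
    have lw: "locally_integrable \<Omega> (F n)" "locally_integrable \<Omega> (G n)" for n using w by (auto simp: has_weak_deriv_iff)
    have "(\<lambda>n. LINT x|lebesgue_on \<Omega>. F n x * pderivative i \<phi> x) \<longlonglongrightarrow> (LINT x|lebesgue_on \<Omega>. f x * pderivative i \<phi> x)"
      by (rule conv[OF lim(1) b(1)]) (intro I lw li lf)+
    moreover have "(\<lambda>n. LINT x|lebesgue_on \<Omega>. G n x * \<phi> x) \<longlonglongrightarrow> (LINT x|lebesgue_on \<Omega>. g x * \<phi> x)"
      by (rule conv[OF lim(2) b(2)]) (intro I lw li lg)+
    moreover have "(LINT x|lebesgue_on \<Omega>. F n x * pderivative i \<phi> x) = - (LINT x|lebesgue_on \<Omega>. G n x * \<phi> x)" for n
      using w \<phi> by (simp add: has_weak_deriv_iff)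
    ultimately have "(\<lambda>n. - (LINT x|lebesgue_on \<Omega>. G n x * \<phi> x)) \<longlonglongrightarrow> (LINT x|lebesgue_on \<Omega>. f x * pderivative i \<phi> x)"
      and "(\<lambda>n. - (LINT x|lebesgue_on \<Omega>. G n x * \<phi> x)) \<longlonglongrightarrow> - (LINT x|lebesgue_on \<Omega>. g x * \<phi> x)"
      by (simp_all add: tendsto_minus)
    then show ?thesis by (rule LIMSEQ_unique)
  qed
  then show ?thesis using lf lg by (simp add: has_weak_deriv_iff)
qed

subsection \<open>Chain rule and product rule\<close>

text \<open>
  A product of two sequences that converge in mean square converges in the mean, so that in a chain
  rule the derivative may be mollified along with the function.
\<close>

lemma L2_tendsto_integral_mult2:
  assumes F: "L2_tendsto M F f" and G: "L2_tendsto M G g"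
  shows "(\<lambda>n. LINT x|M. F n x * G n x) \<longlonglongrightarrow> (LINT x|M. f x * g x)"
proof -
  have sq: "square_integrable M (F n)" "square_integrable M (G n)" "square_integrable M f" "square_integrable M g" for n
    using F G by (auto simp: L2_tendsto_def)
  have "(\<lambda>n. LINT x|M. (F n x - f x) * (G n x - g x)) \<longlonglongrightarrow> 0"
  proof (rule Lim_null_comparison)
    show "\<forall>\<^sub>F n in sequentially. norm (LINT x|M. (F n x - f x) * (G n x - g x))
        \<le> sqrt (LINT x|M. (F n x - f x)\<^sup>2) * sqrt (LINT x|M. (G n x - g x)\<^sup>2)"
      using sq by (auto intro!: always_eventually abs_integral_mult_le square_integrable_diff)
    have "(\<lambda>n. sqrt (LINT x|M. (F n x - f x)\<^sup>2) * sqrt (LINT x|M. (G n x - g x)\<^sup>2)) \<longlonglongrightarrow> sqrt 0 * sqrt 0"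
      using F G by (intro tendsto_intros) (auto simp: L2_tendsto_def)
    then show "(\<lambda>n. sqrt (LINT x|M. (F n x - f x)\<^sup>2) * sqrt (LINT x|M. (G n x - g x)\<^sup>2)) \<longlonglongrightarrow> 0" by simp
  qed
  moreover have "(\<lambda>n. LINT x|M. F n x * g x) \<longlonglongrightarrow> (LINT x|M. f x * g x)"
    by (rule L2_tendsto_integral_mult[OF F sq(4)])
  moreover have "(\<lambda>n. LINT x|M. G n x * f x) \<longlonglongrightarrow> (LINT x|M. g x * f x)"
    by (rule L2_tendsto_integral_mult[OF G sq(3)])
  ultimately have "(\<lambda>n. (LINT x|M. (F n x - f x) * (G n x - g x)) + (LINT x|M. F n x * g x) + (LINT x|M. G n x * f x) - (LINT x|M. f x * g x))
      \<longlonglongrightarrow> 0 + (LINT x|M. f x * g x) + (LINT x|M. g x * f x) - (LINT x|M. f x * g x)"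
    by (intro tendsto_intros)
  moreover have "(LINT x|M. (F n x - f x) * (G n x - g x)) + (LINT x|M. F n x * g x) + (LINT x|M. G n x * f x) - (LINT x|M. f x * g x)
     = (LINT x|M. F n x * G n x)" for n
  proof -
    have "(LINT x|M. (F n x - f x) * (G n x - g x)) = (LINT x|M. F n x * G n x - F n x * g x - G n x * f x + f x * g x)"
      by (intro Bochner_Integration.integral_cong refl) (simp add: algebra_simps)
    then show ?thesis
      using integrable_mult_square_integrable[OF sq(1,2)[of n]] integrable_mult_square_integrable[OF sq(1,4), of n]
        integrable_mult_square_integrable[OF sq(2,3), of n] integrable_mult_square_integrable[OF sq(3,4)] by simp
  qed
  ultimately show ?thesis by (simp add: mult.commute)
qed

lemma square_integrable_Lipschitz:
  fixes h :: "real \<Rightarrow> real"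
  assumes "square_integrable M u" "h \<in> borel_measurable borel" "h 0 = 0" "\<And>s t. \<bar>h s - h t\<bar> \<le> L * \<bar>s - t\<bar>"
  shows "square_integrable M (\<lambda>x. h (u x))"
proof (rule square_integrable_bound[OF _ square_integrable_cmult[OF assms(1), of L]])
  show "(\<lambda>x. h (u x)) \<in> borel_measurable M"
    using square_integrable_measurable[OF assms(1)] assms(2) by measurable
  show "AE x in M. \<bar>h (u x)\<bar> \<le> \<bar>L * u x\<bar>"
  proof (intro AE_I2)
    fix x
    have "\<bar>h (u x)\<bar> \<le> L * \<bar>u x\<bar>" using assms(4)[of "u x" 0] assms(3) by simp
    also have "\<dots> \<le> \<bar>L * u x\<bar>" by (simp add: abs_mult mult_right_mono)
    finally show "\<bar>h (u x)\<bar> \<le> \<bar>L * u x\<bar>" .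
  qed
qed

lemma L2_tendsto_Lipschitz:
  fixes h :: "real \<Rightarrow> real"
  assumes F: "L2_tendsto M F f" and h: "h \<in> borel_measurable borel" "h 0 = 0" "\<And>s t. \<bar>h s - h t\<bar> \<le> L * \<bar>s - t\<bar>"
  shows "L2_tendsto M (\<lambda>n x. h (F n x)) (\<lambda>x. h (f x))"
proof -
  have sq: "square_integrable M (F n)" "square_integrable M f" for n
    using F by (auto simp: L2_tendsto_def)
  note a = square_integrable_Lipschitz[OF _ h]
  have "(\<lambda>n. LINT x|M. (h (F n x) - h (f x))\<^sup>2) \<longlonglongrightarrow> 0"
  proof (rule tendsto_sandwich[OF _ _ tendsto_const])
    show "(\<lambda>n. L\<^sup>2 * (LINT x|M. (F n x - f x)\<^sup>2)) \<longlonglongrightarrow> 0"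
      using F by (auto simp: L2_tendsto_def intro!: tendsto_mult_right_zero)
    have "(h (F n x) - h (f x))\<^sup>2 \<le> L\<^sup>2 * (F n x - f x)\<^sup>2" for n x
      using power_mono[OF h(3)[of "F n x" "f x"], of 2] by (simp add: power_mult_distrib)
    then have "(LINT x|M. (h (F n x) - h (f x))\<^sup>2) \<le> (LINT x|M. L\<^sup>2 * (F n x - f x)\<^sup>2)" for n
      by (intro integral_mono integrable_mult_right square_integrableD square_integrable_diff a sq)
    then show "\<forall>\<^sub>F n in sequentially. (LINT x|M. (h (F n x) - h (f x))\<^sup>2) \<le> L\<^sup>2 * (LINT x|M. (F n x - f x)\<^sup>2)"
      by simp
  qed auto
  then show ?thesis using a[OF sq(1)] a[OF sq(2)] by (simp add: L2_tendsto_def)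
qed

lemma Lipschitz_of_DERIV:
  fixes h :: "real \<Rightarrow> real"
  assumes "\<And>t. (h has_real_derivative h' t) (at t)" "\<And>t. \<bar>h' t\<bar> \<le> L"
  shows "\<bar>h s - h t\<bar> \<le> L * \<bar>s - t\<bar>"
proof -
  have "norm (h s - h t) \<le> L * norm (s - t)"
    by (rule differentiable_bound[of UNIV h "\<lambda>t. (*) (h' t)"])
      (use assms in \<open>auto simp: has_field_derivative_def abs_mult intro!: onorm_le mult_right_mono\<close>)
  then show ?thesis by simp
qed

lemma Ck_compose_C1:
  fixes f :: "real ^ 'n \<Rightarrow> real"
  assumes h: "\<And>t. (h has_real_derivative h' t) (at t)" "continuous_on UNIV h'" and f: "Ck_function (Suc 0) f"
  shows "Ck_function (Suc 0) (\<lambda>x. h (f x))" and "pderivative i (\<lambda>x. h (f x)) x = h' (f x) * pderivative i f x"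
proof -
  have D: "((\<lambda>x. h (f x)) has_derivative (\<lambda>k. h' (f x) * frechet_derivative f (at x) k)) (at x)" for x
    using has_derivative_compose[OF Ck_Suc_has_derivative[OF f] h(1)[unfolded has_field_derivative_def]] .
  show "pderivative i (\<lambda>x. h (f x)) x = h' (f x) * pderivative i f x"
    unfolding pderivative_eq[OF D] by (simp add: pderivative_def)
  have "continuous_on UNIV (\<lambda>x. h' (f x) * pderivative i f x)" for i
    by (intro continuous_on_mult continuous_on_compose2[OF h(2) Ck_continuous[OF f]] pderivative_continuous[OF f]) auto
  then show "Ck_function (Suc 0) (\<lambda>x. h (f x))"
    by (intro Ck_SucI[OF D]) (simp flip: pderivative_def)
qed

lemma square_integrable_test:
  assumes "\<phi> \<in> test_functions \<Omega>"
  shows "square_integrable lebesgue \<phi>" "square_integrable lebesgue (pderivative i \<phi>)"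
proof -
  obtain K where K: "compact K" "\<forall>x. x \<notin> K \<longrightarrow> \<phi> x = 0" "\<forall>i x. x \<notin> K \<longrightarrow> pderivative i \<phi> x = 0"
    using test_functionsE[OF assms] by metis
  have *: "square_integrable lebesgue u" if "continuous_on UNIV u" "\<forall>x. x \<notin> K \<longrightarrow> u x = 0" for u :: "real ^ 'a \<Rightarrow> real"
  proof -
    obtain R where R: "\<forall>x\<in>K. norm x \<le> R" using compact_imp_bounded[OF K(1)] by (auto simp: bounded_iff)
    have "\<forall>x. norm x > R \<longrightarrow> (u x)\<^sup>2 = 0" using R that(2) by force
    then show ?thesis unfolding square_integrable_def
      using that(1) by (intro conjI continuous_measurable_lebesgue integrable_continuous_bounded_support continuous_intros)
  qed
  show "square_integrable lebesgue \<phi>" "square_integrable lebesgue (pderivative i \<phi>)"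
    using K * Ck_continuous[OF test_functions_Ck[OF assms]] pderivative_continuous[OF test_functions_Ck[OF assms]] by blast+
qed

text \<open>
  On the support of a test function \<open>f\<close> and \<open>g\<close> are replaced by mollifications \<open>F n\<close> and \<open>G n\<close>, for
  which the classical chain rule holds. The functions \<open>h (F n)\<close> converge in mean square since \<open>h\<close> is
  Lipschitz, and \<open>h' (F n)\<close> converges boundedly almost everywhere along a subsequence. The condition
  \<open>h 0 = 0\<close> keeps \<open>h (f x)\<close> square integrable on a set of infinite measure.
\<close>

lemma chain_rule_zero:
  fixes f g :: "real ^ 'n \<Rightarrow> real"
  assumes \<Omega>: "open \<Omega>" and w: "has_weak_deriv \<Omega> i f g"
    and sq: "square_integrable (lebesgue_on \<Omega>) f" "square_integrable (lebesgue_on \<Omega>) g"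
    and h: "\<And>t. (h has_real_derivative h' t) (at t)" "continuous_on UNIV h'" "\<And>t. \<bar>h' t\<bar> \<le> L" and h0: "h 0 = 0"
  shows "has_weak_deriv \<Omega> i (\<lambda>x. h (f x)) (\<lambda>x. h' (f x) * g x)"
proof -
  have L: "L \<ge> 0" using h(3)[of 0] by linarith
  have hL: "\<bar>h s - h t\<bar> \<le> L * \<bar>s - t\<bar>" for s t by (rule Lipschitz_of_DERIV[OF h(1,3)])
  have hc: "continuous_on UNIV h" using h(1) DERIV_isCont by (metis continuous_at_imp_continuous_on)
  have hm [measurable]: "h \<in> borel_measurable borel" "h' \<in> borel_measurable borel"
    using hc h(2) by (auto intro: borel_measurable_continuous_onI)
  note [measurable] = square_integrable_measurable[OF sq(1)] square_integrable_measurable[OF sq(2)]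
  have sqh: "square_integrable (lebesgue_on \<Omega>) (\<lambda>x. h (f x))"
    by (rule square_integrable_Lipschitz[OF sq(1) hm(1) h0 hL])
  have sqh': "square_integrable (lebesgue_on \<Omega>) (\<lambda>x. h' (f x) * g x)"
    by (rule square_integrable_mult_bounded[OF sq(2), of _ L]) (use h(3) in auto)
  note li = locally_integrable_square[OF \<Omega> sqh] locally_integrable_square[OF \<Omega> sqh']
  have "(LINT x|lebesgue_on \<Omega>. h (f x) * pderivative i \<phi> x) = - (LINT x|lebesgue_on \<Omega>. (h' (f x) * g x) * \<phi> x)"
    if \<phi>: "\<phi> \<in> test_functions \<Omega>" for \<phi>
  proof -
    obtain K where K: "compact K" "K \<subseteq> \<Omega>" "\<forall>x. x \<notin> K \<longrightarrow> \<phi> x = 0" "\<forall>i x. x \<notin> K \<longrightarrow> pderivative i \<phi> x = 0"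
      using test_functionsE[OF \<phi>] by metis
    have out: "\<phi> x = 0" "pderivative i \<phi> x = 0" if "x \<notin> \<Omega>" for x i using that K by blast+
    note Ck\<phi> = test_functions_Ck[OF \<phi>]
    obtain e where e: "e > 0" "fatten K e \<subseteq> \<Omega>" using fatten_in_open[OF K(1) \<Omega> K(2)] by blast
    define K' where "K' = fatten K e"
    have K': "compact K'" "K' \<subseteq> \<Omega>" using e compact_fatten[OF K(1)] by (auto simp: K'_def)
    have KK': "K \<subseteq> K'" using e(1) by (auto simp: K'_def fatten_def)
    define f1 where "f1 = (\<lambda>x. indicat_real K' x * f x)"
    define g1 where "g1 = (\<lambda>x. indicat_real K' x * g x)"
    have sq1: "square_integrable lebesgue f1" "square_integrable lebesgue g1"
      unfolding f1_def g1_def by (intro square_integrable_restrict[OF \<Omega> _ K'] sq)+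
    note [measurable] = square_integrable_measurable[OF sq1(1)] square_integrable_measurable[OF sq1(2)]
    have f1i: "integrable lebesgue f1" "integrable lebesgue g1"
      using w K' by (auto simp: f1_def g1_def has_weak_deriv_iff locally_integrable_def)
    define F where "F n = convolve f1 (mollifier (shrinking e n))" for n
    define G where "G n = convolve g1 (mollifier (shrinking e n))" for n
    have LF: "L2_tendsto lebesgue F f1" and LG: "L2_tendsto lebesgue G g1"
      unfolding F_def G_def f1_def g1_def using sq1
      by (auto intro!: L2_tendsto_restricted_mollification K' e simp: f1_def g1_def)
    obtain r where r: "strict_mono r" "AE x in lebesgue. (\<lambda>n. F (r n) x) \<longlonglongrightarrow> f1 x"
      using L2_tendsto_AE_subseq[OF LF] by blast
    have CkF: "Ck_function k (F n)" for k n
      unfolding F_def by (rule Ck_convolve_mollifier[OF f1i(1) shrinking(1)[OF e(1)]])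
    have dF: "pderivative i (F n) x = G n x" if "x \<in> K" for n x
      unfolding F_def G_def f1_def g1_def
      by (rule pderivative_mollification[OF \<Omega> w K' shrinking(1)[OF e(1)]])
        (use that shrinking(2)[OF e(1), of n] in \<open>auto simp: K'_def fatten_def\<close>)
    note C1 = Ck_compose_C1[OF h(1,2) CkF]
    have Fm [measurable]: "F n \<in> borel_measurable lebesgue" for n by (rule continuous_measurable_lebesgue[OF Ck_continuous[OF CkF]])
    have parts: "(LINT x|lebesgue. h (F n x) * pderivative i \<phi> x) = - (LINT x|lebesgue. (h' (F n x) * \<phi> x) * G n x)" for n
    proof -
      have "has_weak_deriv UNIV i (\<lambda>x. h (F n x)) (pderivative i (\<lambda>x. h (F n x)))"
        by (rule has_weak_deriv_continuous[OF open_UNIV C1(1)])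
      moreover have "\<phi> \<in> test_functions UNIV"
        by (rule test_functionsI[OF Ck\<phi> K(1)]) (use K(3) in auto)
      ultimately have "(LINT x|lebesgue. h (F n x) * pderivative i \<phi> x) = - (LINT x|lebesgue. pderivative i (\<lambda>x. h (F n x)) x * \<phi> x)"
        by (simp add: has_weak_deriv_iff lebesgue_on_UNIV_eq)
      also have "(\<lambda>x. pderivative i (\<lambda>x. h (F n x)) x * \<phi> x) = (\<lambda>x. (h' (F n x) * \<phi> x) * G n x)"
        using dF K(3) by (auto simp: C1(2) fun_eq_iff)
      finally show ?thesis .
    qed
    have LhF: "L2_tendsto lebesgue (\<lambda>n x. h (F n x)) (\<lambda>x. h (f1 x))"
      by (rule L2_tendsto_Lipschitz[OF LF hm(1) h0 hL])
    have Lh': "L2_tendsto lebesgue (\<lambda>n x. h' (F (r n) x) * \<phi> x) (\<lambda>x. h' (f1 x) * \<phi> x)"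
    proof (rule L2_tendsto_dominated[where G = "\<lambda>x. L * \<bar>\<phi> x\<bar>"])
      have [measurable]: "\<phi> \<in> borel_measurable lebesgue" by (rule continuous_measurable_lebesgue[OF Ck_continuous[OF Ck\<phi>]])
      show "(\<lambda>x. h' (F (r n) x) * \<phi> x) \<in> borel_measurable lebesgue" "(\<lambda>x. h' (f1 x) * \<phi> x) \<in> borel_measurable lebesgue" for n
        by measurable
      show "square_integrable lebesgue (\<lambda>x. L * \<bar>\<phi> x\<bar>)"
        by (intro square_integrable_cmult square_integrable_abs square_integrable_test[OF \<phi>])
      show "AE x in lebesgue. \<bar>h' (F (r n) x) * \<phi> x\<bar> \<le> L * \<bar>\<phi> x\<bar>" for n
        by (intro AE_I2) (auto simp: abs_mult intro!: mult_right_mono h(3))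
      show "AE x in lebesgue. (\<lambda>n. h' (F (r n) x) * \<phi> x) \<longlonglongrightarrow> h' (f1 x) * \<phi> x"
        using r(2)
      proof eventually_elim
        case (elim x)
        have "isCont h' (f1 x)" using h(2) by (simp add: continuous_on_eq_continuous_at)
        then show ?case by (intro tendsto_mult tendsto_const isCont_tendsto_compose[OF _ elim])
      qed
    qed
    have "(\<lambda>n. LINT x|lebesgue. h (F (r n) x) * pderivative i \<phi> x) \<longlonglongrightarrow> (LINT x|lebesgue. h (f1 x) * pderivative i \<phi> x)"
      by (rule L2_tendsto_integral_mult[OF L2_tendsto_subseq[OF LhF r(1)] square_integrable_test(2)[OF \<phi>]])
    moreover have "(\<lambda>n. LINT x|lebesgue. (h' (F (r n) x) * \<phi> x) * G (r n) x) \<longlonglongrightarrow> (LINT x|lebesgue. (h' (f1 x) * \<phi> x) * g1 x)"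
      by (rule L2_tendsto_integral_mult2[OF Lh' L2_tendsto_subseq[OF LG r(1)]])
    ultimately have "(LINT x|lebesgue. h (f1 x) * pderivative i \<phi> x) = - (LINT x|lebesgue. (h' (f1 x) * \<phi> x) * g1 x)"
      unfolding parts by (intro LIMSEQ_unique[OF _ tendsto_minus])
    moreover have "(LINT x|lebesgue. h (f1 x) * pderivative i \<phi> x) = (LINT x|lebesgue_on \<Omega>. h (f x) * pderivative i \<phi> x)"
    proof -
      have "(\<lambda>x. h (f1 x) * pderivative i \<phi> x) = (\<lambda>x. h (f x) * pderivative i \<phi> x)"
        using K(4) KK' by (auto simp: f1_def indicator_def fun_eq_iff)
      then show ?thesis by (subst lebesgue_on_support(2)[OF \<Omega>]) (simp_all add: out)
    qed
    moreover have "(LINT x|lebesgue. (h' (f1 x) * \<phi> x) * g1 x) = (LINT x|lebesgue_on \<Omega>. (h' (f x) * g x) * \<phi> x)"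
    proof -
      have "(\<lambda>x. (h' (f1 x) * \<phi> x) * g1 x) = (\<lambda>x. (h' (f x) * g x) * \<phi> x)"
        using K(3) KK' by (auto simp: f1_def g1_def indicator_def fun_eq_iff)
      then show ?thesis by (subst lebesgue_on_support(2)[OF \<Omega>]) (simp_all add: out)
    qed
    ultimately show ?thesis by simp
  qed
  then show ?thesis using li by (simp add: has_weak_deriv_iff)
qed

theorem weak_chain_rule:
  fixes f g :: "real ^ 'n \<Rightarrow> real"
  assumes \<Omega>: "open \<Omega>" and w: "has_weak_deriv \<Omega> i f g"
    and sq: "square_integrable (lebesgue_on \<Omega>) f" "square_integrable (lebesgue_on \<Omega>) g"
    and h: "\<And>t. (h has_real_derivative h' t) (at t)" "continuous_on UNIV h'" "\<And>t. \<bar>h' t\<bar> \<le> L"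
  shows "has_weak_deriv \<Omega> i (\<lambda>x. h (f x)) (\<lambda>x. h' (f x) * g x)"
proof -
  have "has_weak_deriv \<Omega> i (\<lambda>x. h (f x) - h 0) (\<lambda>x. h' (f x) * g x)"
    by (rule chain_rule_zero[OF \<Omega> w sq, of "\<lambda>t. h t - h 0" h' L]) (use h in \<open>auto intro!: derivative_eq_intros\<close>)
  from has_weak_deriv_add[OF \<Omega> this has_weak_deriv_const[OF \<Omega>, of i "h 0"]] show ?thesis by simp
qed

text \<open>
  If \<open>M n\<close> is a mollification of \<open>m\<close>, then \<open>M n * \<phi>\<close> is a test function for \<open>f\<close>. On the support of
  \<open>\<phi>\<close> the mollifications and their derivatives keep the bound \<open>B\<close>, so the limit is taken by dominated
  convergence, for which the local integrability of \<open>f\<close> and \<open>g\<close> suffices.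
\<close>

theorem weak_product_rule:
  fixes f g m m' :: "real ^ 'n \<Rightarrow> real"
  assumes \<Omega>: "open \<Omega>" and w: "has_weak_deriv \<Omega> i f g" and wm: "has_weak_deriv \<Omega> i m m'"
    and mm: "m \<in> borel_measurable (lebesgue_on \<Omega>)" "m' \<in> borel_measurable (lebesgue_on \<Omega>)"
    and fm: "f \<in> borel_measurable (lebesgue_on \<Omega>)" "g \<in> borel_measurable (lebesgue_on \<Omega>)"
    and B: "AE x in lebesgue_on \<Omega>. \<bar>m x\<bar> \<le> B" "AE x in lebesgue_on \<Omega>. \<bar>m' x\<bar> \<le> B"
  shows "has_weak_deriv \<Omega> i (\<lambda>x. m x * f x) (\<lambda>x. m x * g x + m' x * f x)"
proof -
  have lf: "locally_integrable \<Omega> f" "locally_integrable \<Omega> g" using w by (auto simp: has_weak_deriv_iff)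
  have mult: "locally_integrable \<Omega> (\<lambda>x. a x * u x)"
    if "locally_integrable \<Omega> u" "u \<in> borel_measurable (lebesgue_on \<Omega>)" "a \<in> borel_measurable (lebesgue_on \<Omega>)"
      "AE x in lebesgue_on \<Omega>. \<bar>a x\<bar> \<le> B" for a u
    by (rule locally_integrable_bound[OF \<Omega> locally_integrable_cmult[OF that(1), of B]])
      (use that in \<open>auto elim!: eventually_mono simp: abs_mult intro!: mult_right_mono\<close>)
  have lm: "locally_integrable \<Omega> (\<lambda>x. m x * f x)" "locally_integrable \<Omega> (\<lambda>x. m x * g x)" "locally_integrable \<Omega> (\<lambda>x. m' x * f x)"
    using mult lf fm mm B by blast+
  have "(LINT x|lebesgue_on \<Omega>. (m x * f x) * pderivative i \<phi> x) = - (LINT x|lebesgue_on \<Omega>. (m x * g x + m' x * f x) * \<phi> x)"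
    if \<phi>: "\<phi> \<in> test_functions \<Omega>" for \<phi>
  proof -
    obtain K where K: "compact K" "K \<subseteq> \<Omega>" "\<forall>x. x \<notin> K \<longrightarrow> \<phi> x = 0" "\<forall>i x. x \<notin> K \<longrightarrow> pderivative i \<phi> x = 0"
      using test_functionsE[OF \<phi>] by metis
    note Ck\<phi> = test_functions_Ck[OF \<phi>]
    obtain C where C: "C > 0" "\<forall>x. \<bar>\<phi> x\<bar> \<le> C" "\<forall>i x. \<bar>pderivative i \<phi> x\<bar> \<le> C" using test_functions_bounded[OF \<phi>] by metis
    obtain e where e: "e > 0" "fatten K e \<subseteq> \<Omega>" using fatten_in_open[OF K(1) \<Omega> K(2)] by blast
    define K' where "K' = fatten K e"
    have K': "compact K'" "K' \<subseteq> \<Omega>" using e compact_fatten[OF K(1)] by (auto simp: K'_def)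
    have KK': "K \<subseteq> K'" using e(1) by (auto simp: K'_def fatten_def)
    have [measurable]: "K' \<in> sets lebesgue" by (rule compact_sets_lebesgue[OF K'(1)])
    have restr: "square_integrable lebesgue (\<lambda>x. indicat_real K' x * a x)" "integrable lebesgue (\<lambda>x. indicat_real K' x * a x)"
      "AE x in lebesgue. \<bar>indicat_real K' x * a x\<bar> \<le> \<bar>B\<bar>"
      if "has_weak_deriv \<Omega> i a a' \<or> has_weak_deriv \<Omega> i a' a" "AE x in lebesgue_on \<Omega>. \<bar>a x\<bar> \<le> B" for a a'
    proof -
      show i: "integrable lebesgue (\<lambda>x. indicat_real K' x * a x)"
        using that(1) K' by (auto simp: has_weak_deriv_iff locally_integrable_def)
      show b: "AE x in lebesgue. \<bar>indicat_real K' x * a x\<bar> \<le> \<bar>B\<bar>"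
        using that(2)[unfolded AE_lebesgue_on[OF \<Omega>]]
        by eventually_elim (use K'(2) in \<open>auto simp: indicator_def\<close>)
      have "integrable lebesgue (\<lambda>x. (indicat_real K' x * a x) * (indicat_real K' x * a x))"
        by (rule integrable_mult_bounded[OF i borel_measurable_integrable[OF i] b])
      then show "square_integrable lebesgue (\<lambda>x. indicat_real K' x * a x)"
        using i by (auto simp: square_integrable_def power2_eq_square)
    qed
    note m1 = restr[OF disjI1[OF wm] B(1)] and m1' = restr[OF disjI2[OF wm] B(2)]
    define M where "M n = convolve (\<lambda>x. indicat_real K' x * m x) (mollifier (shrinking e n))" for n
    define D where "D n = convolve (\<lambda>x. indicat_real K' x * m' x) (mollifier (shrinking e n))" for n
    have LM: "L2_tendsto lebesgue M (\<lambda>x. indicat_real K' x * m x)"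
      unfolding M_def by (rule L2_tendsto_restricted_mollification[OF K'(1) m1(1) e(1)])
    have LD: "L2_tendsto lebesgue D (\<lambda>x. indicat_real K' x * m' x)"
      unfolding D_def by (rule L2_tendsto_restricted_mollification[OF K'(1) m1'(1) e(1)])
    obtain r1 where r1: "strict_mono r1" "AE x in lebesgue. (\<lambda>n. M (r1 n) x) \<longlonglongrightarrow> indicat_real K' x * m x"
      using L2_tendsto_AE_subseq[OF LM] by blast
    obtain r2 where r2: "strict_mono r2" "AE x in lebesgue. (\<lambda>n. D (r1 (r2 n)) x) \<longlonglongrightarrow> indicat_real K' x * m' x"
      using L2_tendsto_AE_subseq[OF L2_tendsto_subseq[OF LD r1(1)]] by blast
    define r where "r n = r1 (r2 n)" for n
    have r: "AE x in lebesgue. (\<lambda>n. M (r n) x) \<longlonglongrightarrow> indicat_real K' x * m x" "AE x in lebesgue. (\<lambda>n. D (r n) x) \<longlonglongrightarrow> indicat_real K' x * m' x"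
    proof -
      show "AE x in lebesgue. (\<lambda>n. M (r n) x) \<longlonglongrightarrow> indicat_real K' x * m x"
        using r1(2) by eventually_elim (use LIMSEQ_subseq_LIMSEQ[OF _ r2(1)] in \<open>auto simp: r_def o_def\<close>)
      show "AE x in lebesgue. (\<lambda>n. D (r n) x) \<longlonglongrightarrow> indicat_real K' x * m' x" using r2(2) by (simp add: r_def)
    qed
    have CkM: "Ck_function k (M n)" "Ck_function k (D n)" for k n
      unfolding M_def D_def by (intro Ck_convolve_mollifier m1(2) m1'(2) shrinking(1)[OF e(1)])+
    have bd: "\<bar>M n x\<bar> \<le> \<bar>B\<bar>" "\<bar>D n x\<bar> \<le> \<bar>B\<bar>" for n x
      unfolding M_def D_def by (intro convolve_bounded shrinking(1)[OF e(1)] m1 m1')+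
    have dM: "pderivative i (M n) x = D n x" if "x \<in> K" for n x
      unfolding M_def D_def
      by (rule pderivative_mollification[OF \<Omega> wm K' shrinking(1)[OF e(1)]])
        (use that shrinking(2)[OF e(1), of n] in \<open>auto simp: K'_def fatten_def\<close>)
    have id: "(LINT x|lebesgue_on \<Omega>. f x * (M n x * pderivative i \<phi> x + D n x * \<phi> x)) = - (LINT x|lebesgue_on \<Omega>. g x * (M n x * \<phi> x))" for n
    proof -
      have "(\<lambda>x. M n x * \<phi> x) \<in> test_functions \<Omega>"
        by (rule test_functionsI[OF Ck_mult[OF CkM(1) Ck\<phi>] K(1,2)]) (use K(3) in auto)
      moreover have "pderivative i (\<lambda>x. M n x * \<phi> x) = (\<lambda>x. M n x * pderivative i \<phi> x + D n x * \<phi> x)"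
      proof
        fix x show "pderivative i (\<lambda>x. M n x * \<phi> x) x = M n x * pderivative i \<phi> x + D n x * \<phi> x"
          using pderivative_mult[OF CkM(1) Ck\<phi>, of i n x] dM[of x n] K(3) by (cases "x \<in> K") auto
      qed
      ultimately show ?thesis using w by (auto simp: has_weak_deriv_iff)
    qed
    have lim: "(\<lambda>n. LINT x|lebesgue_on \<Omega>. u x * (M (r n) x * a x + D (r n) x * b x)) \<longlonglongrightarrow> (LINT x|lebesgue_on \<Omega>. u x * (m x * a x + m' x * b x))"
      if u: "locally_integrable \<Omega> u" "u \<in> borel_measurable (lebesgue_on \<Omega>)"
        and ab: "continuous_on UNIV a" "continuous_on UNIV b" "\<forall>x. \<bar>a x\<bar> \<le> C" "\<forall>x. \<bar>b x\<bar> \<le> C" "\<forall>x. x \<notin> K \<longrightarrow> a x = 0" "\<forall>x. x \<notin> K \<longrightarrow> b x = 0"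
      for u a b
    proof (rule integral_dominated_convergence[where w = "\<lambda>x. 2 * \<bar>B\<bar> * C * \<bar>indicat_real K' x * u x\<bar>"])
      have "integrable lebesgue (\<lambda>x. indicat_real K' x * u x)" using u(1) K' by (simp add: locally_integrable_def)
      then have "integrable (lebesgue_on \<Omega>) (\<lambda>x. indicat_real K' x * u x)"
        using K'(2) by (subst lebesgue_on_support(1)[OF \<Omega>]) (auto simp: indicator_def)
      then show "integrable (lebesgue_on \<Omega>) (\<lambda>x. 2 * \<bar>B\<bar> * C * \<bar>indicat_real K' x * u x\<bar>)" by simp
      have c: "v \<in> borel_measurable (lebesgue_on \<Omega>)" if "continuous_on UNIV v" for v :: "real ^ 'n \<Rightarrow> real"
        using continuous_measurable_lebesgue[OF that] by (rule measurable_restrict_space1)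
      note [measurable] = c[OF ab(1)] c[OF ab(2)] c[OF Ck_continuous[OF CkM(1)]] c[OF Ck_continuous[OF CkM(2)]] u(2) mm
      show "(\<lambda>x. u x * (m x * a x + m' x * b x)) \<in> borel_measurable (lebesgue_on \<Omega>)" by measurable
      show "(\<lambda>x. u x * (M (r n) x * a x + D (r n) x * b x)) \<in> borel_measurable (lebesgue_on \<Omega>)" for n by measurable
      show "AE x in lebesgue_on \<Omega>. (\<lambda>n. u x * (M (r n) x * a x + D (r n) x * b x)) \<longlonglongrightarrow> u x * (m x * a x + m' x * b x)"
        unfolding AE_lebesgue_on[OF \<Omega>] using r
      proof eventually_elim
        case (elim x)
        have "(\<lambda>n. u x * (M (r n) x * a x + D (r n) x * b x)) \<longlonglongrightarrow> u x * (indicat_real K' x * m x * a x + indicat_real K' x * m' x * b x)"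
          by (intro tendsto_intros elim)
        moreover have "indicat_real K' x * m x * a x = m x * a x" "indicat_real K' x * m' x * b x = m' x * b x"
          using ab(5,6) KK' by (auto simp: indicator_def)
        ultimately show ?case by simp
      qed
      show "AE x in lebesgue_on \<Omega>. norm (u x * (M (r n) x * a x + D (r n) x * b x)) \<le> 2 * \<bar>B\<bar> * C * \<bar>indicat_real K' x * u x\<bar>" for n
      proof (intro AE_I2)
        fix x
        show "norm (u x * (M (r n) x * a x + D (r n) x * b x)) \<le> 2 * \<bar>B\<bar> * C * \<bar>indicat_real K' x * u x\<bar>"
        proof (cases "x \<in> K")
          case True
          have "\<bar>M (r n) x * a x + D (r n) x * b x\<bar> \<le> \<bar>M (r n) x * a x\<bar> + \<bar>D (r n) x * b x\<bar>" by (rule abs_triangle_ineq)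
          also have "\<dots> \<le> \<bar>B\<bar> * C + \<bar>B\<bar> * C" unfolding abs_mult using bd ab(3,4) by (intro add_mono mult_mono) auto
          also have "\<dots> = 2 * \<bar>B\<bar> * C" by simp
          finally have "\<bar>u x\<bar> * \<bar>M (r n) x * a x + D (r n) x * b x\<bar> \<le> \<bar>u x\<bar> * (2 * \<bar>B\<bar> * C)"
            by (rule mult_left_mono) simp
          also have "\<dots> = 2 * \<bar>B\<bar> * C * \<bar>indicat_real K' x * u x\<bar>"
            using True KK' by (simp add: subset_iff)
          finally show ?thesis unfolding real_norm_def abs_mult[of "u x"] .
        next
          case False
          then show ?thesis using ab(5,6) C(1) by simp
        qed
      qed
    qed
    have "(\<lambda>n. LINT x|lebesgue_on \<Omega>. f x * (M (r n) x * pderivative i \<phi> x + D (r n) x * \<phi> x)) \<longlonglongrightarrow>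
        (LINT x|lebesgue_on \<Omega>. f x * (m x * pderivative i \<phi> x + m' x * \<phi> x))"
      using lim[OF lf(1) fm(1) pderivative_continuous[OF Ck\<phi>] Ck_continuous[OF Ck\<phi>]] C K(3,4) by blast
    moreover have "(\<lambda>n. LINT x|lebesgue_on \<Omega>. g x * (M (r n) x * \<phi> x)) \<longlonglongrightarrow> (LINT x|lebesgue_on \<Omega>. g x * (m x * \<phi> x))"
      using lim[OF lf(2) fm(2) Ck_continuous[OF Ck\<phi>], of "\<lambda>x. 0"] C K(3,4) by simp
    ultimately have "(LINT x|lebesgue_on \<Omega>. f x * (m x * pderivative i \<phi> x + m' x * \<phi> x)) = - (LINT x|lebesgue_on \<Omega>. g x * (m x * \<phi> x))"
      unfolding id by (intro LIMSEQ_unique[OF _ tendsto_minus])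
    moreover have "(LINT x|lebesgue_on \<Omega>. f x * (m x * pderivative i \<phi> x + m' x * \<phi> x)) =
        (LINT x|lebesgue_on \<Omega>. m x * f x * pderivative i \<phi> x) + (LINT x|lebesgue_on \<Omega>. m' x * f x * \<phi> x)"
      using locally_integrable_mult_test[OF \<Omega> lm(1) \<phi>] locally_integrable_mult_test[OF \<Omega> lm(3) \<phi>]
      by (subst Bochner_Integration.integral_add[symmetric]) (auto simp: algebra_simps)
    moreover have "(LINT x|lebesgue_on \<Omega>. (m x * g x + m' x * f x) * \<phi> x) =
        (LINT x|lebesgue_on \<Omega>. g x * (m x * \<phi> x)) + (LINT x|lebesgue_on \<Omega>. m' x * f x * \<phi> x)"
    proof -
      have "(\<lambda>x. g x * (m x * \<phi> x)) = (\<lambda>x. m x * g x * \<phi> x)" by (simp add: fun_eq_iff)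
      then show ?thesis
        using locally_integrable_mult_test[OF \<Omega> lm(2) \<phi>] locally_integrable_mult_test[OF \<Omega> lm(3) \<phi>]
        by (simp add: distrib_right)
    qed
    ultimately show ?thesis by linarith
  qed
  then show ?thesis using lm locally_integrable_add by (simp add: has_weak_deriv_iff)
qed

section \<open>The Sobolev space \<open>H\<^sup>1\<close>\<close>

text \<open>
  The gradient is carried along explicitly, because \<open>weak_deriv\<close> is an arbitrary representative and
  does not commute with pointwise operations.
\<close>

definition H1_grad :: "(real ^ 'n) set \<Rightarrow> (real ^ 'n \<Rightarrow> real) \<Rightarrow> ('n \<Rightarrow> real ^ 'n \<Rightarrow> real) \<Rightarrow> bool" where
  "H1_grad \<Omega> f g \<longleftrightarrow> square_integrable (lebesgue_on \<Omega>) f \<and>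
     (\<forall>i. square_integrable (lebesgue_on \<Omega>) (g i) \<and> has_weak_deriv \<Omega> i f (g i))"

lemma Lp2_iff: "f \<in> Lp 2 \<Omega> \<longleftrightarrow> square_integrable (lebesgue_on \<Omega>) f"
proof -
  have "\<bar>f x\<bar> powr 2 = (f x)\<^sup>2" for x by (cases "f x = 0") (auto simp: powr_numeral)
  then show ?thesis by (simp add: Lp_def square_integrable_def)
qed

lemma H1_grad_imp_H1: "H1_grad \<Omega> f g \<Longrightarrow> f \<in> H1 \<Omega>"
  by (auto simp: H1_grad_def Lp2_iff simp flip: One_nat_def) (auto simp: Lp2_iff)

lemma measurable_cong_AE_lebesgue_on:
  fixes f g :: "real ^ 'n \<Rightarrow> real"
  assumes "open \<Omega>" "f \<in> borel_measurable (lebesgue_on \<Omega>)" "AE x in lebesgue_on \<Omega>. f x = g x"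
  shows "g \<in> borel_measurable (lebesgue_on \<Omega>)"
proof -
  have "(\<lambda>x. indicator \<Omega> x * g x) \<in> borel_measurable lebesgue"
  proof (rule borel_measurable_AE)
    show "(\<lambda>x. indicator \<Omega> x * f x) \<in> borel_measurable lebesgue"
      using assms(2) by (simp add: lebesgue_on_eqs(1)[OF assms(1)])
    show "AE x in lebesgue. indicat_real \<Omega> x * f x = indicator \<Omega> x * g x"
      using assms(3)[unfolded AE_lebesgue_on[OF assms(1)]] by eventually_elim (auto simp: indicator_def)
  qed
  then show ?thesis by (simp add: lebesgue_on_eqs(1)[OF assms(1)])
qed

lemma H1_grad_weak_deriv_AE:
  assumes "open \<Omega>" "H1_grad \<Omega> f g"
  shows "AE x in lebesgue_on \<Omega>. weak_deriv \<Omega> i f x = g i x" "weak_deriv \<Omega> i f \<in> borel_measurable (lebesgue_on \<Omega>)"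
    "has_weak_deriv \<Omega> i f (weak_deriv \<Omega> i f)"
proof -
  have g: "has_weak_deriv \<Omega> i f (g i)" using assms(2) by (simp add: H1_grad_def)
  then show w: "has_weak_deriv \<Omega> i f (weak_deriv \<Omega> i f)"
    unfolding weak_deriv_def by (rule someI[where P = "has_weak_deriv \<Omega> i f"])
  show ae: "AE x in lebesgue_on \<Omega>. weak_deriv \<Omega> i f x = g i x"
    by (rule has_weak_deriv_unique[OF assms(1) w g])
  show "weak_deriv \<Omega> i f \<in> borel_measurable (lebesgue_on \<Omega>)"
    by (rule measurable_cong_AE_lebesgue_on[OF assms(1), of "g i"])
      (use assms(2) ae in \<open>auto simp: H1_grad_def square_integrable_def elim: eventually_mono\<close>)
qed

lemma H1_grad_of_H1:
  assumes "open \<Omega>" "f \<in> H1 \<Omega>"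
  shows "H1_grad \<Omega> f (\<lambda>i. weak_deriv \<Omega> i f)"
proof -
  have "\<exists>g. square_integrable (lebesgue_on \<Omega>) g \<and> has_weak_deriv \<Omega> i f g" for i
    using assms(2) by (auto simp: Bex_def Lp2_iff)
  then obtain g where "\<And>i. square_integrable (lebesgue_on \<Omega>) (g i) \<and> has_weak_deriv \<Omega> i f (g i)" by metis
  then have g: "H1_grad \<Omega> f g" using assms(2) by (simp add: H1_grad_def Lp2_iff)
  have "square_integrable (lebesgue_on \<Omega>) (weak_deriv \<Omega> i f)" for i
    by (rule square_integrable_cong_AE[of _ "g i"])
      (use g H1_grad_weak_deriv_AE[OF assms(1) g, of i] in \<open>auto simp: H1_grad_def elim: eventually_mono\<close>)
  then show ?thesis using g H1_grad_weak_deriv_AE[OF assms(1) g] by (simp add: H1_grad_def)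
qed

lemma H1_norm_eq:
  assumes "open \<Omega>" "H1_grad \<Omega> f g"
  shows "H1_norm \<Omega> f = sqrt ((LINT x|lebesgue_on \<Omega>. (f x)\<^sup>2) + (\<Sum>i\<in>UNIV. LINT x|lebesgue_on \<Omega>. (g i x)\<^sup>2))"
proof -
  have "(LINT x|lebesgue_on \<Omega>. (weak_deriv \<Omega> i f x)\<^sup>2) = (LINT x|lebesgue_on \<Omega>. (g i x)\<^sup>2)" for i
    using H1_grad_weak_deriv_AE[OF assms, of i] assms(2)
    by (intro integral_cong_AE) (auto simp: H1_grad_def square_integrable_def elim: eventually_mono)
  then show ?thesis by (simp add: H1_norm_def L2_norm_def)
qed

lemma H1_gradD:
  assumes "H1_grad \<Omega> f g"
  shows "square_integrable (lebesgue_on \<Omega>) f" "square_integrable (lebesgue_on \<Omega>) (g i)" "has_weak_deriv \<Omega> i f (g i)"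
    "f \<in> borel_measurable (lebesgue_on \<Omega>)" "g i \<in> borel_measurable (lebesgue_on \<Omega>)"
  using assms by (auto simp: H1_grad_def square_integrable_def)

lemma H1_grad_add:
  "open \<Omega> \<Longrightarrow> H1_grad \<Omega> f f' \<Longrightarrow> H1_grad \<Omega> g g' \<Longrightarrow> H1_grad \<Omega> (\<lambda>x. f x + g x) (\<lambda>i x. f' i x + g' i x)"
  by (simp add: H1_grad_def square_integrable_add has_weak_deriv_add)

lemma H1_grad_cmult: "H1_grad \<Omega> f f' \<Longrightarrow> H1_grad \<Omega> (\<lambda>x. c * f x) (\<lambda>i x. c * f' i x)"
  by (simp add: H1_grad_def square_integrable_cmult has_weak_deriv_cmult)

lemma H1_grad_diff:
  "open \<Omega> \<Longrightarrow> H1_grad \<Omega> f f' \<Longrightarrow> H1_grad \<Omega> g g' \<Longrightarrow> H1_grad \<Omega> (\<lambda>x. f x - g x) (\<lambda>i x. f' i x - g' i x)"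
  by (simp add: H1_grad_def square_integrable_diff has_weak_deriv_diff)

lemma finite_lebesgue_on: "bounded \<Omega> \<Longrightarrow> open \<Omega> \<Longrightarrow> finite_measure (lebesgue_on \<Omega>)" for \<Omega> :: "'a::euclidean_space set"
  using emeasure_bounded_finite[of \<Omega>]
  by (intro finite_measureI) (auto simp: emeasure_restrict_space emeasure_lborel_box)

lemma square_integrable_of_bounded:
  fixes m :: "real ^ 'n \<Rightarrow> real"
  assumes "open \<Omega>" "bounded \<Omega>" "m \<in> borel_measurable (lebesgue_on \<Omega>)" "AE x in lebesgue_on \<Omega>. \<bar>m x\<bar> \<le> B"
  shows "square_integrable (lebesgue_on \<Omega>) m"
proof -
  interpret finite_measure "lebesgue_on \<Omega>" by (rule finite_lebesgue_on[OF assms(2,1)])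
  have "square_integrable (lebesgue_on \<Omega>) (\<lambda>x. B)" by (simp add: square_integrable_def)
  then show ?thesis
    using assms(4) by (intro square_integrable_bound[OF assms(3)]) (auto elim!: eventually_mono)
qed

lemma H1_grad_const: "open \<Omega> \<Longrightarrow> bounded \<Omega> \<Longrightarrow> H1_grad \<Omega> (\<lambda>x. c) (\<lambda>i x. 0)"
  using square_integrable_of_bounded[of \<Omega> "\<lambda>x. c" "\<bar>c\<bar>"]
  by (simp add: H1_grad_def has_weak_deriv_const square_integrable_zero)

lemma H1_grad_cong_AE:
  assumes "open \<Omega>" "H1_grad \<Omega> f g"
    and "AE x in lebesgue_on \<Omega>. f x = f' x"
    and "\<And>i. AE x in lebesgue_on \<Omega>. g i x = g' i x"
  shows "H1_grad \<Omega> f' g'"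
proof -
  have m: "f' \<in> borel_measurable (lebesgue_on \<Omega>)" "g' i \<in> borel_measurable (lebesgue_on \<Omega>)" for i
    using measurable_cong_AE_lebesgue_on[OF assms(1) _ assms(3)] measurable_cong_AE_lebesgue_on[OF assms(1) _ assms(4)[of i]]
      H1_gradD[OF assms(2)] by auto
  then show ?thesis
    using H1_gradD[OF assms(2)] assms(3,4) unfolding H1_grad_def
    by (intro conjI allI square_integrable_cong_AE[OF _ m(1) assms(3)] square_integrable_cong_AE[OF _ m(2) assms(4)]
        has_weak_deriv_cong_AE[OF assms(1) _ assms(3) m(1) assms(4) m(2)])
qed

subsection \<open>Absolute values and truncations\<close>

lemma root_approx:
  fixes t :: real
  shows "(\<lambda>n. sqrt (t\<^sup>2 + (shrinking 1 n)\<^sup>2)) \<longlonglongrightarrow> \<bar>t\<bar>"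
    and "(\<lambda>n. t / sqrt (t\<^sup>2 + (shrinking 1 n)\<^sup>2)) \<longlonglongrightarrow> sgn t"
    and "(\<lambda>n. t\<^sup>2 / (t\<^sup>2 + (shrinking 1 n)\<^sup>2)) \<longlonglongrightarrow> (if t = 0 then 0 else 1)"
proof -
  have s: "(\<lambda>n. t\<^sup>2 + (shrinking 1 n)\<^sup>2) \<longlonglongrightarrow> t\<^sup>2 + 0\<^sup>2"
    by (intro tendsto_intros shrinking(3))
  then show a: "(\<lambda>n. sqrt (t\<^sup>2 + (shrinking 1 n)\<^sup>2)) \<longlonglongrightarrow> \<bar>t\<bar>"
    using tendsto_real_sqrt[OF s] by simp
  show "(\<lambda>n. t / sqrt (t\<^sup>2 + (shrinking 1 n)\<^sup>2)) \<longlonglongrightarrow> sgn t"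
  proof (cases "t = 0")
    case False
    then show ?thesis using tendsto_divide[OF tendsto_const[of t] a] by (simp add: real_sgn_eq)
  qed simp
  show "(\<lambda>n. t\<^sup>2 / (t\<^sup>2 + (shrinking 1 n)\<^sup>2)) \<longlonglongrightarrow> (if t = 0 then 0 else 1)"
    using tendsto_divide[OF tendsto_const s, of "t\<^sup>2"] by (cases "t = 0") auto
qed

text \<open>The chain rule is applied to \<open>sqrt (t\<^sup>2 + \<delta>\<^sup>2)\<close>, and \<open>\<delta>\<close> tends to zero.\<close>

lemma H1_grad_abs:
  fixes f :: "real ^ 'n \<Rightarrow> real"
  assumes \<Omega>: "open \<Omega>" and f: "H1_grad \<Omega> f g"
  shows "H1_grad \<Omega> (\<lambda>x. \<bar>f x\<bar>) (\<lambda>i x. sgn (f x) * g i x)"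
proof -
  note F = H1_gradD[OF f]
  note [measurable] = F(4,5)
  have "has_weak_deriv \<Omega> i (\<lambda>x. \<bar>f x\<bar>) (\<lambda>x. sgn (f x) * g i x)" for i
  proof (rule has_weak_deriv_limit[OF \<Omega>, where A = "\<lambda>x. \<bar>f x\<bar> + 1" and B = "g i"
        and F = "\<lambda>n x. sqrt ((f x)\<^sup>2 + (shrinking 1 n)\<^sup>2)" and G = "\<lambda>n x. (f x / sqrt ((f x)\<^sup>2 + (shrinking 1 n)\<^sup>2)) * g i x"])
    fix n
    let ?d = "shrinking 1 n"
    have d: "?d > 0" "?d \<le> 1" using shrinking(1,2)[of 1 n] by auto
    have pos: "t\<^sup>2 + ?d\<^sup>2 > 0" for t using d by (simp add: add_nonneg_pos)
    have le: "\<bar>t\<bar> \<le> sqrt (t\<^sup>2 + ?d\<^sup>2)" for t by (rule real_le_rsqrt) (simp)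
    have le1: "\<bar>t / sqrt (t\<^sup>2 + ?d\<^sup>2)\<bar> \<le> 1" for t
      using le[of t] pos[of t] by (simp add: abs_divide divide_le_eq)
    show "has_weak_deriv \<Omega> i (\<lambda>x. sqrt ((f x)\<^sup>2 + ?d\<^sup>2)) (\<lambda>x. (f x / sqrt ((f x)\<^sup>2 + ?d\<^sup>2)) * g i x)"
    proof (rule weak_chain_rule[OF \<Omega> F(3,1,2)])
      show "((\<lambda>t. sqrt (t\<^sup>2 + ?d\<^sup>2)) has_real_derivative t / sqrt (t\<^sup>2 + ?d\<^sup>2)) (at t)" for t
        using pos[of t] by (auto intro!: derivative_eq_intros simp: divide_simps)
      show "continuous_on UNIV (\<lambda>t. t / sqrt (t\<^sup>2 + ?d\<^sup>2))"
        by (intro continuous_intros) (use d in auto)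
    qed (rule le1)
    show "AE x in lebesgue_on \<Omega>. \<bar>sqrt ((f x)\<^sup>2 + ?d\<^sup>2)\<bar> \<le> \<bar>\<bar>f x\<bar> + 1\<bar>"
    proof (intro AE_I2)
      fix x
      have "sqrt ((f x)\<^sup>2 + ?d\<^sup>2) \<le> \<bar>f x\<bar> + \<bar>?d\<bar>" by (rule sqrt_sum_squares_le_sum_abs)
      then show "\<bar>sqrt ((f x)\<^sup>2 + ?d\<^sup>2)\<bar> \<le> \<bar>\<bar>f x\<bar> + 1\<bar>" using d pos[of "f x"] by simp
    qed
    show "AE x in lebesgue_on \<Omega>. \<bar>(f x / sqrt ((f x)\<^sup>2 + ?d\<^sup>2)) * g i x\<bar> \<le> \<bar>g i x\<bar>"
      using le1 by (intro AE_I2) (auto simp only: abs_mult intro!: mult_left_le_one_le)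
  next
    show "locally_integrable \<Omega> (\<lambda>x. \<bar>f x\<bar> + 1)"
      by (intro locally_integrable_add locally_integrable_const locally_integrable_square[OF \<Omega>] square_integrable_abs F)
    show "locally_integrable \<Omega> (g i)" by (rule locally_integrable_square[OF \<Omega> F(2)])
    show "AE x in lebesgue_on \<Omega>. (\<lambda>n. f x / sqrt ((f x)\<^sup>2 + (shrinking 1 n)\<^sup>2) * g i x) \<longlonglongrightarrow> sgn (f x) * g i x"
      by (intro AE_I2 tendsto_mult root_approx tendsto_const)
  qed (auto simp: root_approx)
  moreover have "square_integrable (lebesgue_on \<Omega>) (\<lambda>x. sgn (f x) * g i x)" for i
    by (rule square_integrable_mult_bounded[OF F(2), of _ 1]) (auto simp: sgn_if)
  ultimately show ?thesis using square_integrable_abs[OF F(1)] by (simp add: H1_grad_def)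
qed

text \<open>
  The functions \<open>t - \<delta> arctan (t / \<delta>)\<close> converge to \<open>t\<close>, and their derivatives to the indicator of
  \<open>t \<noteq> 0\<close>; hence the weak derivative does not change when it is set to zero on the zero set of \<open>f\<close>.
\<close>

lemma weak_deriv_zero_set:
  fixes f :: "real ^ 'n \<Rightarrow> real"
  assumes \<Omega>: "open \<Omega>" and f: "H1_grad \<Omega> f g"
  shows "AE x in lebesgue_on \<Omega>. f x = 0 \<longrightarrow> g i x = 0"
proof -
  note F = H1_gradD[OF f]
  note [measurable] = F(4,5)
  have "has_weak_deriv \<Omega> i f (\<lambda>x. (if f x = 0 then 0 else 1) * g i x)"
  proof (rule has_weak_deriv_limit[OF \<Omega>, where A = f and B = "g i"
        and F = "\<lambda>n x. f x - shrinking 1 n * arctan (f x / shrinking 1 n)" and G = "\<lambda>n x. ((f x)\<^sup>2 / ((f x)\<^sup>2 + (shrinking 1 n)\<^sup>2)) * g i x"])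
    fix n
    let ?d = "shrinking 1 n"
    have d: "?d > 0" "?d \<le> 1" using shrinking(1,2)[of 1 n] by auto
    have pos: "t\<^sup>2 + ?d\<^sup>2 > 0" for t using d by (simp add: add_nonneg_pos)
    have le1: "\<bar>t\<^sup>2 / (t\<^sup>2 + ?d\<^sup>2)\<bar> \<le> 1" for t
      using pos[of t] by (simp add: abs_divide divide_le_eq)
    have D: "((\<lambda>t. t - ?d * arctan (t / ?d)) has_real_derivative t\<^sup>2 / (t\<^sup>2 + ?d\<^sup>2)) (at t)" for t
      using d pos[of t] by (auto intro!: derivative_eq_intros simp: field_simps power2_eq_square add_nonneg_eq_0_iff)
    show "has_weak_deriv \<Omega> i (\<lambda>x. f x - ?d * arctan (f x / ?d)) (\<lambda>x. ((f x)\<^sup>2 / ((f x)\<^sup>2 + ?d\<^sup>2)) * g i x)"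
    proof (rule weak_chain_rule[OF \<Omega> F(3,1,2) D])
      show "continuous_on UNIV (\<lambda>t. t\<^sup>2 / (t\<^sup>2 + ?d\<^sup>2))"
        by (intro continuous_intros) (use d in auto)
    qed (rule le1)
    show "AE x in lebesgue_on \<Omega>. \<bar>f x - ?d * arctan (f x / ?d)\<bar> \<le> \<bar>f x\<bar>"
      using Lipschitz_of_DERIV[OF D le1, of _ 0] by (intro AE_I2) simp
    show "AE x in lebesgue_on \<Omega>. \<bar>((f x)\<^sup>2 / ((f x)\<^sup>2 + ?d\<^sup>2)) * g i x\<bar> \<le> \<bar>g i x\<bar>"
      using le1 by (intro AE_I2) (auto simp only: abs_mult intro!: mult_left_le_one_le)
  next
    show "locally_integrable \<Omega> f" "locally_integrable \<Omega> (g i)" by (intro locally_integrable_square[OF \<Omega>] F)+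
    show "AE x in lebesgue_on \<Omega>. (\<lambda>n. (f x)\<^sup>2 / ((f x)\<^sup>2 + (shrinking 1 n)\<^sup>2) * g i x) \<longlonglongrightarrow> (if f x = 0 then 0 else 1) * g i x"
      by (intro AE_I2 tendsto_mult root_approx tendsto_const)
    have null: "(\<lambda>n. shrinking 1 n * arctan (t / shrinking 1 n)) \<longlonglongrightarrow> 0" for t
    proof (rule Lim_null_comparison)
      show "\<forall>\<^sub>F n in sequentially. norm (shrinking 1 n * arctan (t / shrinking 1 n)) \<le> shrinking 1 n * 2"
      proof (intro always_eventually allI)
        fix n
        have "\<bar>arctan (t / shrinking 1 n)\<bar> \<le> 2" using arctan_bounded[of "t / shrinking 1 n"] pi_less_4 by linarith
        then show "norm (shrinking 1 n * arctan (t / shrinking 1 n)) \<le> shrinking 1 n * 2"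
          using shrinking(1)[of 1 n] by (simp add: abs_mult)
      qed
      show "(\<lambda>n. shrinking 1 n * 2) \<longlonglongrightarrow> 0" by (intro tendsto_mult_left_zero shrinking)
    qed
    have "(\<lambda>n. t - shrinking 1 n * arctan (t / shrinking 1 n)) \<longlonglongrightarrow> t - 0" for t
      by (intro tendsto_diff tendsto_const null)
    then show "AE x in lebesgue_on \<Omega>. (\<lambda>n. f x - shrinking 1 n * arctan (f x / shrinking 1 n)) \<longlonglongrightarrow> f x" by simp
  qed auto
  from has_weak_deriv_unique[OF \<Omega> F(3) this] show ?thesis
    by eventually_elim auto
qed

text \<open>
  \<open>clip N t = (|t + N| - |t - N|) / 2\<close>; on the level sets \<open>|f| = N\<close> the gradient vanishes by the
  preceding lemma, so its value there is immaterial.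
\<close>

lemma H1_grad_clip:
  fixes f :: "real ^ 'n \<Rightarrow> real"
  assumes \<Omega>: "open \<Omega>" "bounded \<Omega>" and f: "H1_grad \<Omega> f g" and N: "N > 0"
  shows "H1_grad \<Omega> (\<lambda>x. clip N (f x)) (\<lambda>i x. if \<bar>f x\<bar> < N then g i x else 0)"
proof -
  have p: "H1_grad \<Omega> (\<lambda>x. f x + c) g" for c
    using H1_grad_add[OF \<Omega>(1) f H1_grad_const[OF \<Omega>, of c]] by simp
  have "H1_grad \<Omega> (\<lambda>x. (1/2) * (\<bar>f x + N\<bar> - \<bar>f x + - N\<bar>)) (\<lambda>i x. (1/2) * (sgn (f x + N) * g i x - sgn (f x + - N) * g i x))"
    by (intro H1_grad_cmult H1_grad_diff H1_grad_abs \<Omega> p)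
  then show ?thesis
  proof (rule H1_grad_cong_AE[OF \<Omega>(1)])
    show "AE x in lebesgue_on \<Omega>. (1/2) * (\<bar>f x + N\<bar> - \<bar>f x + - N\<bar>) = clip N (f x)"
      using N by (auto simp: clip_def)
    fix i
    show "AE x in lebesgue_on \<Omega>. (1/2) * (sgn (f x + N) * g i x - sgn (f x + - N) * g i x) = (if \<bar>f x\<bar> < N then g i x else 0)"
      using weak_deriv_zero_set[OF \<Omega>(1) p, of N i] weak_deriv_zero_set[OF \<Omega>(1) p, of "- N" i]
      by eventually_elim (use N in \<open>auto simp: sgn_if abs_if split: if_splits\<close>)
  qed
qed

subsection \<open>Bounded functions with bounded weak derivatives\<close>

definition W1inf_grad :: "(real ^ 'n) set \<Rightarrow> real \<Rightarrow> (real ^ 'n \<Rightarrow> real) \<Rightarrow> ('n \<Rightarrow> real ^ 'n \<Rightarrow> real) \<Rightarrow> bool" where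
  "W1inf_grad \<Omega> B m d \<longleftrightarrow> m \<in> borel_measurable (lebesgue_on \<Omega>) \<and> (AE x in lebesgue_on \<Omega>. \<bar>m x\<bar> \<le> B) \<and>
    (\<forall>i. d i \<in> borel_measurable (lebesgue_on \<Omega>) \<and> (AE x in lebesgue_on \<Omega>. \<bar>d i x\<bar> \<le> B) \<and> has_weak_deriv \<Omega> i m (d i))"

lemma W1inf_gradD:
  assumes "W1inf_grad \<Omega> B m d"
  shows "m \<in> borel_measurable (lebesgue_on \<Omega>)" "AE x in lebesgue_on \<Omega>. \<bar>m x\<bar> \<le> B"
    "d i \<in> borel_measurable (lebesgue_on \<Omega>)" "AE x in lebesgue_on \<Omega>. \<bar>d i x\<bar> \<le> B" "has_weak_deriv \<Omega> i m (d i)"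
  using assms by (auto simp: W1inf_grad_def)

lemma W1inf_grad_H1:
  assumes "open \<Omega>" "bounded \<Omega>" "W1inf_grad \<Omega> B m d"
  shows "H1_grad \<Omega> m d"
  unfolding H1_grad_def
  by (intro conjI allI square_integrable_of_bounded[OF assms(1,2), of _ B] W1inf_gradD[OF assms(3)])

lemma H1_grad_mult_W1inf:
  assumes "open \<Omega>" and m: "W1inf_grad \<Omega> B m d" and f: "H1_grad \<Omega> f g"
  shows "H1_grad \<Omega> (\<lambda>x. m x * f x) (\<lambda>i x. m x * g i x + d i x * f x)"
  unfolding H1_grad_def
  by (intro conjI allI square_integrable_add square_integrable_mult_bounded[of _ _ _ B] weak_product_rule[OF assms(1), of _ _ _ _ _ B]
      W1inf_gradD[OF m] H1_gradD[OF f])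

lemma AE_mult_bound:
  fixes f g :: "'a \<Rightarrow> real"
  assumes "AE x in M. \<bar>f x\<bar> \<le> B" "AE x in M. \<bar>g x\<bar> \<le> C"
  shows "AE x in M. \<bar>f x * g x\<bar> \<le> B * C"
  using assms
proof eventually_elim
  case (elim x)
  then show ?case unfolding abs_mult by (intro mult_mono) auto
qed

lemma W1inf_grad_mult:
  assumes "open \<Omega>" and m: "W1inf_grad \<Omega> B m d" and f: "W1inf_grad \<Omega> C f g"
  shows "W1inf_grad \<Omega> (2 * B * C) (\<lambda>x. m x * f x) (\<lambda>i x. m x * g i x + d i x * f x)"
proof -
  note M = W1inf_gradD[OF m] and F = W1inf_gradD[OF f]
  note [measurable] = M(1,3) F(1,3)
  have "AE x in lebesgue_on \<Omega>. \<bar>m x * f x\<bar> \<le> 2 * B * C"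
    using AE_mult_bound[OF M(2) F(2)] by eventually_elim auto
  moreover have "AE x in lebesgue_on \<Omega>. \<bar>m x * g i x + d i x * f x\<bar> \<le> 2 * B * C" for i
    using AE_mult_bound[OF M(2) F(4), of i] AE_mult_bound[OF M(4) F(2), of i] by eventually_elim auto
  moreover have "has_weak_deriv \<Omega> i (\<lambda>x. m x * f x) (\<lambda>x. m x * g i x + d i x * f x)" for i
    by (rule weak_product_rule[OF assms(1) F(5) M(5) M(1,3) F(1,3) M(2,4)])
  ultimately show ?thesis by (auto simp: W1inf_grad_def)
qed

lemma W1inf_grad_diff:
  assumes "open \<Omega>" and m: "W1inf_grad \<Omega> B m d" and f: "W1inf_grad \<Omega> C f g"
  shows "W1inf_grad \<Omega> (B + C) (\<lambda>x. m x - f x) (\<lambda>i x. d i x - g i x)"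
proof -
  note M = W1inf_gradD[OF m] and F = W1inf_gradD[OF f]
  note [measurable] = M(1,3) F(1,3)
  have "AE x in lebesgue_on \<Omega>. \<bar>m x - f x\<bar> \<le> B + C"
    using M(2) F(2) by eventually_elim auto
  moreover have "AE x in lebesgue_on \<Omega>. \<bar>d i x - g i x\<bar> \<le> B + C" for i
    using M(4)[of i] F(4)[of i] by eventually_elim auto
  ultimately show ?thesis
    using has_weak_deriv_diff[OF assms(1) M(5) F(5)] by (auto simp: W1inf_grad_def)
qed

text \<open>
  The coefficients are bounded below by a positive constant, and they are composed with functions like
  \<open>1 / t\<close> and \<open>sqrt t\<close> that are singular at the origin. Continued by its tangent line such a function is
  continuously differentiable on the whole line and keeps the bound of its derivative.
\<close>

definition tangent_extension :: "real \<Rightarrow> (real \<Rightarrow> real) \<Rightarrow> (real \<Rightarrow> real) \<Rightarrow> real \<Rightarrow> real" where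
  "tangent_extension a h h' t = (if a \<le> t then h t else h a + h' a * (t - a))"

lemma tangent_extension_DERIV:
  assumes "\<And>t. a \<le> t \<Longrightarrow> (h has_real_derivative h' t) (at t)"
  shows "(tangent_extension a h h' has_real_derivative h' (max a t)) (at t)"
proof -
  consider "t > a" | "t < a" | "t = a" by linarith
  then show ?thesis
  proof cases
    case 1
    have ev: "\<forall>\<^sub>F s in nhds t. tangent_extension a h h' s = h s"
      using eventually_nhds_in_open[of "{a<..}" t] 1
      by (auto simp: tangent_extension_def elim!: eventually_mono)
    show ?thesis using DERIV_cong_ev[OF refl ev refl] assms[of t] 1 by simp
  next
    case 2
    have ev: "\<forall>\<^sub>F s in nhds t. tangent_extension a h h' s = h a + h' a * (s - a)"
      using eventually_nhds_in_open[of "{..<a}" t] 2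
      by (auto simp: tangent_extension_def elim!: eventually_mono)
    have "((\<lambda>s. h a + h' a * (s - a)) has_real_derivative h' a) (at t)"
      by (auto intro!: derivative_eq_intros)
    then show ?thesis using DERIV_cong_ev[OF refl ev refl] 2 by simp
  next
    case 3
    have "((\<lambda>k. norm (h (a + k) - h a - h' a * k) / norm k) \<longlongrightarrow> 0) (at 0)"
      using assms[of a] unfolding has_field_derivative_def has_derivative_at by simp
    then have "((\<lambda>k. norm (tangent_extension a h h' (a + k) - tangent_extension a h h' a - h' a * k) / norm k) \<longlongrightarrow> 0) (at 0)"
    proof (rule Lim_null_comparison[rotated], intro always_eventually allI)
      fix k
      have "0 \<le> norm (h (a + k) - h a - h' a * k) / norm k" by simp
      then show "norm (norm (tangent_extension a h h' (a + k) - tangent_extension a h h' a - h' a * k) / norm k)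
          \<le> norm (h (a + k) - h a - h' a * k) / norm k"
        by (cases "0 \<le> k") (simp_all add: tangent_extension_def)
    qed
    then show ?thesis
      using 3 unfolding has_field_derivative_def has_derivative_at by (simp add: bounded_linear_mult_right)
  qed
qed

lemma W1inf_grad_compose:
  assumes \<Omega>: "open \<Omega>" "bounded \<Omega>" and m: "W1inf_grad \<Omega> B m d" and a: "AE x in lebesgue_on \<Omega>. a \<le> m x"
    and h: "\<And>t. a \<le> t \<Longrightarrow> (h has_real_derivative h' t) (at t)" "continuous_on {a..} h'" "\<And>t. a \<le> t \<Longrightarrow> \<bar>h' t\<bar> \<le> L"
    and C: "\<And>t. a \<le> t \<Longrightarrow> t \<le> B \<Longrightarrow> \<bar>h t\<bar> \<le> C" "L * B \<le> C"
  shows "W1inf_grad \<Omega> C (\<lambda>x. h (m x)) (\<lambda>i x. h' (m x) * d i x)"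
proof -
  note M = W1inf_gradD[OF m]
  let ?h = "tangent_extension a h h'" and ?h' = "\<lambda>t. h' (max a t)"
  have c: "continuous_on UNIV ?h'"
    by (intro continuous_on_compose2[OF h(2)] continuous_intros) auto
  have hc: "continuous_on UNIV ?h"
    using tangent_extension_DERIV[OF h(1)] DERIV_isCont by (metis continuous_at_imp_continuous_on)
  have hm: "?h \<in> borel_measurable borel" "?h' \<in> borel_measurable borel"
    using c hc by (auto intro: borel_measurable_continuous_onI)
  note [measurable] = M(1,3)
  have w: "has_weak_deriv \<Omega> i (\<lambda>x. ?h (m x)) (\<lambda>x. ?h' (m x) * d i x)" for i
    by (rule weak_chain_rule[OF \<Omega>(1) M(5) _ _ tangent_extension_DERIV[OF h(1)] c h(3)])
      (use H1_gradD[OF W1inf_grad_H1[OF \<Omega> m]] in auto)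
  have eq: "AE x in lebesgue_on \<Omega>. ?h (m x) = h (m x)" "AE x in lebesgue_on \<Omega>. ?h' (m x) * d i x = h' (m x) * d i x" for i
    using a by (eventually_elim, simp add: tangent_extension_def max_def)+
  have me: "(\<lambda>x. h (m x)) \<in> borel_measurable (lebesgue_on \<Omega>)" "(\<lambda>x. h' (m x) * d i x) \<in> borel_measurable (lebesgue_on \<Omega>)" for i
  proof -
    have u: "(\<lambda>x. ?h (m x)) \<in> borel_measurable (lebesgue_on \<Omega>)" "(\<lambda>x. ?h' (m x) * d i x) \<in> borel_measurable (lebesgue_on \<Omega>)"
      by (intro borel_measurable_times M(3) measurable_compose[OF M(1)] hm)+
    show "(\<lambda>x. h (m x)) \<in> borel_measurable (lebesgue_on \<Omega>)"
      by (rule measurable_cong_AE_lebesgue_on[OF \<Omega>(1) u(1) eq(1)])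
    show "(\<lambda>x. h' (m x) * d i x) \<in> borel_measurable (lebesgue_on \<Omega>)"
      by (rule measurable_cong_AE_lebesgue_on[OF \<Omega>(1) u(2) eq(2)])
  qed
  have "AE x in lebesgue_on \<Omega>. \<bar>h (m x)\<bar> \<le> C" using a M(2) by eventually_elim (auto intro: C(1))
  moreover have "AE x in lebesgue_on \<Omega>. \<bar>h' (m x) * d i x\<bar> \<le> C" for i
    using a M(4)[of i]
  proof eventually_elim
    case (elim x)
    have "\<bar>h' (m x) * d i x\<bar> \<le> L * B"
      unfolding abs_mult using elim h(3)[of "m x"] by (intro mult_mono) auto
    then show ?case using C(2) by linarith
  qed
  ultimately show ?thesis
    using me has_weak_deriv_cong_AE[OF \<Omega>(1) w eq(1) me(1) eq(2) me(2)] by (auto simp: W1inf_grad_def)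
qed

section \<open>The closure of the test functions in \<open>H\<^sup>1\<close>\<close>

text \<open>
  Membership in \<open>H\<^sub>0\<^sup>1\<close> together with the gradient, in terms of an approximating sequence;
  \<open>H10_grad_of_H10\<close> and \<open>H10_of_H10_grad\<close> relate it to the definition by the norm.
\<close>

definition H10_grad :: "(real ^ 'n) set \<Rightarrow> (real ^ 'n \<Rightarrow> real) \<Rightarrow> ('n \<Rightarrow> real ^ 'n \<Rightarrow> real) \<Rightarrow> bool" where
  "H10_grad \<Omega> f g \<longleftrightarrow> H1_grad \<Omega> f g \<and>
    (\<exists>\<theta>. (\<forall>k. \<theta> k \<in> test_functions \<Omega>) \<and> L2_tendsto (lebesgue_on \<Omega>) \<theta> f \<and>
         (\<forall>i. L2_tendsto (lebesgue_on \<Omega>) (\<lambda>k. pderivative i (\<theta> k)) (g i)))"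

lemma square_integrable_lebesgue_on:
  fixes f :: "real ^ 'n \<Rightarrow> real"
  assumes "open \<Omega>" "square_integrable lebesgue f"
  shows "square_integrable (lebesgue_on \<Omega>) f" "(LINT x|lebesgue_on \<Omega>. (f x)\<^sup>2) \<le> (LINT x|lebesgue. (f x)\<^sup>2)"
proof -
  have [measurable]: "\<Omega> \<in> sets lebesgue" using assms(1) by auto
  have i: "integrable lebesgue (\<lambda>x. indicator \<Omega> x * (f x)\<^sup>2)"
    by (rule integrable_mult_bounded[OF square_integrableD[OF assms(2)], of _ 1]) (auto simp: indicator_def[abs_def])
  then show "square_integrable (lebesgue_on \<Omega>) f"
    using square_integrable_measurable[OF assms(2)]
    by (auto simp: square_integrable_def lebesgue_on_eqs(2)[OF assms(1)] intro: measurable_restrict_space1)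
  show "(LINT x|lebesgue_on \<Omega>. (f x)\<^sup>2) \<le> (LINT x|lebesgue. (f x)\<^sup>2)"
    unfolding lebesgue_on_eqs(3)[OF assms(1)]
    by (rule integral_mono[OF i square_integrableD[OF assms(2)]]) (auto simp: indicator_def)
qed

lemma L2_tendsto_lebesgue_on:
  fixes f :: "real ^ 'n \<Rightarrow> real"
  assumes "open \<Omega>" "L2_tendsto lebesgue F f"
  shows "L2_tendsto (lebesgue_on \<Omega>) F f"
proof -
  have sq: "square_integrable lebesgue (F n)" "square_integrable lebesgue f" for n using assms(2) by (auto simp: L2_tendsto_def)
  have "(\<lambda>n. LINT x|lebesgue_on \<Omega>. (F n x - f x)\<^sup>2) \<longlonglongrightarrow> 0"
  proof (rule tendsto_sandwich[OF _ _ tendsto_const])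
    show "\<forall>\<^sub>F n in sequentially. (LINT x|lebesgue_on \<Omega>. (F n x - f x)\<^sup>2) \<le> (LINT x|lebesgue. (F n x - f x)\<^sup>2)"
      by (intro always_eventually allI square_integrable_lebesgue_on(2)[OF assms(1)] square_integrable_diff sq)
    show "(\<lambda>n. LINT x|lebesgue. (F n x - f x)\<^sup>2) \<longlonglongrightarrow> 0" using assms(2) by (simp add: L2_tendsto_def)
  qed auto
  then show ?thesis using square_integrable_lebesgue_on(1)[OF assms(1)] sq by (simp add: L2_tendsto_def)
qed

lemma L2_tendsto_cong_AE:
  assumes "L2_tendsto M F f" "AE x in M. f x = f' x" "f' \<in> borel_measurable M"
  shows "L2_tendsto M F f'"
proof -
  have sq: "square_integrable M (F n)" "square_integrable M f" for n using assms(1) by (auto simp: L2_tendsto_def)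
  note [measurable] = square_integrable_measurable[OF sq(1)] square_integrable_measurable[OF sq(2)] assms(3)
  have "(LINT x|M. (F n x - f' x)\<^sup>2) = (LINT x|M. (F n x - f x)\<^sup>2)" for n
    using assms(2) by (intro integral_cong_AE) (auto elim: eventually_mono)
  then show ?thesis
    using assms(1) square_integrable_cong_AE[OF sq(2) assms(3,2)] by (simp add: L2_tendsto_def)
qed

lemma L2_tendsto_nearby:
  assumes F: "L2_tendsto M F f" and sq: "\<And>n. square_integrable M (G n)"
    and lim: "(\<lambda>n. LINT x|M. (G n x - F n x)\<^sup>2) \<longlonglongrightarrow> 0"
  shows "L2_tendsto M G f"
proof -
  have "L2_tendsto M (\<lambda>n x. G n x - F n x) (\<lambda>x. 0)"
    using F sq lim by (auto simp: L2_tendsto_def square_integrable_zero intro: square_integrable_diff)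
  from L2_tendsto_add[OF this F] show ?thesis by simp
qed

lemma H1_grad_test: "open \<Omega> \<Longrightarrow> \<phi> \<in> test_functions \<Omega> \<Longrightarrow> H1_grad \<Omega> \<phi> (\<lambda>i. pderivative i \<phi>)"
  unfolding H1_grad_def
  by (intro conjI allI square_integrable_lebesgue_on square_integrable_test has_weak_deriv_continuous test_functions_Ck)

lemma H10_gradI_approx:
  assumes \<Omega>: "open \<Omega>" and f: "H1_grad \<Omega> f g"
    and ap: "\<And>\<epsilon>. \<epsilon> > 0 \<Longrightarrow> \<exists>\<theta>\<in>test_functions \<Omega>. (LINT x|lebesgue_on \<Omega>. (\<theta> x - f x)\<^sup>2) < \<epsilon> \<and>
        (\<forall>i. (LINT x|lebesgue_on \<Omega>. (pderivative i \<theta> x - g i x)\<^sup>2) < \<epsilon>)"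
  shows "H10_grad \<Omega> f g"
proof -
  define P where "P k \<theta> \<longleftrightarrow> \<theta> \<in> test_functions \<Omega> \<and> (LINT x|lebesgue_on \<Omega>. (\<theta> x - f x)\<^sup>2) < shrinking 1 k \<and>
        (\<forall>i. (LINT x|lebesgue_on \<Omega>. (pderivative i \<theta> x - g i x)\<^sup>2) < shrinking 1 k)" for k \<theta>
  define \<theta> where "\<theta> k = (SOME \<theta>. P k \<theta>)" for k
  have "\<exists>\<theta>. P k \<theta>" for k
    using ap[of "shrinking 1 k"] shrinking(1)[of 1 k] unfolding P_def by auto
  then have "P k (\<theta> k)" for k unfolding \<theta>_def by (rule someI_ex)
  then have \<theta>: "\<And>k. \<theta> k \<in> test_functions \<Omega>" "\<And>k. (LINT x|lebesgue_on \<Omega>. (\<theta> k x - f x)\<^sup>2) < shrinking 1 k"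
    "\<And>k i. (LINT x|lebesgue_on \<Omega>. (pderivative i (\<theta> k) x - g i x)\<^sup>2) < shrinking 1 k" unfolding P_def by auto
  have lim: "F \<longlonglongrightarrow> 0" if "\<And>k. 0 \<le> F k" "\<And>k. F k < shrinking 1 k" for F :: "nat \<Rightarrow> real"
    by (rule tendsto_sandwich[OF _ _ tendsto_const shrinking(3)[of 1]]) (use that in \<open>auto intro!: always_eventually less_imp_le\<close>)
  note T = H1_gradD[OF H1_grad_test[OF \<Omega> \<theta>(1)]] and F = H1_gradD[OF f]
  have "L2_tendsto (lebesgue_on \<Omega>) \<theta> f"
    using lim[of "\<lambda>k. LINT x|lebesgue_on \<Omega>. (\<theta> k x - f x)\<^sup>2"] \<theta>(2) T(1) F(1) by (simp add: L2_tendsto_def)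
  moreover have "L2_tendsto (lebesgue_on \<Omega>) (\<lambda>k. pderivative i (\<theta> k)) (g i)" for i
    using lim[of "\<lambda>k. LINT x|lebesgue_on \<Omega>. (pderivative i (\<theta> k) x - g i x)\<^sup>2"] \<theta>(3) T(2) F(2) by (simp add: L2_tendsto_def)
  ultimately show ?thesis using f \<theta>(1) by (auto simp: H10_grad_def)
qed

lemma H10_grad_approx:
  assumes "H10_grad \<Omega> f g" "\<epsilon> > 0"
  shows "\<exists>\<theta>\<in>test_functions \<Omega>. (LINT x|lebesgue_on \<Omega>. (\<theta> x - f x)\<^sup>2) < \<epsilon> \<and>
        (\<forall>i. (LINT x|lebesgue_on \<Omega>. (pderivative i \<theta> x - g i x)\<^sup>2) < \<epsilon>)"
proof -
  obtain \<theta> where \<theta>: "\<And>k. \<theta> k \<in> test_functions \<Omega>" "L2_tendsto (lebesgue_on \<Omega>) \<theta> f"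
    "\<And>i. L2_tendsto (lebesgue_on \<Omega>) (\<lambda>k. pderivative i (\<theta> k)) (g i)" using assms(1) by (auto simp: H10_grad_def)
  have "\<forall>\<^sub>F k in sequentially. (LINT x|lebesgue_on \<Omega>. (\<theta> k x - f x)\<^sup>2) < \<epsilon>"
    using \<theta>(2) assms(2) by (intro order_tendstoD) (auto simp: L2_tendsto_def)
  moreover have "\<forall>\<^sub>F k in sequentially. (LINT x|lebesgue_on \<Omega>. (pderivative i (\<theta> k) x - g i x)\<^sup>2) < \<epsilon>" for i
    using \<theta>(3)[of i] assms(2) by (intro order_tendstoD) (auto simp: L2_tendsto_def)
  then have "\<forall>\<^sub>F k in sequentially. \<forall>i. (LINT x|lebesgue_on \<Omega>. (pderivative i (\<theta> k) x - g i x)\<^sup>2) < \<epsilon>"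
    by (intro eventually_all_finite)
  ultimately have "\<forall>\<^sub>F k in sequentially. (LINT x|lebesgue_on \<Omega>. (\<theta> k x - f x)\<^sup>2) < \<epsilon> \<and>
      (\<forall>i. (LINT x|lebesgue_on \<Omega>. (pderivative i (\<theta> k) x - g i x)\<^sup>2) < \<epsilon>)" by (rule eventually_conj)
  then obtain k where "(LINT x|lebesgue_on \<Omega>. (\<theta> k x - f x)\<^sup>2) < \<epsilon> \<and>
      (\<forall>i. (LINT x|lebesgue_on \<Omega>. (pderivative i (\<theta> k) x - g i x)\<^sup>2) < \<epsilon>)"
    using eventually_happens by force
  then show ?thesis using \<theta>(1) by blast
qed

text \<open>
  The space is closed: test functions that approximate \<open>F n\<close> with a squared error below \<open>1 / (n + 1)\<close>
  form a sequence that converges to the limit.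
\<close>

lemma H10_grad_limit:
  assumes \<Omega>: "open \<Omega>" and F: "\<And>n. H10_grad \<Omega> (F n) (G n)" and f: "H1_grad \<Omega> f g"
    and lim: "L2_tendsto (lebesgue_on \<Omega>) F f" "\<And>i. L2_tendsto (lebesgue_on \<Omega>) (\<lambda>n. G n i) (g i)"
  shows "H10_grad \<Omega> f g"
proof -
  define P where "P k \<theta> \<longleftrightarrow> \<theta> \<in> test_functions \<Omega> \<and> (LINT x|lebesgue_on \<Omega>. (\<theta> x - F k x)\<^sup>2) < shrinking 1 k \<and>
        (\<forall>i. (LINT x|lebesgue_on \<Omega>. (pderivative i \<theta> x - G k i x)\<^sup>2) < shrinking 1 k)" for k \<theta>
  define \<theta> where "\<theta> k = (SOME \<theta>. P k \<theta>)" for k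
  have "\<exists>\<theta>. P k \<theta>" for k
    using H10_grad_approx[OF F[of k], of "shrinking 1 k"] shrinking(1)[of 1 k] unfolding P_def by auto
  then have "P k (\<theta> k)" for k unfolding \<theta>_def by (rule someI_ex)
  then have \<theta>: "\<And>k. \<theta> k \<in> test_functions \<Omega>" "\<And>k. (LINT x|lebesgue_on \<Omega>. (\<theta> k x - F k x)\<^sup>2) < shrinking 1 k"
    "\<And>k i. (LINT x|lebesgue_on \<Omega>. (pderivative i (\<theta> k) x - G k i x)\<^sup>2) < shrinking 1 k" unfolding P_def by auto
  have z: "F \<longlonglongrightarrow> 0" if "\<And>k. 0 \<le> F k" "\<And>k. F k < shrinking 1 k" for F :: "nat \<Rightarrow> real"
    by (rule tendsto_sandwich[OF _ _ tendsto_const shrinking(3)[of 1]]) (use that in \<open>auto intro!: always_eventually less_imp_le\<close>)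
  note T = H1_gradD[OF H1_grad_test[OF \<Omega> \<theta>(1)]]
  have "L2_tendsto (lebesgue_on \<Omega>) \<theta> f"
    by (rule L2_tendsto_nearby[OF lim(1) T(1)]) (rule z, use \<theta>(2) in auto)
  moreover have "L2_tendsto (lebesgue_on \<Omega>) (\<lambda>k. pderivative i (\<theta> k)) (g i)" for i
    by (rule L2_tendsto_nearby[OF lim(2) T(2)]) (rule z, use \<theta>(3) in auto)
  ultimately show ?thesis using f \<theta>(1) by (auto simp: H10_grad_def)
qed

lemma H10_grad_of_H10:
  assumes \<Omega>: "open \<Omega>" and f: "f \<in> H10 \<Omega>" and g: "H1_grad \<Omega> f g"
  shows "H10_grad \<Omega> f g"
proof (rule H10_gradI_approx[OF \<Omega> g])
  fix \<epsilon> :: real assume "\<epsilon> > 0"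
  then have "sqrt \<epsilon> > 0" by simp
  then obtain \<theta> where \<theta>: "\<theta> \<in> test_functions \<Omega>" "H1_norm \<Omega> (\<lambda>x. f x - \<theta> x) < sqrt \<epsilon>"
    using f unfolding H10_def by blast
  have n: "H1_norm \<Omega> (\<lambda>x. f x - \<theta> x) = sqrt ((LINT x|lebesgue_on \<Omega>. (f x - \<theta> x)\<^sup>2) +
      (\<Sum>i\<in>UNIV. LINT x|lebesgue_on \<Omega>. (g i x - pderivative i \<theta> x)\<^sup>2))"
    by (rule H1_norm_eq[OF \<Omega> H1_grad_diff[OF \<Omega> g H1_grad_test[OF \<Omega> \<theta>(1)]]])
  have s: "(LINT x|lebesgue_on \<Omega>. (f x - \<theta> x)\<^sup>2) + (\<Sum>i\<in>UNIV. LINT x|lebesgue_on \<Omega>. (g i x - pderivative i \<theta> x)\<^sup>2) < \<epsilon>"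
    using \<theta>(2) unfolding n by simp
  have le: "(LINT x|lebesgue_on \<Omega>. (g i x - pderivative i \<theta> x)\<^sup>2) \<le> (\<Sum>i\<in>UNIV. LINT x|lebesgue_on \<Omega>. (g i x - pderivative i \<theta> x)\<^sup>2)" for i
    by (rule member_le_sum) auto
  have nn: "(LINT x|lebesgue_on \<Omega>. (f x - \<theta> x)\<^sup>2) \<ge> 0" by simp
  have nn': "(\<Sum>i\<in>UNIV. LINT x|lebesgue_on \<Omega>. (g i x - pderivative i \<theta> x)\<^sup>2) \<ge> 0" by (intro sum_nonneg) auto
  show "\<exists>\<theta>\<in>test_functions \<Omega>. (LINT x|lebesgue_on \<Omega>. (\<theta> x - f x)\<^sup>2) < \<epsilon> \<and>
        (\<forall>i. (LINT x|lebesgue_on \<Omega>. (pderivative i \<theta> x - g i x)\<^sup>2) < \<epsilon>)"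
  proof (intro bexI[OF _ \<theta>(1)] conjI allI)
    have "(LINT x|lebesgue_on \<Omega>. (\<theta> x - f x)\<^sup>2) = (LINT x|lebesgue_on \<Omega>. (f x - \<theta> x)\<^sup>2)"
      by (intro Bochner_Integration.integral_cong refl power2_commute)
    then show "(LINT x|lebesgue_on \<Omega>. (\<theta> x - f x)\<^sup>2) < \<epsilon>" using s nn' by linarith
    have e2: "(LINT x|lebesgue_on \<Omega>. (pderivative i \<theta> x - g i x)\<^sup>2) = (LINT x|lebesgue_on \<Omega>. (g i x - pderivative i \<theta> x)\<^sup>2)" for i
      by (intro Bochner_Integration.integral_cong refl power2_commute)
    show "(LINT x|lebesgue_on \<Omega>. (pderivative i \<theta> x - g i x)\<^sup>2) < \<epsilon>" for i
      unfolding e2 using s nn le[of i] by linarith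
  qed
qed

lemma H10_of_H10_grad:
  assumes \<Omega>: "open \<Omega>" and f: "H10_grad \<Omega> f (g :: 'n \<Rightarrow> real ^ 'n \<Rightarrow> real)"
  shows "f \<in> H10 \<Omega>"
proof -
  have g: "H1_grad \<Omega> f g" using f by (simp add: H10_grad_def)
  have "\<exists>\<phi>\<in>test_functions \<Omega>. H1_norm \<Omega> (\<lambda>x. f x - \<phi> x) < \<epsilon>" if e: "\<epsilon> > 0" for \<epsilon>
  proof -
    define c where "c = 1 + real CARD('n)"
    have c: "c > 0" by (simp add: c_def add_pos_nonneg)
    obtain \<theta> where \<theta>: "\<theta> \<in> test_functions \<Omega>" "(LINT x|lebesgue_on \<Omega>. (\<theta> x - f x)\<^sup>2) < \<epsilon>\<^sup>2 / c"
      "\<And>i. (LINT x|lebesgue_on \<Omega>. (pderivative i \<theta> x - g i x)\<^sup>2) < \<epsilon>\<^sup>2 / c"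
      using H10_grad_approx[OF f, of "\<epsilon>\<^sup>2 / c"] e c by auto
    have "H1_norm \<Omega> (\<lambda>x. f x - \<theta> x) = sqrt ((LINT x|lebesgue_on \<Omega>. (f x - \<theta> x)\<^sup>2) +
        (\<Sum>i\<in>UNIV. LINT x|lebesgue_on \<Omega>. (g i x - pderivative i \<theta> x)\<^sup>2))"
      by (rule H1_norm_eq[OF \<Omega> H1_grad_diff[OF \<Omega> g H1_grad_test[OF \<Omega> \<theta>(1)]]])
    also have "\<dots> < sqrt (\<epsilon>\<^sup>2 / c + (\<Sum>i\<in>(UNIV::'n set). \<epsilon>\<^sup>2 / c))"
      using \<theta>(2,3) by (intro real_sqrt_less_mono add_less_le_mono sum_mono) (auto simp: power2_commute less_imp_le)
    also have "\<epsilon>\<^sup>2 / c + (\<Sum>i\<in>(UNIV::'n set). \<epsilon>\<^sup>2 / c) = c * (\<epsilon>\<^sup>2 / c)"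
      by (simp only: c_def distrib_right mult_1 sum_constant)
    also have "\<dots> = \<epsilon>\<^sup>2" using c by simp
    finally show ?thesis using \<theta>(1) e by auto
  qed
  then show ?thesis using H1_grad_imp_H1[OF g] by (simp add: H10_def)
qed

lemma test_functions_add:
  assumes "\<phi> \<in> test_functions \<Omega>" "\<psi> \<in> test_functions \<Omega>"
  shows "(\<lambda>x. \<phi> x + \<psi> x) \<in> test_functions \<Omega>" "pderivative i (\<lambda>x. \<phi> x + \<psi> x) x = pderivative i \<phi> x + pderivative i \<psi> x"
proof -
  obtain K where K: "compact K" "K \<subseteq> \<Omega>" "\<forall>x. x \<notin> K \<longrightarrow> \<phi> x = 0" using test_functionsE[OF assms(1)] by metis
  obtain L where L: "compact L" "L \<subseteq> \<Omega>" "\<forall>x. x \<notin> L \<longrightarrow> \<psi> x = 0" using test_functionsE[OF assms(2)] by metis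
  show "(\<lambda>x. \<phi> x + \<psi> x) \<in> test_functions \<Omega>"
    using K L by (intro test_functionsI[of _ "K \<union> L"] Ck_add test_functions_Ck[OF assms(1)] test_functions_Ck[OF assms(2)]) auto
  show "pderivative i (\<lambda>x. \<phi> x + \<psi> x) x = pderivative i \<phi> x + pderivative i \<psi> x"
    using pderivative_eq[OF has_derivative_add[OF Ck_Suc_has_derivative[OF test_functions_Ck[OF assms(1)]]
          Ck_Suc_has_derivative[OF test_functions_Ck[OF assms(2)]]]] by (simp add: pderivative_def)
qed

lemma test_functions_cmult:
  assumes "\<phi> \<in> test_functions \<Omega>"
  shows "(\<lambda>x. c * \<phi> x) \<in> test_functions \<Omega>" "pderivative i (\<lambda>x. c * \<phi> x) x = c * pderivative i \<phi> x"
proof -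
  obtain K where K: "compact K" "K \<subseteq> \<Omega>" "\<forall>x. x \<notin> K \<longrightarrow> \<phi> x = 0" using test_functionsE[OF assms(1)] by metis
  show "(\<lambda>x. c * \<phi> x) \<in> test_functions \<Omega>"
    using K by (intro test_functionsI[of _ K] Ck_mult Ck_const test_functions_Ck[OF assms(1)]) auto
  show "pderivative i (\<lambda>x. c * \<phi> x) x = c * pderivative i \<phi> x"
    using pderivative_eq[OF has_derivative_mult_right[OF Ck_Suc_has_derivative[OF test_functions_Ck[OF assms]]]]
    by (simp add: pderivative_def)
qed

lemma L2_tendsto_cmult: "L2_tendsto M F f \<Longrightarrow> L2_tendsto M (\<lambda>n x. c * F n x) (\<lambda>x. c * f x)"
  by (rule L2_tendsto_mult_bounded[where B = "\<bar>c\<bar>"]) auto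

lemma H10_grad_add:
  assumes \<Omega>: "open \<Omega>" and "H10_grad \<Omega> f f'" "H10_grad \<Omega> g g'"
  shows "H10_grad \<Omega> (\<lambda>x. f x + g x) (\<lambda>i x. f' i x + g' i x)"
proof -
  obtain \<theta> where \<theta>: "\<And>k. \<theta> k \<in> test_functions \<Omega>" "L2_tendsto (lebesgue_on \<Omega>) \<theta> f"
    "\<And>i. L2_tendsto (lebesgue_on \<Omega>) (\<lambda>k. pderivative i (\<theta> k)) (f' i)" using assms(2) by (auto simp: H10_grad_def)
  obtain \<eta> where \<eta>: "\<And>k. \<eta> k \<in> test_functions \<Omega>" "L2_tendsto (lebesgue_on \<Omega>) \<eta> g"
    "\<And>i. L2_tendsto (lebesgue_on \<Omega>) (\<lambda>k. pderivative i (\<eta> k)) (g' i)" using assms(3) by (auto simp: H10_grad_def)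
  have p: "pderivative i (\<lambda>x. \<theta> k x + \<eta> k x) = (\<lambda>x. pderivative i (\<theta> k) x + pderivative i (\<eta> k) x)" for i k
    using test_functions_add(2)[OF \<theta>(1) \<eta>(1)] by blast
  show ?thesis unfolding H10_grad_def
    using assms test_functions_add(1)[OF \<theta>(1) \<eta>(1)] L2_tendsto_add[OF \<theta>(2) \<eta>(2)] L2_tendsto_add[OF \<theta>(3) \<eta>(3)]
    by (intro conjI H1_grad_add exI[of _ "\<lambda>k x. \<theta> k x + \<eta> k x"]) (auto simp: H10_grad_def p)
qed

lemma H10_grad_cmult:
  assumes "H10_grad \<Omega> f f'"
  shows "H10_grad \<Omega> (\<lambda>x. c * f x) (\<lambda>i x. c * f' i x)"
proof -
  obtain \<theta> where \<theta>: "\<And>k. \<theta> k \<in> test_functions \<Omega>" "L2_tendsto (lebesgue_on \<Omega>) \<theta> f"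
    "\<And>i. L2_tendsto (lebesgue_on \<Omega>) (\<lambda>k. pderivative i (\<theta> k)) (f' i)" using assms by (auto simp: H10_grad_def)
  have p: "pderivative i (\<lambda>x. c * \<theta> k x) = (\<lambda>x. c * pderivative i (\<theta> k) x)" for i k
    using test_functions_cmult(2)[OF \<theta>(1)] by blast
  show ?thesis unfolding H10_grad_def
    using assms test_functions_cmult(1)[OF \<theta>(1)] L2_tendsto_cmult[OF \<theta>(2)] L2_tendsto_cmult[OF \<theta>(3)]
    by (intro conjI H1_grad_cmult exI[of _ "\<lambda>k x. c * \<theta> k x"]) (auto simp: H10_grad_def p)
qed

text \<open>
  Mollifications of a function supported in a compact subset of \<open>\<Omega>\<close> are test functions, and their
  derivatives are the mollifications of the weak derivative.
\<close>

lemma H10_grad_compact_support: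
  assumes \<Omega>: "open \<Omega>" and f: "H1_grad \<Omega> f g" and K: "compact K" "K \<subseteq> \<Omega>" "\<And>x. x \<in> \<Omega> \<Longrightarrow> x \<notin> K \<Longrightarrow> f x = 0"
  shows "H10_grad \<Omega> f g"
proof -
  obtain e where e: "e > 0" "fatten K e \<subseteq> \<Omega>" using fatten_in_open[OF K(1) \<Omega> K(2)] by blast
  define K' where "K' = fatten K e"
  have K': "compact K'" "K' \<subseteq> \<Omega>" using e compact_fatten[OF K(1)] by (auto simp: K'_def)
  have KK': "K \<subseteq> K'" using e(1) by (auto simp: K'_def fatten_def)
  have [measurable]: "K \<in> sets lebesgue" by (rule compact_sets_lebesgue[OF K(1)])
  note F = H1_gradD[OF f]
  define f1 where "f1 = (\<lambda>x. indicat_real K' x * f x)"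
  define g1 where "g1 i = (\<lambda>x. indicat_real K' x * g i x)" for i
  have sq: "square_integrable lebesgue f1" "square_integrable lebesgue (g1 i)" for i
    unfolding f1_def g1_def by (intro square_integrable_restrict[OF \<Omega> _ K'] F)+
  have fi: "integrable lebesgue f1" "integrable lebesgue (g1 i)" for i
    using F(3)[of i] K' by (auto simp: f1_def g1_def has_weak_deriv_iff locally_integrable_def)
  have f1K: "\<forall>y. y \<notin> K \<longrightarrow> f1 y = 0" using K(3) K'(2) by (auto simp: f1_def indicator_def)
  have z: "AE x in lebesgue. x \<in> \<Omega> \<longrightarrow> f x = 0 \<longrightarrow> g i x = 0" for i
    using weak_deriv_zero_set[OF \<Omega> f, of i] unfolding AE_lebesgue_on[OF \<Omega>] .
  have g1K: "AE x in lebesgue. g1 i x = indicat_real K x * g i x" for i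
    using z[of i] by eventually_elim (use K(3) K'(2) KK' in \<open>auto simp: g1_def indicator_def\<close>)
  \<comment> \<open>With radii at most \<open>e / 2\<close> every point falls into one of two cases: within \<open>e / 2\<close> of \<open>K\<close> the
    ball of averaging lies in \<open>K'\<close>, and elsewhere it misses \<open>K\<close>.\<close>
  define \<epsilon> where "\<epsilon> = shrinking (e / 2)"
  have \<epsilon>: "\<epsilon> n > 0" "\<epsilon> n \<le> e / 2" for n using shrinking(1,2)[of "e / 2"] e(1) by (auto simp: \<epsilon>_def)
  define \<theta> where "\<theta> n = convolve f1 (mollifier (\<epsilon> n))" for n
  have "fatten K (e / 2) \<subseteq> fatten K e" unfolding fatten_def using e(1) by (intro UN_mono subset_cball) auto
  then have sub: "fatten K (e / 2) \<subseteq> \<Omega>" using e(2) by blast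
  have test: "\<theta> n \<in> test_functions \<Omega>" for n
    unfolding \<theta>_def by (rule convolve_test_function[OF fi(1) f1K K(1) sub \<epsilon>])
  have d: "pderivative i (\<theta> n) x = convolve (g1 i) (mollifier (\<epsilon> n)) x" for i n x
  proof (cases "x \<in> fatten K (e / 2)")
    case True
    then obtain y where y: "y \<in> K" "dist y x \<le> e / 2" by (auto simp: fatten_def)
    have "cball x (\<epsilon> n) \<subseteq> K'"
    proof
      fix z assume "z \<in> cball x (\<epsilon> n)"
      then have "dist y z \<le> e" using y(2) \<epsilon>(2)[of n] dist_triangle[of y z x] by auto
      then show "z \<in> K'" using y(1) by (auto simp: K'_def fatten_def)
    qed
    then show ?thesis unfolding \<theta>_def f1_def g1_def
      by (rule pderivative_mollification[OF \<Omega> F(3) K' \<epsilon>(1)])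
  next
    case False
    have "\<And>x. x \<notin> fatten K (e / 2) \<Longrightarrow> \<theta> n x = 0"
      unfolding \<theta>_def by (rule convolve_fatten[OF \<epsilon> f1K])
    then have "pderivative i (\<theta> n) x = 0"
      using pderivative_zero_outside[OF compact_imp_closed[OF compact_fatten[OF K(1)]] _ False] by blast
    moreover have "convolve (g1 i) (mollifier (\<epsilon> n)) x = convolve (\<lambda>x. indicat_real K x * g i x) (mollifier (\<epsilon> n)) x"
    proof (rule convolve_cong_AE[OF _ _ g1K Ck_continuous[OF Ck_mollifier]])
      show "g1 i \<in> borel_measurable lebesgue" using fi(2) by simp
      have "integrable lebesgue (\<lambda>x. indicat_real K x * g i x)"
        using F(3)[of i] K(1,2) by (simp add: has_weak_deriv_iff locally_integrable_def)
      then show "(\<lambda>x. indicat_real K x * g i x) \<in> borel_measurable lebesgue" by simp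
    qed
    moreover have "convolve (\<lambda>x. indicat_real K x * g i x) (mollifier (\<epsilon> n)) x = 0"
      by (rule convolve_fatten[OF \<epsilon> _ False]) auto
    ultimately show ?thesis by simp
  qed
  have e2: "e / 2 > 0" using e(1) by simp
  have "L2_tendsto (lebesgue_on \<Omega>) \<theta> f1"
    unfolding \<theta>_def f1_def \<epsilon>_def
    by (intro L2_tendsto_lebesgue_on[OF \<Omega>] L2_tendsto_restricted_mollification[OF K'(1) _ e2] sq(1)[unfolded f1_def])
  moreover have "f1 x = f x" if "x \<in> \<Omega>" for x using that K(3)[OF that] KK' by (auto simp: f1_def indicator_def)
  then have "AE x in lebesgue_on \<Omega>. f1 x = f x" unfolding AE_lebesgue_on[OF \<Omega>] by simp
  ultimately have L: "L2_tendsto (lebesgue_on \<Omega>) \<theta> f" by (rule L2_tendsto_cong_AE[OF _ _ F(4)])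
  have "pderivative i (\<theta> n) = convolve (g1 i) (mollifier (\<epsilon> n))" for i n using d by blast
  then have "L2_tendsto (lebesgue_on \<Omega>) (\<lambda>n. pderivative i (\<theta> n)) (g1 i)" for i
    unfolding g1_def \<epsilon>_def using L2_tendsto_restricted_mollification[OF K'(1) sq(2)[unfolded g1_def] e2]
    by (auto intro: L2_tendsto_lebesgue_on[OF \<Omega>])
  moreover have "AE x in lebesgue_on \<Omega>. g1 i x = g i x" for i
    unfolding AE_lebesgue_on[OF \<Omega>] using z[of i]
    by eventually_elim (use K(3) KK' in \<open>auto simp: g1_def indicator_def\<close>)
  ultimately have "L2_tendsto (lebesgue_on \<Omega>) (\<lambda>n. pderivative i (\<theta> n)) (g i)" for i
    by (intro L2_tendsto_cong_AE[OF _ _ F(5)])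
  then show ?thesis using f test L by (auto simp: H10_grad_def)
qed

text \<open>
  The product of \<open>m\<close> with a test function need not be smooth, but it is compactly supported in \<open>\<Omega>\<close>;
  the general case is a limit of such products.
\<close>

lemma H10_grad_mult_W1inf:
  assumes \<Omega>: "open \<Omega>" and f: "H10_grad \<Omega> f g" and m: "W1inf_grad \<Omega> B m d"
  shows "H10_grad \<Omega> (\<lambda>x. m x * f x) (\<lambda>i x. m x * g i x + d i x * f x)"
proof -
  obtain \<theta> where \<theta>: "\<And>k. \<theta> k \<in> test_functions \<Omega>" "L2_tendsto (lebesgue_on \<Omega>) \<theta> f"
    "\<And>i. L2_tendsto (lebesgue_on \<Omega>) (\<lambda>k. pderivative i (\<theta> k)) (g i)" using f by (auto simp: H10_grad_def)
  show ?thesis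
  proof (rule H10_grad_limit[OF \<Omega>, where F = "\<lambda>k x. m x * \<theta> k x"
        and G = "\<lambda>k i x. m x * pderivative i (\<theta> k) x + d i x * \<theta> k x"])
    fix k
    obtain K where K: "compact K" "K \<subseteq> \<Omega>" "\<forall>x. x \<notin> K \<longrightarrow> \<theta> k x = 0" using test_functionsE[OF \<theta>(1)] by metis
    show "H10_grad \<Omega> (\<lambda>x. m x * \<theta> k x) (\<lambda>i x. m x * pderivative i (\<theta> k) x + d i x * \<theta> k x)"
      by (rule H10_grad_compact_support[OF \<Omega> H1_grad_mult_W1inf[OF \<Omega> m H1_grad_test[OF \<Omega> \<theta>(1)]] K(1,2)]) (use K(3) in simp)
  next
    show "H1_grad \<Omega> (\<lambda>x. m x * f x) (\<lambda>i x. m x * g i x + d i x * f x)"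
      using f by (intro H1_grad_mult_W1inf[OF \<Omega> m]) (simp add: H10_grad_def)
  qed (intro L2_tendsto_add L2_tendsto_mult_bounded[of _ _ _ _ B] \<theta> W1inf_gradD[OF m])+
qed

text \<open>
  The function \<open>f - clip \<epsilon> f\<close> vanishes where \<open>|f| < \<epsilon>\<close>, hence near the boundary, and it tends to \<open>f\<close>
  as \<open>\<epsilon>\<close> tends to zero.
\<close>

lemma H10_grad_zero_boundary:
  assumes \<Omega>: "open \<Omega>" "bounded \<Omega>" and f: "H1_grad \<Omega> f g"
    and c: "continuous_on (closure \<Omega>) f" "\<And>x. x \<in> frontier \<Omega> \<Longrightarrow> f x = 0"
  shows "H10_grad \<Omega> f g"
proof -
  note F = H1_gradD[OF f]
  note [measurable] = F(4,5)
  define s where "s = shrinking 1"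
  have s: "s n > 0" "s \<longlonglongrightarrow> 0" for n using shrinking(1)[of 1 n] shrinking(3)[of 1] by (auto simp: s_def)
  define T where "T n x = f x - clip (s n) (f x)" for n x
  define G where "G n i x = g i x - (if \<bar>f x\<bar> < s n then g i x else 0)" for n i x
  have TG: "H1_grad \<Omega> (T n) (G n)" for n
    unfolding T_def G_def by (intro H1_grad_diff H1_grad_clip \<Omega> f s)
  have m: "T n \<in> borel_measurable (lebesgue_on \<Omega>)" "G n i \<in> borel_measurable (lebesgue_on \<Omega>)" for n i
    using H1_gradD[OF TG] by auto
  show ?thesis
  proof (rule H10_grad_limit[OF \<Omega>(1) _ f])
    fix n
    let ?K = "{x \<in> closure \<Omega>. s n \<le> \<bar>f x\<bar>}"
    have "closed ?K"
      using c(1) by (intro continuous_on_closed_Collect_le continuous_intros) auto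
    moreover have "bounded ?K" using bounded_closure[OF \<Omega>(2)] by (rule bounded_subset) auto
    ultimately have K: "compact ?K" by (simp add: compact_eq_bounded_closed)
    have K\<Omega>: "?K \<subseteq> \<Omega>"
    proof
      fix x assume x: "x \<in> ?K"
      show "x \<in> \<Omega>"
      proof (rule ccontr)
        assume "x \<notin> \<Omega>"
        then have "x \<in> frontier \<Omega>" using x \<Omega>(1) by (simp add: frontier_def interior_open)
        then show False using c(2)[of x] x s(1)[of n] by simp
      qed
    qed
    show "H10_grad \<Omega> (T n) (G n)"
    proof (rule H10_grad_compact_support[OF \<Omega>(1) TG K K\<Omega>])
      fix x assume "x \<in> \<Omega>" "x \<notin> ?K"
      then have "\<bar>f x\<bar> < s n" using closure_subset by force
      then show "T n x = 0" by (simp add: T_def clip_props(3))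
    qed
  next
    show "L2_tendsto (lebesgue_on \<Omega>) T f"
    proof (rule L2_tendsto_dominated[OF m(1) F(4) square_integrable_cmult[OF square_integrable_abs[OF F(1)], of 2]])
      show "AE x in lebesgue_on \<Omega>. \<bar>T n x\<bar> \<le> 2 * \<bar>f x\<bar>" for n
      proof (intro AE_I2)
        fix x
        have "\<bar>clip (s n) (f x)\<bar> \<le> \<bar>f x\<bar>" using s(1)[of n] by (intro clip_props) simp
        then show "\<bar>T n x\<bar> \<le> 2 * \<bar>f x\<bar>" unfolding T_def by linarith
      qed
      have "(\<lambda>n. T n x) \<longlonglongrightarrow> f x - 0" for x
        unfolding T_def
      proof (intro tendsto_diff tendsto_const)
        show "(\<lambda>n. clip (s n) (f x)) \<longlonglongrightarrow> 0"
          by (rule Lim_null_comparison[OF _ s(2)]) (use s(1) clip_props(1) in \<open>auto intro!: always_eventually simp: less_imp_le\<close>)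
      qed
      then show "AE x in lebesgue_on \<Omega>. (\<lambda>n. T n x) \<longlonglongrightarrow> f x" by simp
    qed
    fix i
    show "L2_tendsto (lebesgue_on \<Omega>) (\<lambda>n. G n i) (g i)"
    proof (rule L2_tendsto_dominated[OF m(2) F(5) square_integrable_abs[OF F(2)]])
      show "AE x in lebesgue_on \<Omega>. \<bar>G n i x\<bar> \<le> \<bar>g i x\<bar>" for n by (simp add: G_def)
      show "AE x in lebesgue_on \<Omega>. (\<lambda>n. G n i x) \<longlonglongrightarrow> g i x"
        using weak_deriv_zero_set[OF \<Omega>(1) f, of i]
      proof eventually_elim
        case (elim x)
        show ?case
        proof (cases "f x = 0")
          case True
          then show ?thesis using elim s(1) by (simp add: G_def)
        next
          case False
          have "\<forall>\<^sub>F n in sequentially. s n < \<bar>f x\<bar>" using s(2) False by (intro order_tendstoD) auto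
          then have "\<forall>\<^sub>F n in sequentially. G n i x = g i x" by eventually_elim (simp add: G_def)
          then show ?thesis by (rule tendsto_eventually)
        qed
      qed
    qed
  qed
qed

section \<open>Testing the equation\<close>

text \<open>Gradients are families of functions above and vectors in the pointwise inequalities below.\<close>

definition vec_of :: "('n \<Rightarrow> 'a \<Rightarrow> real) \<Rightarrow> 'a \<Rightarrow> real ^ 'n" where
  "vec_of U x = (\<chi> i. U i x)"

lemma flux_component: "(a x *v vec_of U x) $ i = (\<Sum>j\<in>UNIV. a x $ i $ j * U j x)"
  by (simp add: matrix_vector_mult_def vec_of_def)

lemma flux_inner: "(a x *v vec_of U x) \<bullet> vec_of V x = (\<Sum>i\<in>UNIV. (a x *v vec_of U x) $ i * V i x)"
  by (simp add: inner_vec_def vec_of_def)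

definition bounded_coeff :: "(real ^ 'n) set \<Rightarrow> real \<Rightarrow> (real ^ 'n \<Rightarrow> real ^ 'n ^ 'n) \<Rightarrow> bool" where
  "bounded_coeff \<Omega> A a \<longleftrightarrow> (\<forall>i j. (\<lambda>x. a x $ i $ j) \<in> borel_measurable (lebesgue_on \<Omega>) \<and>
     (AE x in lebesgue_on \<Omega>. \<bar>a x $ i $ j\<bar> \<le> A))"

lemma square_integrable_flux:
  assumes "bounded_coeff \<Omega> A a" "\<And>i. square_integrable (lebesgue_on \<Omega>) (U i)"
  shows "square_integrable (lebesgue_on \<Omega>) (\<lambda>x. (a x *v vec_of U x) $ i)"
  unfolding flux_component
  by (intro square_integrable_sum square_integrable_mult_bounded[of _ _ _ A])
    (use assms in \<open>auto simp: bounded_coeff_def\<close>)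

lemma integral_flux_inner:
  assumes "bounded_coeff \<Omega> A a" "\<And>i. square_integrable (lebesgue_on \<Omega>) (U i)" "\<And>i. square_integrable (lebesgue_on \<Omega>) (V i)"
  shows "integrable (lebesgue_on \<Omega>) (\<lambda>x. (a x *v vec_of U x) \<bullet> vec_of V x)"
    and "(LINT x|lebesgue_on \<Omega>. (a x *v vec_of U x) \<bullet> vec_of V x) = (\<Sum>i\<in>UNIV. LINT x|lebesgue_on \<Omega>. (a x *v vec_of U x) $ i * V i x)"
proof -
  have i: "integrable (lebesgue_on \<Omega>) (\<lambda>x. (a x *v vec_of U x) $ i * V i x)" for i
    by (intro integrable_mult_square_integrable square_integrable_flux[OF assms(1)] assms)
  then show "integrable (lebesgue_on \<Omega>) (\<lambda>x. (a x *v vec_of U x) \<bullet> vec_of V x)"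
    and "(LINT x|lebesgue_on \<Omega>. (a x *v vec_of U x) \<bullet> vec_of V x) = (\<Sum>i\<in>UNIV. LINT x|lebesgue_on \<Omega>. (a x *v vec_of U x) $ i * V i x)"
    unfolding flux_inner by (auto intro: Bochner_Integration.integral_sum)
qed

lemma Lq_eq_iff:
  fixes a :: "real ^ 'n \<Rightarrow> real ^ 'n ^ 'n"
  assumes \<Omega>: "open \<Omega>" and a: "bounded_coeff \<Omega> A a"
    and q: "q \<in> borel_measurable (lebesgue_on \<Omega>)" "AE x in lebesgue_on \<Omega>. \<bar>q x\<bar> \<le> Mq"
    and u: "H1_grad \<Omega> u U" and f: "square_integrable (lebesgue_on \<Omega>) f"
  shows "Lq_eq \<Omega> a q u f \<longleftrightarrow> (\<forall>\<phi>\<in>test_functions \<Omega>.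
     (\<Sum>i\<in>UNIV. LINT x|lebesgue_on \<Omega>. pderivative i \<phi> x * (a x *v vec_of U x) $ i)
      = (LINT x|lebesgue_on \<Omega>. \<phi> x * (q x * u x)) - (LINT x|lebesgue_on \<Omega>. \<phi> x * f x))"
proof -
  let ?A = "\<lambda>i x. (a x *v vec_of U x) $ i"
  let ?W = "\<lambda>j. weak_deriv \<Omega> j u"
  note U = H1_gradD[OF u]
  have A: "square_integrable (lebesgue_on \<Omega>) (?A i)" for i by (rule square_integrable_flux[OF a U(2)])
  have qu: "square_integrable (lebesgue_on \<Omega>) (\<lambda>x. q x * u x)" by (rule square_integrable_mult_bounded[OF U(1) q])
  have "AE x in lebesgue_on \<Omega>. \<forall>j. ?W j x = U j x"
    using H1_grad_weak_deriv_AE(1)[OF \<Omega> u] by (simp add: AE_all_countable)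
  then have W: "AE x in lebesgue_on \<Omega>. vec_of ?W x = vec_of U x"
    by eventually_elim (simp add: vec_of_def)
  have WA: "square_integrable (lebesgue_on \<Omega>) (\<lambda>x. (a x *v vec_of ?W x) $ i)" for i
    by (rule square_integrable_flux[OF a H1_gradD(2)[OF H1_grad_of_H1[OF \<Omega> H1_grad_imp_H1[OF u]]]])
  have X: "(LINT x|lebesgue_on \<Omega>. - (\<Sum>i\<in>UNIV. \<Sum>j\<in>UNIV. a x $ i $ j * ?W j x * pderivative i \<phi> x) + q x * u x * \<phi> x)
      = (LINT x|lebesgue_on \<Omega>. \<phi> x * (q x * u x)) - (\<Sum>i\<in>UNIV. LINT x|lebesgue_on \<Omega>. pderivative i \<phi> x * ?A i x)"
    if \<phi>: "\<phi> \<in> test_functions \<Omega>" for \<phi>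
  proof -
    note T = H1_gradD[OF H1_grad_test[OF \<Omega> \<phi>]]
    note i = integrable_mult_square_integrable[OF T(2) A] integrable_mult_square_integrable[OF T(1) qu]
    have pw: "- (\<Sum>i\<in>UNIV. \<Sum>j\<in>UNIV. a x $ i $ j * ?W j x * pderivative i \<phi> x) + q x * u x * \<phi> x
       = \<phi> x * (q x * u x) - (\<Sum>i\<in>UNIV. pderivative i \<phi> x * (a x *v vec_of ?W x) $ i)" for x
      by (simp add: flux_component sum_distrib_left mult_ac)
    have "(LINT x|lebesgue_on \<Omega>. \<phi> x * (q x * u x) - (\<Sum>i\<in>UNIV. pderivative i \<phi> x * (a x *v vec_of ?W x) $ i))
        = (LINT x|lebesgue_on \<Omega>. \<phi> x * (q x * u x) - (\<Sum>i\<in>UNIV. pderivative i \<phi> x * ?A i x))"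
    proof (rule integral_cong_AE)
      show "AE x in lebesgue_on \<Omega>. \<phi> x * (q x * u x) - (\<Sum>i\<in>UNIV. pderivative i \<phi> x * (a x *v vec_of ?W x) $ i)
          = \<phi> x * (q x * u x) - (\<Sum>i\<in>UNIV. pderivative i \<phi> x * ?A i x)"
        using W by eventually_elim simp
    qed (intro borel_measurable_diff borel_measurable_sum borel_measurable_times T(4,5)
        square_integrable_measurable[OF A] square_integrable_measurable[OF WA] U(4) q(1))+
    then show ?thesis
      unfolding pw using i by (simp add: Bochner_Integration.integral_sum Bochner_Integration.integrable_sum)
  qed
  have Y: "(LINT x|lebesgue_on \<Omega>. f x * \<phi> x) = (LINT x|lebesgue_on \<Omega>. \<phi> x * f x)" for \<phi>
    by (simp only: mult.commute)
  have "Lq_eq \<Omega> a q u f \<longleftrightarrow> (\<forall>\<phi>\<in>test_functions \<Omega>. (LINT x|lebesgue_on \<Omega>. \<phi> x * (q x * u x))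
      - (\<Sum>i\<in>UNIV. LINT x|lebesgue_on \<Omega>. pderivative i \<phi> x * ?A i x) = (LINT x|lebesgue_on \<Omega>. \<phi> x * f x))"
    unfolding Lq_eq_def Y by (intro ball_cong refl) (simp only: X)
  also have "\<dots> \<longleftrightarrow> (\<forall>\<phi>\<in>test_functions \<Omega>. (\<Sum>i\<in>UNIV. LINT x|lebesgue_on \<Omega>. pderivative i \<phi> x * ?A i x)
      = (LINT x|lebesgue_on \<Omega>. \<phi> x * (q x * u x)) - (LINT x|lebesgue_on \<Omega>. \<phi> x * f x))"
    by (intro ball_cong refl) linarith
  finally show ?thesis .
qed

text \<open>All the integrals are continuous in the test function with respect to the \<open>H\<^sup>1\<close> norm.\<close>

lemma weak_form_H10:
  fixes a :: "real ^ 'n \<Rightarrow> real ^ 'n ^ 'n"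
  assumes \<Omega>: "open \<Omega>" and a: "bounded_coeff \<Omega> A a"
    and q: "q \<in> borel_measurable (lebesgue_on \<Omega>)" "AE x in lebesgue_on \<Omega>. \<bar>q x\<bar> \<le> Mq"
    and u: "H1_grad \<Omega> u U" and f: "square_integrable (lebesgue_on \<Omega>) f" and L: "Lq_eq \<Omega> a q u f"
    and v: "H10_grad \<Omega> v V"
  shows "(LINT x|lebesgue_on \<Omega>. (a x *v vec_of U x) \<bullet> vec_of V x)
    = (LINT x|lebesgue_on \<Omega>. q x * u x * v x) - (LINT x|lebesgue_on \<Omega>. f x * v x)"
proof -
  let ?A = "\<lambda>i x. (a x *v vec_of U x) $ i"
  note U = H1_gradD[OF u]
  have A: "square_integrable (lebesgue_on \<Omega>) (?A i)" for i by (rule square_integrable_flux[OF a U(2)])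
  have qu: "square_integrable (lebesgue_on \<Omega>) (\<lambda>x. q x * u x)" by (rule square_integrable_mult_bounded[OF U(1) q])
  note test = L[unfolded Lq_eq_iff[OF \<Omega> a q u f], rule_format]
  obtain \<theta> where \<theta>: "\<And>k. \<theta> k \<in> test_functions \<Omega>" "L2_tendsto (lebesgue_on \<Omega>) \<theta> v"
    "\<And>i. L2_tendsto (lebesgue_on \<Omega>) (\<lambda>k. pderivative i (\<theta> k)) (V i)" using v by (auto simp: H10_grad_def)
  have V: "square_integrable (lebesgue_on \<Omega>) (V i)" for i using \<theta>(3)[of i] by (simp add: L2_tendsto_def)
  have "(\<lambda>k. \<Sum>i\<in>UNIV. LINT x|lebesgue_on \<Omega>. pderivative i (\<theta> k) x * ?A i x) \<longlonglongrightarrow> (\<Sum>i\<in>UNIV. LINT x|lebesgue_on \<Omega>. V i x * ?A i x)"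
    by (intro tendsto_sum L2_tendsto_integral_mult \<theta> A)
  moreover have "(\<lambda>k. (LINT x|lebesgue_on \<Omega>. \<theta> k x * (q x * u x)) - (LINT x|lebesgue_on \<Omega>. \<theta> k x * f x))
      \<longlonglongrightarrow> (LINT x|lebesgue_on \<Omega>. v x * (q x * u x)) - (LINT x|lebesgue_on \<Omega>. v x * f x)"
    by (intro tendsto_diff L2_tendsto_integral_mult \<theta> qu f)
  ultimately have "(\<Sum>i\<in>UNIV. LINT x|lebesgue_on \<Omega>. V i x * ?A i x) = (LINT x|lebesgue_on \<Omega>. v x * (q x * u x)) - (LINT x|lebesgue_on \<Omega>. v x * f x)"
    unfolding test[OF \<theta>(1)] by (rule LIMSEQ_unique)
  then show ?thesis
    unfolding integral_flux_inner(2)[OF a U(2) V] by (simp add: mult.commute)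
qed

lemma dominated_mult:
  fixes h s :: "'a \<Rightarrow> real"
  assumes "integrable M w" "h \<in> borel_measurable M" "\<And>k. S k \<in> borel_measurable M" "s \<in> borel_measurable M"
    and "\<And>k. AE x in M. \<bar>S k x * h x\<bar> \<le> w x" "AE x in M. (\<lambda>k. S k x) \<longlonglongrightarrow> s x"
  shows "(\<lambda>k. LINT x|M. S k x * h x) \<longlonglongrightarrow> (LINT x|M. s x * h x)"
proof (rule integral_dominated_convergence[OF _ _ assms(1)])
  show "AE x in M. (\<lambda>k. S k x * h x) \<longlonglongrightarrow> s x * h x"
    using assms(6) by eventually_elim (intro tendsto_mult tendsto_const)
qed (use assms in auto)

lemma limit_of_sums:
  fixes F :: "nat \<Rightarrow> real" and G :: "'n::finite \<Rightarrow> nat \<Rightarrow> real"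
  assumes "F \<longlonglongrightarrow> f" "\<And>i. G i \<longlonglongrightarrow> g i" "H \<longlonglongrightarrow> h" "\<And>n. F n + (\<Sum>i\<in>UNIV. G i n) = H n"
  shows "f + (\<Sum>i\<in>UNIV. g i) = h"
proof -
  have "(\<lambda>n. F n + (\<Sum>i\<in>UNIV. G i n)) \<longlonglongrightarrow> f + (\<Sum>i\<in>UNIV. g i)"
    by (intro tendsto_add tendsto_sum assms)
  then show ?thesis unfolding assms(4) by (rule LIMSEQ_unique[OF _ assms(3)])
qed

lemma clip_tendsto_Suc: "(\<lambda>n. clip (real (Suc n)) t) \<longlonglongrightarrow> t"
  using LIMSEQ_Suc[OF clip_tendsto[of t]] by simp

lemma truncation_indicator_tendsto: "(\<lambda>n. if \<bar>t\<bar> < real (Suc n) then 1 else 0 :: real) \<longlonglongrightarrow> 1"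
proof (rule tendsto_eventually)
  obtain n0 where "\<bar>t\<bar> < real n0" using reals_Archimedean2 by blast
  then show "\<forall>\<^sub>F n in sequentially. (if \<bar>t\<bar> < real (Suc n) then 1 else 0 :: real) = 1"
    by (intro eventually_sequentiallyI[of n0]) auto
qed

text \<open>
  This is the weak form with \<open>v = u \<phi>\<close>. That this product lies in \<open>H\<^sub>0\<^sup>1\<close> is circumvented: both \<open>u\<close> and
  the test functions that approximate \<open>\<phi>\<close> are truncated, so that every product is bounded and has
  compact support, and the truncations are removed by dominated convergence.
\<close>

lemma energy_identity:
  fixes a :: "real ^ 'n \<Rightarrow> real ^ 'n ^ 'n"
  assumes \<Omega>: "open \<Omega>" "bounded \<Omega>" and a: "bounded_coeff \<Omega> A a"
    and q: "q \<in> borel_measurable (lebesgue_on \<Omega>)" "AE x in lebesgue_on \<Omega>. \<bar>q x\<bar> \<le> Mq"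
    and u: "H1_grad \<Omega> u U"
    and eq: "\<And>v V. H10_grad \<Omega> v V \<Longrightarrow>
       (LINT x|lebesgue_on \<Omega>. (a x *v vec_of U x) \<bullet> vec_of V x) = (LINT x|lebesgue_on \<Omega>. q x * u x * v x)"
    and \<phi>: "W1inf_grad \<Omega> B \<phi> \<Phi>" "H10_grad \<Omega> \<phi> \<Phi>"
  shows "integrable (lebesgue_on \<Omega>) (\<lambda>x. \<phi> x * ((a x *v vec_of U x) \<bullet> vec_of U x) + u x * ((a x *v vec_of U x) \<bullet> vec_of \<Phi> x))"
    and "integrable (lebesgue_on \<Omega>) (\<lambda>x. q x * (u x)\<^sup>2 * \<phi> x)"
    and "(LINT x|lebesgue_on \<Omega>. \<phi> x * ((a x *v vec_of U x) \<bullet> vec_of U x) + u x * ((a x *v vec_of U x) \<bullet> vec_of \<Phi> x))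
      = (LINT x|lebesgue_on \<Omega>. q x * (u x)\<^sup>2 * \<phi> x)"
proof -
  let ?M = "lebesgue_on \<Omega>"
  let ?A = "\<lambda>i x. (a x *v vec_of U x) $ i"
  let ?E = "\<lambda>x. (a x *v vec_of U x) \<bullet> vec_of U x"
  note UD = H1_gradD[OF u] and PD = W1inf_gradD[OF \<phi>(1)]
  have A: "square_integrable ?M (?A i)" for i by (rule square_integrable_flux[OF a UD(2)])
  have E: "integrable ?M ?E" by (rule integral_flux_inner(1)[OF a UD(2) UD(2)])
  have qu: "square_integrable ?M (\<lambda>x. q x * u x)" by (rule square_integrable_mult_bounded[OF UD(1) q])
  have quu: "integrable ?M (\<lambda>x. q x * u x * u x)" by (rule integrable_mult_square_integrable[OF qu UD(1)])
  have uA: "integrable ?M (\<lambda>x. u x * ?A i x)" for i by (rule integrable_mult_square_integrable[OF UD(1) A])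
  note [measurable] = UD(4,5) PD(1,3) q(1) A[THEN square_integrable_measurable] E[THEN borel_measurable_integrable]
  \<comment> \<open>A level that \<open>\<phi>\<close> stays strictly below, so that truncation at \<open>N\<close> is inactive in the limit.\<close>
  define N where "N = \<bar>B\<bar> + 1"
  have N: "N > 0" by (simp add: N_def)
  have \<phi>N: "AE x in ?M. \<bar>\<phi> x\<bar> < N" using PD(2) by eventually_elim (simp add: N_def)
  obtain \<theta>0 where \<theta>0: "\<And>k. \<theta>0 k \<in> test_functions \<Omega>" "L2_tendsto ?M \<theta>0 \<phi>"
    "\<And>i. L2_tendsto ?M (\<lambda>k. pderivative i (\<theta>0 k)) (\<Phi> i)" using \<phi>(2) by (auto simp: H10_grad_def)
  obtain r where r: "strict_mono r" "AE x in ?M. (\<lambda>k. \<theta>0 (r k) x) \<longlonglongrightarrow> \<phi> x"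
    using L2_tendsto_AE_subseq[OF \<theta>0(2)] by blast
  define \<theta> where "\<theta> k = \<theta>0 (r k)" for k
  have \<theta>: "\<And>k. \<theta> k \<in> test_functions \<Omega>" "AE x in ?M. (\<lambda>k. \<theta> k x) \<longlonglongrightarrow> \<phi> x"
    "\<And>i. L2_tendsto ?M (\<lambda>k. pderivative i (\<theta> k)) (\<Phi> i)"
    using \<theta>0(1) r(2) L2_tendsto_subseq[OF \<theta>0(3) r(1)] by (auto simp: \<theta>_def)
  note TD = H1_gradD[OF H1_grad_test[OF \<Omega>(1) \<theta>(1)]]
  define S where "S k x = clip N (\<theta> k x)" for k x
  define D where "D k i x = (if \<bar>\<theta> k x\<bar> < N then pderivative i (\<theta> k) x else 0)" for k i x
  have SG: "H1_grad \<Omega> (S k) (D k)" for k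
    unfolding S_def D_def by (rule H1_grad_clip[OF \<Omega> H1_grad_test[OF \<Omega>(1) \<theta>(1)] N])
  note SD = H1_gradD[OF SG]
  note [measurable] = SD(4,5) TD(4,5)
  have SN: "\<bar>S k x\<bar> \<le> N" for k x unfolding S_def using N by (intro clip_props) simp
  have SW: "\<exists>B. W1inf_grad \<Omega> B (S k) (D k)" for k
  proof -
    obtain C where C: "C > 0" "\<forall>x. \<bar>\<theta> k x\<bar> \<le> C" "\<forall>i x. \<bar>pderivative i (\<theta> k) x\<bar> \<le> C"
      using test_functions_bounded[OF \<theta>(1)] by metis
    have "\<bar>S k x\<bar> \<le> N + C" "\<bar>D k i x\<bar> \<le> N + C" for i x
      using SN[of k x] C(1) C(3)[rule_format, of i x] N by (auto simp: D_def)
    then show ?thesis using SD by (intro exI[of _ "N + C"]) (auto simp: W1inf_grad_def)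
  qed
  have Slim: "AE x in ?M. (\<lambda>k. S k x) \<longlonglongrightarrow> \<phi> x"
    using \<theta>(2) \<phi>N
  proof eventually_elim
    case (elim x)
    have "isCont (clip N) (\<phi> x)" using continuous_clip by (simp add: continuous_on_eq_continuous_at)
    from isCont_tendsto_compose[OF this elim(1)] show ?case
      using clip_props(3)[of "\<phi> x" N] elim(2) by (simp add: S_def)
  qed
  have Dlim: "L2_tendsto ?M (\<lambda>k. D k i) (\<Phi> i)" for i
  proof -
    let ?I = "\<lambda>k x. if \<bar>\<theta> k x\<bar> < N then 1 else 0 :: real"
    have \<Phi>: "square_integrable ?M (\<Phi> i)" using \<theta>(3)[of i] by (simp add: L2_tendsto_def)
    have "L2_tendsto ?M (\<lambda>k x. ?I k x * \<Phi> i x) (\<Phi> i)"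
    proof (rule L2_tendsto_dominated[OF _ _ square_integrable_abs[OF \<Phi>]])
      show "AE x in ?M. (\<lambda>k. ?I k x * \<Phi> i x) \<longlonglongrightarrow> \<Phi> i x"
        using \<theta>(2) \<phi>N
      proof eventually_elim
        case (elim x)
        have "\<forall>\<^sub>F k in sequentially. \<bar>\<theta> k x\<bar> < N" by (rule order_tendstoD(2)[OF tendsto_rabs[OF elim(1)] elim(2)])
        then have "\<forall>\<^sub>F k in sequentially. ?I k x * \<Phi> i x = \<Phi> i x" by eventually_elim simp
        then show ?case by (rule tendsto_eventually)
      qed
    qed auto
    then show ?thesis
    proof (rule L2_tendsto_nearby[OF _ SD(2)])
      show "(\<lambda>k. LINT x|?M. (D k i x - ?I k x * \<Phi> i x)\<^sup>2) \<longlonglongrightarrow> 0"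
      proof (rule tendsto_sandwich[OF _ _ tendsto_const])
        show "(\<lambda>k. LINT x|?M. (pderivative i (\<theta> k) x - \<Phi> i x)\<^sup>2) \<longlonglongrightarrow> 0" using \<theta>(3)[of i] by (simp add: L2_tendsto_def)
        have "(LINT x|?M. (D k i x - ?I k x * \<Phi> i x)\<^sup>2) \<le> (LINT x|?M. (pderivative i (\<theta> k) x - \<Phi> i x)\<^sup>2)" for k
        proof (rule integral_mono')
          show "integrable ?M (\<lambda>x. (pderivative i (\<theta> k) x - \<Phi> i x)\<^sup>2)"
            by (intro square_integrableD square_integrable_diff TD \<Phi>)
        qed (auto simp: D_def)
        then show "\<forall>\<^sub>F k in sequentially. (LINT x|?M. (D k i x - ?I k x * \<Phi> i x)\<^sup>2) \<le> (LINT x|?M. (pderivative i (\<theta> k) x - \<Phi> i x)\<^sup>2)"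
          by simp
      qed auto
    qed
  qed
  let ?T = "\<lambda>n x. clip (real (Suc n)) (u x)"
  let ?J = "\<lambda>n x. if \<bar>u x\<bar> < real (Suc n) then 1 else 0 :: real"
  have step: "(LINT x|?M. \<phi> x * (?J n x * ?E x)) + (\<Sum>i\<in>UNIV. LINT x|?M. \<Phi> i x * (?T n x * ?A i x)) = (LINT x|?M. \<phi> x * (?T n x * (q x * u x)))" for n
  proof -
    let ?TG = "\<lambda>i x. if \<bar>u x\<bar> < real (Suc n) then U i x else 0"
    have T: "H1_grad \<Omega> (?T n) ?TG" by (rule H1_grad_clip[OF \<Omega> u]) simp
    note [measurable] = H1_gradD(4)[OF T]
    have TA: "square_integrable ?M (\<lambda>x. ?T n x * ?A i x)" for i
      by (rule square_integrable_mult_bounded[OF A H1_gradD(4)[OF T], where B = "real (Suc n)"]) (intro AE_I2 clip_props, simp)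
    have JE: "integrable ?M (\<lambda>x. ?J n x * ?E x)"
      by (rule integrable_mult_bounded[OF E, of _ 1]) auto
    have Tqu: "integrable ?M (\<lambda>x. ?T n x * (q x * u x))"
      by (rule integrable_mult_square_integrable[OF H1_gradD(1)[OF T] qu])
    have k: "(LINT x|?M. S k x * (?J n x * ?E x)) + (\<Sum>i\<in>UNIV. LINT x|?M. D k i x * (?T n x * ?A i x)) = (LINT x|?M. S k x * (?T n x * (q x * u x)))" for k
    proof -
      obtain B' where W: "W1inf_grad \<Omega> B' (S k) (D k)" using SW by blast
      obtain K where K: "compact K" "K \<subseteq> \<Omega>" "\<forall>x. x \<notin> K \<longrightarrow> \<theta> k x = 0" using test_functionsE[OF \<theta>(1)] by metis
      let ?V = "\<lambda>i x. S k x * ?TG i x + D k i x * ?T n x"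
      have V: "H10_grad \<Omega> (\<lambda>x. S k x * ?T n x) ?V"
        by (rule H10_grad_compact_support[OF \<Omega>(1) H1_grad_mult_W1inf[OF \<Omega>(1) W T] K(1,2)])
          (use K(3) N in \<open>simp add: S_def clip_props(3)\<close>)
      have pw: "(a x *v vec_of U x) \<bullet> vec_of ?V x = S k x * (?J n x * ?E x) + (\<Sum>i\<in>UNIV. D k i x * (?T n x * ?A i x))" for x
        unfolding flux_inner by (auto simp: distrib_left sum.distrib sum_distrib_left mult_ac)
      have i1: "integrable ?M (\<lambda>x. S k x * (?J n x * ?E x))"
        by (rule integrable_mult_bounded[OF JE SD(4), of _ N]) (intro AE_I2 SN)
      have i2: "integrable ?M (\<lambda>x. D k i x * (?T n x * ?A i x))" for i
        by (rule integrable_mult_square_integrable[OF SD(2) TA])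
      have "(LINT x|?M. (a x *v vec_of U x) \<bullet> vec_of ?V x) = (LINT x|?M. S k x * (?J n x * ?E x)) + (\<Sum>i\<in>UNIV. LINT x|?M. D k i x * (?T n x * ?A i x))"
        unfolding pw using i1 i2 by (simp add: Bochner_Integration.integral_sum Bochner_Integration.integrable_sum)
      moreover have "(LINT x|?M. q x * u x * (S k x * ?T n x)) = (LINT x|?M. S k x * (?T n x * (q x * u x)))"
        by (intro Bochner_Integration.integral_cong refl) simp
      ultimately show ?thesis using eq[OF V] by simp
    qed
    have conv: "(\<lambda>k. LINT x|?M. S k x * h x) \<longlonglongrightarrow> (LINT x|?M. \<phi> x * h x)" if "integrable ?M h" for h
    proof (rule dominated_mult[OF _ _ SD(4) PD(1) _ Slim])
      show "integrable ?M (\<lambda>x. N * \<bar>h x\<bar>)" using that by simp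
      show "h \<in> borel_measurable ?M" using that by simp
      show "AE x in ?M. \<bar>S k x * h x\<bar> \<le> N * \<bar>h x\<bar>" for k
        unfolding abs_mult by (intro AE_I2 mult_right_mono SN) simp
    qed
    have "(\<lambda>k. (LINT x|?M. S k x * (?J n x * ?E x)) + (\<Sum>i\<in>UNIV. LINT x|?M. D k i x * (?T n x * ?A i x)))
        \<longlonglongrightarrow> (LINT x|?M. \<phi> x * (?J n x * ?E x)) + (\<Sum>i\<in>UNIV. LINT x|?M. \<Phi> i x * (?T n x * ?A i x))"
      by (intro tendsto_add tendsto_sum conv JE L2_tendsto_integral_mult Dlim TA)
    then show ?thesis unfolding k by (rule LIMSEQ_unique[OF _ conv[OF Tqu]])
  qed
  have b: "AE x in ?M. \<bar>\<phi> x * h x\<bar> \<le> \<bar>B\<bar> * \<bar>h x\<bar>" "AE x in ?M. \<bar>\<Phi> i x * h x\<bar> \<le> \<bar>B\<bar> * \<bar>h x\<bar>" for h :: "real ^ 'n \<Rightarrow> real" and i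
    using PD(2) PD(4)[of i] by (eventually_elim, auto simp: abs_mult intro!: mult_right_mono)+
  have Tle: "\<bar>?T n x\<bar> \<le> \<bar>u x\<bar>" for n x by (intro clip_props) simp
  have m: "(\<lambda>x. ?J n x) \<in> borel_measurable ?M" "(\<lambda>x. ?T n x) \<in> borel_measurable ?M" for n
    by measurable
  have iE: "integrable ?M (\<lambda>x. \<phi> x * ?E x)"
    by (rule Bochner_Integration.integrable_bound[of _ "\<lambda>x. \<bar>B\<bar> * \<bar>?E x\<bar>"]) (use E b(1)[of ?E] in auto)
  have iA: "integrable ?M (\<lambda>x. \<Phi> i x * (u x * ?A i x))" for i
    by (rule Bochner_Integration.integrable_bound[of _ "\<lambda>x. \<bar>B\<bar> * \<bar>u x * ?A i x\<bar>"]) (use uA[of i] b(2)[of i "\<lambda>x. u x * ?A i x"] in auto)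
  have iq: "integrable ?M (\<lambda>x. \<phi> x * (q x * u x * u x))"
    by (rule Bochner_Integration.integrable_bound[of _ "\<lambda>x. \<bar>B\<bar> * \<bar>q x * u x * u x\<bar>"]) (use quu b(1)[of "\<lambda>x. q x * u x * u x"] in auto)
  have "(\<lambda>n. LINT x|?M. ?J n x * (\<phi> x * ?E x)) \<longlonglongrightarrow> (LINT x|?M. 1 * (\<phi> x * ?E x))"
  proof (rule dominated_mult[where w = "\<lambda>x. \<bar>\<phi> x * ?E x\<bar>"])
    show "AE x in ?M. (\<lambda>n. ?J n x) \<longlonglongrightarrow> 1" by (intro AE_I2 truncation_indicator_tendsto)
  qed (use iE m(1) in auto)
  moreover have "(\<lambda>n. LINT x|?M. ?T n x * (\<Phi> i x * ?A i x)) \<longlonglongrightarrow> (LINT x|?M. u x * (\<Phi> i x * ?A i x))" for i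
  proof (rule dominated_mult[where w = "\<lambda>x. \<bar>\<Phi> i x * (u x * ?A i x)\<bar>"])
    show "AE x in ?M. \<bar>?T n x * (\<Phi> i x * ?A i x)\<bar> \<le> \<bar>\<Phi> i x * (u x * ?A i x)\<bar>" for n
    proof (intro AE_I2)
      fix x
      have "\<bar>?T n x\<bar> * \<bar>\<Phi> i x * ?A i x\<bar> \<le> \<bar>u x\<bar> * \<bar>\<Phi> i x * ?A i x\<bar>" by (intro mult_right_mono Tle) simp
      then show "\<bar>?T n x * (\<Phi> i x * ?A i x)\<bar> \<le> \<bar>\<Phi> i x * (u x * ?A i x)\<bar>" by (simp only: abs_mult mult_ac)
    qed
    show "AE x in ?M. (\<lambda>n. ?T n x) \<longlonglongrightarrow> u x" by (intro AE_I2 clip_tendsto_Suc)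
  qed (use iA m in auto)
  moreover have "(\<lambda>n. LINT x|?M. ?T n x * (\<phi> x * (q x * u x))) \<longlonglongrightarrow> (LINT x|?M. u x * (\<phi> x * (q x * u x)))"
  proof (rule dominated_mult[where w = "\<lambda>x. \<bar>\<phi> x * (q x * u x * u x)\<bar>"])
    show "AE x in ?M. \<bar>?T n x * (\<phi> x * (q x * u x))\<bar> \<le> \<bar>\<phi> x * (q x * u x * u x)\<bar>" for n
    proof (intro AE_I2)
      fix x
      have "\<bar>?T n x\<bar> * \<bar>\<phi> x * (q x * u x)\<bar> \<le> \<bar>u x\<bar> * \<bar>\<phi> x * (q x * u x)\<bar>" by (intro mult_right_mono Tle) simp
      then show "\<bar>?T n x * (\<phi> x * (q x * u x))\<bar> \<le> \<bar>\<phi> x * (q x * u x * u x)\<bar>" by (simp only: abs_mult mult_ac)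
    qed
    show "AE x in ?M. (\<lambda>n. ?T n x) \<longlonglongrightarrow> u x" by (intro AE_I2 clip_tendsto_Suc)
  qed (use iq m in auto)
  moreover have "(LINT x|?M. ?J n x * (\<phi> x * ?E x)) + (\<Sum>i\<in>UNIV. LINT x|?M. ?T n x * (\<Phi> i x * ?A i x)) = (LINT x|?M. ?T n x * (\<phi> x * (q x * u x)))" for n
    using step[of n] by (simp only: mult.left_commute)
  ultimately have fin: "(LINT x|?M. 1 * (\<phi> x * ?E x)) + (\<Sum>i\<in>UNIV. LINT x|?M. u x * (\<Phi> i x * ?A i x)) = (LINT x|?M. u x * (\<phi> x * (q x * u x)))"
    by (rule limit_of_sums)
  have pw: "\<phi> x * ?E x + u x * ((a x *v vec_of U x) \<bullet> vec_of \<Phi> x) = \<phi> x * ?E x + (\<Sum>i\<in>UNIV. \<Phi> i x * (u x * ?A i x))" for x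
    unfolding flux_inner[of a x U \<Phi>] by (simp add: sum_distrib_left mult_ac)
  have pq: "(\<lambda>x. q x * (u x)\<^sup>2 * \<phi> x) = (\<lambda>x. \<phi> x * (q x * u x * u x))" by (simp add: fun_eq_iff power2_eq_square)
  show "integrable ?M (\<lambda>x. \<phi> x * ?E x + u x * ((a x *v vec_of U x) \<bullet> vec_of \<Phi> x))"
    unfolding pw by (intro Bochner_Integration.integrable_add Bochner_Integration.integrable_sum iE iA)
  show "integrable ?M (\<lambda>x. q x * (u x)\<^sup>2 * \<phi> x)" unfolding pq by (rule iq)
  have "(LINT x|?M. \<phi> x * ?E x + u x * ((a x *v vec_of U x) \<bullet> vec_of \<Phi> x)) = (LINT x|?M. \<phi> x * ?E x) + (\<Sum>i\<in>UNIV. LINT x|?M. \<Phi> i x * (u x * ?A i x))"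
    unfolding pw using iE iA by (simp add: Bochner_Integration.integral_sum Bochner_Integration.integrable_sum)
  also have "\<dots> = (LINT x|?M. 1 * (\<phi> x * ?E x)) + (\<Sum>i\<in>UNIV. LINT x|?M. u x * (\<Phi> i x * ?A i x))"
    by (simp only: mult_1 mult.left_commute)
  also have "\<dots> = (LINT x|?M. q x * (u x)\<^sup>2 * \<phi> x)"
    unfolding fin pq by (intro Bochner_Integration.integral_cong refl) simp
  finally show "(LINT x|?M. \<phi> x * ?E x + u x * ((a x *v vec_of U x) \<bullet> vec_of \<Phi> x)) = (LINT x|?M. q x * (u x)\<^sup>2 * \<phi> x)" .
qed

section \<open>Boundary values and the resolvent\<close>

text \<open>
  The continuous extensions of \<open>g\<close> that witness the two traces may differ; their difference is
  continuous up to the boundary and vanishes there.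
\<close>

lemma H10_grad_trace_diff:
  assumes \<Omega>: "open \<Omega>" "bounded \<Omega>" and tr: "has_trace \<Omega> u g" "has_trace \<Omega> z g"
  shows "H10_grad \<Omega> (\<lambda>x. u x - z x) (\<lambda>i x. weak_deriv \<Omega> i u x - weak_deriv \<Omega> i z x)"
proof -
  obtain G where G: "G \<in> H1 \<Omega>" "continuous_on (closure \<Omega>) G" "\<forall>x\<in>frontier \<Omega>. G x = g x" "(\<lambda>x. u x - G x) \<in> H10 \<Omega>"
    using tr(1) unfolding has_trace_def by blast
  obtain H where H: "H \<in> H1 \<Omega>" "continuous_on (closure \<Omega>) H" "\<forall>x\<in>frontier \<Omega>. H x = g x" "(\<lambda>x. z x - H x) \<in> H10 \<Omega>"
    using tr(2) unfolding has_trace_def by blast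
  have uz: "u \<in> H1 \<Omega>" "z \<in> H1 \<Omega>" using tr by (auto simp only: has_trace_def)
  note g = H1_grad_of_H1[OF \<Omega>(1)]
  have 1: "H10_grad \<Omega> (\<lambda>x. u x - G x) (\<lambda>i x. weak_deriv \<Omega> i u x - weak_deriv \<Omega> i G x)"
    by (rule H10_grad_of_H10[OF \<Omega>(1) G(4) H1_grad_diff[OF \<Omega>(1) g[OF uz(1)] g[OF G(1)]]])
  have 2: "H10_grad \<Omega> (\<lambda>x. z x - H x) (\<lambda>i x. weak_deriv \<Omega> i z x - weak_deriv \<Omega> i H x)"
    by (rule H10_grad_of_H10[OF \<Omega>(1) H(4) H1_grad_diff[OF \<Omega>(1) g[OF uz(2)] g[OF H(1)]]])
  have 3: "H10_grad \<Omega> (\<lambda>x. G x - H x) (\<lambda>i x. weak_deriv \<Omega> i G x - weak_deriv \<Omega> i H x)"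
    by (rule H10_grad_zero_boundary[OF \<Omega> H1_grad_diff[OF \<Omega>(1) g[OF G(1)] g[OF H(1)]] continuous_on_diff[OF G(2) H(2)]])
      (use G(3) H(3) in simp)
  have "H10_grad \<Omega> (\<lambda>x. (u x - G x) + ((G x - H x) + (-1) * (z x - H x)))
      (\<lambda>i x. (weak_deriv \<Omega> i u x - weak_deriv \<Omega> i G x) + ((weak_deriv \<Omega> i G x - weak_deriv \<Omega> i H x) + (-1) * (weak_deriv \<Omega> i z x - weak_deriv \<Omega> i H x)))"
    by (rule H10_grad_add[OF \<Omega>(1) 1 H10_grad_add[OF \<Omega>(1) 3 H10_grad_cmult[OF 2]]])
  then show ?thesis by simp
qed

lemma H10_grad_cong:
  assumes \<Omega>: "open \<Omega>" and f: "H10_grad \<Omega> f g" and f': "H1_grad \<Omega> f' g'" and eq: "AE x in lebesgue_on \<Omega>. f x = f' x"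
  shows "H10_grad \<Omega> f' g'"
proof -
  note F = H1_gradD[OF f']
  have fg: "H1_grad \<Omega> f g" using f by (simp add: H10_grad_def)
  have "H1_grad \<Omega> f' g" by (rule H1_grad_cong_AE[OF \<Omega> fg eq]) simp
  then have gg: "AE x in lebesgue_on \<Omega>. g i x = g' i x" for i
    by (rule has_weak_deriv_unique[OF \<Omega> H1_gradD(3) F(3)])
  show ?thesis
    using f f' L2_tendsto_cong_AE[OF _ eq F(4)] L2_tendsto_cong_AE[OF _ gg F(5)] unfolding H10_grad_def by blast
qed

lemma H10_grad_imp_H1_grad: "H10_grad \<Omega> f g \<Longrightarrow> H1_grad \<Omega> f g"
  by (simp add: H10_grad_def)

lemma flux_linear:
  "(a *v vec_of (\<lambda>i x. U i x + c * V i x) x) $ i = (a *v vec_of U x) $ i + c * (a *v vec_of V x) $ i" for a :: "real ^ 'n ^ 'n"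
  by (simp add: matrix_vector_mult_def vec_of_def sum.distrib distrib_left sum_distrib_left mult_ac)

lemma Lq_eq_add:
  fixes a :: "real ^ 'n \<Rightarrow> real ^ 'n ^ 'n"
  assumes \<Omega>: "open \<Omega>" and a: "bounded_coeff \<Omega> A a"
    and q: "q \<in> borel_measurable (lebesgue_on \<Omega>)" "AE x in lebesgue_on \<Omega>. \<bar>q x\<bar> \<le> Mq"
    and u: "H1_grad \<Omega> u U" and f: "square_integrable (lebesgue_on \<Omega>) f" and uf: "Lq_eq \<Omega> a q u f"
    and v: "H1_grad \<Omega> v V" and h: "square_integrable (lebesgue_on \<Omega>) h" and vh: "Lq_eq \<Omega> a q v h"
  shows "Lq_eq \<Omega> a q (\<lambda>x. u x + c * v x) (\<lambda>x. f x + c * h x)"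
proof -
  have w: "H1_grad \<Omega> (\<lambda>x. u x + c * v x) (\<lambda>i x. U i x + c * V i x)"
    by (intro H1_grad_add H1_grad_cmult \<Omega> u v)
  have k: "square_integrable (lebesgue_on \<Omega>) (\<lambda>x. f x + c * h x)" by (intro square_integrable_add square_integrable_cmult f h)
  note U = H1_gradD[OF u] and V = H1_gradD[OF v]
  note A = square_integrable_flux[OF a U(2)] square_integrable_flux[OF a V(2)]
  have q2: "square_integrable (lebesgue_on \<Omega>) (\<lambda>x. q x * u x)" "square_integrable (lebesgue_on \<Omega>) (\<lambda>x. q x * v x)"
    by (intro square_integrable_mult_bounded[OF _ q] U(1) V(1))+
  show ?thesis
    unfolding Lq_eq_iff[OF \<Omega> a q w k]
  proof
    fix \<phi> assume \<phi>: "\<phi> \<in> test_functions \<Omega>"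
    note T = H1_gradD[OF H1_grad_test[OF \<Omega> \<phi>]]
    have I: "(LINT x|lebesgue_on \<Omega>. \<psi> x * (y x + c * z x)) = (LINT x|lebesgue_on \<Omega>. \<psi> x * y x) + c * (LINT x|lebesgue_on \<Omega>. \<psi> x * z x)"
      if "square_integrable (lebesgue_on \<Omega>) \<psi>" "square_integrable (lebesgue_on \<Omega>) y" "square_integrable (lebesgue_on \<Omega>) z" for \<psi> y z
    proof -
      have "(\<lambda>x. \<psi> x * (y x + c * z x)) = (\<lambda>x. \<psi> x * y x + c * (\<psi> x * z x))" by (simp add: fun_eq_iff algebra_simps)
      then show ?thesis using integrable_mult_square_integrable[OF that(1,2)] integrable_mult_square_integrable[OF that(1,3)] by simp
    qed
    have qw: "(\<lambda>x. \<phi> x * (q x * (u x + c * v x))) = (\<lambda>x. \<phi> x * (q x * u x + c * (q x * v x)))" by (simp add: fun_eq_iff algebra_simps)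
    show "(\<Sum>i\<in>UNIV. LINT x|lebesgue_on \<Omega>. pderivative i \<phi> x * (a x *v vec_of (\<lambda>i x. U i x + c * V i x) x) $ i)
        = (LINT x|lebesgue_on \<Omega>. \<phi> x * (q x * (u x + c * v x))) - (LINT x|lebesgue_on \<Omega>. \<phi> x * (f x + c * h x))"
      unfolding flux_linear qw I[OF T(2) A] I[OF T(1) q2] I[OF T(1) f h] sum.distrib sum_distrib_left[symmetric]
        uf[unfolded Lq_eq_iff[OF \<Omega> a q u f], rule_format, OF \<phi>] vh[unfolded Lq_eq_iff[OF \<Omega> a q v h], rule_format, OF \<phi>]
      by (simp add: algebra_simps)
  qed
qed

text \<open>
  A solution for the potential \<open>q\<close> solves an inhomogeneous equation for any other potential \<open>s\<close>, with
  a right-hand side that is small when \<open>s - q\<close> is.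
\<close>

lemma Lq_eq_change_potential:
  fixes a :: "real ^ 'n \<Rightarrow> real ^ 'n ^ 'n"
  assumes \<Omega>: "open \<Omega>" and a: "bounded_coeff \<Omega> A a"
    and q: "q \<in> borel_measurable (lebesgue_on \<Omega>)" "AE x in lebesgue_on \<Omega>. \<bar>q x\<bar> \<le> Mq"
    and s: "s \<in> borel_measurable (lebesgue_on \<Omega>)" "AE x in lebesgue_on \<Omega>. \<bar>s x\<bar> \<le> Ms"
    and u: "H1_grad \<Omega> u U" and L: "Lq_eq \<Omega> a q u (\<lambda>x. 0)"
  shows "Lq_eq \<Omega> a s u (\<lambda>x. s x * u x - q x * u x)"
proof -
  note U = H1_gradD[OF u]
  have sq: "square_integrable (lebesgue_on \<Omega>) (\<lambda>x. q x * u x)" "square_integrable (lebesgue_on \<Omega>) (\<lambda>x. s x * u x)"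
    by (intro square_integrable_mult_bounded[OF U(1) q] square_integrable_mult_bounded[OF U(1) s])+
  have f: "square_integrable (lebesgue_on \<Omega>) (\<lambda>x. s x * u x - q x * u x)" by (intro square_integrable_diff sq)
  show ?thesis unfolding Lq_eq_iff[OF \<Omega> a s u f]
  proof
    fix \<phi> assume \<phi>: "\<phi> \<in> test_functions \<Omega>"
    note T = H1_gradD[OF H1_grad_test[OF \<Omega> \<phi>]]
    have "(LINT x|lebesgue_on \<Omega>. \<phi> x * (s x * u x - q x * u x)) = (LINT x|lebesgue_on \<Omega>. \<phi> x * (s x * u x)) - (LINT x|lebesgue_on \<Omega>. \<phi> x * (q x * u x))"
      unfolding right_diff_distrib
      by (intro Bochner_Integration.integral_diff integrable_mult_square_integrable T sq)
    then show "(\<Sum>i\<in>UNIV. LINT x|lebesgue_on \<Omega>. pderivative i \<phi> x * (a x *v vec_of U x) $ i)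
        = (LINT x|lebesgue_on \<Omega>. \<phi> x * (s x * u x)) - (LINT x|lebesgue_on \<Omega>. \<phi> x * (s x * u x - q x * u x))"
      using L[unfolded Lq_eq_iff[OF \<Omega> a q u square_integrable_zero], rule_format, OF \<phi>] by simp
  qed
qed

lemma L2_norm_nonneg: "L2_norm \<Omega> f \<ge> 0" by (simp add: L2_norm_def)

lemma L2_norm_cong_AE:
  assumes "square_integrable (lebesgue_on \<Omega>) f" "square_integrable (lebesgue_on \<Omega>) g" "AE x in lebesgue_on \<Omega>. f x = g x"
  shows "L2_norm \<Omega> f = L2_norm \<Omega> g"
  unfolding L2_norm_def using assms square_integrable_measurable
  by (intro arg_cong[of _ _ sqrt] integral_cong_AE) (auto elim: eventually_mono)

lemma L2_norm_cmult: "L2_norm \<Omega> (\<lambda>x. c * f x) = \<bar>c\<bar> * L2_norm \<Omega> f"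
  by (simp add: L2_norm_def power_mult_distrib real_sqrt_mult)

lemma L2_norm_mult_bounded:
  assumes "square_integrable (lebesgue_on \<Omega>) f" "m \<in> borel_measurable (lebesgue_on \<Omega>)" "AE x in lebesgue_on \<Omega>. \<bar>m x\<bar> \<le> B" "B \<ge> 0"
  shows "L2_norm \<Omega> (\<lambda>x. m x * f x) \<le> B * L2_norm \<Omega> f"
proof -
  have "(LINT x|lebesgue_on \<Omega>. (m x * f x)\<^sup>2) \<le> (LINT x|lebesgue_on \<Omega>. (B * f x)\<^sup>2)"
  proof (rule integral_mono_AE)
    show "AE x in lebesgue_on \<Omega>. (m x * f x)\<^sup>2 \<le> (B * f x)\<^sup>2"
      using assms(3)
    proof eventually_elim
      case (elim x)
      then show ?case using assms(4) by (auto simp: abs_le_square_iff[symmetric] abs_mult intro!: mult_right_mono)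
    qed
  qed (intro square_integrableD square_integrable_cmult square_integrable_mult_bounded[OF assms(1-3)] assms(1))+
  then have "L2_norm \<Omega> (\<lambda>x. m x * f x) \<le> L2_norm \<Omega> (\<lambda>x. B * f x)" unfolding L2_norm_def by (rule real_sqrt_le_mono)
  then show ?thesis using assms(4) by (simp add: L2_norm_cmult)
qed

lemma A_rel_iff:
  assumes \<Omega>: "open \<Omega>"
  shows "A_rel \<Omega> a q w f \<longleftrightarrow> H10_grad \<Omega> w (\<lambda>i. weak_deriv \<Omega> i w) \<and> square_integrable (lebesgue_on \<Omega>) f \<and> Lq_eq \<Omega> a q w (\<lambda>x. - f x)"
proof -
  have "w \<in> H10 \<Omega> \<longleftrightarrow> H10_grad \<Omega> w (\<lambda>i. weak_deriv \<Omega> i w)"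
    using H10_grad_of_H10[OF \<Omega> _ H1_grad_of_H1[OF \<Omega>]] H10_of_H10_grad[OF \<Omega>] unfolding H10_def by blast
  then show ?thesis by (simp add: A_rel_def Lp2_iff)
qed

lemma A_rel_add:
  fixes a :: "real ^ 'n \<Rightarrow> real ^ 'n ^ 'n"
  assumes \<Omega>: "open \<Omega>" and a: "bounded_coeff \<Omega> A a"
    and q: "q \<in> borel_measurable (lebesgue_on \<Omega>)" "AE x in lebesgue_on \<Omega>. \<bar>q x\<bar> \<le> Mq"
    and r: "A_rel \<Omega> a q w f" "A_rel \<Omega> a q z h"
  shows "A_rel \<Omega> a q (\<lambda>x. w x + c * z x) (\<lambda>x. f x + c * h x)"
proof -
  note W = r[unfolded A_rel_iff[OF \<Omega>]]
  have H: "H10_grad \<Omega> (\<lambda>x. w x + c * z x) (\<lambda>i x. weak_deriv \<Omega> i w x + c * weak_deriv \<Omega> i z x)"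
    using W by (intro H10_grad_add H10_grad_cmult \<Omega>) auto
  have s: "square_integrable (lebesgue_on \<Omega>) (\<lambda>x. - f x)" "square_integrable (lebesgue_on \<Omega>) (\<lambda>x. - h x)"
    using W square_integrable_cmult[of _ f "-1"] square_integrable_cmult[of _ h "-1"] by auto
  have "Lq_eq \<Omega> a q (\<lambda>x. w x + c * z x) (\<lambda>x. - f x + c * - h x)"
    using W by (intro Lq_eq_add[OF \<Omega> a q _ s(1) _ _ s(2)] H10_grad_imp_H1_grad) auto
  moreover have "(\<lambda>x. - f x + c * - h x) = (\<lambda>x. - (f x + c * h x))" by (simp add: fun_eq_iff)
  moreover have "square_integrable (lebesgue_on \<Omega>) (\<lambda>x. f x + c * h x)"
    using W by (intro square_integrable_add square_integrable_cmult) auto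
  ultimately show ?thesis
    using H10_of_H10_grad[OF \<Omega> H] by (simp add: A_rel_def Lp2_iff)
qed

text \<open>
  The operator norm is a supremum over all right-hand sides in the unit ball, with an inverse that is
  chosen arbitrarily where no solution exists. For a right-hand side that has a solution, uniqueness
  identifies the solution with the chosen one; scaling by \<open>1 / c\<close> with \<open>c\<close> slightly larger than the
  norm of \<open>f\<close> covers the case \<open>f = 0\<close>.
\<close>

lemma resolvent_bound:
  fixes a :: "real ^ 'n \<Rightarrow> real ^ 'n ^ 'n"
  assumes \<Omega>: "open \<Omega>" and a: "bounded_coeff \<Omega> A a"
    and q: "q \<in> Q0_set \<Omega> a" "AE x in lebesgue_on \<Omega>. \<bar>q x\<bar> \<le> Mq"
    and N: "L2_opnorm \<Omega> (A_inv \<Omega> a q) \<le> ereal N"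
    and r: "A_rel \<Omega> a q w f"
  shows "L2_norm \<Omega> w \<le> N * L2_norm \<Omega> f"
proof -
  have qm: "q \<in> borel_measurable (lebesgue_on \<Omega>)" using q(1) by (simp add: Q0_set_def Linf_def)
  note W = r[unfolded A_rel_iff[OF \<Omega>]]
  have zero: "A_rel \<Omega> a q (\<lambda>x. 0) (\<lambda>x. 0)"
    using A_rel_add[OF \<Omega> a qm q(2) r r, of "-1"] by simp
  have le: "L2_norm \<Omega> w \<le> N * c" if c: "c > 0" "L2_norm \<Omega> f \<le> c" for c
  proof -
    have r': "A_rel \<Omega> a q (\<lambda>x. (1 / c) * w x) (\<lambda>x. (1 / c) * f x)"
      using A_rel_add[OF \<Omega> a qm q(2) zero r, of "1 / c"] by simp
    let ?f = "\<lambda>x. (1 / c) * f x"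
    define z where "z = A_inv \<Omega> a q ?f"
    have z: "A_rel \<Omega> a q z ?f" unfolding z_def A_inv_def by (rule someI[of "\<lambda>w. A_rel \<Omega> a q w ?f", OF r'])
    have "A_rel \<Omega> a q (\<lambda>x. z x + (-1) * ((1 / c) * w x)) (\<lambda>x. 0)"
      using A_rel_add[OF \<Omega> a qm q(2) z r', of "-1"] by simp
    then have "AE x in lebesgue_on \<Omega>. z x + (-1) * ((1 / c) * w x) = 0" using q(1) unfolding Q0_set_def by blast
    then have eq: "AE x in lebesgue_on \<Omega>. z x = (1 / c) * w x" by eventually_elim simp
    have sz: "square_integrable (lebesgue_on \<Omega>) z" "square_integrable (lebesgue_on \<Omega>) (\<lambda>x. (1 / c) * w x)"
      using z r' unfolding A_rel_iff[OF \<Omega>] H10_grad_def H1_grad_def by blast+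
    have fn: "L2_norm \<Omega> ?f \<le> 1" unfolding L2_norm_cmult using c by (simp add: divide_le_eq)
    have "?f \<in> Lp 2 \<Omega>" using r' by (simp add: A_rel_def)
    then have "ereal (L2_norm \<Omega> (A_inv \<Omega> a q ?f)) \<le> L2_opnorm \<Omega> (A_inv \<Omega> a q)"
      unfolding L2_opnorm_def using fn by (intro SUP_upper) auto
    then have "L2_norm \<Omega> z \<le> N" using N by (auto simp: z_def dest: order_trans)
    then have "L2_norm \<Omega> (\<lambda>x. (1 / c) * w x) \<le> N" using L2_norm_cong_AE[OF sz eq] by simp
    then show ?thesis unfolding L2_norm_cmult using c(1) by (simp add: field_simps)
  qed
  have "((\<lambda>e. N * (L2_norm \<Omega> f + e)) \<longlongrightarrow> N * (L2_norm \<Omega> f + 0)) (at_right 0)"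
    by (intro tendsto_intros)
  moreover have "\<forall>\<^sub>F e in at_right 0. L2_norm \<Omega> w \<le> N * (L2_norm \<Omega> f + e)"
    unfolding eventually_at_right_field using le L2_norm_nonneg[of \<Omega> f] by (intro exI[of _ 1]) (auto intro!: le add_nonneg_pos)
  ultimately have "L2_norm \<Omega> w \<le> N * (L2_norm \<Omega> f + 0)" by (rule tendsto_lowerbound) auto
  then show ?thesis by simp
qed

lemma norm_vec_of_squared: "(norm (vec_of U x))\<^sup>2 = (\<Sum>i\<in>UNIV. (U i x)\<^sup>2)"
  by (simp add: norm_vec_def L2_set_def vec_of_def sum_nonneg)

lemma square_integrable_norm_vec:
  fixes U :: "'n::finite \<Rightarrow> 'a \<Rightarrow> real"
  assumes "\<And>i. square_integrable M (U i)"
  shows "square_integrable M (\<lambda>x. norm (vec_of U x))" "integrable M (\<lambda>x. (norm (vec_of U x))\<^sup>2)"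
    "(LINT x|M. (norm (vec_of U x))\<^sup>2) = (\<Sum>i\<in>UNIV. LINT x|M. (U i x)\<^sup>2)"
proof -
  note [measurable] = square_integrable_measurable[OF assms]
  show i: "integrable M (\<lambda>x. (norm (vec_of U x))\<^sup>2)"
    unfolding norm_vec_of_squared by (intro Bochner_Integration.integrable_sum square_integrableD assms)
  have "(\<lambda>x. norm (vec_of U x)) = (\<lambda>x. sqrt (\<Sum>i\<in>UNIV. (U i x)\<^sup>2))"
    by (simp add: norm_vec_def L2_set_def vec_of_def)
  then have "(\<lambda>x. norm (vec_of U x)) \<in> borel_measurable M" by simp
  then show "square_integrable M (\<lambda>x. norm (vec_of U x))" using i by (simp add: square_integrable_def)
  show "(LINT x|M. (norm (vec_of U x))\<^sup>2) = (\<Sum>i\<in>UNIV. LINT x|M. (U i x)\<^sup>2)"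
    unfolding norm_vec_of_squared by (intro Bochner_Integration.integral_sum square_integrableD assms)
qed

lemma vec_of_diff: "vec_of (\<lambda>i x. U i x - V i x) x = vec_of U x - vec_of V x"
  by (simp add: vec_of_def vec_eq_iff)

section \<open>Pointwise inequalities\<close>

text \<open>The energy density of the operator, with the coefficient matrix frozen at a point.\<close>

definition bil :: "real ^ 'n ^ 'n \<Rightarrow> real ^ 'n \<Rightarrow> real ^ 'n \<Rightarrow> real" where
  "bil m \<xi> \<eta> = (m *v \<xi>) \<bullet> \<eta>"

lemma bil_linear:
  "bil m (x + y) z = bil m x z + bil m y z" "bil m (x - y) z = bil m x z - bil m y z" "bil m (c *\<^sub>R x) z = c * bil m x z"
  "bil m z (x + y) = bil m z x + bil m z y" "bil m z (x - y) = bil m z x - bil m z y" "bil m z (c *\<^sub>R x) = c * bil m z x"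
  by (simp_all add: bil_def matrix_vector_right_distrib matrix_vector_mult_diff_distrib matrix_vector_mult_scaleR inner_simps)

lemma bil_sym:
  assumes "transpose m = m"
  shows "bil m x y = bil m y x"
proof -
  have "(m *v x) \<bullet> y = (transpose m *v x) \<bullet> y" using assms by simp
  also have "\<dots> = x \<bullet> (m *v y)" by (simp add: transpose_matrix_vector dot_lmul_matrix)
  finally show ?thesis by (simp add: bil_def inner_commute)
qed

lemma bil_bound:
  assumes "\<And>\<xi>. norm (m *v \<xi>) \<le> A * norm \<xi>"
  shows "\<bar>bil m x y\<bar> \<le> A * norm x * norm y"
proof -
  have "\<bar>bil m x y\<bar> \<le> norm (m *v x) * norm y" unfolding bil_def by (rule Cauchy_Schwarz_ineq2)
  also have "\<dots> \<le> A * norm x * norm y" by (intro mult_right_mono assms) simp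
  finally show ?thesis .
qed

text \<open>
  With \<open>s = sqrt q\<close>, \<open>v = |u|\<close>, \<open>J = s v\<close> and \<open>P = \<nabla> J\<close>, the left-hand side is the density of the equation
  for \<open>u\<close> tested with \<open>q \<psi> u\<close>. On the right it is expressed by the data \<open>J\<close> and by \<open>R = \<nabla> (ln \<rho>)\<close>,
  \<open>\<rho> = 1 / s\<close>, so that the coefficient occurs in the factor of \<open>J\<^sup>2\<close> and in the test function only.
\<close>

lemma energy_density_change_variables:
  assumes s: "s > 0" and sym: "transpose m = m"
    and P: "P = s *\<^sub>R V + (v / (2 * s)) *\<^sub>R Q" and J: "J = s * v" and R: "R = (- 1 / (2 * s\<^sup>2)) *\<^sub>R Q"
  shows "(s\<^sup>2 * \<psi>) * bil m V V + v * bil m V (s\<^sup>2 *\<^sub>R \<Psi> + \<psi> *\<^sub>R Q) - s\<^sup>2 * v\<^sup>2 * (s\<^sup>2 * \<psi>)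
    = \<psi> * bil m P P + J * bil m P \<Psi> + J\<^sup>2 * (bil m R \<Psi> - bil m R R * \<psi> - s\<^sup>2 * \<psi>)"
  unfolding P J R bil_linear bil_sym[OF sym, of Q V]
  using s by (simp add: field_simps power2_eq_square)

text \<open>
  The algebraic core of the argument, a form of Picone's identity for \<open>\<rho> = 1 / sqrt q\<close>: here \<open>R = \<nabla> (ln \<rho>)\<close>,
  \<open>\<psi> = \<rho>\<^sup>2 - \<rho>t\<^sup>2\<close> and \<open>\<Psi> = \<nabla> \<psi>\<close>. The factors of \<open>J\<^sup>2\<close> in the two tested equations differ by an
  expression that is coercive in \<open>R - Rt\<close> and in \<open>q - qt\<close>.
\<close>

lemma picone_difference:
  assumes q: "q > 0" "qt > 0" and sym: "transpose m = m"
    and \<psi>: "\<psi> = 1 / q - 1 / qt" and \<Psi>: "\<Psi> = (2 / q) *\<^sub>R R - (2 / qt) *\<^sub>R Rt"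
  shows "(bil m R \<Psi> - bil m R R * \<psi> - q * \<psi>) - (bil m Rt \<Psi> - bil m Rt Rt * \<psi> - qt * \<psi>)
    = (1 / q + 1 / qt) * bil m (R - Rt) (R - Rt) + (q - qt)\<^sup>2 / (q * qt)"
  unfolding \<psi> \<Psi> bil_linear bil_sym[OF sym, of Rt R]
  using q by (simp add: field_simps power2_eq_square)

text \<open>
  The terms that arise in the difference of the two tested equations when \<open>Jt\<close> and \<open>Pt = \<nabla> Jt\<close> replace
  \<open>J\<close> and \<open>P = \<nabla> J\<close>; each of them contains a difference of the data.
\<close>

lemma perturbation_bound:
  assumes A: "\<And>\<xi>. norm (m *v \<xi>) \<le> A * norm \<xi>" "A \<ge> 0" and c: "\<bar>\<psi>\<bar> \<le> c" "norm \<Psi> \<le> c" "norm Rt \<le> c" "\<bar>qt\<bar> \<le> M"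
  shows "\<bar>\<psi> * bil m (P - Pt) (P + Pt) + bil m (J *\<^sub>R (P - Pt) + (J - Jt) *\<^sub>R Pt) \<Psi>
      + (J\<^sup>2 - Jt\<^sup>2) * (bil m Rt \<Psi> - bil m Rt Rt * \<psi> - qt * \<psi>)\<bar>
    \<le> (2 * A * c + A * c * c + A * c * c * c + M * c) * (\<bar>J - Jt\<bar> + norm (P - Pt)) * (\<bar>J\<bar> + \<bar>Jt\<bar> + norm P + norm Pt)"
proof -
  note b = bil_bound[OF A(1)]
  have c0: "c \<ge> 0" "M \<ge> 0" using c by auto
  define j where "j = \<bar>J - Jt\<bar>"
  define p where "p = norm (P - Pt)"
  define S where "S = \<bar>J\<bar> + \<bar>Jt\<bar> + norm P + norm Pt"
  have nn: "j \<ge> 0" "p \<ge> 0" "S \<ge> 0" "A * c \<ge> 0" "A * c * c \<ge> 0" "A * c * c * c \<ge> 0" "M * c \<ge> 0"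
    using A(2) c0 by (auto simp: j_def p_def S_def)
  have "\<bar>\<psi> * bil m (P - Pt) (P + Pt)\<bar> \<le> c * (A * p * S)"
    unfolding abs_mult
  proof (intro mult_mono c)
    have "\<bar>bil m (P - Pt) (P + Pt)\<bar> \<le> A * norm (P - Pt) * norm (P + Pt)" by (rule b)
    also have "\<dots> \<le> A * p * S"
      unfolding p_def using norm_triangle_ineq[of P Pt] A(2) by (intro mult_left_mono) (auto simp: S_def)
    finally show "\<bar>bil m (P - Pt) (P + Pt)\<bar> \<le> A * p * S" .
  qed (use c0 in auto)
  then have 1: "\<bar>\<psi> * bil m (P - Pt) (P + Pt)\<bar> \<le> A * c * p * S" by (simp add: mult_ac)
  have "norm (J *\<^sub>R (P - Pt) + (J - Jt) *\<^sub>R Pt) \<le> \<bar>J\<bar> * p + j * norm Pt"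
    using norm_triangle_ineq[of "J *\<^sub>R (P - Pt)" "(J - Jt) *\<^sub>R Pt"] by (simp add: j_def p_def)
  also have "\<dots> \<le> S * p + j * S"
    using nn by (intro add_mono mult_left_mono mult_right_mono) (auto simp: S_def)
  finally have n: "norm (J *\<^sub>R (P - Pt) + (J - Jt) *\<^sub>R Pt) \<le> S * p + j * S" .
  have "\<bar>bil m (J *\<^sub>R (P - Pt) + (J - Jt) *\<^sub>R Pt) \<Psi>\<bar> \<le> A * norm (J *\<^sub>R (P - Pt) + (J - Jt) *\<^sub>R Pt) * norm \<Psi>" by (rule b)
  also have "\<dots> \<le> A * (S * p + j * S) * c"
    using A(2) nn by (intro mult_mono n c mult_left_mono mult_nonneg_nonneg add_nonneg_nonneg) auto
  finally have 2: "\<bar>bil m (J *\<^sub>R (P - Pt) + (J - Jt) *\<^sub>R Pt) \<Psi>\<bar> \<le> A * c * (j + p) * S" by (simp add: algebra_simps)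
  have "\<bar>bil m Rt \<Psi> - bil m Rt Rt * \<psi> - qt * \<psi>\<bar> \<le> \<bar>bil m Rt \<Psi>\<bar> + \<bar>bil m Rt Rt * \<psi>\<bar> + \<bar>qt * \<psi>\<bar>" by linarith
  also have "\<dots> \<le> A * c * c + A * c * c * c + M * c"
  proof (intro add_mono)
    have "\<bar>bil m Rt \<Psi>\<bar> \<le> A * norm Rt * norm \<Psi>" by (rule b)
    also have "\<dots> \<le> A * c * c" using A(2) c0 by (intro mult_mono c mult_left_mono) auto
    finally show "\<bar>bil m Rt \<Psi>\<bar> \<le> A * c * c" .
    have "\<bar>bil m Rt Rt\<bar> \<le> A * norm Rt * norm Rt" by (rule b)
    also have "\<dots> \<le> A * c * c" using A(2) c0 by (intro mult_mono c mult_left_mono) auto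
    finally show "\<bar>bil m Rt Rt * \<psi>\<bar> \<le> A * c * c * c" unfolding abs_mult using nn by (intro mult_mono c) auto
    show "\<bar>qt * \<psi>\<bar> \<le> M * c" unfolding abs_mult using c0 by (intro mult_mono c) auto
  qed
  finally have X: "\<bar>bil m Rt \<Psi> - bil m Rt Rt * \<psi> - qt * \<psi>\<bar> \<le> A * c * c + A * c * c * c + M * c" .
  have "\<bar>J\<^sup>2 - Jt\<^sup>2\<bar> = j * \<bar>J + Jt\<bar>" by (simp add: j_def power2_eq_square flip: abs_mult) (simp add: algebra_simps)
  also have "\<dots> \<le> j * S"
  proof (intro mult_left_mono nn)
    show "\<bar>J + Jt\<bar> \<le> S"
      unfolding S_def using abs_triangle_ineq[of J Jt] norm_ge_zero[of P] norm_ge_zero[of Pt] by linarith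
  qed
  finally have 3: "\<bar>(J\<^sup>2 - Jt\<^sup>2) * (bil m Rt \<Psi> - bil m Rt Rt * \<psi> - qt * \<psi>)\<bar> \<le> (j * S) * (A * c * c + A * c * c * c + M * c)"
    unfolding abs_mult using X nn by (intro mult_mono) auto
  have "\<bar>\<psi> * bil m (P - Pt) (P + Pt) + bil m (J *\<^sub>R (P - Pt) + (J - Jt) *\<^sub>R Pt) \<Psi>
      + (J\<^sup>2 - Jt\<^sup>2) * (bil m Rt \<Psi> - bil m Rt Rt * \<psi> - qt * \<psi>)\<bar>
    \<le> A * c * p * S + A * c * (j + p) * S + (j * S) * (A * c * c + A * c * c * c + M * c)"
    using 1 2 3 by linarith
  also have "\<dots> \<le> A * c * (j + p) * S + A * c * (j + p) * S + ((j + p) * S) * (A * c * c + A * c * c * c + M * c)"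
    using nn by (intro add_mono mult_right_mono mult_left_mono) auto
  also have "\<dots> = (2 * A * c + A * c * c + A * c * c * c + M * c) * (j + p) * S" by (simp add: algebra_simps)
  finally show ?thesis by (simp add: j_def p_def S_def)
qed

text \<open>The gradient of \<open>- (ln q) / 2\<close> for the value \<open>q\<close> and the gradient \<open>Q\<close>.\<close>

definition log_grad :: "real \<Rightarrow> real ^ 'n \<Rightarrow> real ^ 'n" where
  "log_grad q Q = (- 1 / (2 * q)) *\<^sub>R Q"

text \<open>The integrand that the difference of the two tested equations controls.\<close>

definition defect :: "real \<Rightarrow> real \<Rightarrow> real ^ 'n \<Rightarrow> real \<Rightarrow> real ^ 'n \<Rightarrow> real" where
  "defect v q Q qt Qt = (sqrt q * v)\<^sup>2 * ((norm (log_grad q Q - log_grad qt Qt))\<^sup>2 + (q - qt)\<^sup>2)"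

lemma defect_nonneg: "defect v q Q qt Qt \<ge> 0" by (simp add: defect_def)

text \<open>
  The difference of the two energy densities is split into the Picone expression, with the weight
  \<open>J\<^sup>2\<close>, and the terms of \<open>perturbation_bound\<close>. The constant \<open>c\<close> is the sum of the bounds of \<open>\<psi>\<close>,
  \<open>\<Psi>\<close> and \<open>Rt\<close>, and thereby a bound of each.
\<close>

lemma pointwise_defect_bound:
  fixes m :: "real ^ 'n ^ 'n"
  assumes sym: "transpose m = m" and ell: "\<And>\<xi>. lam * (norm \<xi>)\<^sup>2 \<le> bil m \<xi> \<xi>" "lam > 0"
    and A: "\<And>\<xi>. norm (m *v \<xi>) \<le> A * norm \<xi>" "A \<ge> 0"
    and q: "q0 > 0" "q0 \<le> q" "q \<le> M" "q0 \<le> qt" "qt \<le> M" and Q: "norm Q \<le> D" "norm Qt \<le> D"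
    and P: "P = sqrt q *\<^sub>R V + (v / (2 * sqrt q)) *\<^sub>R Q" and J: "J = sqrt q * v"
    and Pt: "Pt = sqrt qt *\<^sub>R Vt + (vt / (2 * sqrt qt)) *\<^sub>R Qt" and Jt: "Jt = sqrt qt * vt"
    and \<psi>: "\<psi> = 1 / q - 1 / qt" and \<Psi>: "\<Psi> = (- 1 / q\<^sup>2) *\<^sub>R Q - (- 1 / qt\<^sup>2) *\<^sub>R Qt"
    and c: "c = 2 / q0 + 2 * D / q0\<^sup>2 + D / (2 * q0)"
  shows "min (2 * lam / M) (1 / M\<^sup>2) * defect v q Q qt Qt
    \<le> ((q * \<psi>) * bil m V V + v * bil m V (q *\<^sub>R \<Psi> + \<psi> *\<^sub>R Q) - q * v\<^sup>2 * (q * \<psi>))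
      - ((qt * \<psi>) * bil m Vt Vt + vt * bil m Vt (qt *\<^sub>R \<Psi> + \<psi> *\<^sub>R Qt) - qt * vt\<^sup>2 * (qt * \<psi>))
      + (2 * A * c + A * c * c + A * c * c * c + M * c) * (\<bar>J - Jt\<bar> + norm (P - Pt)) * (\<bar>J\<bar> + \<bar>Jt\<bar> + norm P + norm Pt)"
proof -
  have pos: "q > 0" "qt > 0" "M > 0" using q by auto
  have D: "D \<ge> 0" using Q(1) norm_ge_zero[of Q] by linarith
  let ?R = "log_grad q Q" and ?Rt = "log_grad qt Qt"
  have sq: "(sqrt q)\<^sup>2 = q" "(sqrt qt)\<^sup>2 = qt" "sqrt q > 0" "sqrt qt > 0" using pos by auto
  have G: "(q * \<psi>) * bil m V V + v * bil m V (q *\<^sub>R \<Psi> + \<psi> *\<^sub>R Q) - q * v\<^sup>2 * (q * \<psi>)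
      = \<psi> * bil m P P + J * bil m P \<Psi> + J\<^sup>2 * (bil m ?R \<Psi> - bil m ?R ?R * \<psi> - q * \<psi>)"
    using energy_density_change_variables[OF sq(3) sym P J, of ?R \<psi> \<Psi>] by (simp add: sq log_grad_def)
  have Gt: "(qt * \<psi>) * bil m Vt Vt + vt * bil m Vt (qt *\<^sub>R \<Psi> + \<psi> *\<^sub>R Qt) - qt * vt\<^sup>2 * (qt * \<psi>)
      = \<psi> * bil m Pt Pt + Jt * bil m Pt \<Psi> + Jt\<^sup>2 * (bil m ?Rt \<Psi> - bil m ?Rt ?Rt * \<psi> - qt * \<psi>)"
    using energy_density_change_variables[OF sq(4) sym Pt Jt, of ?Rt \<psi> \<Psi>] by (simp add: sq log_grad_def)
  have \<Psi>': "\<Psi> = (2 / q) *\<^sub>R ?R - (2 / qt) *\<^sub>R ?Rt"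
    unfolding \<Psi> log_grad_def using pos by (simp add: power2_eq_square)
  note pic = picone_difference[OF pos(1,2) sym \<psi> \<Psi>']
  have id: "\<psi> * bil m P P - \<psi> * bil m Pt Pt + J * bil m P \<Psi> - Jt * bil m Pt \<Psi>
     = \<psi> * bil m (P - Pt) (P + Pt) + bil m (J *\<^sub>R (P - Pt) + (J - Jt) *\<^sub>R Pt) \<Psi>"
    unfolding bil_linear bil_sym[OF sym, of Pt P] by (simp add: algebra_simps)
  have inv: "1 / q \<le> 1 / q0" "1 / qt \<le> 1 / q0" "1 / q\<^sup>2 \<le> 1 / q0\<^sup>2" "1 / qt\<^sup>2 \<le> 1 / q0\<^sup>2" "1 / q > 0" "1 / qt > 0" "1 / (2 * qt) \<le> 1 / (2 * q0)"
    using q pos by (auto intro!: divide_left_mono power_mono mult_pos_pos)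
  have cn: "2 / q0 \<ge> 0" "2 * D / q0\<^sup>2 \<ge> 0" "D / (2 * q0) \<ge> 0" using q(1) D by auto
  have c1: "\<bar>\<psi>\<bar> \<le> c"
  proof -
    have "2 / q0 = 1 / q0 + 1 / q0" by simp
    then show ?thesis unfolding \<psi> c abs_le_iff using inv cn by linarith
  qed
  have c2: "norm \<Psi> \<le> c"
  proof -
    have "norm \<Psi> \<le> norm ((- 1 / q\<^sup>2) *\<^sub>R Q) + norm ((- 1 / qt\<^sup>2) *\<^sub>R Qt)" unfolding \<Psi> by (rule norm_triangle_ineq4)
    also have "\<dots> = 1 / q\<^sup>2 * norm Q + 1 / qt\<^sup>2 * norm Qt" by simp
    also have "\<dots> \<le> 1 / q0\<^sup>2 * D + 1 / q0\<^sup>2 * D" using inv Q q(1) by (intro add_mono mult_mono) auto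
    also have "\<dots> \<le> c" using cn unfolding c by simp
    finally show ?thesis .
  qed
  have c3: "norm ?Rt \<le> c"
  proof -
    have "norm ?Rt = 1 / (2 * qt) * norm Qt" using pos by (simp add: log_grad_def)
    also have "\<dots> \<le> 1 / (2 * q0) * D" using inv Q q(1) by (intro mult_mono) auto
    also have "\<dots> \<le> c" using cn unfolding c by simp
    finally show ?thesis .
  qed
  note err = perturbation_bound[OF A c1 c2 c3, of qt M P Pt J Jt]
  have "min (2 * lam / M) (1 / M\<^sup>2) * ((norm (?R - ?Rt))\<^sup>2 + (q - qt)\<^sup>2) \<le> (1 / q + 1 / qt) * bil m (?R - ?Rt) (?R - ?Rt) + (q - qt)\<^sup>2 / (q * qt)"
    unfolding distrib_left
  proof (intro add_mono)
    have "1 / M + 1 / M \<le> 1 / q + 1 / qt" using q pos by (intro add_mono divide_left_mono) auto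
    then have "(1 / M + 1 / M) * (lam * (norm (?R - ?Rt))\<^sup>2) \<le> (1 / q + 1 / qt) * bil m (?R - ?Rt) (?R - ?Rt)"
      using ell pos by (intro mult_mono) (auto intro: order_trans[OF _ ell(1)] add_nonneg_nonneg)
    moreover have "min (2 * lam / M) (1 / M\<^sup>2) * (norm (?R - ?Rt))\<^sup>2 \<le> (2 * lam / M) * (norm (?R - ?Rt))\<^sup>2"
      by (intro mult_right_mono) auto
    ultimately show "min (2 * lam / M) (1 / M\<^sup>2) * (norm (?R - ?Rt))\<^sup>2 \<le> (1 / q + 1 / qt) * bil m (?R - ?Rt) (?R - ?Rt)"
      by (simp add: field_simps)
    have "min (2 * lam / M) (1 / M\<^sup>2) * (q - qt)\<^sup>2 \<le> (1 / M\<^sup>2) * (q - qt)\<^sup>2"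
      by (intro mult_right_mono) auto
    also have "\<dots> \<le> (1 / (q * qt)) * (q - qt)\<^sup>2"
      using q pos by (intro mult_right_mono divide_left_mono) (auto simp: power2_eq_square intro!: mult_mono)
    finally show "min (2 * lam / M) (1 / M\<^sup>2) * (q - qt)\<^sup>2 \<le> (q - qt)\<^sup>2 / (q * qt)" by simp
  qed
  then have "J\<^sup>2 * (min (2 * lam / M) (1 / M\<^sup>2) * ((norm (?R - ?Rt))\<^sup>2 + (q - qt)\<^sup>2))
     \<le> J\<^sup>2 * ((bil m ?R \<Psi> - bil m ?R ?R * \<psi> - q * \<psi>) - (bil m ?Rt \<Psi> - bil m ?Rt ?Rt * \<psi> - qt * \<psi>))"
    unfolding pic by (rule mult_left_mono) simp
  moreover have "min (2 * lam / M) (1 / M\<^sup>2) * defect v q Q qt Qt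
      = J\<^sup>2 * (min (2 * lam / M) (1 / M\<^sup>2) * ((norm (?R - ?Rt))\<^sup>2 + (q - qt)\<^sup>2))"
    unfolding defect_def J by (rule mult.left_commute)
  ultimately have main: "min (2 * lam / M) (1 / M\<^sup>2) * defect v q Q qt Qt
     \<le> J\<^sup>2 * (bil m ?R \<Psi> - bil m ?R ?R * \<psi> - q * \<psi>) - J\<^sup>2 * (bil m ?Rt \<Psi> - bil m ?Rt ?Rt * \<psi> - qt * \<psi>)"
    unfolding right_diff_distrib[of "J\<^sup>2" "bil m ?R \<Psi> - bil m ?R ?R * \<psi> - q * \<psi>", symmetric]
    by (simp only:)
  have split: "(J\<^sup>2 - Jt\<^sup>2) * (bil m ?Rt \<Psi> - bil m ?Rt ?Rt * \<psi> - qt * \<psi>)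
     = J\<^sup>2 * (bil m ?Rt \<Psi> - bil m ?Rt ?Rt * \<psi> - qt * \<psi>) - Jt\<^sup>2 * (bil m ?Rt \<Psi> - bil m ?Rt ?Rt * \<psi> - qt * \<psi>)"
    by (simp only: left_diff_distrib)
  have "\<bar>qt\<bar> \<le> M" using pos q by simp
  note err = err[OF this]
  have combine: "D \<le> (a1 + b1 + x) - (a2 + b2 + z) + K"
    if "D \<le> x - y" "a1 - a2 + b1 - b2 = e" "\<bar>e + s\<bar> \<le> K" "s = y - z" for D x y a1 a2 b1 b2 e s z K :: real
    using that by linarith
  show ?thesis unfolding G Gt by (rule combine[OF main id err split])
qed

text \<open>\<open>\<nabla> (q - qt) = - 2 q (R - Rt) + ((q - qt) / qt) \<nabla> qt\<close> for \<open>R = - \<nabla> q / (2 q)\<close>.\<close>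

lemma gradient_difference_bound:
  assumes q: "q0 > 0" "q0 \<le> q" "q \<le> M" "q0 \<le> qt" and Q: "norm Qt \<le> D"
  shows "(norm (Q - Qt))\<^sup>2 \<le> (8 * M\<^sup>2 + 2 * (D / q0)\<^sup>2) * ((norm (log_grad q Q - log_grad qt Qt))\<^sup>2 + (q - qt)\<^sup>2)"
proof -
  let ?r = "norm (log_grad q Q - log_grad qt Qt)"
  have pos: "q > 0" "qt > 0" "M > 0" using q by auto
  have eq: "Q - Qt = (- 2 * q) *\<^sub>R (log_grad q Q - log_grad qt Qt) + ((q - qt) / qt) *\<^sub>R Qt"
  proof -
    have "(- 2 * q) *\<^sub>R log_grad q Q = Q" using pos by (simp add: log_grad_def)
    moreover have "(- 2 * q) *\<^sub>R log_grad qt Qt = (q / qt) *\<^sub>R Qt" using pos by (simp add: log_grad_def)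
    moreover have "((q - qt) / qt) *\<^sub>R Qt = (q / qt) *\<^sub>R Qt - Qt" using pos by (simp add: diff_divide_distrib scaleR_diff_left)
    ultimately show ?thesis by (simp only: scaleR_diff_right) simp
  qed
  have D: "D \<ge> 0" using Q norm_ge_zero[of Qt] by linarith
  have "norm (Q - Qt) \<le> norm ((- 2 * q) *\<^sub>R (log_grad q Q - log_grad qt Qt)) + norm (((q - qt) / qt) *\<^sub>R Qt)"
    unfolding eq by (rule norm_triangle_ineq)
  also have "\<dots> = 2 * q * ?r + \<bar>q - qt\<bar> * (norm Qt / qt)" using pos by (simp add: abs_mult)
  also have "\<dots> \<le> 2 * M * ?r + \<bar>q - qt\<bar> * (D / q0)"
    using q pos Q D by (intro add_mono mult_right_mono mult_left_mono frac_le) auto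
  finally have "(norm (Q - Qt))\<^sup>2 \<le> (2 * M * ?r + \<bar>q - qt\<bar> * (D / q0))\<^sup>2" by (intro power_mono) auto
  also have "\<dots> \<le> 2 * (2 * M * ?r)\<^sup>2 + 2 * (\<bar>q - qt\<bar> * (D / q0))\<^sup>2" by (rule square_sum_le)
  also have "\<dots> = 8 * M\<^sup>2 * ?r\<^sup>2 + 2 * (D / q0)\<^sup>2 * (q - qt)\<^sup>2" by (simp add: power_mult_distrib power_divide mult.commute)
  also have "\<dots> \<le> (8 * M\<^sup>2 + 2 * (D / q0)\<^sup>2) * (?r\<^sup>2 + (q - qt)\<^sup>2)"
    by (simp add: algebra_simps)
  finally show ?thesis .
qed

lemma square_le_defect:
  assumes q: "q0 > 0" "q0 \<le> q"
  shows "v\<^sup>2 * ((norm (log_grad q Q - log_grad qt Qt))\<^sup>2 + (q - qt)\<^sup>2) \<le> defect v q Q qt Qt / q0"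
proof -
  let ?X = "(norm (log_grad q Q - log_grad qt Qt))\<^sup>2 + (q - qt)\<^sup>2"
  have "q0 * (v\<^sup>2 * ?X) \<le> q * (v\<^sup>2 * ?X)" using q by (intro mult_right_mono) auto
  also have "\<dots> = defect v q Q qt Qt" using q by (simp add: defect_def power_mult_distrib)
  finally show ?thesis using q(1) by (simp add: field_simps)
qed

text \<open>
  Caccioppoli's inequality: in the equation for \<open>u\<close> tested with \<open>\<eta>\<^sup>2 u\<close>, half of the elliptic term
  absorbs the mixed term, and what remains carries the weight \<open>u\<^sup>2\<close> and is bounded by the defect.
\<close>

lemma pointwise_caccioppoli:
  fixes m :: "real ^ 'n ^ 'n"
  assumes ell: "lam * (norm U)\<^sup>2 \<le> bil m U U" "lam > 0"
    and A: "\<And>\<xi>. norm (m *v \<xi>) \<le> A * norm \<xi>" "A \<ge> 0"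
    and q: "q0 > 0" "q0 \<le> q" "q \<le> M" "q0 \<le> qt" and Q: "norm Qt \<le> D"
  defines "\<eta> \<equiv> q - qt"
  shows "lam / 2 * (\<eta>\<^sup>2 * (norm U)\<^sup>2)
    \<le> (\<eta> * \<eta> * bil m U U + u * bil m U (\<eta> *\<^sub>R (Q - Qt) + \<eta> *\<^sub>R (Q - Qt)) - q * u\<^sup>2 * (\<eta> * \<eta>))
      + (2 * A\<^sup>2 / lam * (8 * M\<^sup>2 + 2 * (D / q0)\<^sup>2) + M) / q0 * defect u q Q qt Qt"
proof -
  let ?C = "8 * M\<^sup>2 + 2 * (D / q0)\<^sup>2"
  let ?X = "(norm (log_grad q Q - log_grad qt Qt))\<^sup>2 + (q - qt)\<^sup>2"
  let ?g = "norm (Q - Qt)"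
  have M: "M > 0" using q by linarith
  \<comment> \<open>Young's inequality, with weights that leave \<open>lam / 2\<close> of the elliptic term.\<close>
  have cross: "\<bar>2 * u * \<eta> * bil m U (Q - Qt)\<bar> \<le> lam / 2 * (\<eta>\<^sup>2 * (norm U)\<^sup>2) + 2 * A\<^sup>2 / lam * (u\<^sup>2 * ?g\<^sup>2)"
  proof -
    have "\<bar>2 * u * \<eta> * bil m U (Q - Qt)\<bar> = 2 * \<bar>u\<bar> * \<bar>\<eta>\<bar> * \<bar>bil m U (Q - Qt)\<bar>" by (simp add: abs_mult)
    also have "\<dots> \<le> 2 * \<bar>u\<bar> * \<bar>\<eta>\<bar> * (A * norm U * ?g)" by (intro mult_left_mono bil_bound A) auto
    also have "\<dots> = 2 * (sqrt (lam / 2) * (\<bar>\<eta>\<bar> * norm U)) * (A * \<bar>u\<bar> * ?g / sqrt (lam / 2))"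
      using ell(2) by (simp add: mult_ac)
    also have "\<dots> \<le> (sqrt (lam / 2) * (\<bar>\<eta>\<bar> * norm U))\<^sup>2 + (A * \<bar>u\<bar> * ?g / sqrt (lam / 2))\<^sup>2"
      by (rule sum_squares_bound)
    also have "\<dots> = lam / 2 * (\<eta>\<^sup>2 * (norm U)\<^sup>2) + 2 * A\<^sup>2 / lam * (u\<^sup>2 * ?g\<^sup>2)"
      using ell(2) by (simp add: power_mult_distrib power_divide)
    finally show ?thesis .
  qed
  have e1: "lam * (\<eta>\<^sup>2 * (norm U)\<^sup>2) \<le> \<eta> * \<eta> * bil m U U"
    using mult_left_mono[OF ell(1), of "\<eta>\<^sup>2"] by (simp add: power2_eq_square mult_ac)
  have e2: "u * bil m U (\<eta> *\<^sub>R (Q - Qt) + \<eta> *\<^sub>R (Q - Qt)) = 2 * u * \<eta> * bil m U (Q - Qt)"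
    by (simp only: bil_linear(4,6)) simp
  have e3: "2 * A\<^sup>2 / lam * (u\<^sup>2 * ?g\<^sup>2) \<le> 2 * A\<^sup>2 / lam * (?C * (u\<^sup>2 * ?X))"
  proof (intro mult_left_mono)
    have "u\<^sup>2 * ?g\<^sup>2 \<le> u\<^sup>2 * (?C * ?X)" by (intro mult_left_mono gradient_difference_bound q Q) auto
    then show "u\<^sup>2 * ?g\<^sup>2 \<le> ?C * (u\<^sup>2 * ?X)" by (simp only: mult.left_commute)
  qed (use ell(2) in auto)
  have e4: "q * u\<^sup>2 * (\<eta> * \<eta>) \<le> M * (u\<^sup>2 * ?X)"
  proof -
    have "q * (u\<^sup>2 * \<eta>\<^sup>2) \<le> M * (u\<^sup>2 * ?X)" unfolding \<eta>_def using q M by (intro mult_mono mult_left_mono) auto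
    then show ?thesis by (simp add: power2_eq_square mult_ac)
  qed
  have "(2 * A\<^sup>2 / lam * ?C + M) * (u\<^sup>2 * ?X) \<le> (2 * A\<^sup>2 / lam * ?C + M) * (defect u q Q qt Qt / q0)"
    using ell(2) M by (intro mult_left_mono square_le_defect q add_nonneg_nonneg mult_nonneg_nonneg) auto
  moreover have "(2 * A\<^sup>2 / lam * ?C + M) * (u\<^sup>2 * ?X) = 2 * A\<^sup>2 / lam * (?C * (u\<^sup>2 * ?X)) + M * (u\<^sup>2 * ?X)"
    by (simp only: distrib_right mult.assoc)
  moreover have "(2 * A\<^sup>2 / lam * ?C + M) / q0 * defect u q Q qt Qt = (2 * A\<^sup>2 / lam * ?C + M) * (defect u q Q qt Qt / q0)"
    by simp
  moreover have "lam / 2 * (\<eta>\<^sup>2 * (norm U)\<^sup>2) + lam / 2 * (\<eta>\<^sup>2 * (norm U)\<^sup>2) = lam * (\<eta>\<^sup>2 * (norm U)\<^sup>2)" by simp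
  ultimately show ?thesis using cross e1 e2 e3 e4 unfolding abs_le_iff by linarith
qed

lemma pointwise_gradient_bound:
  assumes q: "q0 > 0" "q0 \<le> q" "q \<le> M" and Q: "norm Q \<le> D"
    and P: "P = sqrt q *\<^sub>R V + (v / (2 * sqrt q)) *\<^sub>R Q" and V: "norm V \<le> norm U"
  shows "(norm P)\<^sup>2 \<le> 2 * M * (norm U)\<^sup>2 + D\<^sup>2 / q0 * v\<^sup>2"
proof -
  have pos: "q > 0" using q by auto
  have "norm P \<le> norm (sqrt q *\<^sub>R V) + norm ((v / (2 * sqrt q)) *\<^sub>R Q)" unfolding P by (rule norm_triangle_ineq)
  also have "\<dots> = sqrt q * norm V + \<bar>v\<bar> / (2 * sqrt q) * norm Q" using pos by (simp add: abs_mult)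
  finally have "(norm P)\<^sup>2 \<le> (sqrt q * norm V + \<bar>v\<bar> / (2 * sqrt q) * norm Q)\<^sup>2" by (intro power_mono) auto
  also have "\<dots> \<le> 2 * (sqrt q * norm V)\<^sup>2 + 2 * (\<bar>v\<bar> / (2 * sqrt q) * norm Q)\<^sup>2" by (rule square_sum_le)
  also have "\<dots> = 2 * (q * (norm V)\<^sup>2) + (v\<^sup>2 / 2) * ((norm Q)\<^sup>2 / q)"
    using pos by (simp add: power_mult_distrib power_divide)
  also have "\<dots> \<le> 2 * (M * (norm U)\<^sup>2) + v\<^sup>2 * (D\<^sup>2 / q0)"
    using q pos Q V by (intro add_mono mult_left_mono mult_mono power_mono frac_le) auto
  finally show ?thesis by (simp add: mult_ac)
qed

text \<open>
  \<open>\<nabla> (\<eta> J) = \<eta> \<nabla> J + J \<nabla> \<eta>\<close>, where \<open>J \<nabla> \<eta>\<close> is bounded by the defect, and \<open>\<eta> \<nabla> J\<close> by the defect and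
  by \<open>\<eta> \<nabla> u\<close>, which is left to Caccioppoli's inequality.
\<close>

lemma pointwise_target_bound:
  assumes q: "q0 > 0" "q0 \<le> q" "q \<le> M" "q0 \<le> qt" and Q: "norm Q \<le> D" "norm Qt \<le> D"
    and P: "P = sqrt q *\<^sub>R V + (v / (2 * sqrt q)) *\<^sub>R Q" and J: "J = sqrt q * v" and V: "norm V \<le> norm U"
  defines "\<eta> \<equiv> q - qt"
  shows "(\<eta> * J)\<^sup>2 + (norm (\<eta> *\<^sub>R P + J *\<^sub>R (Q - Qt)))\<^sup>2
    \<le> (1 + 4 * M + 2 * (D / q0)\<^sup>2 + 2 * (8 * M\<^sup>2 + 2 * (D / q0)\<^sup>2)) * (defect v q Q qt Qt + \<eta>\<^sup>2 * (norm U)\<^sup>2)"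
proof -
  let ?C = "8 * M\<^sup>2 + 2 * (D / q0)\<^sup>2"
  let ?X = "(norm (log_grad q Q - log_grad qt Qt))\<^sup>2 + (q - qt)\<^sup>2"
  let ?Y = "defect v q Q qt Qt"
  have M: "M > 0" using q by linarith
  have "norm (\<eta> *\<^sub>R P + J *\<^sub>R (Q - Qt)) \<le> \<bar>\<eta>\<bar> * norm P + \<bar>J\<bar> * norm (Q - Qt)"
    using norm_triangle_ineq[of "\<eta> *\<^sub>R P" "J *\<^sub>R (Q - Qt)"] by simp
  then have "(norm (\<eta> *\<^sub>R P + J *\<^sub>R (Q - Qt)))\<^sup>2 \<le> (\<bar>\<eta>\<bar> * norm P + \<bar>J\<bar> * norm (Q - Qt))\<^sup>2" by (intro power_mono) auto
  also have "\<dots> \<le> 2 * (\<bar>\<eta>\<bar> * norm P)\<^sup>2 + 2 * (\<bar>J\<bar> * norm (Q - Qt))\<^sup>2" by (rule square_sum_le)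
  also have "\<dots> = 2 * (\<eta>\<^sup>2 * (norm P)\<^sup>2) + 2 * (J\<^sup>2 * (norm (Q - Qt))\<^sup>2)" by (simp add: power_mult_distrib)
  also have "\<dots> \<le> 2 * (\<eta>\<^sup>2 * (2 * M * (norm U)\<^sup>2 + D\<^sup>2 / q0 * v\<^sup>2)) + 2 * (J\<^sup>2 * (?C * ?X))"
    by (intro add_mono mult_left_mono pointwise_gradient_bound[OF q(1-3) Q(1) P V] gradient_difference_bound[OF q Q(2)]) auto
  also have "\<dots> = 4 * M * (\<eta>\<^sup>2 * (norm U)\<^sup>2) + 2 * D\<^sup>2 / q0 * (v\<^sup>2 * \<eta>\<^sup>2) + 2 * ?C * ?Y"
    by (simp add: defect_def J algebra_simps)
  also have "2 * D\<^sup>2 / q0 * (v\<^sup>2 * \<eta>\<^sup>2) \<le> 2 * D\<^sup>2 / q0 * (?Y / q0)"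
  proof (intro mult_left_mono)
    have "v\<^sup>2 * \<eta>\<^sup>2 \<le> v\<^sup>2 * ?X" unfolding \<eta>_def by (intro mult_left_mono) auto
    also have "\<dots> \<le> ?Y / q0" by (rule square_le_defect[OF q(1,2)])
    finally show "v\<^sup>2 * \<eta>\<^sup>2 \<le> ?Y / q0" .
  qed (use q(1) in auto)
  also have "2 * D\<^sup>2 / q0 * (?Y / q0) = 2 * (D / q0)\<^sup>2 * ?Y" by (simp add: power2_eq_square)
  finally have 1: "(norm (\<eta> *\<^sub>R P + J *\<^sub>R (Q - Qt)))\<^sup>2 \<le> 4 * M * (\<eta>\<^sup>2 * (norm U)\<^sup>2) + 2 * (D / q0)\<^sup>2 * ?Y + 2 * ?C * ?Y"
    by simp
  have 2: "(\<eta> * J)\<^sup>2 \<le> ?Y" unfolding defect_def J \<eta>_def by (simp add: power_mult_distrib mult.commute distrib_left)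
  have Z: "0 \<le> \<eta>\<^sup>2 * (norm U)\<^sup>2" by simp
  have "(\<eta> * J)\<^sup>2 + (norm (\<eta> *\<^sub>R P + J *\<^sub>R (Q - Qt)))\<^sup>2 \<le> (1 + 2 * (D / q0)\<^sup>2 + 2 * ?C) * ?Y + 4 * M * (\<eta>\<^sup>2 * (norm U)\<^sup>2)"
    using 1 2 by (simp only: distrib_right mult_1)
  also have "\<dots> \<le> (1 + 4 * M + 2 * (D / q0)\<^sup>2 + 2 * ?C) * ?Y + (1 + 4 * M + 2 * (D / q0)\<^sup>2 + 2 * ?C) * (\<eta>\<^sup>2 * (norm U)\<^sup>2)"
    using M defect_nonneg[of v q Q qt Qt] by (intro add_mono mult_right_mono Z) auto
  finally show ?thesis by (simp only: distrib_left)
qed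

section \<open>Essentially bounded coefficients\<close>

text \<open>
  The essential supremum of a nonnegative function over a null set would be negative infinity, so it
  matters that a nonempty open set has positive measure.
\<close>

lemma Linf_norm_nonneg:
  fixes \<Omega> :: "(real ^ 'n) set"
  assumes "open \<Omega>" "\<Omega> \<noteq> {}"
  shows "0 \<le> Linf_norm \<Omega> f"
proof (cases "(\<lambda>x. ereal \<bar>f x\<bar>) \<in> borel_measurable (lebesgue_on \<Omega>)")
  case True
  have "emeasure (lebesgue_on \<Omega>) (space (lebesgue_on \<Omega>)) = emeasure lebesgue \<Omega>"
    using assms(1) by (simp add: emeasure_restrict_space)
  moreover have "emeasure lebesgue \<Omega> \<noteq> 0"
  proof
    assume "emeasure lebesgue \<Omega> = 0"
    then have "\<Omega> \<in> null_sets lebesgue" using assms(1) by (simp add: null_sets_def)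
    then show False using open_not_negligible[OF assms] by (simp add: negligible_iff_null_sets)
  qed
  ultimately have "esssup (lebesgue_on \<Omega>) (\<lambda>x. 0 :: ereal) = 0" by (intro esssup_const) simp
  moreover have "esssup (lebesgue_on \<Omega>) (\<lambda>x. 0 :: ereal) \<le> Linf_norm \<Omega> f"
    unfolding Linf_norm_def by (intro esssup_mono) auto
  ultimately show ?thesis by simp
qed (simp add: Linf_norm_def esssup_non_measurable)

lemma Linf_norm_AE: "Linf_norm \<Omega> f \<le> ereal B \<Longrightarrow> AE x in lebesgue_on \<Omega>. \<bar>f x\<bar> \<le> B"
  using esssup_AE[where M = "lebesgue_on \<Omega>" and f = "\<lambda>x. ereal \<bar>f x\<bar>"] unfolding Linf_norm_def
  by (rule eventually_mono) (metis ereal_less_eq(3) order_trans)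

lemma W1inf_weak_deriv:
  assumes "open \<Omega>" "f \<in> W1inf \<Omega>"
  shows "f \<in> borel_measurable (lebesgue_on \<Omega>)" "has_weak_deriv \<Omega> i f (weak_deriv \<Omega> i f)"
    "weak_deriv \<Omega> i f \<in> borel_measurable (lebesgue_on \<Omega>)"
proof -
  have f: "f \<in> Linf \<Omega>" "\<exists>g\<in>Linf \<Omega>. has_weak_deriv \<Omega> i f g" using assms(2) by auto
  then show "f \<in> borel_measurable (lebesgue_on \<Omega>)" by (simp add: Linf_def)
  obtain g where g: "g \<in> Linf \<Omega>" "has_weak_deriv \<Omega> i f g" using f(2) by blast
  show w: "has_weak_deriv \<Omega> i f (weak_deriv \<Omega> i f)"
    unfolding weak_deriv_def by (rule someI[where P = "has_weak_deriv \<Omega> i f", OF g(2)])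
  show "weak_deriv \<Omega> i f \<in> borel_measurable (lebesgue_on \<Omega>)"
    by (rule measurable_cong_AE_lebesgue_on[OF assms(1) _ has_weak_deriv_unique[OF assms(1) g(2) w]])
      (use g(1) in \<open>simp add: Linf_def\<close>)
qed

lemma W1inf_grad_of_W1inf:
  assumes \<Omega>: "open \<Omega>" "\<Omega> \<noteq> {}" and q: "q \<in> W1inf \<Omega>" "W1inf_norm \<Omega> q \<le> ereal M"
  shows "W1inf_grad \<Omega> M q (\<lambda>i. weak_deriv \<Omega> i q)"
proof -
  let ?s = "\<Sum>i\<in>UNIV. Linf_norm \<Omega> (weak_deriv \<Omega> i q)"
  have nn: "0 \<le> Linf_norm \<Omega> q" "0 \<le> Linf_norm \<Omega> (weak_deriv \<Omega> i q)" for i by (intro Linf_norm_nonneg[OF \<Omega>])+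
  have "Linf_norm \<Omega> q + 0 \<le> Linf_norm \<Omega> q + ?s" by (intro add_left_mono sum_nonneg nn)
  then have 1: "Linf_norm \<Omega> q \<le> ereal M" using q(2) by (simp add: W1inf_norm_def)
  have 2: "Linf_norm \<Omega> (weak_deriv \<Omega> i q) \<le> ereal M" for i
  proof -
    have "Linf_norm \<Omega> (weak_deriv \<Omega> i q) \<le> ?s"
      by (subst sum.remove[of _ i]) (auto intro!: add_increasing2 sum_nonneg nn)
    also have "0 + ?s \<le> Linf_norm \<Omega> q + ?s" by (intro add_right_mono nn)
    then have "?s \<le> ereal M" using q(2) by (simp add: W1inf_norm_def)
    finally show ?thesis .
  qed
  show ?thesis
    unfolding W1inf_grad_def using W1inf_weak_deriv[OF \<Omega>(1) q(1)] Linf_norm_AE[OF 1] Linf_norm_AE[OF 2] by blast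
qed

lemma Linf_bounded:
  assumes \<Omega>: "open \<Omega>" "\<Omega> \<noteq> {}" and f: "f \<in> Linf \<Omega>"
  shows "\<exists>B. AE x in lebesgue_on \<Omega>. \<bar>f x\<bar> \<le> B"
proof -
  have "Linf_norm \<Omega> f < \<infinity>" using f by (simp add: Linf_def)
  moreover have "0 \<le> Linf_norm \<Omega> f" by (rule Linf_norm_nonneg[OF \<Omega>])
  ultimately obtain B where "Linf_norm \<Omega> f = ereal B" by (cases "Linf_norm \<Omega> f") auto
  then show ?thesis using Linf_norm_AE[of \<Omega> f B] by auto
qed

lemma bounded_coeff_of_W1inf:
  fixes a :: "real ^ 'n \<Rightarrow> real ^ 'n ^ 'n"
  assumes \<Omega>: "open \<Omega>" "\<Omega> \<noteq> {}" and a: "\<And>i j. (\<lambda>x. a x $ i $ j) \<in> W1inf \<Omega>"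
  obtains A where "A \<ge> 0" "bounded_coeff \<Omega> A a"
proof -
  have L: "(\<lambda>x. a x $ i $ j) \<in> Linf \<Omega>" for i j using a[of i j] by auto
  have "\<exists>B. AE x in lebesgue_on \<Omega>. \<bar>a x $ i $ j\<bar> \<le> B" for i j by (rule Linf_bounded[OF \<Omega> L])
  then obtain B where B: "\<And>i j. AE x in lebesgue_on \<Omega>. \<bar>a x $ i $ j\<bar> \<le> B i j" by metis
  define A where "A = (\<Sum>i\<in>UNIV. \<Sum>j\<in>UNIV. \<bar>B i j\<bar>)"
  have le: "B i j \<le> A" for i j
  proof -
    have "B i j \<le> \<bar>B i j\<bar>" by simp
    also have "\<dots> \<le> (\<Sum>j\<in>UNIV. \<bar>B i j\<bar>)" by (rule member_le_sum) auto
    also have "\<dots> \<le> A" unfolding A_def by (rule member_le_sum[of i UNIV "\<lambda>i. \<Sum>j\<in>UNIV. \<bar>B i j\<bar>"]) (auto intro: sum_nonneg)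
    finally show ?thesis .
  qed
  have "AE x in lebesgue_on \<Omega>. \<bar>a x $ i $ j\<bar> \<le> A" for i j
    using B[of i j] by eventually_elim (use le[of i j] in linarith)
  then have "bounded_coeff \<Omega> A a" using L by (auto simp: bounded_coeff_def Linf_def)
  moreover have "A \<ge> 0" unfolding A_def by (intro sum_nonneg) auto
  ultimately show ?thesis using that by blast
qed

lemma bounded_coeff_norm:
  fixes a :: "real ^ 'n \<Rightarrow> real ^ 'n ^ 'n"
  assumes "bounded_coeff \<Omega> A a"
  shows "AE x in lebesgue_on \<Omega>. \<forall>\<xi>. norm (a x *v \<xi>) \<le> (real CARD('n))\<^sup>2 * A * norm \<xi>"
proof -
  have "AE x in lebesgue_on \<Omega>. \<forall>i j. \<bar>a x $ i $ j\<bar> \<le> A"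
    using assms by (simp add: bounded_coeff_def AE_all_countable)
  then show ?thesis
  proof eventually_elim
    case (elim x)
    show ?case
    proof
      fix \<xi> :: "real ^ 'n"
      have "norm (a x *v \<xi>) \<le> (\<Sum>i\<in>UNIV. \<bar>(a x *v \<xi>) $ i\<bar>)" by (rule norm_le_l1_cart)
      also have "\<dots> \<le> (\<Sum>i\<in>(UNIV :: 'n set). \<Sum>j\<in>(UNIV :: 'n set). A * norm \<xi>)"
      proof (rule sum_mono)
        fix i
        have "\<bar>(a x *v \<xi>) $ i\<bar> \<le> (\<Sum>j\<in>UNIV. \<bar>a x $ i $ j * \<xi> $ j\<bar>)"
          by (simp add: matrix_vector_mult_def sum_abs)
        also have "\<dots> \<le> (\<Sum>j\<in>(UNIV :: 'n set). A * norm \<xi>)"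
          unfolding abs_mult using elim component_le_norm_cart[of \<xi>] by (intro sum_mono mult_mono) (auto intro: order_trans[OF abs_ge_zero])
        finally show "\<bar>(a x *v \<xi>) $ i\<bar> \<le> (\<Sum>j\<in>(UNIV :: 'n set). A * norm \<xi>)" .
      qed
      also have "\<dots> = (real CARD('n))\<^sup>2 * A * norm \<xi>" by (simp add: power2_eq_square mult_ac)
      finally show "norm (a x *v \<xi>) \<le> (real CARD('n))\<^sup>2 * A * norm \<xi>" .
    qed
  qed
qed

section \<open>The weighted stability estimate\<close>

lemma energy_balance:
  fixes a :: "real ^ 'n \<Rightarrow> real ^ 'n ^ 'n"
  assumes \<Omega>: "open \<Omega>" "bounded \<Omega>" and a: "bounded_coeff \<Omega> A a"
    and q: "q \<in> borel_measurable (lebesgue_on \<Omega>)" "AE x in lebesgue_on \<Omega>. \<bar>q x\<bar> \<le> Mq"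
    and u: "H1_grad \<Omega> u U"
    and eq: "\<And>v V. H10_grad \<Omega> v V \<Longrightarrow>
       (LINT x|lebesgue_on \<Omega>. bil (a x) (vec_of U x) (vec_of V x)) = (LINT x|lebesgue_on \<Omega>. q x * u x * v x)"
    and \<phi>: "W1inf_grad \<Omega> B \<phi> \<Phi>" "H10_grad \<Omega> \<phi> \<Phi>"
  shows "integrable (lebesgue_on \<Omega>) (\<lambda>x. \<phi> x * bil (a x) (vec_of U x) (vec_of U x) + u x * bil (a x) (vec_of U x) (vec_of \<Phi> x) - q x * (u x)\<^sup>2 * \<phi> x)"
    and "(LINT x|lebesgue_on \<Omega>. \<phi> x * bil (a x) (vec_of U x) (vec_of U x) + u x * bil (a x) (vec_of U x) (vec_of \<Phi> x) - q x * (u x)\<^sup>2 * \<phi> x) = 0"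
proof -
  note e = energy_identity[OF \<Omega> a q u eq[unfolded bil_def] \<phi>]
  show "integrable (lebesgue_on \<Omega>) (\<lambda>x. \<phi> x * bil (a x) (vec_of U x) (vec_of U x) + u x * bil (a x) (vec_of U x) (vec_of \<Phi> x) - q x * (u x)\<^sup>2 * \<phi> x)"
    unfolding bil_def by (rule Bochner_Integration.integrable_diff[OF e(1,2)])
  show "(LINT x|lebesgue_on \<Omega>. \<phi> x * bil (a x) (vec_of U x) (vec_of U x) + u x * bil (a x) (vec_of U x) (vec_of \<Phi> x) - q x * (u x)\<^sup>2 * \<phi> x) = 0"
    unfolding bil_def using Bochner_Integration.integral_diff[OF e(1,2)] e(3) by linarith
qed

lemma W1inf_grad_sqrt:
  assumes \<Omega>: "open \<Omega>" "bounded \<Omega>" and q: "W1inf_grad \<Omega> M q Q" and lower: "AE x in lebesgue_on \<Omega>. q0 \<le> q x" "q0 > 0" and M: "M > 0"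
  obtains B where "W1inf_grad \<Omega> B (\<lambda>x. sqrt (q x)) (\<lambda>i x. inverse (sqrt (q x)) / 2 * Q i x)"
proof -
  have "W1inf_grad \<Omega> (sqrt M + inverse (sqrt q0) / 2 * M) (\<lambda>x. sqrt (q x)) (\<lambda>i x. inverse (sqrt (q x)) / 2 * Q i x)"
  proof (rule W1inf_grad_compose[OF \<Omega> q lower(1)])
    fix t assume t: "q0 \<le> t"
    show "(sqrt has_real_derivative inverse (sqrt t) / 2) (at t)" using t lower(2) by (intro DERIV_real_sqrt) simp
    show "\<bar>inverse (sqrt t) / 2\<bar> \<le> inverse (sqrt q0) / 2"
      using t lower(2) by (simp add: le_imp_inverse_le)
    show "t \<le> M \<Longrightarrow> \<bar>sqrt t\<bar> \<le> sqrt M + inverse (sqrt q0) / 2 * M"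
    proof -
      assume "t \<le> M"
      then have "\<bar>sqrt t\<bar> \<le> sqrt M" using t lower(2) by simp
      moreover have "0 \<le> inverse (sqrt q0) / 2 * M" using lower(2) M by simp
      ultimately show ?thesis by linarith
    qed
  next
    show "continuous_on {q0..} (\<lambda>t. inverse (sqrt t) / 2)"
      by (intro continuous_intros) (use lower(2) in auto)
    show "inverse (sqrt q0) / 2 * M \<le> sqrt M + inverse (sqrt q0) / 2 * M" using M by simp
  qed
  then show ?thesis by (rule that)
qed

lemma W1inf_grad_inverse:
  assumes \<Omega>: "open \<Omega>" "bounded \<Omega>" and q: "W1inf_grad \<Omega> M q Q" and lower: "AE x in lebesgue_on \<Omega>. q0 \<le> q x" "q0 > 0" and M: "M > 0"
  obtains B where "W1inf_grad \<Omega> B (\<lambda>x. 1 / q x) (\<lambda>i x. - 1 / (q x)\<^sup>2 * Q i x)"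
proof -
  have "W1inf_grad \<Omega> (1 / q0 + 1 / q0\<^sup>2 * M) (\<lambda>x. 1 / q x) (\<lambda>i x. - 1 / (q x)\<^sup>2 * Q i x)"
  proof (rule W1inf_grad_compose[OF \<Omega> q lower(1), of "\<lambda>t. 1 / t" "\<lambda>t. - 1 / t\<^sup>2" "1 / q0\<^sup>2"])
    fix t assume t: "q0 \<le> t"
    show "((\<lambda>t. 1 / t) has_real_derivative - 1 / t\<^sup>2) (at t)"
      using t lower(2) by (auto intro!: derivative_eq_intros simp: power2_eq_square)
    show "\<bar>- 1 / t\<^sup>2\<bar> \<le> 1 / q0\<^sup>2"
      using t lower(2) by (auto simp: abs_divide intro!: divide_left_mono power_mono)
    show "\<bar>1 / t\<bar> \<le> 1 / q0 + 1 / q0\<^sup>2 * M"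
    proof -
      have "\<bar>1 / t\<bar> \<le> 1 / q0" using t lower(2) by (auto intro!: divide_left_mono)
      moreover have "0 \<le> 1 / q0\<^sup>2 * M" using M by simp
      ultimately show ?thesis by linarith
    qed
  next
    show "continuous_on {q0..} (\<lambda>t. - 1 / t\<^sup>2)"
      by (intro continuous_intros) (use lower(2) in auto)
    show "1 / q0\<^sup>2 * M \<le> 1 / q0 + 1 / q0\<^sup>2 * M" using lower(2) by simp
  qed
  then show ?thesis by (rule that)
qed

lemma vec_of_scaled_add: "vec_of (\<lambda>i x. c x * U i x + V i x * d x) x = c x *\<^sub>R vec_of U x + d x *\<^sub>R vec_of V x"
  by (simp add: vec_of_def vec_eq_iff)

lemma norm_vec_of_le:
  fixes U :: "'n::finite \<Rightarrow> 'a \<Rightarrow> real"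
  assumes "\<forall>i. \<bar>U i x\<bar> \<le> M"
  shows "norm (vec_of U x) \<le> real CARD('n) * M"
proof -
  have "norm (vec_of U x) \<le> (\<Sum>i\<in>UNIV. \<bar>vec_of U x $ i\<bar>)" by (rule norm_le_l1_cart)
  also have "\<dots> \<le> (\<Sum>i\<in>(UNIV :: 'n set). M)" using assms by (intro sum_mono) (simp add: vec_of_def)
  finally show ?thesis by simp
qed

text \<open>
  What the stability estimate uses of a coefficient \<open>q\<close> and a solution \<open>u\<close>: the bounds are the same
  throughout the class, and the constant of the estimate depends on them alone.
\<close>

definition admissible ::
  "(real ^ 'n) set \<Rightarrow> (real ^ 'n \<Rightarrow> real ^ 'n ^ 'n) \<Rightarrow> real \<Rightarrow> real \<Rightarrow> real \<Rightarrow> (real ^ 'n \<Rightarrow> real) \<Rightarrow> ('n \<Rightarrow> real ^ 'n \<Rightarrow> real) \<Rightarrow>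
   (real ^ 'n \<Rightarrow> real) \<Rightarrow> ('n \<Rightarrow> real ^ 'n \<Rightarrow> real) \<Rightarrow> bool" where
  "admissible \<Omega> a q0 M K q Q u U \<longleftrightarrow> W1inf_grad \<Omega> M q Q \<and> (AE x in lebesgue_on \<Omega>. q0 \<le> q x) \<and> H1_grad \<Omega> u U \<and>
     (LINT x|lebesgue_on \<Omega>. (u x)\<^sup>2) \<le> K \<and> (LINT x|lebesgue_on \<Omega>. (norm (vec_of U x))\<^sup>2) \<le> K \<and>
     (\<forall>v V. H10_grad \<Omega> v V \<longrightarrow>
       (LINT x|lebesgue_on \<Omega>. bil (a x) (vec_of U x) (vec_of V x)) = (LINT x|lebesgue_on \<Omega>. q x * u x * v x))"

lemma admissibleD:
  assumes "admissible \<Omega> a q0 M K q Q u U"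
  shows "W1inf_grad \<Omega> M q Q" "AE x in lebesgue_on \<Omega>. q0 \<le> q x" "H1_grad \<Omega> u U"
    "(LINT x|lebesgue_on \<Omega>. (u x)\<^sup>2) \<le> K" "(LINT x|lebesgue_on \<Omega>. (norm (vec_of U x))\<^sup>2) \<le> K"
    "H10_grad \<Omega> v V \<Longrightarrow>
      (LINT x|lebesgue_on \<Omega>. bil (a x) (vec_of U x) (vec_of V x)) = (LINT x|lebesgue_on \<Omega>. q x * u x * v x)"
  using assms unfolding admissible_def by blast+

text \<open>The gradient of \<open>sqrt q * |u|\<close>.\<close>

definition data_grad :: "('a \<Rightarrow> real) \<Rightarrow> ('n \<Rightarrow> 'a \<Rightarrow> real) \<Rightarrow> ('a \<Rightarrow> real) \<Rightarrow> ('n \<Rightarrow> 'a \<Rightarrow> real) \<Rightarrow> 'n \<Rightarrow> 'a \<Rightarrow> real" where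
  "data_grad q Q u U i x = sqrt (q x) * (sgn (u x) * U i x) + inverse (sqrt (q x)) / 2 * Q i x * \<bar>u x\<bar>"

lemma admissible_data:
  assumes \<Omega>: "open \<Omega>" "bounded \<Omega>" and c: "q0 > 0" "M > 0" and ad: "admissible \<Omega> a q0 M K q Q u U"
  shows "H1_grad \<Omega> (\<lambda>x. sqrt (q x) * \<bar>u x\<bar>) (data_grad q Q u U)"
proof -
  note q = admissibleD[OF ad]
  obtain B where B: "W1inf_grad \<Omega> B (\<lambda>x. sqrt (q x)) (\<lambda>i x. inverse (sqrt (q x)) / 2 * Q i x)"
    by (rule W1inf_grad_sqrt[OF \<Omega> q(1,2) c])
  note H1_grad_mult_W1inf[OF \<Omega>(1) B H1_grad_abs[OF \<Omega>(1) q(3)]]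
  then show ?thesis unfolding data_grad_def[abs_def] .
qed

lemma vec_of_data_grad:
  "vec_of (data_grad q Q u U) x = sqrt (q x) *\<^sub>R (sgn (u x) *\<^sub>R vec_of U x) + (\<bar>u x\<bar> / (2 * sqrt (q x))) *\<^sub>R vec_of Q x"
proof (subst vec_eq_iff, rule allI)
  fix i
  have "inverse (sqrt (q x)) / 2 * Q i x * \<bar>u x\<bar> = \<bar>u x\<bar> / (2 * sqrt (q x)) * Q i x" by (simp add: field_simps)
  then show "vec_of (data_grad q Q u U) x $ i = (sqrt (q x) *\<^sub>R (sgn (u x) *\<^sub>R vec_of U x) + (\<bar>u x\<bar> / (2 * sqrt (q x))) *\<^sub>R vec_of Q x) $ i"
    by (simp only: vec_of_def data_grad_def vec_lambda_beta vector_add_component vector_scaleR_component real_scaleR_def)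
qed

lemma admissible_data_bound:
  assumes \<Omega>: "open \<Omega>" "bounded \<Omega>" and c: "q0 > 0" "M > 0" and ad: "admissible \<Omega> a q0 M K q (Q :: 'n \<Rightarrow> real ^ 'n \<Rightarrow> real) u U"
  defines "D \<equiv> real CARD('n) * M"
  shows "(LINT x|lebesgue_on \<Omega>. (sqrt (q x) * \<bar>u x\<bar>)\<^sup>2) \<le> M * K"
    and "(LINT x|lebesgue_on \<Omega>. (norm (vec_of (data_grad q Q u U) x))\<^sup>2) \<le> 2 * M * K + D\<^sup>2 / q0 * K"
proof -
  let ?M = "lebesgue_on \<Omega>"
  note q = admissibleD[OF ad]
  note U = H1_gradD[OF q(3)]
  have iU: "integrable ?M (\<lambda>x. (norm (vec_of U x))\<^sup>2)" by (rule square_integrable_norm_vec(2)) (rule U(2))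
  note P = H1_gradD[OF admissible_data[OF \<Omega> c ad]]
  have Qb: "AE x in ?M. norm (vec_of Q x) \<le> D"
  proof -
    have "AE x in ?M. \<forall>i. \<bar>Q i x\<bar> \<le> M" using W1inf_gradD(4)[OF q(1)] by (simp add: AE_all_countable)
    then show ?thesis unfolding D_def by eventually_elim (rule norm_vec_of_le)
  qed
  have "(LINT x|?M. (sqrt (q x) * \<bar>u x\<bar>)\<^sup>2) \<le> (LINT x|?M. M * (u x)\<^sup>2)"
  proof (rule integral_mono_AE[OF square_integrableD[OF P(1)]])
    show "integrable ?M (\<lambda>x. M * (u x)\<^sup>2)" using square_integrableD[OF U(1)] by simp
    show "AE x in ?M. (sqrt (q x) * \<bar>u x\<bar>)\<^sup>2 \<le> M * (u x)\<^sup>2"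
      using q(2) W1inf_gradD(2)[OF q(1)]
    proof eventually_elim
      case (elim x)
      then have "q x * (u x)\<^sup>2 \<le> M * (u x)\<^sup>2" by (intro mult_right_mono) auto
      then show ?case using elim c by (simp add: power_mult_distrib)
    qed
  qed
  also have "\<dots> = M * (LINT x|?M. (u x)\<^sup>2)" by simp
  also have "\<dots> \<le> M * K" using q(4) c by simp
  finally show "(LINT x|?M. (sqrt (q x) * \<bar>u x\<bar>)\<^sup>2) \<le> M * K" .
  have "(LINT x|?M. (norm (vec_of (data_grad q Q u U) x))\<^sup>2) \<le> (LINT x|?M. 2 * M * (norm (vec_of U x))\<^sup>2 + D\<^sup>2 / q0 * (u x)\<^sup>2)"
  proof (rule integral_mono_AE[OF square_integrable_norm_vec(2)[OF P(2)]])
    show "integrable ?M (\<lambda>x. 2 * M * (norm (vec_of U x))\<^sup>2 + D\<^sup>2 / q0 * (u x)\<^sup>2)"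
      by (intro Bochner_Integration.integrable_add integrable_mult_right square_integrable_norm_vec(2) square_integrableD U)
    show "AE x in ?M. (norm (vec_of (data_grad q Q u U) x))\<^sup>2 \<le> 2 * M * (norm (vec_of U x))\<^sup>2 + D\<^sup>2 / q0 * (u x)\<^sup>2"
      using q(2) W1inf_gradD(2)[OF q(1)] Qb
    proof eventually_elim
      case (elim x)
      have le: "q x \<le> M" using elim(2) by simp
      have n: "norm (sgn (u x) *\<^sub>R vec_of U x) \<le> norm (vec_of U x)" by (simp add: sgn_if)
      have "(norm (vec_of (data_grad q Q u U) x))\<^sup>2 \<le> 2 * M * (norm (vec_of U x))\<^sup>2 + D\<^sup>2 / q0 * \<bar>u x\<bar>\<^sup>2"
        by (rule pointwise_gradient_bound[OF c(1) elim(1) le elim(3) vec_of_data_grad[of q Q u U x] n])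
      then show ?case by simp
    qed
  qed
  also have "\<dots> = 2 * M * (LINT x|?M. (norm (vec_of U x))\<^sup>2) + D\<^sup>2 / q0 * (LINT x|?M. (u x)\<^sup>2)"
    using iU square_integrableD[OF U(1)] by simp
  also have "\<dots> \<le> 2 * M * K + D\<^sup>2 / q0 * K" using q(4,5) c by (intro add_mono mult_left_mono) auto
  finally show "(LINT x|?M. (norm (vec_of (data_grad q Q u U) x))\<^sup>2) \<le> 2 * M * K + D\<^sup>2 / q0 * K" .
qed

lemma admissible_AE:
  fixes Q :: "'n \<Rightarrow> real ^ 'n \<Rightarrow> real"
  assumes \<Omega>: "open \<Omega>" and ad: "admissible \<Omega> a q0 M K q Q u U"
  shows "AE x in lebesgue_on \<Omega>. x \<in> \<Omega> \<and> q0 \<le> q x \<and> q x \<le> M \<and> norm (vec_of Q x) \<le> real CARD('n) * M \<and> (u x = 0 \<longrightarrow> vec_of U x = 0)"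
proof -
  note q = admissibleD[OF ad]
  have 1: "AE x in lebesgue_on \<Omega>. x \<in> \<Omega>" by (rule AE_I2) simp
  have 2: "AE x in lebesgue_on \<Omega>. \<forall>i. \<bar>Q i x\<bar> \<le> M" using W1inf_gradD(4)[OF q(1)] by (simp add: AE_all_countable)
  have 3: "AE x in lebesgue_on \<Omega>. \<forall>i. u x = 0 \<longrightarrow> U i x = 0" unfolding AE_all_countable by (intro allI weak_deriv_zero_set[OF \<Omega> q(3)])
  show ?thesis
    using 1 q(2) W1inf_gradD(2)[OF q(1)] 2 3
  proof eventually_elim
    case (elim x)
    have "norm (vec_of Q x) \<le> real CARD('n) * M" by (rule norm_vec_of_le[where U = Q and x = x, OF elim(4)])
    moreover have "u x = 0 \<longrightarrow> vec_of U x = 0" using elim(5) by (simp add: vec_of_def vec_eq_iff)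
    ultimately show ?case using elim(1-3) by (auto simp: abs_le_iff)
  qed
qed

text \<open>
  The data contain \<open>|u|\<close>, with the gradient \<open>sgn u * \<nabla> u\<close>. The energy density does not see the sign,
  because \<open>\<nabla> u = 0\<close> almost everywhere on the zero set of \<open>u\<close>.
\<close>

lemma bil_sgn:
  assumes "t = 0 \<longrightarrow> U = 0"
  shows "bil m (sgn t *\<^sub>R U) (sgn t *\<^sub>R U) = bil m U U" "\<bar>t\<bar> * bil m (sgn t *\<^sub>R U) X = t * bil m U X"
proof -
  have s: "sgn t * sgn t = 1" "\<bar>t\<bar> * sgn t = t" if "t \<noteq> 0" using that by (auto simp: sgn_if)
  show "bil m (sgn t *\<^sub>R U) (sgn t *\<^sub>R U) = bil m U U"
  proof (cases "t = 0")
    case False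
    then show ?thesis using s(1) by (simp only: bil_linear flip: mult.assoc) simp
  qed (use assms in simp)
  show "\<bar>t\<bar> * bil m (sgn t *\<^sub>R U) X = t * bil m U X"
  proof (cases "t = 0")
    case False
    then show ?thesis by (simp only: bil_linear s(2)[OF False] flip: mult.assoc)
  qed simp
qed

text \<open>
  With \<open>r\<close> one of the two coefficients and \<open>s\<close> the other one, \<open>r * (1 / q - 1 / qt) = - (q - qt) / s\<close>.
  The left-hand side has the gradient that is convenient for computation, and the right-hand side
  shows that the boundary values vanish.
\<close>

lemma quotient_test_function:
  fixes \<Omega> :: "(real ^ 'n) set"
  assumes \<Omega>: "open \<Omega>" "bounded \<Omega>" and c: "q0 > 0" "M > 0"
    and q: "W1inf_grad \<Omega> M q Q" "AE x in lebesgue_on \<Omega>. q0 \<le> q x"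
    and qt: "W1inf_grad \<Omega> M qt Qt" "AE x in lebesgue_on \<Omega>. q0 \<le> qt x"
    and r: "W1inf_grad \<Omega> M r R" and s: "W1inf_grad \<Omega> M s S" "AE x in lebesgue_on \<Omega>. q0 \<le> s x"
    and \<eta>: "H10_grad \<Omega> (\<lambda>x. q x - qt x) G"
    and eq: "AE x in lebesgue_on \<Omega>. - 1 * (1 / s x * (q x - qt x)) = r x * (1 / q x - 1 / qt x)"
  defines "\<Psi> \<equiv> \<lambda>i x. - 1 / (q x)\<^sup>2 * Q i x - - 1 / (qt x)\<^sup>2 * Qt i x"
  obtains B where "W1inf_grad \<Omega> B (\<lambda>x. r x * (1 / q x - 1 / qt x)) (\<lambda>i x. r x * \<Psi> i x + R i x * (1 / q x - 1 / qt x))"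
    "H10_grad \<Omega> (\<lambda>x. r x * (1 / q x - 1 / qt x)) (\<lambda>i x. r x * \<Psi> i x + R i x * (1 / q x - 1 / qt x))"
proof -
  obtain B1 where B1: "W1inf_grad \<Omega> B1 (\<lambda>x. 1 / q x) (\<lambda>i x. - 1 / (q x)\<^sup>2 * Q i x)"
    by (rule W1inf_grad_inverse[OF \<Omega> q c])
  obtain B2 where B2: "W1inf_grad \<Omega> B2 (\<lambda>x. 1 / qt x) (\<lambda>i x. - 1 / (qt x)\<^sup>2 * Qt i x)"
    by (rule W1inf_grad_inverse[OF \<Omega> qt c])
  obtain B3 where B3: "W1inf_grad \<Omega> B3 (\<lambda>x. 1 / s x) (\<lambda>i x. - 1 / (s x)\<^sup>2 * S i x)"
    by (rule W1inf_grad_inverse[OF \<Omega> s c])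
  note W = W1inf_grad_mult[OF \<Omega>(1) r W1inf_grad_diff[OF \<Omega>(1) B1 B2]]
  note H = H10_grad_cmult[OF H10_grad_mult_W1inf[OF \<Omega>(1) \<eta> B3], of "- 1"]
  show ?thesis by (rule that[unfolded \<Psi>_def, OF W H10_grad_cong[OF \<Omega>(1) H W1inf_grad_H1[OF \<Omega> W] eq]])
qed

lemma power2_sum4_le: "(a + b + c + d)\<^sup>2 \<le> 4 * (a\<^sup>2 + b\<^sup>2 + c\<^sup>2 + (d::real)\<^sup>2)"
proof -
  have "(a + b + c + d)\<^sup>2 = ((a + b) + (c + d))\<^sup>2" by (simp add: add.assoc)
  also have "\<dots> \<le> 2 * (a + b)\<^sup>2 + 2 * (c + d)\<^sup>2" by (rule square_sum_le)
  also have "\<dots> \<le> 2 * (2 * a\<^sup>2 + 2 * b\<^sup>2) + 2 * (2 * c\<^sup>2 + 2 * d\<^sup>2)" by (intro add_mono mult_left_mono square_sum_le) auto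
  finally show ?thesis by simp
qed

lemma H1_norm_vec:
  fixes \<Omega> :: "(real ^ 'n) set"
  assumes "open \<Omega>" "H1_grad \<Omega> f g"
  shows "H1_norm \<Omega> f = sqrt ((LINT x|lebesgue_on \<Omega>. (f x)\<^sup>2) + (LINT x|lebesgue_on \<Omega>. (norm (vec_of g x))\<^sup>2))"
  unfolding H1_norm_eq[OF assms] by (subst square_integrable_norm_vec(3)) (rule H1_gradD[OF assms(2)], rule refl)

text \<open>
  By the Cauchy--Schwarz inequality the error term of \<open>pointwise_defect_bound\<close> is of first order in the
  distance of the data.
\<close>

lemma data_product_integral:
  fixes \<Omega> :: "(real ^ 'n) set"
  assumes \<Omega>: "open \<Omega>" "bounded \<Omega>"
    and J: "H1_grad \<Omega> J P" "(LINT x|lebesgue_on \<Omega>. (J x)\<^sup>2) \<le> k1" "(LINT x|lebesgue_on \<Omega>. (norm (vec_of P x))\<^sup>2) \<le> k2"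
    and Jt: "H1_grad \<Omega> Jt Pt" "(LINT x|lebesgue_on \<Omega>. (Jt x)\<^sup>2) \<le> k1" "(LINT x|lebesgue_on \<Omega>. (norm (vec_of Pt x))\<^sup>2) \<le> k2"
  defines "m \<equiv> \<lambda>x. \<bar>J x - Jt x\<bar> + norm (vec_of P x - vec_of Pt x)"
    and "n \<equiv> \<lambda>x. \<bar>J x\<bar> + \<bar>Jt x\<bar> + norm (vec_of P x) + norm (vec_of Pt x)"
  shows "integrable (lebesgue_on \<Omega>) (\<lambda>x. m x * n x)"
    and "(LINT x|lebesgue_on \<Omega>. m x * n x) \<le> sqrt (2 * (8 * (k1 + k2))) * H1_norm \<Omega> (\<lambda>x. J x - Jt x)"
proof -
  let ?M = "lebesgue_on \<Omega>"
  note d = H1_grad_diff[OF \<Omega>(1) J(1) Jt(1)]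
  note j = H1_gradD[OF J(1)] and jt = H1_gradD[OF Jt(1)] and dd = H1_gradD[OF d]
  have vP: "square_integrable ?M (\<lambda>x. norm (vec_of P x))" by (rule square_integrable_norm_vec(1)) (rule j(2))
  have vPt: "square_integrable ?M (\<lambda>x. norm (vec_of Pt x))" by (rule square_integrable_norm_vec(1)) (rule jt(2))
  have vd: "square_integrable ?M (\<lambda>x. norm (vec_of (\<lambda>i x. P i x - Pt i x) x))" by (rule square_integrable_norm_vec(1)) (rule dd(2))
  then have vd': "square_integrable ?M (\<lambda>x. norm (vec_of P x - vec_of Pt x))" by (simp only: vec_of_diff)
  have m: "square_integrable ?M m" unfolding m_def by (intro square_integrable_add square_integrable_abs vd' dd(1))
  have n: "square_integrable ?M n" unfolding n_def by (intro square_integrable_add square_integrable_abs vP vPt j(1) jt(1))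
  show "integrable ?M (\<lambda>x. m x * n x)" by (rule integrable_mult_square_integrable[OF m n])
  have "(LINT x|?M. (m x)\<^sup>2) \<le> (LINT x|?M. 2 * (J x - Jt x)\<^sup>2 + 2 * (norm (vec_of P x - vec_of Pt x))\<^sup>2)"
  proof (rule integral_mono[OF square_integrableD[OF m]])
    show "integrable ?M (\<lambda>x. 2 * (J x - Jt x)\<^sup>2 + 2 * (norm (vec_of P x - vec_of Pt x))\<^sup>2)"
      by (intro Bochner_Integration.integrable_add integrable_mult_right square_integrableD vd' dd(1))
    show "(m x)\<^sup>2 \<le> 2 * (J x - Jt x)\<^sup>2 + 2 * (norm (vec_of P x - vec_of Pt x))\<^sup>2" for x
      using square_sum_le[of "\<bar>J x - Jt x\<bar>" "norm (vec_of P x - vec_of Pt x)"] by (simp add: m_def)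
  qed
  also have "\<dots> = 2 * (LINT x|?M. (J x - Jt x)\<^sup>2) + 2 * (LINT x|?M. (norm (vec_of P x - vec_of Pt x))\<^sup>2)"
    using square_integrableD[OF dd(1)] square_integrableD[OF vd'] by simp
  also have "\<dots> = 2 * (H1_norm \<Omega> (\<lambda>x. J x - Jt x))\<^sup>2"
    unfolding H1_norm_vec[OF \<Omega>(1) d] by (simp add: vec_of_diff)
  finally have im: "(LINT x|?M. (m x)\<^sup>2) \<le> 2 * (H1_norm \<Omega> (\<lambda>x. J x - Jt x))\<^sup>2" .
  have "(LINT x|?M. (n x)\<^sup>2) \<le> (LINT x|?M. 4 * ((J x)\<^sup>2 + (Jt x)\<^sup>2 + (norm (vec_of P x))\<^sup>2 + (norm (vec_of Pt x))\<^sup>2))"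
  proof (rule integral_mono[OF square_integrableD[OF n]])
    show "integrable ?M (\<lambda>x. 4 * ((J x)\<^sup>2 + (Jt x)\<^sup>2 + (norm (vec_of P x))\<^sup>2 + (norm (vec_of Pt x))\<^sup>2))"
      by (intro Bochner_Integration.integrable_add integrable_mult_right square_integrableD vP vPt j(1) jt(1))
    show "(n x)\<^sup>2 \<le> 4 * ((J x)\<^sup>2 + (Jt x)\<^sup>2 + (norm (vec_of P x))\<^sup>2 + (norm (vec_of Pt x))\<^sup>2)" for x
      using power2_sum4_le[of "\<bar>J x\<bar>" "\<bar>Jt x\<bar>" "norm (vec_of P x)" "norm (vec_of Pt x)"] by (simp add: n_def)
  qed
  also have "\<dots> = 4 * ((LINT x|?M. (J x)\<^sup>2) + (LINT x|?M. (Jt x)\<^sup>2) + (LINT x|?M. (norm (vec_of P x))\<^sup>2) + (LINT x|?M. (norm (vec_of Pt x))\<^sup>2))"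
    using square_integrableD[OF j(1)] square_integrableD[OF jt(1)] square_integrableD[OF vP] square_integrableD[OF vPt] by simp
  also have "\<dots> \<le> 8 * (k1 + k2)" using J(2,3) Jt(2,3) by simp
  finally have inn: "(LINT x|?M. (n x)\<^sup>2) \<le> 8 * (k1 + k2)" .
  have k: "0 \<le> 8 * (k1 + k2)"
    by (rule order_trans[OF _ inn]) simp
  have "(LINT x|?M. m x * n x) \<le> sqrt (LINT x|?M. (m x)\<^sup>2) * sqrt (LINT x|?M. (n x)\<^sup>2)"
    using abs_integral_mult_le[OF m n] by linarith
  also have "\<dots> \<le> sqrt (2 * (H1_norm \<Omega> (\<lambda>x. J x - Jt x))\<^sup>2) * sqrt (8 * (k1 + k2))"
    using im inn k by (intro mult_mono) auto
  also have "\<dots> = sqrt (2 * (8 * (k1 + k2))) * \<bar>H1_norm \<Omega> (\<lambda>x. J x - Jt x)\<bar>"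
    by (simp only: real_sqrt_mult real_sqrt_abs mult_ac)
  also have "\<bar>H1_norm \<Omega> (\<lambda>x. J x - Jt x)\<bar> = H1_norm \<Omega> (\<lambda>x. J x - Jt x)"
    unfolding H1_norm_vec[OF \<Omega>(1) d] by simp
  finally show "(LINT x|?M. m x * n x) \<le> sqrt (2 * (8 * (k1 + k2))) * H1_norm \<Omega> (\<lambda>x. J x - Jt x)" .
qed

lemma defect_measurable:
  fixes Q Qt :: "'n::finite \<Rightarrow> 'a \<Rightarrow> real"
  assumes [measurable]: "u \<in> borel_measurable M" "q \<in> borel_measurable M" "qt \<in> borel_measurable M"
    "\<And>i. Q i \<in> borel_measurable M" "\<And>i. Qt i \<in> borel_measurable M"
  shows "(\<lambda>x. defect (u x) (q x) (vec_of Q x) (qt x) (vec_of Qt x)) \<in> borel_measurable M"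
proof -
  define L where "L = (\<lambda>i x. - 1 / (2 * q x) * Q i x - - 1 / (2 * qt x) * Qt i x)"
  have [measurable]: "L i \<in> borel_measurable M" for i unfolding L_def by measurable
  have "log_grad (q x) (vec_of Q x) - log_grad (qt x) (vec_of Qt x) = vec_of L x" for x
    by (simp add: log_grad_def L_def vec_of_def vec_eq_iff)
  then show ?thesis unfolding defect_def by (simp only: norm_vec_of_squared) measurable
qed

text \<open>
  The equation for \<open>u\<close> is tested with \<open>u q \<psi>\<close> and the one for \<open>ut\<close> with \<open>ut qt \<psi>\<close>, \<open>\<psi> = 1 / q - 1 / qt\<close>.
  Both densities integrate to zero, so integrating \<open>pointwise_defect_bound\<close> leaves the defect and the
  error term.
\<close>

lemma defect_integral_bound:
  fixes \<Omega> :: "(real ^ 'n) set"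
  assumes \<Omega>: "open \<Omega>" "bounded \<Omega>" and a: "bounded_coeff \<Omega> A a" "A \<ge> 0"
    and sym: "\<And>x. x \<in> \<Omega> \<Longrightarrow> transpose (a x) = a x"
    and ell: "\<And>x \<xi>. x \<in> \<Omega> \<Longrightarrow> lam * (norm \<xi>)\<^sup>2 \<le> bil (a x) \<xi> \<xi>" "lam > 0"
    and c: "q0 > 0" "M > 0"
    and ad: "admissible \<Omega> a q0 M K q Q u U" and adt: "admissible \<Omega> a q0 M K qt Qt ut Ut"
    and \<eta>: "H10_grad \<Omega> (\<lambda>x. q x - qt x) G"
  defines "D \<equiv> real CARD('n) * M" and "A' \<equiv> (real CARD('n))\<^sup>2 * A"
    and "J \<equiv> \<lambda>x. sqrt (q x) * \<bar>u x\<bar>" and "Jt \<equiv> \<lambda>x. sqrt (qt x) * \<bar>ut x\<bar>"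
    and "P \<equiv> vec_of (data_grad q Q u U)" and "Pt \<equiv> vec_of (data_grad qt Qt ut Ut)"
    and "d \<equiv> \<lambda>x. defect \<bar>u x\<bar> (q x) (vec_of Q x) (qt x) (vec_of Qt x)"
  defines "b \<equiv> 2 / q0 + 2 * D / q0\<^sup>2 + D / (2 * q0)"
  defines "C1 \<equiv> 2 * A' * b + A' * b * b + A' * b * b * b + M * b"
  assumes int: "integrable (lebesgue_on \<Omega>) (\<lambda>x. (\<bar>J x - Jt x\<bar> + norm (P x - Pt x)) * (\<bar>J x\<bar> + \<bar>Jt x\<bar> + norm (P x) + norm (Pt x)))"
  shows "integrable (lebesgue_on \<Omega>) d"
    and "min (2 * lam / M) (1 / M\<^sup>2) * (LINT x|lebesgue_on \<Omega>. d x)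
     \<le> C1 * (LINT x|lebesgue_on \<Omega>. (\<bar>J x - Jt x\<bar> + norm (P x - Pt x)) * (\<bar>J x\<bar> + \<bar>Jt x\<bar> + norm (P x) + norm (Pt x)))"
proof -
  let ?M = "lebesgue_on \<Omega>"
  define X where "X = (\<lambda>x. (\<bar>J x - Jt x\<bar> + norm (P x - Pt x)) * (\<bar>J x\<bar> + \<bar>Jt x\<bar> + norm (P x) + norm (Pt x)))"
  define c1 where "c1 = min (2 * lam / M) (1 / M\<^sup>2)"
  have c1: "c1 > 0" using ell(2) c(2) by (simp add: c1_def)
  note q = admissibleD[OF ad] and qt = admissibleD[OF adt]
  define \<Psi> where "\<Psi> = (\<lambda>i x. - 1 / (q x)\<^sup>2 * Q i x - - 1 / (qt x)\<^sup>2 * Qt i x)"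
  define \<psi> where "\<psi> = (\<lambda>x. 1 / q x - 1 / qt x)"
  have "AE x in ?M. - 1 * (1 / qt x * (q x - qt x)) = q x * (1 / q x - 1 / qt x)"
    using q(2) qt(2) by eventually_elim (use c(1) in \<open>simp add: field_simps\<close>)
  then obtain B where B: "W1inf_grad \<Omega> B (\<lambda>x. q x * \<psi> x) (\<lambda>i x. q x * \<Psi> i x + Q i x * \<psi> x)"
    "H10_grad \<Omega> (\<lambda>x. q x * \<psi> x) (\<lambda>i x. q x * \<Psi> i x + Q i x * \<psi> x)"
    unfolding \<psi>_def \<Psi>_def by (rule quotient_test_function[OF \<Omega> c q(1,2) qt(1,2) q(1) qt(1,2) \<eta>])
  have "AE x in ?M. - 1 * (1 / q x * (q x - qt x)) = qt x * (1 / q x - 1 / qt x)"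
    using q(2) qt(2) by eventually_elim (use c(1) in \<open>simp add: field_simps\<close>)
  then obtain Bt where Bt: "W1inf_grad \<Omega> Bt (\<lambda>x. qt x * \<psi> x) (\<lambda>i x. qt x * \<Psi> i x + Qt i x * \<psi> x)"
    "H10_grad \<Omega> (\<lambda>x. qt x * \<psi> x) (\<lambda>i x. qt x * \<Psi> i x + Qt i x * \<psi> x)"
    unfolding \<psi>_def \<Psi>_def by (rule quotient_test_function[OF \<Omega> c q(1,2) qt(1,2) qt(1) q(1,2) \<eta>])
  define E where "E = (\<lambda>x. q x * \<psi> x * bil (a x) (vec_of U x) (vec_of U x)
    + u x * bil (a x) (vec_of U x) (q x *\<^sub>R vec_of \<Psi> x + \<psi> x *\<^sub>R vec_of Q x) - q x * (u x)\<^sup>2 * (q x * \<psi> x))"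
  define Et where "Et = (\<lambda>x. qt x * \<psi> x * bil (a x) (vec_of Ut x) (vec_of Ut x)
    + ut x * bil (a x) (vec_of Ut x) (qt x *\<^sub>R vec_of \<Psi> x + \<psi> x *\<^sub>R vec_of Qt x) - qt x * (ut x)\<^sup>2 * (qt x * \<psi> x))"
  have E: "integrable ?M E" "(LINT x|?M. E x) = 0"
    unfolding E_def
    by (rule energy_balance(1)[OF \<Omega> a(1) W1inf_gradD(1,2)[OF q(1)] q(3,6) B, unfolded vec_of_scaled_add], assumption)
      (rule energy_balance(2)[OF \<Omega> a(1) W1inf_gradD(1,2)[OF q(1)] q(3,6) B, unfolded vec_of_scaled_add])
  have Et: "integrable ?M Et" "(LINT x|?M. Et x) = 0"
    unfolding Et_def
    by (rule energy_balance(1)[OF \<Omega> a(1) W1inf_gradD(1,2)[OF qt(1)] qt(3,6) Bt, unfolded vec_of_scaled_add], assumption)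
      (rule energy_balance(2)[OF \<Omega> a(1) W1inf_gradD(1,2)[OF qt(1)] qt(3,6) Bt, unfolded vec_of_scaled_add])
  have A': "A' \<ge> 0" using a(2) by (simp add: A'_def)
  have \<Psi>: "vec_of \<Psi> x = (- 1 / (q x)\<^sup>2) *\<^sub>R vec_of Q x - (- 1 / (qt x)\<^sup>2) *\<^sub>R vec_of Qt x" for x
    by (simp add: \<Psi>_def vec_of_def vec_eq_iff)
  have pw: "AE x in ?M. c1 * d x \<le> E x - Et x + C1 * X x"
    using admissible_AE[OF \<Omega>(1) ad] admissible_AE[OF \<Omega>(1) adt] bounded_coeff_norm[OF a(1)]
  proof eventually_elim
    case (elim x)
    then have x: "x \<in> \<Omega>" "q0 \<le> q x" "q x \<le> M" "q0 \<le> qt x" "qt x \<le> M" "norm (vec_of Q x) \<le> D" "norm (vec_of Qt x) \<le> D"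
      "u x = 0 \<longrightarrow> vec_of U x = 0" "ut x = 0 \<longrightarrow> vec_of Ut x = 0" "\<And>\<xi>. norm (a x *v \<xi>) \<le> A' * norm \<xi>"
      unfolding D_def A'_def by blast+
    have e: "E x = (q x * \<psi> x) * bil (a x) (sgn (u x) *\<^sub>R vec_of U x) (sgn (u x) *\<^sub>R vec_of U x)
      + \<bar>u x\<bar> * bil (a x) (sgn (u x) *\<^sub>R vec_of U x) (q x *\<^sub>R vec_of \<Psi> x + \<psi> x *\<^sub>R vec_of Q x) - q x * \<bar>u x\<bar>\<^sup>2 * (q x * \<psi> x)"
      unfolding E_def bil_sgn[OF x(8)] by simp
    have et: "Et x = (qt x * \<psi> x) * bil (a x) (sgn (ut x) *\<^sub>R vec_of Ut x) (sgn (ut x) *\<^sub>R vec_of Ut x)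
      + \<bar>ut x\<bar> * bil (a x) (sgn (ut x) *\<^sub>R vec_of Ut x) (qt x *\<^sub>R vec_of \<Psi> x + \<psi> x *\<^sub>R vec_of Qt x) - qt x * \<bar>ut x\<bar>\<^sup>2 * (qt x * \<psi> x)"
      unfolding Et_def bil_sgn[OF x(9)] by simp
    show ?case
      unfolding e et c1_def d_def C1_def X_def mult.assoc[of C1, symmetric] mult.assoc[of "2 * A' * b + A' * b * b + A' * b * b * b + M * b", symmetric]
      by (rule pointwise_defect_bound[OF sym[OF x(1)] ell(1)[OF x(1)] ell(2) x(10) A' c(1) x(2-7)])
        (simp_all only: P_def Pt_def J_def Jt_def vec_of_data_grad \<psi>_def \<Psi> b_def)
  qed
  have iR: "integrable ?M (\<lambda>x. E x - Et x + C1 * X x)"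
    using E(1) Et(1) int by (simp add: X_def)
  have dm: "d \<in> borel_measurable ?M"
    unfolding d_def using H1_gradD(4)[OF q(3)] W1inf_gradD(1,3)[OF q(1)] W1inf_gradD(1,3)[OF qt(1)]
    by (intro defect_measurable) auto
  have d0: "d x \<ge> 0" for x by (simp add: d_def defect_nonneg)
  have "integrable ?M (\<lambda>x. c1 * d x)"
  proof (rule Bochner_Integration.integrable_bound[OF iR])
    show "(\<lambda>x. c1 * d x) \<in> borel_measurable ?M" using dm by simp
    show "AE x in ?M. norm (c1 * d x) \<le> norm (E x - Et x + C1 * X x)"
      using pw by eventually_elim (use c1 d0 in \<open>simp add: abs_mult\<close>)
  qed
  then show id: "integrable ?M d" using c1 by simp
  have "c1 * (LINT x|?M. d x) = (LINT x|?M. c1 * d x)" by simp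
  also have "\<dots> \<le> (LINT x|?M. E x - Et x + C1 * X x)"
    using id by (intro integral_mono_AE[OF _ iR pw]) simp
  also have "\<dots> = C1 * (LINT x|?M. X x)"
    using E Et int by (simp add: X_def)
  finally show "min (2 * lam / M) (1 / M\<^sup>2) * (LINT x|?M. d x) \<le> C1 * (LINT x|?M. (\<bar>J x - Jt x\<bar> + norm (P x - Pt x)) * (\<bar>J x\<bar> + \<bar>Jt x\<bar> + norm (P x) + norm (Pt x)))"
    unfolding c1_def X_def .
qed

lemma caccioppoli_integral_bound:
  fixes \<Omega> :: "(real ^ 'n) set"
  assumes \<Omega>: "open \<Omega>" "bounded \<Omega>" and a: "bounded_coeff \<Omega> A a" "A \<ge> 0"
    and ell: "\<And>x \<xi>. x \<in> \<Omega> \<Longrightarrow> lam * (norm \<xi>)\<^sup>2 \<le> bil (a x) \<xi> \<xi>" "lam > 0"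
    and c: "q0 > 0" "M > 0"
    and ad: "admissible \<Omega> a q0 M K q Q u U" and adt: "admissible \<Omega> a q0 M K qt Qt ut Ut"
    and \<eta>: "H10_grad \<Omega> (\<lambda>x. q x - qt x) (\<lambda>i x. Q i x - Qt i x)"
  defines "D \<equiv> real CARD('n) * M" and "A' \<equiv> (real CARD('n))\<^sup>2 * A"
    and "d \<equiv> \<lambda>x. defect \<bar>u x\<bar> (q x) (vec_of Q x) (qt x) (vec_of Qt x)"
  defines "C3 \<equiv> (2 * A'\<^sup>2 / lam * (8 * M\<^sup>2 + 2 * (D / q0)\<^sup>2) + M) / q0"
  assumes d: "integrable (lebesgue_on \<Omega>) d"
  shows "integrable (lebesgue_on \<Omega>) (\<lambda>x. (q x - qt x)\<^sup>2 * (norm (vec_of U x))\<^sup>2)"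
    and "lam / 2 * (LINT x|lebesgue_on \<Omega>. (q x - qt x)\<^sup>2 * (norm (vec_of U x))\<^sup>2) \<le> C3 * (LINT x|lebesgue_on \<Omega>. d x)"
proof -
  let ?M = "lebesgue_on \<Omega>"
  note q = admissibleD[OF ad] and qt = admissibleD[OF adt]
  define h where "h = (\<lambda>i x. Q i x - Qt i x)"
  have W0: "W1inf_grad \<Omega> (M + M) (\<lambda>x. q x - qt x) h"
    unfolding h_def by (rule W1inf_grad_diff[OF \<Omega>(1) q(1) qt(1)])
  note W = W1inf_grad_mult[OF \<Omega>(1) W0 W0]
  note H = H10_grad_mult_W1inf[OF \<Omega>(1) \<eta>[folded h_def] W0]
  define E where "E = (\<lambda>x. (q x - qt x) * (q x - qt x) * bil (a x) (vec_of U x) (vec_of U x)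
    + u x * bil (a x) (vec_of U x) ((q x - qt x) *\<^sub>R vec_of h x + (q x - qt x) *\<^sub>R vec_of h x) - q x * (u x)\<^sup>2 * ((q x - qt x) * (q x - qt x)))"
  have E: "integrable ?M E" "(LINT x|?M. E x) = 0"
    unfolding E_def
    by (rule energy_balance(1)[OF \<Omega> a(1) W1inf_gradD(1,2)[OF q(1)] q(3,6) W H, unfolded vec_of_scaled_add], assumption)
      (rule energy_balance(2)[OF \<Omega> a(1) W1inf_gradD(1,2)[OF q(1)] q(3,6) W H, unfolded vec_of_scaled_add])
  have A': "A' \<ge> 0" using a(2) by (simp add: A'_def)
  have pw: "AE x in ?M. lam / 2 * ((q x - qt x)\<^sup>2 * (norm (vec_of U x))\<^sup>2) \<le> E x + C3 * d x"
    using admissible_AE[OF \<Omega>(1) ad] admissible_AE[OF \<Omega>(1) adt] bounded_coeff_norm[OF a(1)]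
  proof eventually_elim
    case (elim x)
    then have x: "x \<in> \<Omega>" "q0 \<le> q x" "q x \<le> M" "q0 \<le> qt x" "norm (vec_of Qt x) \<le> D"
      "\<And>\<xi>. norm (a x *v \<xi>) \<le> A' * norm \<xi>"
      unfolding D_def A'_def by blast+
    have "d x = defect (u x) (q x) (vec_of Q x) (qt x) (vec_of Qt x)" by (simp add: d_def defect_def power_mult_distrib)
    moreover have "vec_of h x = vec_of Q x - vec_of Qt x" unfolding h_def by (rule vec_of_diff)
    ultimately show ?case
      unfolding E_def C3_def
      using pointwise_caccioppoli[OF ell(1)[OF x(1)] ell(2) x(6) A' c(1) x(2-5), where u = "u x" and Q = "vec_of Q x"] by simp
  qed
  have iR: "integrable ?M (\<lambda>x. E x + C3 * d x)" using E(1) d by simp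
  have m: "(\<lambda>x. (q x - qt x)\<^sup>2 * (norm (vec_of U x))\<^sup>2) \<in> borel_measurable ?M"
    using W1inf_gradD(1)[OF q(1)] W1inf_gradD(1)[OF qt(1)] H1_gradD(5)[OF q(3)] unfolding norm_vec_of_squared by measurable
  have "integrable ?M (\<lambda>x. lam / 2 * ((q x - qt x)\<^sup>2 * (norm (vec_of U x))\<^sup>2))"
  proof (rule Bochner_Integration.integrable_bound[OF iR])
    show "(\<lambda>x. lam / 2 * ((q x - qt x)\<^sup>2 * (norm (vec_of U x))\<^sup>2)) \<in> borel_measurable ?M" using m by simp
    show "AE x in ?M. norm (lam / 2 * ((q x - qt x)\<^sup>2 * (norm (vec_of U x))\<^sup>2)) \<le> norm (E x + C3 * d x)"
      using pw
    proof eventually_elim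
      case (elim x)
      moreover have "0 \<le> lam / 2 * ((q x - qt x)\<^sup>2 * (norm (vec_of U x))\<^sup>2)" using ell(2) by simp
      ultimately show ?case unfolding real_norm_def by linarith
    qed
  qed
  then have "integrable ?M (\<lambda>x. 2 / lam * (lam / 2 * ((q x - qt x)\<^sup>2 * (norm (vec_of U x))\<^sup>2)))"
    by (rule integrable_mult_right)
  then show i: "integrable ?M (\<lambda>x. (q x - qt x)\<^sup>2 * (norm (vec_of U x))\<^sup>2)"
    using ell(2) by simp
  have "lam / 2 * (LINT x|?M. (q x - qt x)\<^sup>2 * (norm (vec_of U x))\<^sup>2) = (LINT x|?M. lam / 2 * ((q x - qt x)\<^sup>2 * (norm (vec_of U x))\<^sup>2))"
    by simp
  also have "\<dots> \<le> (LINT x|?M. E x + C3 * d x)"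
    by (rule integral_mono_AE[OF integrable_mult_right iR pw]) (rule i)
  also have "\<dots> = C3 * (LINT x|?M. d x)" using E d by simp
  finally show "lam / 2 * (LINT x|?M. (q x - qt x)\<^sup>2 * (norm (vec_of U x))\<^sup>2) \<le> C3 * (LINT x|?M. d x)" .
qed

lemma target_bound:
  fixes \<Omega> :: "(real ^ 'n) set"
  assumes \<Omega>: "open \<Omega>" "bounded \<Omega>" and c: "q0 > 0" "M > 0"
    and ad: "admissible \<Omega> a q0 M K q Q u U" and adt: "admissible \<Omega> a q0 M K qt Qt ut Ut"
  defines "D \<equiv> real CARD('n) * M"
    and "J \<equiv> \<lambda>x. sqrt (q x) * \<bar>u x\<bar>"
    and "d \<equiv> \<lambda>x. defect \<bar>u x\<bar> (q x) (vec_of Q x) (qt x) (vec_of Qt x)"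
    and "e \<equiv> \<lambda>x. (q x - qt x)\<^sup>2 * (norm (vec_of U x))\<^sup>2"
  defines "C2 \<equiv> 1 + 4 * M + 2 * (D / q0)\<^sup>2 + 2 * (8 * M\<^sup>2 + 2 * (D / q0)\<^sup>2)"
  assumes int: "integrable (lebesgue_on \<Omega>) d" "integrable (lebesgue_on \<Omega>) e"
  shows "H1_grad \<Omega> (\<lambda>x. (q x - qt x) * J x) (\<lambda>i x. (q x - qt x) * data_grad q Q u U i x + (Q i x - Qt i x) * J x)"
    and "(H1_norm \<Omega> (\<lambda>x. (q x - qt x) * J x))\<^sup>2 \<le> C2 * ((LINT x|lebesgue_on \<Omega>. d x) + (LINT x|lebesgue_on \<Omega>. e x))"
proof -
  let ?M = "lebesgue_on \<Omega>"
  note q = admissibleD[OF ad] and qt = admissibleD[OF adt]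
  show H: "H1_grad \<Omega> (\<lambda>x. (q x - qt x) * J x) (\<lambda>i x. (q x - qt x) * data_grad q Q u U i x + (Q i x - Qt i x) * J x)"
    unfolding J_def by (rule H1_grad_mult_W1inf[OF \<Omega>(1) W1inf_grad_diff[OF \<Omega>(1) q(1) qt(1)] admissible_data[OF \<Omega> c ad]])
  define P where "P = vec_of (\<lambda>i x. (q x - qt x) * data_grad q Q u U i x + (Q i x - Qt i x) * J x)"
  have P: "P x = (q x - qt x) *\<^sub>R vec_of (data_grad q Q u U) x + J x *\<^sub>R (vec_of Q x - vec_of Qt x)" for x
    by (simp add: P_def vec_of_def vec_eq_iff)
  have iP: "integrable ?M (\<lambda>x. (norm (P x))\<^sup>2)"
    unfolding P_def by (rule square_integrable_norm_vec(2)) (rule H1_gradD(2)[OF H])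
  note iJ = square_integrableD[OF H1_gradD(1)[OF H]]
  have pw: "AE x in ?M. ((q x - qt x) * J x)\<^sup>2 + (norm (P x))\<^sup>2 \<le> C2 * (d x + e x)"
    using admissible_AE[OF \<Omega>(1) ad] admissible_AE[OF \<Omega>(1) adt]
  proof eventually_elim
    case (elim x)
    then have x: "q0 \<le> q x" "q x \<le> M" "q0 \<le> qt x" "norm (vec_of Q x) \<le> D" "norm (vec_of Qt x) \<le> D"
      unfolding D_def by blast+
    have n: "norm (sgn (u x) *\<^sub>R vec_of U x) \<le> norm (vec_of U x)" by (simp add: sgn_if)
    show ?case
      unfolding P C2_def d_def e_def
      by (rule pointwise_target_bound[OF c(1) x vec_of_data_grad[of q Q u U x] _ n]) (simp add: J_def)
  qed
  have "(H1_norm \<Omega> (\<lambda>x. (q x - qt x) * J x))\<^sup>2 = (LINT x|?M. ((q x - qt x) * J x)\<^sup>2) + (LINT x|?M. (norm (P x))\<^sup>2)"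
    unfolding H1_norm_vec[OF \<Omega>(1) H] P_def by simp
  also have "\<dots> = (LINT x|?M. ((q x - qt x) * J x)\<^sup>2 + (norm (P x))\<^sup>2)"
    by (rule Bochner_Integration.integral_add[OF iJ iP, symmetric])
  also have "\<dots> \<le> (LINT x|?M. C2 * (d x + e x))"
    by (rule integral_mono_AE[OF Bochner_Integration.integrable_add[OF iJ iP] _ pw]) (use int in simp)
  also have "\<dots> = C2 * ((LINT x|?M. d x) + (LINT x|?M. e x))" using int by simp
  finally show "(H1_norm \<Omega> (\<lambda>x. (q x - qt x) * J x))\<^sup>2 \<le> C2 * ((LINT x|?M. d x) + (LINT x|?M. e x))" .
qed

text \<open>
  The integrals of the defect and, by Caccioppoli's inequality, of \<open>\<eta>\<^sup>2 |\<nabla> u|\<^sup>2\<close> are bounded by the first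
  power of the distance of the data, and together they bound the square of the left-hand side; whence
  the root.
\<close>

lemma stability_of_admissible:
  fixes \<Omega> :: "(real ^ 'n) set"
  assumes \<Omega>: "open \<Omega>" "bounded \<Omega>" and a: "bounded_coeff \<Omega> A a" "A \<ge> 0"
    and sym: "\<And>x. x \<in> \<Omega> \<Longrightarrow> transpose (a x) = a x"
    and ell: "\<And>x \<xi>. x \<in> \<Omega> \<Longrightarrow> lam * (norm \<xi>)\<^sup>2 \<le> bil (a x) \<xi> \<xi>" "lam > 0"
    and c: "q0 > 0" "M > 0"
  obtains C where "C > 0"
    "\<And>q Q u U qt Qt ut Ut. admissible \<Omega> a q0 M K q Q u U \<Longrightarrow> admissible \<Omega> a q0 M K qt Qt ut Ut \<Longrightarrow>
      H10_grad \<Omega> (\<lambda>x. q x - qt x) (\<lambda>i x. Q i x - Qt i x) \<Longrightarrow>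
      H1_norm \<Omega> (\<lambda>x. (q x - qt x) * (sqrt (q x) * \<bar>u x\<bar>)) \<le> C * sqrt (H1_norm \<Omega> (\<lambda>x. sqrt (q x) * \<bar>u x\<bar> - sqrt (qt x) * \<bar>ut x\<bar>))"
proof -
  define D where "D = real CARD('n) * M"
  define A' where "A' = (real CARD('n))\<^sup>2 * A"
  define b where "b = 2 / q0 + 2 * D / q0\<^sup>2 + D / (2 * q0)"
  define C1 where "C1 = 2 * A' * b + A' * b * b + A' * b * b * b + M * b"
  define C2 where "C2 = 1 + 4 * M + 2 * (D / q0)\<^sup>2 + 2 * (8 * M\<^sup>2 + 2 * (D / q0)\<^sup>2)"
  define C3 where "C3 = (2 * A'\<^sup>2 / lam * (8 * M\<^sup>2 + 2 * (D / q0)\<^sup>2) + M) / q0"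
  define c1 where "c1 = min (2 * lam / M) (1 / M\<^sup>2)"
  define k where "k = sqrt (2 * (8 * (M * K + (2 * M * K + D\<^sup>2 / q0 * K))))"
  define S where "S = C2 * ((1 + 2 / lam * C3) * (C1 / c1 * k))"
  have D: "D \<ge> 0" "A' \<ge> 0" using c a(2) by (auto simp: D_def A'_def)
  have b: "b \<ge> 0" unfolding b_def using D c by (intro add_nonneg_nonneg divide_nonneg_pos) auto
  have C1: "C1 \<ge> 0" unfolding C1_def using D b c by (intro add_nonneg_nonneg mult_nonneg_nonneg) auto
  have C2: "C2 \<ge> 0" unfolding C2_def using c by (intro add_nonneg_nonneg mult_nonneg_nonneg) auto
  have C3: "C3 \<ge> 0" unfolding C3_def using c ell(2) by (intro divide_nonneg_pos add_nonneg_nonneg mult_nonneg_nonneg) auto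
  have c1: "c1 > 0" using ell(2) c(2) by (simp add: c1_def)
  show ?thesis
  proof (rule that[of "sqrt \<bar>S\<bar> + 1"])
    show "0 < sqrt \<bar>S\<bar> + 1" by (intro add_nonneg_pos) auto
  next
    fix q u qt ut :: "real ^ 'n \<Rightarrow> real" and Q U Qt Ut :: "'n \<Rightarrow> real ^ 'n \<Rightarrow> real"
    assume ad: "admissible \<Omega> a q0 M K q Q u U" and adt: "admissible \<Omega> a q0 M K qt Qt ut Ut"
      and \<eta>: "H10_grad \<Omega> (\<lambda>x. q x - qt x) (\<lambda>i x. Q i x - Qt i x)"
    let ?M = "lebesgue_on \<Omega>"
    define \<delta> where "\<delta> = H1_norm \<Omega> (\<lambda>x. sqrt (q x) * \<bar>u x\<bar> - sqrt (qt x) * \<bar>ut x\<bar>)"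
    define d where "d = (\<lambda>x. defect \<bar>u x\<bar> (q x) (vec_of Q x) (qt x) (vec_of Qt x))"
    define e where "e = (\<lambda>x. (q x - qt x)\<^sup>2 * (norm (vec_of U x))\<^sup>2)"
    note J = admissible_data[OF \<Omega> c ad] admissible_data_bound[OF \<Omega> c ad, folded D_def]
    note Jt = admissible_data[OF \<Omega> c adt] admissible_data_bound[OF \<Omega> c adt, folded D_def]
    note X = data_product_integral[OF \<Omega> J Jt, folded k_def \<delta>_def]
    note Y = defect_integral_bound[OF \<Omega> a sym ell c ad adt \<eta> X(1),
        folded d_def D_def A'_def c1_def, folded b_def, folded C1_def]
    note Z = caccioppoli_integral_bound[OF \<Omega> a ell c ad adt \<eta> Y(1)[unfolded d_def], folded d_def e_def D_def A'_def, folded C3_def]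
    note T = target_bound(2)[OF \<Omega> c ad adt Y(1)[unfolded d_def] Z(1)[unfolded e_def], folded d_def e_def D_def, folded C2_def]
    have \<delta>: "\<delta> \<ge> 0" unfolding \<delta>_def H1_norm_def by (intro real_sqrt_ge_zero add_nonneg_nonneg sum_nonneg) auto
    have "c1 * (LINT x|?M. d x) \<le> C1 * (k * \<delta>)"
      using Y(2) mult_left_mono[OF X(2) C1] by linarith
    then have d: "(LINT x|?M. d x) \<le> C1 / c1 * k * \<delta>" using c1 by (simp add: field_simps)
    have "(LINT x|?M. e x) \<le> 2 / lam * C3 * (LINT x|?M. d x)" using Z(2) ell(2) by (simp add: field_simps)
    then have "(LINT x|?M. d x) + (LINT x|?M. e x) \<le> (1 + 2 / lam * C3) * (LINT x|?M. d x)" by (simp add: distrib_right)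
    also have "\<dots> \<le> (1 + 2 / lam * C3) * (C1 / c1 * k * \<delta>)" using C3 ell(2) d by (intro mult_left_mono) auto
    finally have "C2 * ((LINT x|?M. d x) + (LINT x|?M. e x)) \<le> C2 * ((1 + 2 / lam * C3) * (C1 / c1 * k * \<delta>))"
      using C2 by (rule mult_left_mono)
    also have "\<dots> = S * \<delta>" by (simp add: S_def)
    also have "\<dots> \<le> \<bar>S\<bar> * \<delta>" using \<delta> by (intro mult_right_mono) auto
    finally have "H1_norm \<Omega> (\<lambda>x. (q x - qt x) * (sqrt (q x) * \<bar>u x\<bar>)) \<le> sqrt (\<bar>S\<bar> * \<delta>)"
      using T by (intro real_le_rsqrt) linarith
    also have "\<dots> \<le> (sqrt \<bar>S\<bar> + 1) * sqrt \<delta>" using \<delta> by (simp add: real_sqrt_mult distrib_right)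
    finally show "H1_norm \<Omega> (\<lambda>x. (q x - qt x) * (sqrt (q x) * \<bar>u x\<bar>)) \<le> (sqrt \<bar>S\<bar> + 1) * sqrt (H1_norm \<Omega> (\<lambda>x. sqrt (q x) * \<bar>u x\<bar> - sqrt (qt x) * \<bar>ut x\<bar>))"
      unfolding \<delta>_def .
  qed
qed

section \<open>Uniform bounds for the solutions\<close>

lemma L2_norm_triangle:
  assumes "square_integrable (lebesgue_on \<Omega>) f" "square_integrable (lebesgue_on \<Omega>) g"
  shows "L2_norm \<Omega> (\<lambda>x. f x + g x) \<le> L2_norm \<Omega> f + L2_norm \<Omega> g"
  using L2_triangle[OF assms] by (simp add: L2_norm_def)

lemma L2_norm_squared:
  "(LINT x|lebesgue_on \<Omega>. (f x)\<^sup>2) = (L2_norm \<Omega> f)\<^sup>2" by (simp add: L2_norm_def)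

text \<open>
  The difference \<open>w = u - z\<close> of two solutions has zero boundary values and satisfies
  \<open>A w = (q - qs) u - (r - qs) z\<close> with the operator of the reference potential \<open>qs\<close>. Since
  \<open>N * \<kappa> \<le> k < 1\<close>, the contribution of \<open>w\<close> to the right-hand side is absorbed.
\<close>

lemma solution_L2_bound:
  fixes \<Omega> :: "(real ^ 'n) set"
  assumes \<Omega>: "open \<Omega>" "bounded \<Omega>" and a: "bounded_coeff \<Omega> A a"
    and qs: "qs \<in> Q0_set \<Omega> a" "AE x in lebesgue_on \<Omega>. \<bar>qs x\<bar> \<le> Ms"
    and N: "L2_opnorm \<Omega> (A_inv \<Omega> a qs) \<le> ereal N" "N \<ge> 0" and \<kappa>: "\<kappa> \<ge> 0" "N * \<kappa> \<le> k" "k < 1"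
    and q: "q \<in> borel_measurable (lebesgue_on \<Omega>)" "AE x in lebesgue_on \<Omega>. \<bar>q x\<bar> \<le> M" "AE x in lebesgue_on \<Omega>. \<bar>q x - qs x\<bar> \<le> \<kappa>"
    and r: "r \<in> borel_measurable (lebesgue_on \<Omega>)" "AE x in lebesgue_on \<Omega>. \<bar>r x\<bar> \<le> M" "AE x in lebesgue_on \<Omega>. \<bar>r x - qs x\<bar> \<le> \<kappa>"
    and u: "weak_solution \<Omega> a g q u" and z: "weak_solution \<Omega> a g r z"
  shows "L2_norm \<Omega> (\<lambda>x. u x - z x) \<le> 2 * k / (1 - k) * L2_norm \<Omega> z"
    and "L2_norm \<Omega> u \<le> (1 + 2 * k / (1 - k)) * L2_norm \<Omega> z"
proof -
  let ?M = "lebesgue_on \<Omega>"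
  have qsm: "qs \<in> borel_measurable ?M" using qs(1) by (simp add: Q0_set_def Linf_def)
  have U: "H1_grad \<Omega> u (\<lambda>i. weak_deriv \<Omega> i u)" "Lq_eq \<Omega> a q u (\<lambda>x. 0)" "has_trace \<Omega> u g"
    using u H1_grad_of_H1[OF \<Omega>(1), of u] unfolding weak_solution_def by blast+
  have Z: "H1_grad \<Omega> z (\<lambda>i. weak_deriv \<Omega> i z)" "Lq_eq \<Omega> a r z (\<lambda>x. 0)" "has_trace \<Omega> z g"
    using z H1_grad_of_H1[OF \<Omega>(1), of z] unfolding weak_solution_def by blast+
  note u2 = H1_gradD(1)[OF U(1)] and z2 = H1_gradD(1)[OF Z(1)]
  define f where "f = (\<lambda>x. (q x - qs x) * u x + (- 1) * ((r x - qs x) * z x))"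
  have m: "(\<lambda>x. q x - qs x) \<in> borel_measurable ?M" "(\<lambda>x. r x - qs x) \<in> borel_measurable ?M"
    using q(1) r(1) qsm by auto
  have d: "square_integrable ?M (\<lambda>x. (q x - qs x) * u x)" "square_integrable ?M (\<lambda>x. (r x - qs x) * z x)"
    by (rule square_integrable_mult_bounded[OF u2 m(1) q(3)], rule square_integrable_mult_bounded[OF z2 m(2) r(3)])
  have f: "square_integrable ?M f" unfolding f_def by (intro square_integrable_add square_integrable_cmult d)
  have qu: "square_integrable ?M (\<lambda>x. qs x * u x - q x * u x)"
    using square_integrable_cmult[OF d(1), of "- 1"] by (simp add: algebra_simps)
  have rz: "square_integrable ?M (\<lambda>x. qs x * z x - r x * z x)"
    using square_integrable_cmult[OF d(2), of "- 1"] by (simp add: algebra_simps)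
  have "Lq_eq \<Omega> a qs (\<lambda>x. u x + (- 1) * z x) (\<lambda>x. (qs x * u x - q x * u x) + (- 1) * (qs x * z x - r x * z x))"
    by (rule Lq_eq_add[OF \<Omega>(1) a qsm qs(2) U(1) qu Lq_eq_change_potential[OF \<Omega>(1) a q(1,2) qsm qs(2) U(1,2)]
          Z(1) rz Lq_eq_change_potential[OF \<Omega>(1) a r(1,2) qsm qs(2) Z(1,2)]])
  moreover have "(\<lambda>x. (qs x * u x - q x * u x) + (- 1) * (qs x * z x - r x * z x)) = (\<lambda>x. - f x)"
    by (simp add: f_def fun_eq_iff algebra_simps)
  moreover have w: "(\<lambda>x. u x + (- 1) * z x) = (\<lambda>x. u x - z x)" by simp
  ultimately have L: "Lq_eq \<Omega> a qs (\<lambda>x. u x - z x) (\<lambda>x. - f x)" by simp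
  have "A_rel \<Omega> a qs (\<lambda>x. u x - z x) f"
    unfolding A_rel_def using L f H10_of_H10_grad[OF \<Omega>(1) H10_grad_trace_diff[OF \<Omega> U(3) Z(3)]] by (simp add: Lp2_iff)
  from resolvent_bound[OF \<Omega>(1) a qs N(1) this]
  have w1: "L2_norm \<Omega> (\<lambda>x. u x - z x) \<le> N * L2_norm \<Omega> f" .
  have "L2_norm \<Omega> f \<le> L2_norm \<Omega> (\<lambda>x. (q x - qs x) * u x) + L2_norm \<Omega> (\<lambda>x. (- 1) * ((r x - qs x) * z x))"
    unfolding f_def by (intro L2_norm_triangle square_integrable_cmult d)
  also have "\<dots> \<le> \<kappa> * L2_norm \<Omega> u + \<kappa> * L2_norm \<Omega> z"
    unfolding L2_norm_cmult
    using L2_norm_mult_bounded[OF u2 m(1) q(3) \<kappa>(1)] L2_norm_mult_bounded[OF z2 m(2) r(3) \<kappa>(1)] by simp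
  finally have "N * L2_norm \<Omega> f \<le> N * (\<kappa> * L2_norm \<Omega> u + \<kappa> * L2_norm \<Omega> z)" using N(2) by (rule mult_left_mono)
  also have "\<dots> = (N * \<kappa>) * (L2_norm \<Omega> u + L2_norm \<Omega> z)" by (simp add: algebra_simps)
  also have "\<dots> \<le> k * (L2_norm \<Omega> u + L2_norm \<Omega> z)"
    using \<kappa>(2) by (intro mult_right_mono add_nonneg_nonneg L2_norm_nonneg)
  finally have w2: "L2_norm \<Omega> (\<lambda>x. u x - z x) \<le> k * (L2_norm \<Omega> u + L2_norm \<Omega> z)" using w1 by linarith
  have "L2_norm \<Omega> (\<lambda>x. (u x - z x) + z x) \<le> L2_norm \<Omega> (\<lambda>x. u x - z x) + L2_norm \<Omega> z"
    by (intro L2_norm_triangle square_integrable_diff u2 z2)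
  then have w3: "L2_norm \<Omega> u \<le> L2_norm \<Omega> (\<lambda>x. u x - z x) + L2_norm \<Omega> z" by simp
  have "k \<ge> 0" using N(2) \<kappa>(1,2) by (intro order_trans[OF mult_nonneg_nonneg \<kappa>(2)])
  then have "k * (L2_norm \<Omega> u + L2_norm \<Omega> z) \<le> k * (L2_norm \<Omega> (\<lambda>x. u x - z x) + 2 * L2_norm \<Omega> z)"
    using w3 by (intro mult_left_mono) auto
  then have "(1 - k) * L2_norm \<Omega> (\<lambda>x. u x - z x) \<le> 2 * k * L2_norm \<Omega> z" using w2 by (simp add: algebra_simps)
  then show w4: "L2_norm \<Omega> (\<lambda>x. u x - z x) \<le> 2 * k / (1 - k) * L2_norm \<Omega> z"
    using \<kappa>(3) by (simp add: field_simps)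
  show "L2_norm \<Omega> u \<le> (1 + 2 * k / (1 - k)) * L2_norm \<Omega> z"
    using w3 w4 by (simp only: distrib_right mult_1)
qed

text \<open>The equation for \<open>u\<close> is tested with \<open>u - z\<close>, which has zero boundary values.\<close>

lemma solution_gradient_bound:
  fixes \<Omega> :: "(real ^ 'n) set"
  assumes \<Omega>: "open \<Omega>" "bounded \<Omega>" and a: "bounded_coeff \<Omega> A a"
    and ell: "\<And>x \<xi>. x \<in> \<Omega> \<Longrightarrow> lam * (norm \<xi>)\<^sup>2 \<le> bil (a x) \<xi> \<xi>" "lam > 0"
    and q: "q \<in> borel_measurable (lebesgue_on \<Omega>)" "AE x in lebesgue_on \<Omega>. \<bar>q x\<bar> \<le> M" "M \<ge> 0"
    and u: "weak_solution \<Omega> a g q u" and z: "has_trace \<Omega> z g"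
  defines "U \<equiv> \<lambda>i. weak_deriv \<Omega> i u" and "Z \<equiv> \<lambda>i. weak_deriv \<Omega> i z"
    and "A' \<equiv> (real CARD('n))\<^sup>2 * A"
  shows "lam / 2 * (LINT x|lebesgue_on \<Omega>. (norm (vec_of U x))\<^sup>2)
    \<le> M * ((L2_norm \<Omega> u)\<^sup>2 + (L2_norm \<Omega> (\<lambda>x. u x - z x))\<^sup>2) + A'\<^sup>2 / (2 * lam) * (LINT x|lebesgue_on \<Omega>. (norm (vec_of Z x))\<^sup>2)"
proof -
  let ?M = "lebesgue_on \<Omega>"
  have zH: "z \<in> H1 \<Omega>" using z unfolding has_trace_def by blast
  have S: "H1_grad \<Omega> u U" "Lq_eq \<Omega> a q u (\<lambda>x. 0)" "has_trace \<Omega> u g" "H1_grad \<Omega> z Z"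
    using u H1_grad_of_H1[OF \<Omega>(1), of u] H1_grad_of_H1[OF \<Omega>(1) zH] unfolding weak_solution_def U_def Z_def by blast+
  define w where "w = (\<lambda>x. u x - z x)"
  define W where "W = (\<lambda>i x. U i x - Z i x)"
  have w: "H10_grad \<Omega> w W" unfolding w_def W_def U_def Z_def by (rule H10_grad_trace_diff[OF \<Omega> S(3) z])
  have W: "H1_grad \<Omega> w W" by (rule H10_grad_imp_H1_grad[OF w])
  have iU: "integrable ?M (\<lambda>x. (norm (vec_of U x))\<^sup>2)" by (rule square_integrable_norm_vec(2)) (rule H1_gradD(2)[OF S(1)])
  have iZ: "integrable ?M (\<lambda>x. (norm (vec_of Z x))\<^sup>2)" by (rule square_integrable_norm_vec(2)) (rule H1_gradD(2)[OF S(4)])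
  have iB: "integrable ?M (\<lambda>x. bil (a x) (vec_of U x) (vec_of W x))"
    unfolding bil_def by (rule integral_flux_inner(1)[OF a H1_gradD(2)[OF S(1)] H1_gradD(2)[OF W]])
  have eq: "(LINT x|?M. bil (a x) (vec_of U x) (vec_of W x)) = (LINT x|?M. q x * u x * w x)"
    using weak_form_H10[OF \<Omega>(1) a q(1,2) S(1) square_integrable_zero S(2) w] by (simp add: bil_def)
  note u2 = H1_gradD(1)[OF S(1)] and w2 = H1_gradD(1)[OF W]
  have "(LINT x|?M. q x * u x * w x) \<le> (LINT x|?M. M * ((u x)\<^sup>2 + (w x)\<^sup>2))"
  proof (rule integral_mono_AE)
    show "integrable ?M (\<lambda>x. q x * u x * w x)"
      by (intro integrable_mult_square_integrable square_integrable_mult_bounded[OF u2 q(1,2)] w2)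
    show "integrable ?M (\<lambda>x. M * ((u x)\<^sup>2 + (w x)\<^sup>2))"
      by (intro integrable_mult_right Bochner_Integration.integrable_add square_integrableD u2 w2)
    show "AE x in ?M. q x * u x * w x \<le> M * ((u x)\<^sup>2 + (w x)\<^sup>2)"
      using q(2)
    proof eventually_elim
      case (elim x)
      have "q x * u x * w x \<le> \<bar>q x\<bar> * \<bar>u x * w x\<bar>" unfolding mult.assoc abs_mult[symmetric] by simp
      also have "\<dots> \<le> M * ((u x)\<^sup>2 + (w x)\<^sup>2)" using elim q(3) abs_mult_le_squares by (intro mult_mono) auto
      finally show ?case .
    qed
  qed
  also have "\<dots> = M * ((L2_norm \<Omega> u)\<^sup>2 + (L2_norm \<Omega> w)\<^sup>2)"
    unfolding L2_norm_squared[symmetric] using square_integrableD[OF u2] square_integrableD[OF w2] by simp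
  finally have B: "(LINT x|?M. bil (a x) (vec_of U x) (vec_of W x)) \<le> M * ((L2_norm \<Omega> u)\<^sup>2 + (L2_norm \<Omega> w)\<^sup>2)"
    unfolding eq .
  have "AE x in ?M. x \<in> \<Omega>" by (rule AE_I2) simp
  then have pw: "AE x in ?M. lam / 2 * (norm (vec_of U x))\<^sup>2 \<le> bil (a x) (vec_of U x) (vec_of W x) + A'\<^sup>2 / (2 * lam) * (norm (vec_of Z x))\<^sup>2"
    using bounded_coeff_norm[OF a]
  proof eventually_elim
    case (elim x)
    have e1: "lam * (norm (vec_of U x))\<^sup>2 \<le> bil (a x) (vec_of U x) (vec_of U x)" by (rule ell(1)[OF elim(1)])
    have e2: "bil (a x) (vec_of U x) (vec_of W x) = bil (a x) (vec_of U x) (vec_of U x) - bil (a x) (vec_of U x) (vec_of Z x)"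
      unfolding W_def vec_of_diff by (rule bil_linear(5))
    have e3: "\<bar>bil (a x) (vec_of U x) (vec_of Z x)\<bar> \<le> A' * norm (vec_of U x) * norm (vec_of Z x)"
      unfolding A'_def by (rule bil_bound) (use elim(2) in blast)
    have "A' * norm (vec_of U x) * norm (vec_of Z x) = 2 * (sqrt (lam / 2) * norm (vec_of U x)) * (A' * norm (vec_of Z x) / (2 * sqrt (lam / 2)))"
      using ell(2) by simp
    also have "\<dots> \<le> (sqrt (lam / 2) * norm (vec_of U x))\<^sup>2 + (A' * norm (vec_of Z x) / (2 * sqrt (lam / 2)))\<^sup>2"
      by (rule sum_squares_bound)
    also have "\<dots> = lam / 2 * (norm (vec_of U x))\<^sup>2 + A'\<^sup>2 / (2 * lam) * (norm (vec_of Z x))\<^sup>2"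
      using ell(2) by (simp add: power_mult_distrib power_divide)
    finally show ?case using e1 e2 e3 by linarith
  qed
  have "lam / 2 * (LINT x|?M. (norm (vec_of U x))\<^sup>2) = (LINT x|?M. lam / 2 * (norm (vec_of U x))\<^sup>2)" by simp
  also have "\<dots> \<le> (LINT x|?M. bil (a x) (vec_of U x) (vec_of W x) + A'\<^sup>2 / (2 * lam) * (norm (vec_of Z x))\<^sup>2)"
    by (rule integral_mono_AE[OF integrable_mult_right[OF iU] Bochner_Integration.integrable_add[OF iB integrable_mult_right[OF iZ]] pw])
  also have "\<dots> = (LINT x|?M. bil (a x) (vec_of U x) (vec_of W x)) + A'\<^sup>2 / (2 * lam) * (LINT x|?M. (norm (vec_of Z x))\<^sup>2)"
    using iB iZ by simp
  finally show ?thesis using B unfolding w_def by linarith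
qed

section \<open>The Hoelder estimate for the coefficient\<close>

lemma H1_norm_eq_zero:
  fixes \<Omega> :: "(real ^ 'n) set"
  assumes \<Omega>: "open \<Omega>" and f: "H1_grad \<Omega> f g" "AE x in lebesgue_on \<Omega>. f x = 0"
  shows "H1_norm \<Omega> f = 0"
proof -
  have "AE x in lebesgue_on \<Omega>. g i x = 0" for i
    using weak_deriv_zero_set[OF \<Omega> f(1), of i] f(2) by eventually_elim simp
  then have "(LINT x|lebesgue_on \<Omega>. (g i x)\<^sup>2) = 0" for i
    by (intro integral_eq_zero_AE) (auto elim: eventually_mono)
  moreover have "(LINT x|lebesgue_on \<Omega>. (f x)\<^sup>2) = 0"
    using f(2) by (intro integral_eq_zero_AE) (auto elim: eventually_mono)
  ultimately show ?thesis unfolding H1_norm_eq[OF \<Omega> f(1)] by simp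
qed

lemma L2_opnorm_nonneg: "0 \<le> L2_opnorm \<Omega> T"
proof -
  have "(\<lambda>x. 0) \<in> {f \<in> Lp 2 \<Omega>. L2_norm \<Omega> f \<le> 1}" by (simp add: Lp2_iff square_integrable_zero L2_norm_def)
  then have "ereal (L2_norm \<Omega> (T (\<lambda>x. 0))) \<le> L2_opnorm \<Omega> T" unfolding L2_opnorm_def by (rule SUP_upper)
  then show ?thesis using L2_norm_nonneg[of \<Omega> "T (\<lambda>x. 0)"] by (metis ereal_less_eq(3) order_trans zero_ereal_def)
qed

lemma sqrt_internal_data: "sqrt (internal_data q u x) = sqrt (q x) * \<bar>u x\<bar>"
  by (simp add: internal_data_def real_sqrt_mult)

theorem theorem2p2:
  fixes \<Omega> :: "(real ^ 'n) set"
    and a :: "real ^ 'n \<Rightarrow> real ^ 'n ^ 'n"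
    and g qs :: "real ^ 'n \<Rightarrow> real"
    and lam p q0 k M :: real
  assumes "CARD('n) \<in> {2, 3}"
    and "bounded \<Omega>" and "C11_domain \<Omega>"
    and "\<And>x. x \<in> \<Omega> \<Longrightarrow> transpose (a x) = a x"
    and "\<And>i j. (\<lambda>x. a x $ i $ j) \<in> W1inf \<Omega>"
    and "lam > 0"
    and "\<And>x \<xi>. x \<in> \<Omega> \<Longrightarrow> (\<Sum>i\<in>UNIV. \<Sum>j\<in>UNIV. a x $ i $ j * \<xi> $ i * \<xi> $ j) \<ge> lam * (norm \<xi>)\<^sup>2"
    and "p > real CARD('n)" and "g \<in> W2_trace_space p \<Omega>"
    and "\<exists>x\<in>frontier \<Omega>. g x \<noteq> 0"
    and "q0 > 0" and "0 < k" and "k < 1"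
    and "qs \<in> Q0_set \<Omega> a" and "AE x in lebesgue_on \<Omega>. 2 * q0 \<le> qs x"
    and "M > 0"
  shows "\<exists>C>0. \<forall>q qt u ut.
    q \<in> Q_set \<Omega> a q0 k qs \<inter> W1inf \<Omega> \<longrightarrow>
    qt \<in> Q_set \<Omega> a q0 k qs \<inter> W1inf \<Omega> \<longrightarrow>
    (\<lambda>x. q x - qt x) \<in> H10 \<Omega> \<longrightarrow>
    W1inf_norm \<Omega> q \<le> ereal M \<longrightarrow>
    W1inf_norm \<Omega> qt \<le> ereal M \<longrightarrow>
    weak_solution \<Omega> a g q u \<longrightarrow>
    weak_solution \<Omega> a g qt ut \<longrightarrow>
    (\<lambda>x. sqrt (internal_data q u x) * (q x - qt x)) \<in> H1 \<Omega> \<and>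
    (\<lambda>x. sqrt (internal_data q u x) - sqrt (internal_data qt ut x)) \<in> H1 \<Omega> \<and>
    H1_norm \<Omega> (\<lambda>x. sqrt (internal_data q u x) * (q x - qt x))
      \<le> C * H1_norm \<Omega> (\<lambda>x. sqrt (internal_data q u x) - sqrt (internal_data qt ut x)) powr (1/2)"
proof -
  let ?M = "lebesgue_on \<Omega>"
  have \<Omega>: "open \<Omega>" "\<Omega> \<noteq> {}" using assms(3) by (auto simp: C11_domain_def)
  note \<Omega>b = \<Omega>(1) assms(2)
  obtain A where A: "A \<ge> 0" "bounded_coeff \<Omega> A a" using bounded_coeff_of_W1inf[OF \<Omega> assms(5)] by blast
  have ell: "lam * (norm \<xi>)\<^sup>2 \<le> bil (a x) \<xi> \<xi>" if "x \<in> \<Omega>" for x \<xi>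
  proof -
    have "bil (a x) \<xi> \<xi> = (\<Sum>i\<in>UNIV. \<Sum>j\<in>UNIV. a x $ i $ j * \<xi> $ i * \<xi> $ j)"
      by (simp add: bil_def matrix_vector_mult_def inner_vec_def sum_distrib_right)
        (intro sum.cong refl, rule mult.assoc[THEN trans], simp only: mult.commute mult.left_commute)
    then show ?thesis using assms(7)[OF that, of \<xi>] by simp
  qed
  define ok where "ok q u \<longleftrightarrow> q \<in> Q_set \<Omega> a q0 k qs \<inter> W1inf \<Omega> \<and> W1inf_norm \<Omega> q \<le> ereal M \<and> weak_solution \<Omega> a g q u" for q u
  have okD: "W1inf_grad \<Omega> M q (\<lambda>i. weak_deriv \<Omega> i q)" "AE x in ?M. q0 \<le> q x" "H1_grad \<Omega> u (\<lambda>i. weak_deriv \<Omega> i u)"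
    "Lq_eq \<Omega> a q u (\<lambda>x. 0)" "has_trace \<Omega> u g" if o: "ok q u" for q u
  proof -
    have W: "q \<in> W1inf \<Omega>" "W1inf_norm \<Omega> q \<le> ereal M" and S: "weak_solution \<Omega> a g q u" and Q: "q \<in> Q_set \<Omega> a q0 k qs"
      using o unfolding ok_def by blast+
    show "W1inf_grad \<Omega> M q (\<lambda>i. weak_deriv \<Omega> i q)" by (rule W1inf_grad_of_W1inf[OF \<Omega> W])
    show "H1_grad \<Omega> u (\<lambda>i. weak_deriv \<Omega> i u)" "Lq_eq \<Omega> a q u (\<lambda>x. 0)" "has_trace \<Omega> u g"
      using S H1_grad_of_H1[OF \<Omega>(1), of u] unfolding weak_solution_def by blast+
    have "Linf_norm \<Omega> (\<lambda>x. q x - qs x) \<le> ereal q0" using Q by (simp add: Q_set_def)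
    from Linf_norm_AE[OF this] assms(15) show "AE x in ?M. q0 \<le> q x" by eventually_elim linarith
  qed
  have admissible: "admissible \<Omega> a q0 M K q (\<lambda>i. weak_deriv \<Omega> i q) u (\<lambda>i. weak_deriv \<Omega> i u)"
    if o: "ok q u" and K: "(LINT x|?M. (u x)\<^sup>2) \<le> K" "(LINT x|?M. (norm (vec_of (\<lambda>i. weak_deriv \<Omega> i u) x))\<^sup>2) \<le> K" for q u K
  proof -
    note D = okD[OF o]
    have "(LINT x|?M. bil (a x) (vec_of (\<lambda>i. weak_deriv \<Omega> i u) x) (vec_of V x)) = (LINT x|?M. q x * u x * v x)"
      if "H10_grad \<Omega> v V" for v V
      using weak_form_H10[OF \<Omega>(1) A(2) W1inf_gradD(1,2)[OF D(1)] D(3) square_integrable_zero D(4) that] by (simp add: bil_def)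
    then show ?thesis unfolding admissible_def using D(1-3) K by blast
  qed
  \<comment> \<open>Here the bound \<open>K\<close> may depend on the solution: this gives the memberships in \<open>H\<^sup>1\<close>.\<close>
  have main: "(\<lambda>x. sqrt (internal_data q u x) * (q x - qt x)) \<in> H1 \<Omega> \<and>
      (\<lambda>x. sqrt (internal_data q u x) - sqrt (internal_data qt ut x)) \<in> H1 \<Omega> \<and>
      H1_norm \<Omega> (\<lambda>x. sqrt (internal_data q u x) * (q x - qt x))
        \<le> C * H1_norm \<Omega> (\<lambda>x. sqrt (internal_data q u x) - sqrt (internal_data qt ut x)) powr (1/2)"
    if o: "ok q u" "ok qt ut"
      and bound: "H1_norm \<Omega> (\<lambda>x. (q x - qt x) * (sqrt (q x) * \<bar>u x\<bar>)) \<le> C * sqrt (H1_norm \<Omega> (\<lambda>x. sqrt (q x) * \<bar>u x\<bar> - sqrt (qt x) * \<bar>ut x\<bar>))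
        \<or> (AE x in ?M. q x = qt x) \<and> C \<ge> 0" for q u qt ut C
  proof -
    note ad = admissible[OF o(1) max.cobounded1 max.cobounded2] and adt = admissible[OF o(2) max.cobounded1 max.cobounded2]
    note J = admissible_data[OF \<Omega>b assms(11,16) ad] and Jt = admissible_data[OF \<Omega>b assms(11,16) adt]
    have sw: "(\<lambda>x. sqrt (internal_data q u x) * (q x - qt x)) = (\<lambda>x. (q x - qt x) * (sqrt (q x) * \<bar>u x\<bar>))"
      by (simp add: sqrt_internal_data mult.commute)
    have nn: "H1_norm \<Omega> f \<ge> 0" for f unfolding H1_norm_def by (intro real_sqrt_ge_zero add_nonneg_nonneg sum_nonneg) auto
    note H = H1_grad_mult_W1inf[OF \<Omega>(1) W1inf_grad_diff[OF \<Omega>(1) okD(1)[OF o(1)] okD(1)[OF o(2)]] J]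
    have "H1_norm \<Omega> (\<lambda>x. (q x - qt x) * (sqrt (q x) * \<bar>u x\<bar>)) \<le> C * sqrt (H1_norm \<Omega> (\<lambda>x. sqrt (q x) * \<bar>u x\<bar> - sqrt (qt x) * \<bar>ut x\<bar>))"
      using bound
    proof
      assume z: "(AE x in ?M. q x = qt x) \<and> C \<ge> 0"
      have "AE x in ?M. (q x - qt x) * (sqrt (q x) * \<bar>u x\<bar>) = 0" using z by (auto elim: eventually_mono)
      then have "H1_norm \<Omega> (\<lambda>x. (q x - qt x) * (sqrt (q x) * \<bar>u x\<bar>)) = 0" by (rule H1_norm_eq_zero[OF \<Omega>(1) H])
      then show ?thesis using z nn by simp
    qed
    then show ?thesis
      unfolding sw unfolding sqrt_internal_data powr_half_sqrt[OF nn]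
      using H1_grad_imp_H1[OF H] H1_grad_imp_H1[OF H1_grad_diff[OF \<Omega>(1) J Jt]] by blast
  qed
  have finish: ?thesis if "C > 0"
    and bound: "\<And>q u qt ut. ok q u \<Longrightarrow> ok qt ut \<Longrightarrow> (\<lambda>x. q x - qt x) \<in> H10 \<Omega> \<Longrightarrow>
        H1_norm \<Omega> (\<lambda>x. (q x - qt x) * (sqrt (q x) * \<bar>u x\<bar>)) \<le> C * sqrt (H1_norm \<Omega> (\<lambda>x. sqrt (q x) * \<bar>u x\<bar> - sqrt (qt x) * \<bar>ut x\<bar>))
        \<or> (AE x in ?M. q x = qt x) \<and> C \<ge> 0" for C
  proof (rule exI[of _ C], rule conjI[OF that(1)], intro allI impI, goal_cases)
    case (1 q qt u ut)
    have o: "ok q u" "ok qt ut" using 1 unfolding ok_def by blast+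
    show ?case by (rule main[OF o bound[OF o 1(3)]])
  qed
  obtain Ms where Ms: "AE x in ?M. \<bar>qs x\<bar> \<le> Ms" using Linf_bounded[OF \<Omega>] assms(14) by (auto simp: Q0_set_def)
  consider (no) "\<And>q u. \<not> ok q u" | (inf) "L2_opnorm \<Omega> (A_inv \<Omega> a qs) = \<infinity>"
    | (fin) r z N where "ok r z" "L2_opnorm \<Omega> (A_inv \<Omega> a qs) = ereal N" "N \<ge> 0"
  proof (cases "L2_opnorm \<Omega> (A_inv \<Omega> a qs)")
    case (real N)
    then show thesis using that L2_opnorm_nonneg[of \<Omega> "A_inv \<Omega> a qs"] by (cases "\<exists>r z. ok r z") auto
  next
    case PInf
    then show thesis by (rule that(2))
  next
    case MInf
    then show thesis using L2_opnorm_nonneg[of \<Omega> "A_inv \<Omega> a qs"] by simp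
  qed
  then show ?thesis
  proof cases
    case no
    then show ?thesis by (intro finish[of 1]) auto
  next
    case inf
    \<comment> \<open>As \<open>k / \<infinity> = 0\<close>, the class consists of \<open>qs\<close> only, up to null sets.\<close>
    have qs: "AE x in ?M. q x = qs x" if "ok q u" for q u
    proof -
      have "Linf_norm \<Omega> (\<lambda>x. q x - qs x) \<le> ereal 0" using that inf by (simp add: ok_def Q_set_def zero_ereal_def)
      from Linf_norm_AE[OF this] show ?thesis by eventually_elim simp
    qed
    have "AE x in ?M. q x = qt x" if "ok q u" "ok qt ut" for q u qt ut
      using qs[OF that(1)] qs[OF that(2)] by eventually_elim simp
    then show ?thesis by (intro finish[of 1] disjI2 conjI) auto
  next
    case (fin r z N)
    \<comment> \<open>For \<open>N = 0\<close> the quotient \<open>k / N\<close> is infinite and the minimum is \<open>q0\<close>.\<close>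
    define \<kappa> where "\<kappa> = (if N = 0 then q0 else k / N)"
    have \<kappa>: "\<kappa> \<ge> 0" "N * \<kappa> \<le> k" using fin(3) assms(11,12) by (auto simp: \<kappa>_def)
    have near: "AE x in ?M. \<bar>q x - qs x\<bar> \<le> \<kappa>" if "ok q u" for q u
      by (rule Linf_norm_AE) (use that fin(2,3) in \<open>auto simp: ok_def Q_set_def \<kappa>_def\<close>)
    \<comment> \<open>One pair \<open>(r, z)\<close> is kept as a reference; all constants below depend on it and on the class.\<close>
    let ?Z = "LINT x|?M. (norm (vec_of (\<lambda>i. weak_deriv \<Omega> i z) x))\<^sup>2"
    define s where "s = 1 + 2 * k / (1 - k)"
    define l where "l = s * L2_norm \<Omega> z"
    define G where "G = 2 / lam * (M * (l\<^sup>2 + l\<^sup>2) + ((real CARD('n))\<^sup>2 * A)\<^sup>2 / (2 * lam) * ?Z)"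
    define K where "K = max (l\<^sup>2) G"
    have ad: "admissible \<Omega> a q0 M K q (\<lambda>i. weak_deriv \<Omega> i q) u (\<lambda>i. weak_deriv \<Omega> i u)" if o: "ok q u" for q u
    proof (rule admissible[OF o])
      have ws: "weak_solution \<Omega> a g q u" "weak_solution \<Omega> a g r z" using o fin(1) by (auto simp: ok_def)
      note b = solution_L2_bound[OF \<Omega>b A(2) assms(14) Ms _ fin(3) \<kappa> assms(13) W1inf_gradD(1,2)[OF okD(1)[OF o]] near[OF o]
          W1inf_gradD(1,2)[OF okD(1)[OF fin(1)]] near[OF fin(1)] ws]
      have b1: "L2_norm \<Omega> u \<le> l" unfolding l_def s_def using fin(2) by (intro b(2)) simp
      have "L2_norm \<Omega> (\<lambda>x. u x - z x) \<le> 2 * k / (1 - k) * L2_norm \<Omega> z" using fin(2) by (intro b(1)) simp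
      also have "\<dots> \<le> l" unfolding l_def s_def by (intro mult_right_mono L2_norm_nonneg) simp
      finally have b2: "L2_norm \<Omega> (\<lambda>x. u x - z x) \<le> l" .
      have sq: "(L2_norm \<Omega> u)\<^sup>2 \<le> l\<^sup>2" "(L2_norm \<Omega> (\<lambda>x. u x - z x))\<^sup>2 \<le> l\<^sup>2"
        using b1 b2 by (auto intro!: power_mono L2_norm_nonneg)
      then show "(LINT x|?M. (u x)\<^sup>2) \<le> K" unfolding L2_norm_squared K_def by simp
      have "M * ((L2_norm \<Omega> u)\<^sup>2 + (L2_norm \<Omega> (\<lambda>x. u x - z x))\<^sup>2) \<le> M * (l\<^sup>2 + l\<^sup>2)"
        using sq assms(16) by (intro mult_left_mono add_mono) auto
      then have "lam / 2 * (LINT x|?M. (norm (vec_of (\<lambda>i. weak_deriv \<Omega> i u) x))\<^sup>2)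
          \<le> M * (l\<^sup>2 + l\<^sup>2) + ((real CARD('n))\<^sup>2 * A)\<^sup>2 / (2 * lam) * ?Z"
        using solution_gradient_bound[OF \<Omega>b A(2) ell assms(6) W1inf_gradD(1,2)[OF okD(1)[OF o]] less_imp_le[OF assms(16)] ws(1) okD(5)[OF fin(1)]]
        by linarith
      then have "(LINT x|?M. (norm (vec_of (\<lambda>i. weak_deriv \<Omega> i u) x))\<^sup>2) \<le> G"
        unfolding G_def using assms(6) by (simp add: field_simps)
      then show "(LINT x|?M. (norm (vec_of (\<lambda>i. weak_deriv \<Omega> i u) x))\<^sup>2) \<le> K" unfolding K_def by simp
    qed
    obtain C where C: "C > 0"
      "\<And>q Q u U qt Qt ut Ut. admissible \<Omega> a q0 M K q Q u U \<Longrightarrow> admissible \<Omega> a q0 M K qt Qt ut Ut \<Longrightarrow>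
        H10_grad \<Omega> (\<lambda>x. q x - qt x) (\<lambda>i x. Q i x - Qt i x) \<Longrightarrow>
        H1_norm \<Omega> (\<lambda>x. (q x - qt x) * (sqrt (q x) * \<bar>u x\<bar>)) \<le> C * sqrt (H1_norm \<Omega> (\<lambda>x. sqrt (q x) * \<bar>u x\<bar> - sqrt (qt x) * \<bar>ut x\<bar>))"
      using stability_of_admissible[where K = K, OF \<Omega>b A(2,1) assms(4) ell assms(6,11,16)] by blast
    have "H1_norm \<Omega> (\<lambda>x. (q x - qt x) * (sqrt (q x) * \<bar>u x\<bar>)) \<le> C * sqrt (H1_norm \<Omega> (\<lambda>x. sqrt (q x) * \<bar>u x\<bar> - sqrt (qt x) * \<bar>ut x\<bar>))"
      if o: "ok q u" "ok qt ut" and "(\<lambda>x. q x - qt x) \<in> H10 \<Omega>" for q u qt ut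
      by (rule C(2)[OF ad[OF o(1)] ad[OF o(2)] H10_grad_of_H10[OF \<Omega>(1) that(3)
            H1_grad_diff[OF \<Omega>(1) W1inf_grad_H1[OF \<Omega>b okD(1)[OF o(1)]] W1inf_grad_H1[OF \<Omega>b okD(1)[OF o(2)]]]]])
    then show ?thesis by (intro finish[OF C(1)] disjI1)
  qed
qed

end
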